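(* For every discriminant $D > 0$ we have $$\sum_{\substack{x,y \in \mathbb{Z} \\ x \equiv D\, (2)}}H(D-x^{2}-y^{2}) = - 5L_{D}(-1)+\sum_{\substack{[a,b,c] \in \mathcal{Q}_{D} \\ a+c > 0 > a}}(a+c) -\frac{1}{12}\delta_{D = \square}(6D+1),$$ where $\delta_{D=\square}$ equals $1$ or $0$ according to whether $D$ is a square or not.
   Context: A discriminant $D>0$ is a positive integer with $D\equiv 0,1 \pmod 4$ (squares allowed). $\mathcal{Q}_D$ is the set of all integral binary quadratic forms $[a,b,c]$, i.e. triples $(a,b,c)\in\mathbb{Z}^3$, with $b^2-4ac=D$. $H(n)$ are the Hurwitz class numbers: $H(0)=-1/12$; for $n>0$, $H(n)$ is the number of $\mathrm{SL}_2(\mathbb{Z})$-classes of positive definite integral binary quadratic forms of discriminant $-n$ (not necessarily primitive), each class counted with weight $1/|\mathrm{PSL}_2(\mathbb{Z})_Q|$, the inverse order of the stabilizer in $\mathrm{PSL}_2(\mathbb{Z})$ (so $H(n)=0$ for $n\equiv 1,2\pmod 4$); and $H(n)=0$ for $n<0$. Write $D=D_0f^2$ with a fundamental discriminant $D_0$ ($D_0=1$ if $D$ is a square) and $f\in\mathbb{N}$. Then $$L_D(s)=L_{D_0}(s)\sum_{d\mid f}\mu(d)\chi_{D_0}(d)d^{-s}\sigma_{1-2s}(f/d),$$ where $L_{D_0}(s)$ is the (analytically continued) Dirichlet $L$-function of the quadratic character $\chi_{D_0}=\left(\frac{D_0}{\cdot}\right)$ (the Riemann zeta function if $D_0=1$),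 $\mu$ is the Moebius function, and $\sigma_s(n)=\sum_{d\mid n}d^s$. *)

theory Defs
  imports "HOL-Analysis.Analysis" "HOL-Number_Theory.Number_Theory"
    "HOL-Computational_Algebra.Squarefree" "HOL-Computational_Algebra.Nth_Powers"
begin

text \<open>The triple \<open>(a, b, c)\<close> stands for the form \<open>a x\<^sup>2 + b x y + c y\<^sup>2\<close>.\<close>
type_synonym bqf = "int \<times> int \<times> int"

definition is_discriminant :: "int \<Rightarrow> bool" where
  "is_discriminant D \<longleftrightarrow> D mod 4 = 0 \<or> D mod 4 = 1"

fun bqf_disc :: "bqf \<Rightarrow> int" where
  "bqf_disc (a, b, c) = b^2 - 4 * a * c"

fun bqf_eval :: "bqf \<Rightarrow> int \<Rightarrow> int \<Rightarrow> int" where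
  "bqf_eval (a, b, c) x y = a * x^2 + b * x * y + c * y^2"

definition bqf_set :: "int \<Rightarrow> bqf set" where
  "bqf_set D = {Q. bqf_disc Q = D}"

definition bqf_pos_def :: "bqf \<Rightarrow> bool" where
  "bqf_pos_def Q \<longleftrightarrow> (\<forall>x y. (x, y) \<noteq> (0, 0) \<longrightarrow> bqf_eval Q x y > 0)"

definition SL2Z :: "(int^2^2) set" where
  "SL2Z = {A. det A = 1}"

text \<open>The form \<open>Q (p x + q y, r x + s y)\<close>, where \<open>p, q\<close> and \<open>r, s\<close> are the rows of the matrix.\<close>
fun bqf_act :: "bqf \<Rightarrow> int^2^2 \<Rightarrow> bqf" where
  "bqf_act (a, b, c) A =
     (let p = A $ 1 $ 1; q = A $ 1 $ 2; r = A $ 2 $ 1; s = A $ 2 $ 2 in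
       (a * p^2 + b * p * r + c * r^2,
        2 * a * p * q + b * (p * s + q * r) + 2 * c * r * s,
        a * q^2 + b * q * s + c * s^2))"

definition bqf_equiv :: "(bqf \<times> bqf) set" where
  "bqf_equiv = {(Q, Q'). \<exists>A\<in>SL2Z. Q' = bqf_act Q A}"

text \<open>Elements of \<open>PSL\<^sub>2(\<int>)\<close> are the cosets \<open>{A, -A}\<close> with \<open>A \<in> SL\<^sub>2(\<int>)\<close>; \<open>A\<close> and \<open>-A\<close> act alike.\<close>
definition PSL2Z_stabilizer :: "bqf \<Rightarrow> (int^2^2) set set" where
  "PSL2Z_stabilizer Q = (\<lambda>A. {A, -A}) ` {A \<in> SL2Z. bqf_act Q A = Q}"

text \<open>The weight of a class does not depend on the chosen representative, since stabilizers of
  equivalent forms are conjugate.\<close>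
definition hurwitz_class_number :: "int \<Rightarrow> real" where
  "hurwitz_class_number n =
     (if n < 0 then 0
      else if n = 0 then - 1 / 12
      else \<Sum>X \<in> {Q \<in> bqf_set (- n). bqf_pos_def Q} // bqf_equiv.
             1 / real (card (PSL2Z_stabilizer (SOME Q. Q \<in> X))))"

text \<open>This counts \<open>1\<close> as a fundamental discriminant.\<close>
definition fundamental_discriminant :: "int \<Rightarrow> bool" where
  "fundamental_discriminant D \<longleftrightarrow>
     (D mod 4 = 1 \<and> squarefree D) \<or>
     (\<exists>m. D = 4 * m \<and> (m mod 4 = 2 \<or> m mod 4 = 3) \<and> squarefree m)"

text \<open>For a nonzero discriminant \<open>D\<close>, the next two constants give the unique decomposition
  \<open>D = D\<^sub>0 f\<^sup>2\<close> with \<open>D\<^sub>0\<close> fundamental and \<open>f > 0\<close>; in particular \<open>D\<^sub>0 = 1\<close> if \<open>D\<close> is a square.\<close>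
definition fundamental_part :: "int \<Rightarrow> int" where
  "fundamental_part D =
     (THE D0. fundamental_discriminant D0 \<and> (\<exists>f::nat. f > 0 \<and> D = D0 * int f ^ 2))"

definition conductor :: "int \<Rightarrow> nat" where
  "conductor D =
     (THE f. f > 0 \<and> (\<exists>D0. fundamental_discriminant D0 \<and> D = D0 * int f ^ 2))"

definition kronecker_prime :: "int \<Rightarrow> nat \<Rightarrow> int" where
  "kronecker_prime D p =
     (if p = 2 then
        (if even D then 0 else if D mod 8 = 1 \<or> D mod 8 = 7 then 1 else -1)
      else Legendre D (int p))"

definition kronecker_symbol :: "int \<Rightarrow> nat \<Rightarrow> int" where
  "kronecker_symbol D n =
     (if n = 0 then of_bool (\<bar>D\<bar> = 1)
      else prod_mset (image_mset (kronecker_prime D) (prime_factorization n)))"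

definition moebius_mu :: "nat \<Rightarrow> int" where
  "moebius_mu n = (if squarefree n then (-1) ^ card (prime_factors n) else 0)"

definition divisor_power_sum :: "complex \<Rightarrow> nat \<Rightarrow> complex" where
  "divisor_power_sum s n = (\<Sum>d | d dvd n. of_nat d powr s)"

text \<open>The analytic continuation of the Dirichlet series of \<open>(D\<^sub>0/\<cdot>)\<close> from \<open>Re s > 1\<close> to
  \<open>\<complex> - {1}\<close>. Taking the limit at \<open>s\<close> also gives the right value at \<open>s = 1\<close> when the
  singularity there is removable, i.e. when \<open>D\<^sub>0 \<noteq> 1\<close>; for \<open>s \<noteq> 1\<close> it is just \<open>F s\<close>.\<close>
definition dirichlet_L :: "int \<Rightarrow> complex \<Rightarrow> complex" where
  "dirichlet_L D0 s =
     (THE v. \<exists>F. F holomorphic_on (- {1}) \<and>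
        (\<forall>z. Re z > 1 \<longrightarrow>
           (\<lambda>n. of_int (kronecker_symbol D0 (Suc n)) * of_nat (Suc n) powr (- z)) sums F z) \<and>
        (F \<longlongrightarrow> v) (at s))"

definition L_disc :: "int \<Rightarrow> complex \<Rightarrow> complex" where
  "L_disc D s =
     (let D0 = fundamental_part D; f = conductor D in
       dirichlet_L D0 s *
       (\<Sum>d | d dvd f. of_int (moebius_mu d) * of_int (kronecker_symbol D0 d) *
          of_nat d powr (- s) * divisor_power_sum (1 - 2 * s) (f div d)))"

end

theory Submission
  imports Defs "HOL-Complex_Analysis.Complex_Analysis"
begin

text \<open>
  Write \<open>D - x\<^sup>2 = 4 m\<close>. Summing over \<open>y\<close> first, the Kronecker--Hurwitz relation
  \<open>\<Sum>\<^sub>t H(4 m - t\<^sup>2) = \<Sum>\<^bsub>c d = m\<^esub> (2 d - min c d)\<close> turns the left-hand side into sums over forms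
  of discriminant \<open>D\<close> with \<open>a < 0 < c\<close>: the part \<open>d - min c d\<close> is the sum of \<open>a + c\<close> in the statement, and
  the part \<open>d\<close> is \<open>\<alpha> = \<Sum> c\<close>. The relation itself is obtained by writing \<open>3 H(n)\<close> as a count of forms
  weighted by indicators of the ideal triangle and evaluating the resulting count of quadruples elementarily.

  To identify \<open>\<alpha>\<close> with \<open>-5 L\<^sub>D(-1)\<close> (up to the correction for squares), consider Zagier's function
  \<open>F(x) = \<Sum>\<^bsub>a < 0\<^esub> max 0 (a x\<^sup>2 + b x + c)\<close>. It has period 1, and comparing \<open>F(x)\<close> with
  \<open>x\<^sup>2 F(1/x)\<close> only leaves forms with \<open>a c \<le> 0\<close>, so that
  \<open>F(x) - x\<^sup>2 F(1/x) = \<alpha> (1 - x\<^sup>2)\<close> for nonsquare \<open>D\<close>. Euclid's algorithm bounds \<open>F\<close> at rational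
  points, and the contraction in the functional equation then gives \<open>F = \<alpha>\<close> at irrational points.
  Integrating over a period gives
  \<open>\<alpha> = D\<^bsup>3/2\<^esup>/6 \<Sum>\<^sub>n N(n)/n\<^sup>2\<close>, where \<open>N(n)\<close> counts the square roots of \<open>D\<close>
  modulo \<open>4 n\<close> up to shifts by \<open>2 n\<close>. The series is a multiple of the Dirichlet series of \<open>L\<^sub>D\<close> at 2;
  the constant is read off from \<open>D = 1\<close>. Finally \<open>L(2)\<close> is related to \<open>L(-1)\<close> by the Hurwitz formula for
  \<open>\<zeta>(-1, x)\<close> and the evaluation of quadratic Gauss sums.
\<close>

section \<open>Counting quadruples\<close>

text \<open>The ideal triangle replaces the usual fundamental domain because its three sides are
  linear conditions on the coefficients, permuted by an element of order three, and because it
  consists of exactly three fundamental domains, whence \<open>3 H\<close>. A point on a side lies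
  in two triangles; the value 1/2 of \<open>hv\<close> at 0 shares it equally. At rational points
  the series is finite, and the bound found there passes to all finite partial sums by continuity.
  If \<open>D\<close> is a square, forms with \<open>a c = 0\<close> intervene; they add the
  oscillating term \<open>cyc_tau\<close> and move the constant from \<alpha> to
  \<open>cyc_K\<close>, after which both cases obey one equation. No functional equation of an
  L-function is invoked. The finite Fourier transform of the second Bernoulli polynomial and the
  reflection formula of the trigamma function both produce 1/sin^2; comparing them gives the passage
  from 2 to -1. The 5 is the quotient of 15/(6 pi^2) by 1/(2 pi^2): 15/pi^2 = zeta(2)/zeta(4) comes
  from the root counts, 1/6 from the integral, 1/(2 pi^2) from that passage.\<close>

definition hv :: "int \<Rightarrow> real" where
  "hv x = (if x > 0 then 1 else if x = 0 then 1/2 else 0)"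

definition quads :: "int \<Rightarrow> (int \<times> int \<times> int \<times> int) set" where
  "quads n = {(a, c, x, v). a > 0 \<and> c > 0 \<and> x > 0 \<and> v > 0 \<and> a * c + x * v = n}"

definition qsum :: "int \<Rightarrow> (int \<Rightarrow> int \<Rightarrow> int \<Rightarrow> int \<Rightarrow> real) \<Rightarrow> real" where
  "qsum n f = (\<Sum>(a, c, x, v)\<in>quads n. f a c x v)"

definition dpairs :: "int \<Rightarrow> (int \<times> int) set" where
  "dpairs n = {(c, d). c > 0 \<and> d > 0 \<and> c * d = n}"

definition psum :: "int \<Rightarrow> (int \<Rightarrow> int \<Rightarrow> real) \<Rightarrow> real" where
  "psum n f = (\<Sum>(c, d)\<in>dpairs n. f c d)"

lemma pos_factor_le:
  fixes a b :: int
  assumes "a > 0" "b > 0"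
  shows "a \<le> a * b" "b \<le> a * b"
  using assms by (simp_all add: mult_le_cancel_left1 mult_le_cancel_right1)

lemma finite_quads: "finite (quads n)"
proof (rule finite_subset)
  show "quads n \<subseteq> {1..n} \<times> {1..n} \<times> {1..n} \<times> {1..n}"
  proof safe
    fix a c x v assume "(a, c, x, v) \<in> quads n"
    then have *: "a > 0" "c > 0" "x > 0" "v > 0" "a * c + x * v = n"
      by (auto simp: quads_def)
    have "a * c > 0" "x * v > 0" using * by auto
    moreover have "a \<le> a * c" "c \<le> a * c" "x \<le> x * v" "v \<le> x * v"
      using * pos_factor_le by auto
    ultimately have "a \<le> n" "c \<le> n" "x \<le> n" "v \<le> n"
      using *(5) by linarith+
    then show "a \<in> {1..n}" "c \<in> {1..n}" "x \<in> {1..n}" "v \<in> {1..n}" using * by simp_all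
  qed
qed auto

lemma finite_dpairs: "finite (dpairs n)"
proof (rule finite_subset)
  show "dpairs n \<subseteq> {1..n} \<times> {1..n}"
    using pos_factor_le by (auto simp: dpairs_def)
qed auto

lemma qsum_cong:
  "(\<And>a c x v. a > 0 \<Longrightarrow> c > 0 \<Longrightarrow> x > 0 \<Longrightarrow> v > 0 \<Longrightarrow> a * c + x * v = n \<Longrightarrow> f a c x v = g a c x v)
    \<Longrightarrow> qsum n f = qsum n g"
  unfolding qsum_def by (rule sum.cong) (auto simp: quads_def)

lemma psum_cong:
  "(\<And>c d. c > 0 \<Longrightarrow> d > 0 \<Longrightarrow> c * d = n \<Longrightarrow> f c d = g c d) \<Longrightarrow> psum n f = psum n g"
  unfolding psum_def by (rule sum.cong) (auto simp: dpairs_def)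

lemma qsum_add: "qsum n (\<lambda>a c x v. f a c x v + g a c x v) = qsum n f + qsum n g"
  unfolding qsum_def by (simp add: sum.distrib case_prod_unfold)

lemma qsum_diff: "qsum n (\<lambda>a c x v. f a c x v - g a c x v) = qsum n f - qsum n g"
  unfolding qsum_def by (simp add: sum_subtractf case_prod_unfold)

lemma qsum_cmult: "qsum n (\<lambda>a c x v. k * f a c x v) = k * qsum n f"
  unfolding qsum_def by (simp add: sum_distrib_left case_prod_unfold)

lemma psum_add: "psum n (\<lambda>c d. f c d + g c d) = psum n f + psum n g"
  unfolding psum_def by (simp add: sum.distrib case_prod_unfold)

lemma psum_diff: "psum n (\<lambda>c d. f c d - g c d) = psum n f - psum n g"
  unfolding psum_def by (simp add: sum_subtractf case_prod_unfold)

lemma psum_cmult: "psum n (\<lambda>c d. k * f c d) = k * psum n f"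
  unfolding psum_def by (simp add: sum_distrib_left case_prod_unfold)

lemma psum_swap: "psum n (\<lambda>c d. f d c) = psum n f"
  unfolding psum_def
  by (rule sum.reindex_bij_witness[of _ "\<lambda>(c,d). (d,c)" "\<lambda>(c,d). (d,c)"])
     (auto simp: dpairs_def mult.commute)

lemma qsum_swap1: "qsum n (\<lambda>a c x v. f c a x v) = qsum n f"
  unfolding qsum_def
  by (rule sum.reindex_bij_witness[of _ "\<lambda>(a,c,x,v). (c,a,x,v)" "\<lambda>(a,c,x,v). (c,a,x,v)"])
     (auto simp: quads_def mult.commute)

lemma qsum_swap2: "qsum n (\<lambda>a c x v. f a c v x) = qsum n f"
  unfolding qsum_def
  by (rule sum.reindex_bij_witness[of _ "\<lambda>(a,c,x,v). (a,c,v,x)" "\<lambda>(a,c,x,v). (a,c,v,x)"])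
     (auto simp: quads_def mult.commute)

lemma qsum_swap3: "qsum n (\<lambda>a c x v. f x v a c) = qsum n f"
  unfolding qsum_def
  by (rule sum.reindex_bij_witness[of _ "\<lambda>(a,c,x,v). (x,v,a,c)" "\<lambda>(a,c,x,v). (x,v,a,c)"])
     (auto simp: quads_def mult.commute)

text \<open>\<open>(c, v)\<close> is replaced by \<open>(c + x, v - a)\<close>, which keeps
  \<open>a c + x v\<close> and carries the half \<open>v > a\<close> onto the half
  \<open>c > x\<close>. Together with the symmetries of a quadruple this is the only tool of the
  count.\<close>

lemma qsum_shift:
  "qsum n (\<lambda>a c x v. of_bool (v > a) * f a c x v) =
   qsum n (\<lambda>a c x v. of_bool (c > x) * f a (c - x) x (v + a))"
proof -
  have "qsum n (\<lambda>a c x v. of_bool (v > a) * f a c x v) =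
      (\<Sum>(a,c,x,v)\<in>{(a,c,x,v)\<in>quads n. v > a}. f a c x v)"
    unfolding qsum_def
    by (rule sum.mono_neutral_cong_right) (auto simp: finite_quads)
  also have "\<dots> = (\<Sum>(a,c,x,v)\<in>{(a,c,x,v)\<in>quads n. c > x}. f a (c - x) x (v + a))"
    by (rule sum.reindex_bij_witness[of _ "\<lambda>(a,c,x,v). (a,c-x,x,v+a)" "\<lambda>(a,c,x,v). (a,c+x,x,v-a)"])
       (auto simp: quads_def algebra_simps)
  also have "\<dots> = qsum n (\<lambda>a c x v. of_bool (c > x) * f a (c - x) x (v + a))"
    unfolding qsum_def
    by (rule sum.mono_neutral_cong_left) (auto simp: finite_quads)
  finally show ?thesis .
qed

lemma qsum_shift':
  "qsum n (\<lambda>a c x v. of_bool (a > v) * f a c x v) =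
   qsum n (\<lambda>a c x v. of_bool (x > c) * f (a + v) c (x - c) v)"
proof -
  have "qsum n (\<lambda>a c x v. of_bool (a > v) * f a c x v) =
      (\<Sum>(a,c,x,v)\<in>{(a,c,x,v)\<in>quads n. a > v}. f a c x v)"
    unfolding qsum_def
    by (rule sum.mono_neutral_cong_right) (auto simp: finite_quads)
  also have "\<dots> = (\<Sum>(a,c,x,v)\<in>{(a,c,x,v)\<in>quads n. x > c}. f (a + v) c (x - c) v)"
    by (rule sum.reindex_bij_witness[of _ "\<lambda>(a,c,x,v). (a+v,c,x-c,v)" "\<lambda>(a,c,x,v). (a-v,c,x+c,v)"])
       (auto simp: quads_def algebra_simps)
  also have "\<dots> = qsum n (\<lambda>a c x v. of_bool (x > c) * f (a + v) c (x - c) v)"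
    unfolding qsum_def
    by (rule sum.mono_neutral_cong_left) (auto simp: finite_quads)
  finally show ?thesis .
qed

lemma qsum_rev: "qsum n (\<lambda>a c x v. f v x c a) = qsum n f"
  unfolding qsum_def
  by (rule sum.reindex_bij_witness[of _ "\<lambda>(a,c,x,v). (v,x,c,a)" "\<lambda>(a,c,x,v). (v,x,c,a)"])
     (auto simp: quads_def mult.commute)

section \<open>Linear relations between counts of quadruples\<close>

context
  fixes n :: int and p0 E0 E1 E2 E3 M W X Y Z1 Z2 V :: real
  defines "p0 \<equiv> qsum n (\<lambda>a c x v. 1)"
    and "E0 \<equiv> qsum n (\<lambda>a c x v. of_bool (c = x \<and> c = v))"
    and "E1 \<equiv> qsum n (\<lambda>a c x v. of_bool (c = x))"
    and "E2 \<equiv> qsum n (\<lambda>a c x v. of_bool (x = 2 * c) * hv (a - c))"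
    and "E3 \<equiv> qsum n (\<lambda>a c x v. of_bool (c = v \<and> x < c))"
    and "M \<equiv> qsum n (\<lambda>a c x v. of_bool (x < c \<and> v < c))"
    and "W \<equiv> qsum n (\<lambda>a c x v. of_bool (x < a \<and> x < c))"
    and "X \<equiv> qsum n (\<lambda>a c x v. hv (v - a - c))"
    and "Y \<equiv> qsum n (\<lambda>a c x v. hv (a - c - v))"
    and "Z1 \<equiv> qsum n (\<lambda>a c x v. hv (v - x - 2 * a))"
    and "Z2 \<equiv> qsum n (\<lambda>a c x v. hv (v - x - 2 * a) * hv (v - x - 2 * c))"
    and "V \<equiv> qsum n (\<lambda>a c x v. of_bool (x < c) * hv (a - c - v))"
begin

lemma count_c_gt_x: "qsum n (\<lambda>a c x v. of_bool (c > x)) = (p0 - E1) / 2"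
proof -
  have "qsum n (\<lambda>a c x v. of_bool (c < x)) = qsum n (\<lambda>a c x v. of_bool (c > x))"
    using qsum_rev[of n "\<lambda>a c x v. of_bool (c > x)"] by simp
  moreover have "p0 = qsum n (\<lambda>a c x v. of_bool (c > x) + of_bool (c < x) + of_bool (c = x))"
    unfolding p0_def by (rule qsum_cong) auto
  ultimately show ?thesis by (simp add: qsum_add E1_def)
qed

lemma count_c_lt_x: "qsum n (\<lambda>a c x v. of_bool (c < x)) = (p0 - E1) / 2"
  using count_c_gt_x qsum_rev[of n "\<lambda>a c x v. of_bool (c > x)"] by simp

lemma X_shift: "X = qsum n (\<lambda>a c x v. of_bool (c > x) * hv (v + x - c))"
proof -
  have "X = qsum n (\<lambda>a c x v. of_bool (v > a) * hv (v - a - c))"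
    unfolding X_def by (rule qsum_cong) (auto simp: hv_def)
  also have "\<dots> = qsum n (\<lambda>a c x v. of_bool (c > x) * hv (v + a - a - (c - x)))"
    by (rule qsum_shift)
  also have "\<dots> = qsum n (\<lambda>a c x v. of_bool (c > x) * hv (v + x - c))"
    by (rule qsum_cong) (simp add: algebra_simps)
  finally show ?thesis .
qed

lemma X_swap: "qsum n (\<lambda>a c x v. hv (c - x - v)) = X"
  unfolding X_def using qsum_swap3[of n "\<lambda>a c x v. hv (v - a - c)"] by simp

text \<open>The shift turns the weight into \<open>1 - hv (c - x - v)\<close> on
  \<open>c > x\<close>. The subtracted part is \<open>X\<close> again by symmetry, so
  \<open>X\<close> is half the count of \<open>c > x\<close>.\<close>

lemma X_eq: "X = (p0 - E1) / 4"
proof -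
  have "X = qsum n (\<lambda>a c x v. of_bool (c > x) - hv (c - x - v))"
    unfolding X_shift by (rule qsum_cong) (auto simp: hv_def)
  then show ?thesis using X_swap count_c_gt_x by (simp add: qsum_diff)
qed

lemma Y_shift: "Y = qsum n (\<lambda>a c x v. of_bool (c < x) * hv (a - c))"
proof -
  have "Y = qsum n (\<lambda>a c x v. of_bool (a > v) * hv (a - c - v))"
    unfolding Y_def by (rule qsum_cong) (auto simp: hv_def)
  also have "\<dots> = qsum n (\<lambda>a c x v. of_bool (c < x) * hv (a + v - c - v))"
    by (rule qsum_shift')
  also have "\<dots> = qsum n (\<lambda>a c x v. of_bool (c < x) * hv (a - c))"
    by (rule qsum_cong) (simp add: algebra_simps)
  finally show ?thesis .
qed

lemma Z1_shift: "Z1 = qsum n (\<lambda>a c x v. of_bool (2 * x < c) * hv (v - x))"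
proof -
  have "Z1 = qsum n (\<lambda>a c x v. of_bool (v > a) * hv (v - x - 2 * a))"
    unfolding Z1_def by (rule qsum_cong) (auto simp: hv_def)
  also have "\<dots> = qsum n (\<lambda>a c x v. of_bool (c > x) * hv (v + a - x - 2 * a))"
    by (rule qsum_shift)
  also have "\<dots> = qsum n (\<lambda>a c x v. of_bool (v > a) * (of_bool (c > x) * hv (v - a - x)))"
    by (rule qsum_cong) (auto simp: hv_def)
  also have "\<dots> = qsum n (\<lambda>a c x v. of_bool (c > x) * (of_bool (c - x > x) * hv (v + a - a - x)))"
    by (rule qsum_shift)
  also have "\<dots> = qsum n (\<lambda>a c x v. of_bool (2 * x < c) * hv (v - x))"
    by (rule qsum_cong) (auto simp: algebra_simps)
  finally show ?thesis .
qed

lemma Z1_swap: "qsum n (\<lambda>a c x v. of_bool (2 * c < x) * hv (a - c)) = Z1"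
  unfolding Z1_shift
  using qsum_rev[of n "\<lambda>a c x v. of_bool (2 * x < c) * hv (v - x)"] by simp

text \<open>Under the shift the condition \<open>x < c\<close> becomes \<open>x < 2 c\<close>. Its
  complement inside \<open>c < x\<close> is the open part \<open>Z1\<close> and the hyperplane
  \<open>x = 2 c\<close>.\<close>

lemma V_eq: "V = Y - Z1 - E2"
proof -
  have "V = qsum n (\<lambda>a c x v. of_bool (a > v) * (of_bool (x < c) * hv (a - c - v)))"
    unfolding V_def by (rule qsum_cong) (auto simp: hv_def)
  also have "\<dots> = qsum n (\<lambda>a c x v. of_bool (c < x) * (of_bool (x - c < c) * hv (a + v - c - v)))"
    by (rule qsum_shift')
  also have "\<dots> = qsum n (\<lambda>a c x v. of_bool (c < x) * hv (a - c) - of_bool (2 * c < x) * hv (a - c)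
                       - of_bool (x = 2 * c) * hv (a - c))"
    by (rule qsum_cong) auto
  also have "\<dots> = Y - Z1 - E2"
    by (simp add: qsum_diff Y_shift Z1_swap E2_def)
  finally show ?thesis .
qed

lemma W_shift: "W = qsum n (\<lambda>a c x v. of_bool (x < c \<and> c < v))"
proof -
  have "W = qsum n (\<lambda>a c x v. of_bool (c > x) * of_bool (x < a))"
    unfolding W_def by (rule qsum_cong) auto
  also have "\<dots> = qsum n (\<lambda>a c x v. of_bool (v > a) * of_bool (x < a))"
    using qsum_shift[of n "\<lambda>a c x v. of_bool (x < a)"] by simp
  also have "\<dots> = qsum n (\<lambda>a c x v. of_bool (x < c \<and> c < v))"
    using qsum_swap1[of n "\<lambda>a c x v. of_bool (x < c \<and> c < v)"]
    by (subst qsum_cong[where g = "\<lambda>a c x v. of_bool (x < a \<and> a < v)"]) auto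
  finally show ?thesis .
qed

lemma W_swap: "qsum n (\<lambda>a c x v. of_bool (c < x \<and> c < v)) = W"
  unfolding W_def using qsum_swap3[of n "\<lambda>a c x v. of_bool (x < a \<and> x < c)"]
  by (simp add: qsum_swap1[of n "\<lambda>a c x v. of_bool (c < x \<and> c < v)", symmetric])

lemma E1_swap: "qsum n (\<lambda>a c x v. of_bool (c = v)) = E1"
  unfolding E1_def using qsum_swap2[of n "\<lambda>a c x v. of_bool (c = x)"] by simp

text \<open>Comparing \<open>c\<close> with \<open>x\<close> and with \<open>v\<close> gives four
  open regions. One is \<open>M\<close>; the other three have the common count
  \<open>W\<close>.\<close>

lemma M_eq: "M = p0 - 3 * W - 2 * E1 + E0"
proof -
  have "qsum n (\<lambda>a c x v. of_bool (v < c \<and> c < x)) = W"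
    unfolding W_shift using qsum_swap2[of n "\<lambda>a c x v. of_bool (x < c \<and> c < v)"] by simp
  moreover have "p0 = qsum n (\<lambda>a c x v. of_bool (x < c \<and> v < c) + of_bool (c < x \<and> c < v)
      + of_bool (x < c \<and> c < v) + of_bool (v < c \<and> c < x)
      + of_bool (c = x) + of_bool (c = v) - of_bool (c = x \<and> c = v))"
    unfolding p0_def by (rule qsum_cong) auto
  ultimately show ?thesis
    by (simp add: qsum_add qsum_diff W_swap W_shift[symmetric] E1_swap
        E1_def[symmetric] E0_def[symmetric] M_def[symmetric])
qed

text \<open>By reversal \<open>M\<close> counts \<open>c < x\<close> and \<open>a < x\<close>;
  cutting along \<open>a = c\<close> gives two halves that are exchanged by swapping
  \<open>a\<close> and \<open>c\<close>. One half is complementary to \<open>Y\<close> inside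
  \<open>c < x\<close>.\<close>

lemma Y_eq: "Y = (p0 - E1 - M) / 2"
proof -
  let ?B = "\<lambda>a c x v. of_bool (c < x) * hv (c - a)"
  have "M = qsum n (\<lambda>a c x v. of_bool (c < x \<and> a < x))"
    unfolding M_def
    using qsum_rev[of n "\<lambda>a c x v. of_bool (x < c \<and> v < c)"] by (simp add: conj_commute)
  also have "\<dots> = qsum n (\<lambda>a c x v. of_bool (c < x) * hv (c - a) + of_bool (a < x) * hv (a - c))"
    by (rule qsum_cong) (auto simp: hv_def)
  also have "\<dots> = 2 * qsum n ?B"
    unfolding qsum_add using qsum_swap1[of n ?B] by simp
  finally have "M = 2 * qsum n ?B" .
  moreover have "qsum n (\<lambda>a c x v. of_bool (c < x)) =
      qsum n (\<lambda>a c x v. of_bool (c < x) * hv (a - c) + ?B a c x v)"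
    by (rule qsum_cong) (auto simp: hv_def)
  ultimately show ?thesis
    by (simp add: qsum_add Y_shift[symmetric] count_c_lt_x)
qed

text \<open>A second evaluation of \<open>X\<close>, now by the order of \<open>c\<close> and
  \<open>v\<close>. Compared with \<open>X_eq\<close> and \<open>M_eq\<close> it expresses
  \<open>W\<close> and \<open>M\<close> through \<open>p0\<close> and hyperplane sums.\<close>

lemma X_eq2: "2 * X = W + E3 + M"
proof -
  have "X = qsum n (\<lambda>a c x v. of_bool (x < c \<and> c < v) + of_bool (c = v \<and> x < c)
      + of_bool (x < c \<and> v < c) - hv (c - x - v))"
    unfolding X_shift by (rule qsum_cong) (auto simp: hv_def)
  then show ?thesis
    by (simp add: qsum_add qsum_diff X_swap W_shift E3_def M_def)
qed

text \<open>Both factors are nonzero only for \<open>v - x \<ge> 2 * max a c \<ge> a + c\<close>.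
  Equality throughout means \<open>a = c\<close> and \<open>v = x + 2 a\<close>, where the product
  is 1/4. Off this set two shifts, with \<open>a\<close> and \<open>c\<close> swapped in between,
  undo both inequalities.\<close>

lemma Z2_eq: "Z2 = qsum n (\<lambda>a c x v. of_bool (a = c \<and> v = x + 2 * a)) / 4 + W - 2 * V"
proof -
  have "Z2 = qsum n (\<lambda>a c x v. 1/4 * of_bool (a = c \<and> v = x + 2 * a) +
     of_bool (v > a + c + x) * (hv (v - x - 2 * a) * hv (v - x - 2 * c)))"
    unfolding Z2_def by (rule qsum_cong) (auto simp: hv_def)
  also have "\<dots> = qsum n (\<lambda>a c x v. of_bool (a = c \<and> v = x + 2 * a)) / 4 +
     qsum n (\<lambda>a c x v. of_bool (v > a + c + x) * (hv (v - x - 2 * a) * hv (v - x - 2 * c)))"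
    by (simp only: qsum_add qsum_cmult)
  also have "qsum n (\<lambda>a c x v. of_bool (v > a + c + x) * (hv (v - x - 2 * a) * hv (v - x - 2 * c)))
     = qsum n (\<lambda>a c x v. of_bool (v > a) * (of_bool (v > a + c + x) * (hv (v - x - 2 * a) * hv (v - x - 2 * c))))"
    by (rule qsum_cong) auto
  also have "\<dots> = qsum n (\<lambda>a c x v. of_bool (c > x) * (of_bool (v + a > a + (c - x) + x) *
       (hv (v + a - x - 2 * a) * hv (v + a - x - 2 * (c - x)))))"
    by (rule qsum_shift)
  also have "\<dots> = qsum n (\<lambda>a c x v. of_bool (a > x) * (of_bool (v > a) *
       (hv (v - c - x) * hv (v + c - x - 2 * (a - x)))))"
    by (subst qsum_swap1[symmetric], rule qsum_cong) (simp add: algebra_simps hv_def)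
  also have "\<dots> = qsum n (\<lambda>a c x v. of_bool (v > a) * (of_bool (a > x) *
       (hv (v - c - x) * hv (v + c + x - 2 * a))))"
    by (rule qsum_cong) (simp add: algebra_simps)
  also have "\<dots> = qsum n (\<lambda>a c x v. of_bool (c > x) * (of_bool (a > x) *
       (hv (v + a - (c - x) - x) * hv (v + a + (c - x) + x - 2 * a))))"
    by (rule qsum_shift)
  also have "\<dots> = qsum n (\<lambda>a c x v. of_bool (x < a \<and> x < c) - of_bool (x < c) * hv (a - c - v)
       - of_bool (x < a) * hv (c - a - v))"
    by (rule qsum_cong) (auto simp: hv_def)
  also have "\<dots> = W - V - V"
    using qsum_swap1[of n "\<lambda>a c x v. of_bool (x < c) * hv (a - c - v)"]
    by (simp add: qsum_diff W_def V_def)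
  finally show ?thesis by simp
qed

lemma T1_eq: "qsum n (\<lambda>a c x v. 1 - hv (v - a - c) - hv (a - c - v) - hv (c - a - v)) = p0 - X - 2 * Y"
  using qsum_swap1[of n "\<lambda>a c x v. hv (a - c - v)"]
  by (simp add: qsum_diff p0_def X_def Y_def)

lemma T2_eq: "qsum n (\<lambda>a c x v. hv (v - x) * hv (2 * a + x - v) * hv (2 * c + x - v))
   = p0 / 2 - 2 * Z1 + Z2"
proof -
  have "p0 = qsum n (\<lambda>a c x v. hv (v - x) + hv (x - v))"
    unfolding p0_def by (rule qsum_cong) (auto simp: hv_def)
  then have *: "qsum n (\<lambda>a c x v. hv (v - x)) = p0 / 2"
    using qsum_swap2[of n "\<lambda>a c x v. hv (v - x)"] by (simp add: qsum_add)
  have "qsum n (\<lambda>a c x v. hv (v - x) * hv (2 * a + x - v) * hv (2 * c + x - v)) =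
    qsum n (\<lambda>a c x v. hv (v - x) - hv (v - x - 2 * a) - hv (v - x - 2 * c)
      + hv (v - x - 2 * a) * hv (v - x - 2 * c))"
    by (rule qsum_cong) (auto simp: hv_def)
  then show ?thesis
    using qsum_swap1[of n "\<lambda>a c x v. hv (v - x - 2 * a)"]
    by (simp add: qsum_diff qsum_add * Z1_def Z2_def)
qed

text \<open>All open regions cancel, including \<open>p0\<close>, a convolution of divisor counts
  that is never evaluated. What is left lives on hyperplanes and reduces to sums over divisors; the
  last term cancels in \<open>kset_sum\<close>.\<close>

lemma T_sum_eq:
  "qsum n (\<lambda>a c x v. 1 - hv (v - a - c) - hv (a - c - v) - hv (c - a - v)) +
   qsum n (\<lambda>a c x v. hv (v - x) * hv (2 * a + x - v) * hv (2 * c + x - v)) =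
   2 * E1 - 5/2 * E3 - E0 / 2 + 2 * E2 +
   qsum n (\<lambda>a c x v. of_bool (a = c \<and> v = x + 2 * a)) / 4"
proof -
  note T1_eq T2_eq Z2_eq V_eq Y_eq M_eq X_eq2 X_eq
  then show ?thesis by argo
qed

end


text \<open>Here \<open>c\<close> and \<open>d\<close> are complementary divisors and \<open>k\<close> parametrizes a degenerate quadruple.\<close>
lemma qsum_fiber:
  assumes "\<And>c d k. c > 0 \<Longrightarrow> d > 0 \<Longrightarrow> c * d = n \<Longrightarrow> k \<in> I c d \<Longrightarrow>
             F c d k \<in> quads n \<and> G (F c d k) = ((c, d), k)"
    and "\<And>a c x v. a > 0 \<Longrightarrow> c > 0 \<Longrightarrow> x > 0 \<Longrightarrow> v > 0 \<Longrightarrow> a * c + x * v = n \<Longrightarrow> P a c x v \<Longrightarrow>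
             (\<exists>c' d' k'. G (a, c, x, v) = ((c', d'), k') \<and> c' > 0 \<and> d' > 0 \<and> c' * d' = n \<and>
                k' \<in> I c' d' \<and> F c' d' k' = (a, c, x, v))"
    and "\<And>c d k. c > 0 \<Longrightarrow> d > 0 \<Longrightarrow> c * d = n \<Longrightarrow> k \<in> I c d \<Longrightarrow>
           (case F c d k of (a, c', x, v) \<Rightarrow> P a c' x v \<and> f a c' x v = g c d k)"
    and "\<And>c d. finite (I c d)"
  shows "qsum n (\<lambda>a c x v. of_bool (P a c x v) * f a c x v) = psum n (\<lambda>c d. \<Sum>k\<in>I c d. g c d k)"
proof -
  have "qsum n (\<lambda>a c x v. of_bool (P a c x v) * f a c x v)
     = (\<Sum>(a,c,x,v)\<in>{(a,c,x,v)\<in>quads n. P a c x v}. f a c x v)"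
    unfolding qsum_def
    by (rule sum.mono_neutral_cong_right) (auto simp: finite_quads)
  also have "\<dots> = (\<Sum>((c, d), k)\<in>Sigma (dpairs n) (\<lambda>(c, d). I c d). g c d k)"
  proof (rule sum.reindex_bij_witness[of _ "\<lambda>((c, d), k). F c d k" G])
    fix q assume "q \<in> {(a,c,x,v)\<in>quads n. P a c x v}"
    then obtain a c x v where q: "q = (a, c, x, v)" and *: "a > 0" "c > 0" "x > 0" "v > 0"
        "a * c + x * v = n" "P a c x v"
      by (auto simp: quads_def)
    from assms(2)[OF *] obtain c' d' k' where
      **: "G (a, c, x, v) = ((c', d'), k')" "c' > 0" "d' > 0" "c' * d' = n"
        "k' \<in> I c' d'" "F c' d' k' = (a, c, x, v)" by auto
    show "(\<lambda>((c, d), k). F c d k) (G q) = q" using ** q by simp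
    show "G q \<in> Sigma (dpairs n) (\<lambda>(c, d). I c d)" using ** q by (simp add: dpairs_def)
    show "(\<lambda>((c, d), k). g c d k) (G q) = (case q of (a, c, x, v) \<Rightarrow> f a c x v)"
      using assms(3)[OF **(2-5)] ** q by simp
  next
    fix y assume "y \<in> Sigma (dpairs n) (\<lambda>(c, d). I c d)"
    then obtain c d k where y: "y = ((c, d), k)" and *: "c > 0" "d > 0" "c * d = n" "k \<in> I c d"
      by (auto simp: dpairs_def)
    show "G ((\<lambda>((c, d), k). F c d k) y) = y" using assms(1)[OF *] y by simp
    show "(\<lambda>((c, d), k). F c d k) y \<in> {(a,c,x,v)\<in>quads n. P a c x v}"
      using assms(1)[OF *] assms(3)[OF *] y by auto
  qed
  also have "\<dots> = psum n (\<lambda>c d. \<Sum>k\<in>I c d. g c d k)"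
    unfolding psum_def by (subst sum.Sigma[symmetric]) (auto simp: finite_dpairs assms(4) case_prod_unfold)
  finally show ?thesis .
qed

text \<open>On \<open>c = x\<close> the equation reads \<open>c * (a + v) = n\<close>, so each
  factorization \<open>c * d\<close> is hit by the \<open>d - 1\<close> splittings of
  \<open>d\<close>. The other degenerate sums are treated in the same way.\<close>

lemma E1_val: "qsum n (\<lambda>a c x v. of_bool (c = x)) = psum n (\<lambda>c d. real_of_int d) - psum n (\<lambda>c d. 1)"
proof -
  have "qsum n (\<lambda>a c x v. of_bool (c = x) * 1) = psum n (\<lambda>c d. \<Sum>k\<in>{1..<d}. 1)"
    by (rule qsum_fiber[where F = "\<lambda>c d k. (k, c, c, d - k)" and G = "\<lambda>(a, c, x, v). ((c, a + v), a)"])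
       (auto simp: quads_def algebra_simps)
  also have "\<dots> = psum n (\<lambda>c d. real_of_int d - 1)"
    by (rule psum_cong) auto
  finally show ?thesis by (simp add: psum_diff)
qed

lemma E3_val: "qsum n (\<lambda>a c x v. of_bool (c = v \<and> x < c)) =
  psum n (\<lambda>c d. real_of_int (min c d)) - psum n (\<lambda>c d. 1)"
proof -
  have "qsum n (\<lambda>a c x v. of_bool (c = v \<and> x < c) * 1) = psum n (\<lambda>c d. \<Sum>k\<in>{1..<min c d}. 1)"
    by (rule qsum_fiber[where F = "\<lambda>c d k. (d - k, c, k, c)" and G = "\<lambda>(a, c, x, v). ((c, a + x), x)"])
       (auto simp: quads_def algebra_simps)
  also have "\<dots> = psum n (\<lambda>c d. real_of_int (min c d) - 1)"
    by (rule psum_cong) auto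
  finally show ?thesis by (simp add: psum_diff)
qed

lemma psum_less: "psum n (\<lambda>c d. of_bool (c < d)) = (psum n (\<lambda>c d. 1) - psum n (\<lambda>c d. of_bool (c = d))) / 2"
proof -
  have "psum n (\<lambda>c d. 1) = psum n (\<lambda>c d. of_bool (c < d) + of_bool (d < c) + of_bool (c = d))"
    by (rule psum_cong) auto
  then show ?thesis
    using psum_swap[of n "\<lambda>c d. of_bool (c < d)"] by (simp add: psum_add)
qed

lemma E0_val: "qsum n (\<lambda>a c x v. of_bool (c = x \<and> c = v)) =
  (psum n (\<lambda>c d. 1) - psum n (\<lambda>c d. of_bool (c = d))) / 2"
proof -
  have "qsum n (\<lambda>a c x v. of_bool (c = x \<and> c = v) * 1) = psum n (\<lambda>c d. \<Sum>k\<in>(if c < d then {0::int} else {}). 1)"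
    by (rule qsum_fiber[where F = "\<lambda>c d k. (d - c, c, c, c)" and G = "\<lambda>(a, c, x, v). ((c, a + c), 0)"])
       (auto simp: quads_def algebra_simps split: if_splits)
  also have "\<dots> = psum n (\<lambda>c d. of_bool (c < d))"
    by (rule psum_cong) auto
  finally show ?thesis using psum_less by simp
qed

text \<open>The half weight at \<open>e = 2 * k\<close> makes one formula serve both parities of
  \<open>e\<close>. The limit \<open>2 * k < d\<close> cuts nothing off because
  \<open>e < d\<close>.\<close>

lemma sum_hv_double:
  fixes e d :: int
  assumes "e \<ge> 1" "e < d"
  shows "(\<Sum>k\<in>{k. 1 \<le> k \<and> 2 * k < d}. hv (e - 2 * k)) = (real_of_int e - 1) / 2"
proof -
  have fin: "finite {k::int. 1 \<le> k \<and> 2 * k < d}"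
    by (rule finite_subset[of _ "{1..d}"]) auto
  show ?thesis
  proof (cases "even e")
    case True
    then obtain j where j: "e = 2 * j" by blast
    have "(\<Sum>k\<in>{k. 1 \<le> k \<and> 2 * k < d}. hv (e - 2 * k)) = (\<Sum>k\<in>insert j {1..<j}. hv (e - 2 * k))"
      using assms j by (intro sum.mono_neutral_right fin) (auto simp: hv_def)
    also have "\<dots> = hv (e - 2 * j) + (\<Sum>k\<in>{1..<j}. hv (e - 2 * k))"
      by (rule sum.insert) auto
    also have "(\<Sum>k\<in>{1..<j}. hv (e - 2 * k)) = (\<Sum>k\<in>{1..<j}. 1)"
      by (rule sum.cong) (auto simp: hv_def j)
    finally show ?thesis using assms by (simp add: j hv_def)
  next
    case False
    then obtain j where j: "e = 2 * j + 1" by (elim oddE)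
    have "(\<Sum>k\<in>{k. 1 \<le> k \<and> 2 * k < d}. hv (e - 2 * k)) = (\<Sum>k\<in>{1..<j+1}. 1)"
      using assms j by (intro sum.mono_neutral_cong_right fin) (auto simp: hv_def)
    then show ?thesis using assms by (simp add: j)
  qed
qed

lemma E2_val: "qsum n (\<lambda>a c x v. of_bool (x = 2 * c) * hv (a - c)) =
  (psum n (\<lambda>c d. real_of_int d) - psum n (\<lambda>c d. real_of_int (min c d)) - psum n (\<lambda>c d. of_bool (c < d))) / 2"
proof -
  have "qsum n (\<lambda>a c x v. of_bool (x = 2 * c) * hv (a - c)) =
     psum n (\<lambda>c d. \<Sum>k\<in>{k. 1 \<le> k \<and> 2 * k < d}. hv (d - c - 2 * k))"
  proof (rule qsum_fiber[where F = "\<lambda>c d k. (d - 2 * k, c, 2 * c, k)" and G = "\<lambda>(a, c, x, v). ((c, a + 2 * v), v)"])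
    show "finite {k::int. 1 \<le> k \<and> 2 * k < d}" for d
      by (rule finite_subset[of _ "{1..d}"]) auto
  qed (auto simp: quads_def algebra_simps)
  also have "\<dots> = psum n (\<lambda>c d. (1/2) * (real_of_int d - real_of_int (min c d) - of_bool (c < d)))"
  proof (rule psum_cong)
    fix c d :: int assume "c > 0" "d > 0"
    show "(\<Sum>k\<in>{k. 1 \<le> k \<and> 2 * k < d}. hv (d - c - 2 * k)) =
        (1/2) * (real_of_int d - real_of_int (min c d) - of_bool (c < d))"
    proof (cases "c < d")
      case True
      then show ?thesis using sum_hv_double[of "d - c" d] \<open>c > 0\<close> by simp
    next
      case False
      then show ?thesis by (auto intro!: sum.neutral simp: hv_def)
    qed
  qed
  also have "\<dots> = (1/2) * (psum n (\<lambda>c d. real_of_int d) - psum n (\<lambda>c d. real_of_int (min c d))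
      - psum n (\<lambda>c d. of_bool (c < d)))"
    by (simp only: psum_cmult psum_diff)
  finally show ?thesis by simp
qed

text \<open>Matrices with rows \<open>(a, u)\<close> and \<open>(v, c)\<close> and determinant
  \<open>n\<close>. The symmetrized form \<open>(a, u + v, c)\<close> has discriminant
  \<open>(u - v)\<^sup>2 - 4 * n\<close>, so \<open>v - u\<close> is the variable \<open>t\<close>
  of the Kronecker--Hurwitz relation and the strict inequality says that the form is definite. The
  last three conditions place it in the closed ideal triangle.\<close>

definition kset :: "int \<Rightarrow> (int \<times> int \<times> int \<times> int) set" where
  "kset n = {(a, u, v, c). a > 0 \<and> c > 0 \<and> a * c - u * v = n \<and> (u - v)\<^sup>2 < 4 * n \<and>
                0 \<le> u + v \<and> u + v \<le> 2 * a \<and> u + v \<le> 2 * c}"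

definition kwt :: "int \<times> int \<times> int \<times> int \<Rightarrow> real" where
  "kwt = (\<lambda>(a, u, v, c). hv (u + v) * hv (2 * a - u - v) * hv (2 * c - u - v))"

lemma finite_quad_part: "finite {(a,c,x,v)\<in>quads n. P a c x v}"
  by (rule finite_subset[OF _ finite_quads]) auto

lemma qsum_of_bool: "qsum n (\<lambda>a c x v. of_bool (P a c x v) * f a c x v) =
    (\<Sum>(a,c,x,v)\<in>{(a,c,x,v)\<in>quads n. P a c x v}. f a c x v)"
  unfolding qsum_def by (rule sum.mono_neutral_cong_right) (auto simp: finite_quads)

lemma reindex_finite_sum:
  assumes "\<And>a. a \<in> S \<Longrightarrow> i (j a) = a" "\<And>a. a \<in> S \<Longrightarrow> j a \<in> T"
    "\<And>b. b \<in> T \<Longrightarrow> j (i b) = b" "\<And>b. b \<in> T \<Longrightarrow> i b \<in> S"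
    "\<And>a. a \<in> S \<Longrightarrow> h (j a) = g a" "finite T"
  shows "finite S \<and> sum g S = sum h T"
proof
  have "S = i ` T"
    using assms(1-4) by (auto intro!: image_eqI)
  then show "finite S" using assms(6) by simp
  show "sum g S = sum h T"
    using assms by (intro sum.reindex_bij_witness[of S i j]) auto
qed

text \<open>From \<open>(a - u) * (c - u) + u * (a + c - u - v) = a * c - u * v\<close> one gets a
  quadruple \<open>(p, q, r, s)\<close>, and the conditions \<open>u < v\<close>,
  \<open>u + v \<le> 2 * a\<close>, \<open>u + v \<le> 2 * c\<close> become the triangle
  inequalities for \<open>p\<close>, \<open>q\<close>, \<open>s\<close>. At most one of these can
  fail, so the product weight equals 1 minus the three \<open>hv\<close> terms.\<close>

lemma kset_lt: "finite {(a, u, v, c) \<in> kset n. 0 < u \<and> u < v} \<and>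
  sum kwt {(a, u, v, c) \<in> kset n. 0 < u \<and> u < v} =
  qsum n (\<lambda>a c x v. of_bool (v < a + c) * (1 - hv (v - a - c) - hv (a - c - v) - hv (c - a - v)))"
proof -
  let ?g = "\<lambda>(a,c,x,v). 1 - hv (v - a - c) - hv (a - c - v) - hv (c - a - v)"
  let ?T = "{(a,c,x,v)\<in>quads n. v < a + c \<and> a \<le> c + v \<and> c \<le> a + v}"
  let ?j = "\<lambda>(a, u, v, c). (a - u, c - u, u, a + c - u - v) :: int \<times> int \<times> int \<times> int"
  let ?i = "\<lambda>(p, q, r, s). (p + r, r, p + q + r - s, q + r) :: int \<times> int \<times> int \<times> int"
  have "finite {(a, u, v, c) \<in> kset n. 0 < u \<and> u < v} \<and>
    sum kwt {(a, u, v, c) \<in> kset n. 0 < u \<and> u < v} = sum ?g ?T"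
  proof (rule reindex_finite_sum[of _ ?i ?j])
    fix b assume "b \<in> ?T"
    then obtain p q r s where b: "b = (p, q, r, s)" and
      *: "p > 0" "q > 0" "r > 0" "s > 0" "p * q + r * s = n" "s < p + q" "p \<le> q + s" "q \<le> p + s"
      by (auto simp: quads_def)
    have "4 * n - (p + q - s)\<^sup>2 = (s - (p - q)) * (s + (p - q)) + 2 * s * (p + q - s) + 4 * r * s"
      unfolding *(5)[symmetric] by (simp add: power2_eq_square algebra_simps)
    moreover have "(s - (p - q)) * (s + (p - q)) \<ge> 0" "2 * s * (p + q - s) > 0" "4 * r * s > 0"
      using * by auto
    ultimately have "(p + q - s)\<^sup>2 < 4 * n" by linarith
    moreover have "(r - (p + q + r - s))\<^sup>2 = (p + q - s)\<^sup>2" by (simp add: power2_eq_square algebra_simps)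
    moreover have "(p + r) * (q + r) - r * (p + q + r - s) = n"
      using *(5) by (simp add: algebra_simps)
    ultimately show "?i b \<in> {(a, u, v, c) \<in> kset n. 0 < u \<and> u < v}"
      using * b by (simp add: kset_def)
    show "?j (?i b) = b" using b by simp
  next
    fix b assume "b \<in> {(a, u, v, c) \<in> kset n. 0 < u \<and> u < v}"
    then obtain a u v c where b: "b = (a, u, v, c)" and
      *: "0 < u" "u < v" "a * c - u * v = n" "(u - v)\<^sup>2 < 4 * n" "u + v \<le> 2 * a" "u + v \<le> 2 * c"
      by (auto simp: kset_def)
    \<comment> \<open>Equality would force \<open>(u - v)\<^sup>2 = 4 * n\<close>, a form of
      discriminant zero.\<close>
    have ne: "a + c \<noteq> u + v"
    proof
      assume "a + c = u + v"
      then have "a = c" "u + v = 2 * a" using *(5,6) by auto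
      then have "4 * n = (u + v)\<^sup>2 - 4 * (u * v)" using *(3) by (simp add: power2_eq_square)
      then show False using *(4) by (simp add: power2_eq_square algebra_simps)
    qed
    have "(a - u) * (c - u) + u * (a + c - u - v) = n" using *(3) by (simp add: algebra_simps)
    then show "?j b \<in> ?T" using b * ne by (simp add: quads_def)
    show "?g (?j b) = kwt b" using b * ne by (simp add: kwt_def hv_def)
    show "?i (?j b) = b" using b by simp
  qed (rule finite_quad_part)
  moreover have "qsum n (\<lambda>a c x v. of_bool (v < a + c) * (1 - hv (v - a - c) - hv (a - c - v) - hv (c - a - v)))
    = qsum n (\<lambda>a c x v. of_bool (v < a + c \<and> a \<le> c + v \<and> c \<le> a + v) * (1 - hv (v - a - c) - hv (a - c - v) - hv (c - a - v)))"
    by (rule qsum_cong) (auto simp: hv_def)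
  ultimately show ?thesis by (simp add: qsum_of_bool)
qed

text \<open>The same substitution on the diagonal \<open>u = v\<close>. There the weight in
  \<open>kset\<close> is 1 while the expression in \<open>hv\<close> is 1/2, hence the factor 2. The
  excluded cases \<open>a = u\<close> and \<open>c = u\<close> would produce a zero entry.\<close>

lemma kset_eq: "finite {(a, u, v, c) \<in> kset n. 0 < u \<and> u = v \<and> a \<noteq> u \<and> c \<noteq> u} \<and>
  sum kwt {(a, u, v, c) \<in> kset n. 0 < u \<and> u = v \<and> a \<noteq> u \<and> c \<noteq> u} =
  2 * qsum n (\<lambda>a c x v. of_bool (v = a + c) * (1 - hv (v - a - c) - hv (a - c - v) - hv (c - a - v)))"
proof -
  let ?T = "{(a,c,x,v)\<in>quads n. v = a + c}"
  let ?S = "{(a, u, v, c) \<in> kset n. 0 < u \<and> u = v \<and> a \<noteq> u \<and> c \<noteq> u}"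
  have "finite ?S \<and> sum kwt ?S = sum (\<lambda>(a,c,x,v). 1) ?T"
  proof (rule reindex_finite_sum[of _ "\<lambda>(p, q, r, s). (p + r, r, r, q + r)" "\<lambda>(a, u, v, c). (a - u, c - u, u, a + c - u - v)"])
    fix b assume "b \<in> ?T"
    then obtain p q r s where b: "b = (p, q, r, s)" and
      *: "p > 0" "q > 0" "r > 0" "p * q + r * s = n" "s = p + q"
      by (auto simp: quads_def)
    have "p * q > 0" "r * s > 0" using * by auto
    then have "n > 0" using *(4) by linarith
    moreover have "(p + r) * (q + r) - r * r = n" using * by (simp add: algebra_simps)
    ultimately show "(\<lambda>(p, q, r, s). (p + r, r, r, q + r)) b \<in> ?S" using b * by (simp add: kset_def)
    show "(\<lambda>(a, u, v, c). (a - u, c - u, u, a + c - u - v)) ((\<lambda>(p, q, r, s). (p + r, r, r, q + r)) b) = b"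
      using b * by simp
  qed (use finite_quad_part in \<open>auto simp: kset_def kwt_def hv_def quads_def algebra_simps\<close>)
  moreover have "2 * qsum n (\<lambda>a c x v. of_bool (v = a + c) * (1 - hv (v - a - c) - hv (a - c - v) - hv (c - a - v)))
    = qsum n (\<lambda>a c x v. of_bool (v = a + c) * 1)"
    unfolding qsum_cmult[symmetric] by (rule qsum_cong) (auto simp: hv_def)
  ultimately show ?thesis by (simp only: qsum_of_bool)
qed

text \<open>These matrices lie on the side \<open>u + v = 2 * a\<close>, so each has weight 1/2, and
  the determinant is \<open>a * (c - a)\<close>.\<close>

lemma kset_eq1: "finite {(a, u, v, c) \<in> kset n. 0 < u \<and> u = v \<and> a = u} \<and>
  sum kwt {(a, u, v, c) \<in> kset n. 0 < u \<and> u = v \<and> a = u} = psum n (\<lambda>c d. 1) / 2"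
proof -
  have "finite {(a, u, v, c) \<in> kset n. 0 < u \<and> u = v \<and> a = u} \<and>
     sum kwt {(a, u, v, c) \<in> kset n. 0 < u \<and> u = v \<and> a = u} = sum (\<lambda>(c,d). 1/2) (dpairs n)"
  proof (rule reindex_finite_sum[of _ "\<lambda>(c, d). (c, c, c, c + d)" "\<lambda>(a, u, v, c). (a, c - a)"])
    fix b assume "b \<in> {(a, u, v, c) \<in> kset n. 0 < u \<and> u = v \<and> a = u}"
    then obtain a c where b: "b = (a, a, a, c)" and *: "a > 0" "a * c - a * a = n" "0 < 4 * n" "a \<le> c"
      by (auto simp: kset_def)
    have "a \<noteq> c" using * by auto
    then show "(\<lambda>(a, u, v, c). (a, c - a)) b \<in> dpairs n"
       "(case (\<lambda>(a, u, v, c). (a, c - a)) b of (c, d) \<Rightarrow> 1/2) = kwt b" using * b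
      by (auto simp: dpairs_def kwt_def hv_def algebra_simps)
  qed (auto simp: kset_def dpairs_def algebra_simps finite_dpairs[unfolded dpairs_def])
  then show ?thesis by (simp add: psum_def case_prod_unfold sum_divide_distrib)
qed

lemma kset_swap: "(a, u, v, c) \<in> kset n \<longleftrightarrow> (c, u, v, a) \<in> kset n"
  "(a, u, v, c) \<in> kset n \<longleftrightarrow> (a, v, u, c) \<in> kset n"
  by (auto simp: kset_def mult.commute power2_commute add.commute)

lemma kset_eq2: "finite {(a, u, v, c) \<in> kset n. 0 < u \<and> u = v \<and> c = u} \<and>
  sum kwt {(a, u, v, c) \<in> kset n. 0 < u \<and> u = v \<and> c = u} = psum n (\<lambda>c d. 1) / 2"
proof -
  have "finite {(a, u, v, c) \<in> kset n. 0 < u \<and> u = v \<and> c = u} \<and>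
    sum kwt {(a, u, v, c) \<in> kset n. 0 < u \<and> u = v \<and> c = u} =
    sum kwt {(a, u, v, c) \<in> kset n. 0 < u \<and> u = v \<and> a = u}"
    using kset_eq1[of n]
    by (intro reindex_finite_sum[of _ "\<lambda>(a, u, v, c). (c, u, v, a)" "\<lambda>(a, u, v, c). (c, u, v, a)"])
       (auto simp: kset_swap(1) kwt_def)
  then show ?thesis using kset_eq1 by simp
qed

text \<open>With \<open>x = - u\<close> the determinant already has the shape
  \<open>a * c + x * v\<close>. Quadruples with \<open>a = c\<close> and
  \<open>v = x + 2 * a\<close> would give \<open>(u - v)\<^sup>2 = 4 * n\<close> and are missing
  from \<open>kset\<close>; each has weight 1/4 in the first sum.\<close>

lemma kset_neg: "finite {(a, u, v, c) \<in> kset n. u < 0 \<and> 0 < v} \<and>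
  sum kwt {(a, u, v, c) \<in> kset n. u < 0 \<and> 0 < v} =
  qsum n (\<lambda>a c x v. hv (v - x) * hv (2 * a + x - v) * hv (2 * c + x - v)) -
  qsum n (\<lambda>a c x v. of_bool (a = c \<and> v = x + 2 * a)) / 4"
proof -
  let ?P = "\<lambda>a c x v. x \<le> v \<and> v \<le> 2 * a + x \<and> v \<le> 2 * c + x \<and> \<not> (a = c \<and> v = x + 2 * a)"
  let ?T = "{(a,c,x,v)\<in>quads n. ?P a c x v}"
  let ?S = "{(a, u, v, c) \<in> kset n. u < 0 \<and> 0 < v}"
  let ?g = "\<lambda>(a,c,x,v). hv (v - x) * hv (2 * a + x - v) * hv (2 * c + x - v)"
  have "finite ?S \<and> sum kwt ?S = sum ?g ?T"
  proof (rule reindex_finite_sum[of _ "\<lambda>(a, c, x, v). (a, - x, v, c)" "\<lambda>(a, u, v, c). (a, c, - u, v)"])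
    fix b assume "b \<in> ?T"
    then obtain a c x v where b: "b = (a, c, x, v)" and
      *: "a > 0" "c > 0" "x > 0" "v > 0" "a * c + x * v = n" "x \<le> v" "v \<le> 2 * a + x" "v \<le> 2 * c + x"
       "\<not> (a = c \<and> v = x + 2 * a)"
      by (auto simp: quads_def)
    have "(v - x) * (v - x) \<le> (2 * a) * (2 * c)"
      by (rule mult_mono) (use * in auto)
    moreover have "(v - x) * (v - x) \<noteq> (2 * a) * (2 * c)"
    proof
      assume eq: "(v - x) * (v - x) = (2 * a) * (2 * c)"
      show False
      proof (cases "v - x < 2 * a")
        case True
        have "(v - x) * (v - x) \<le> (v - x) * (2 * c)"
          by (rule mult_left_mono) (use * in auto)
        also have "\<dots> < (2 * a) * (2 * c)"
          by (rule mult_strict_right_mono) (use * True in auto)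
        finally show False using eq by simp
      next
        case False
        then have "v - x = 2 * a" using * by simp
        then show False using eq * by auto
      qed
    qed
    ultimately have "(v - x) * (v - x) < 4 * (a * c)" by simp
    then have "(- x - v)\<^sup>2 < 4 * n"
      unfolding *(5)[symmetric] by (simp add: power2_eq_square algebra_simps)
    then show "(\<lambda>(a, c, x, v). (a, - x, v, c)) b \<in> ?S" using b * by (simp add: kset_def)
  next
    fix b assume "b \<in> ?S"
    then obtain a u v c where b: "b = (a, u, v, c)" and
      *: "a > 0" "c > 0" "u < 0" "v > 0" "a * c - u * v = n" "(u - v)\<^sup>2 < 4 * n" "0 \<le> u + v" "u + v \<le> 2 * a" "u + v \<le> 2 * c"
      by (auto simp: kset_def)
    have "\<not> (a = c \<and> v = - u + 2 * a)"
    proof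
      assume "a = c \<and> v = - u + 2 * a"
      then have "4 * n = (u + v)\<^sup>2 - 4 * (u * v)" using *(5) by (simp add: power2_eq_square)
      then show False using *(6) by (simp add: power2_eq_square algebra_simps)
    qed
    then show "(\<lambda>(a, u, v, c). (a, c, - u, v)) b \<in> ?T" using b * by (auto simp: quads_def)
  qed (use finite_quad_part in \<open>auto simp: kwt_def hv_def\<close>)
  moreover have "qsum n (\<lambda>a c x v. hv (v - x) * hv (2 * a + x - v) * hv (2 * c + x - v)) =
    qsum n (\<lambda>a c x v. of_bool (?P a c x v) * (hv (v - x) * hv (2 * a + x - v) * hv (2 * c + x - v)) +
      (1/4) * of_bool (a = c \<and> v = x + 2 * a))"
    by (rule qsum_cong) (auto simp: hv_def)
  moreover have "\<dots> = sum ?g ?T + (1/4) * qsum n (\<lambda>a c x v. of_bool (a = c \<and> v = x + 2 * a))"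
    by (simp only: qsum_add qsum_cmult qsum_of_bool)
  ultimately show ?thesis by simp
qed

lemma kset_zero: "finite {(a, u, v, c) \<in> kset n. u = 0 \<and> v = 0} \<and>
  sum kwt {(a, u, v, c) \<in> kset n. u = 0 \<and> v = 0} = psum n (\<lambda>c d. 1) / 2"
proof -
  have "finite {(a, u, v, c) \<in> kset n. u = 0 \<and> v = 0} \<and>
     sum kwt {(a, u, v, c) \<in> kset n. u = 0 \<and> v = 0} = sum (\<lambda>(c,d). 1/2) (dpairs n)"
    by (rule reindex_finite_sum[of _ "\<lambda>(c, d). (c, 0, 0, d)" "\<lambda>(a, u, v, c). (a, c)"])
       (auto simp: kset_def dpairs_def kwt_def hv_def finite_dpairs[unfolded dpairs_def])
  then show ?thesis by (simp add: psum_def case_prod_unfold sum_divide_distrib)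
qed

text \<open>For \<open>u = 0\<close> one has \<open>a * c = n\<close>, and \<open>v\<close> runs up
  to \<open>2 * min a c\<close> with weight 1/2 at the end. If \<open>a = c\<close>, that end has
  \<open>v\<^sup>2 = 4 * n\<close> and is left out.\<close>

lemma kset_axis: "finite {(a, u, v, c) \<in> kset n. u = 0 \<and> 0 < v} \<and>
  sum kwt {(a, u, v, c) \<in> kset n. u = 0 \<and> 0 < v} =
  2 * psum n (\<lambda>c d. real_of_int (min c d)) - psum n (\<lambda>c d. 1) / 2 - psum n (\<lambda>c d. of_bool (c = d)) / 2"
proof -
  let ?S = "{(a, u, v, c) \<in> kset n. u = 0 \<and> 0 < v}"
  let ?I = "\<lambda>c d. {1..2 * min c d} - (if c = d then {2 * c} else {}) :: int set"
  have "finite ?S \<and> sum kwt ?S = sum (\<lambda>((a, c), v). hv (2 * a - v) * hv (2 * c - v)) (Sigma (dpairs n) (\<lambda>(c, d). ?I c d))"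
  proof (rule reindex_finite_sum[of _ "\<lambda>((a, c), v). (a, 0, v, c)" "\<lambda>(a, u, v, c). ((a, c), v)"])
    fix b assume "b \<in> ?S"
    then obtain a v c where b: "b = (a, 0, v, c)" and
      *: "a > 0" "c > 0" "a * c = n" "v\<^sup>2 < 4 * n" "0 < v" "v \<le> 2 * a" "v \<le> 2 * c"
      by (auto simp: kset_def)
    have "\<not> (a = c \<and> v = 2 * c)" using * by (auto simp: power2_eq_square)
    then show "(\<lambda>(a, u, v, c). ((a, c), v)) b \<in> Sigma (dpairs n) (\<lambda>(c, d). ?I c d)"
      using b * by (auto simp: dpairs_def)
  next
    fix b assume "b \<in> Sigma (dpairs n) (\<lambda>(c, d). ?I c d)"
    then obtain a c v where b: "b = ((a, c), v)" and
      *: "a > 0" "c > 0" "a * c = n" "0 < v" "v \<le> 2 * a" "v \<le> 2 * c" "\<not> (a = c \<and> v = 2 * c)"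
      by (auto simp: dpairs_def split: if_splits)
    have "v\<^sup>2 < 4 * n"
    proof (cases "v < 2 * a")
      case True
      have "v * v < (2 * a) * (2 * c)"
        by (rule mult_less_le_imp_less) (use * True in auto)
      then show ?thesis using * by (simp add: power2_eq_square)
    next
      case False
      then have "v = 2 * a" using * by simp
      then have "v < 2 * c" using * by linarith
      then have "v * v < (2 * c) * v"
        using * by (intro mult_strict_right_mono) auto
      then have "v * v < (2 * a) * (2 * c)"
        using \<open>v = 2 * a\<close> by (simp add: mult.commute)
      then show ?thesis using * by (simp add: power2_eq_square)
    qed
    then show "(\<lambda>((a, c), v). (a, 0, v, c)) b \<in> ?S" using b * by (simp add: kset_def)
  qed (auto simp: kwt_def hv_def finite_dpairs)
  moreover have "sum (\<lambda>((a, c), v). hv (2 * a - v) * hv (2 * c - v)) (Sigma (dpairs n) (\<lambda>(c, d). ?I c d))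
    = psum n (\<lambda>a c. \<Sum>v\<in>?I a c. hv (2 * a - v) * hv (2 * c - v))"
    unfolding psum_def by (subst sum.Sigma[symmetric]) (auto simp: finite_dpairs case_prod_unfold)
  moreover have "\<dots> = psum n (\<lambda>a c. 2 * real_of_int (min a c) - (1/2) * 1 - (1/2) * of_bool (a = c))"
  proof (rule psum_cong)
    fix a c :: int assume *: "a > 0" "c > 0"
    have I: "?I a c = (if a = c then {1..<2 * min a c} else insert (2 * min a c) {1..<2 * min a c})"
      using * by (auto simp: min_def)
    have "(\<Sum>v\<in>{1..<2 * min a c}. hv (2 * a - v) * hv (2 * c - v)) = (\<Sum>v\<in>{1..<2 * min a c}. 1)"
      by (rule sum.cong) (auto simp: hv_def)
    then have "(\<Sum>v\<in>{1..<2 * min a c}. hv (2 * a - v) * hv (2 * c - v)) = 2 * real_of_int (min a c) - 1"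
      using * by (auto simp: min_def)
    then show "(\<Sum>v\<in>?I a c. hv (2 * a - v) * hv (2 * c - v)) = 2 * real_of_int (min a c) - (1/2) * 1 - (1/2) * of_bool (a = c)"
      unfolding I by (auto simp: hv_def min_def)
  qed
  moreover have "\<dots> = 2 * psum n (\<lambda>c d. real_of_int (min c d)) - (1/2) * psum n (\<lambda>c d. 1) - (1/2) * psum n (\<lambda>c d. of_bool (c = d))"
    by (simp only: psum_diff psum_cmult)
  ultimately show ?thesis by simp
qed

text \<open>\<open>kset n\<close> is cut by the signs and the order of \<open>u\<close> and
  \<open>v\<close>; exchanging them doubles the three regions off the diagonal. With the factor 2 of
  \<open>kset_eq\<close> the positive part amounts to twice the first sum of
  \<open>T_sum_eq\<close>, the mixed part to twice the second, and the quarter of the quadruples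
  with \<open>a = c\<close>, \<open>v = x + 2 * a\<close> cancels.\<close>

theorem kset_sum:
  "finite (kset n) \<and> sum kwt (kset n) = 6 * psum n (\<lambda>c d. real_of_int d) - 3 * psum n (\<lambda>c d. real_of_int (min c d))
    + psum n (\<lambda>c d. of_bool (c = d)) / 2"
proof -
  define S where "S P = {(a, u, v, c) \<in> kset n. P a u v c}" for P :: "int \<Rightarrow> int \<Rightarrow> int \<Rightarrow> int \<Rightarrow> bool"
  have swap: "finite (S (\<lambda>a u v c. P v u)) \<and> sum kwt (S (\<lambda>a u v c. P v u)) = sum kwt (S (\<lambda>a u v c. P u v))"
    if "finite (S (\<lambda>a u v c. P u v))" for P
    unfolding S_def using that[unfolded S_def]
    by (intro reindex_finite_sum[of _ "\<lambda>(a, u, v, c). (a, v, u, c)" "\<lambda>(a, u, v, c). (a, v, u, c)"])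
       (auto simp: kset_swap(2) kwt_def add.commute diff_diff_eq)
  define T where "T a c x v = 1 - hv (v - a - c) - hv (a - c - v) - hv (c - a - v)" for a c x v :: int
  have zero: "T a c x v = 0" if "a > 0" "c > 0" "v > a + c" for a c x v
    using that by (auto simp: T_def hv_def)
  have T: "qsum n T = qsum n (\<lambda>a c x v. of_bool (v < a + c) * T a c x v) + qsum n (\<lambda>a c x v. of_bool (v = a + c) * T a c x v)"
    unfolding qsum_add[symmetric] by (rule qsum_cong) (auto simp: zero)
  have 1: "finite (S (\<lambda>a u v c. 0 < u \<and> u < v)) \<and> sum kwt (S (\<lambda>a u v c. 0 < u \<and> u < v)) =
      qsum n (\<lambda>a c x v. of_bool (v < a + c) * T a c x v)"
    unfolding S_def T_def by (rule kset_lt)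
  have 2: "finite (S (\<lambda>a u v c. 0 < u \<and> u = v \<and> a \<noteq> u \<and> c \<noteq> u)) \<and>
      sum kwt (S (\<lambda>a u v c. 0 < u \<and> u = v \<and> a \<noteq> u \<and> c \<noteq> u)) =
      2 * qsum n (\<lambda>a c x v. of_bool (v = a + c) * T a c x v)"
    unfolding S_def T_def by (rule kset_eq)
  have 3: "finite (S (\<lambda>a u v c. 0 < u \<and> u = v \<and> a = u)) \<and>
      sum kwt (S (\<lambda>a u v c. 0 < u \<and> u = v \<and> a = u)) = psum n (\<lambda>c d. 1) / 2"
    unfolding S_def by (rule kset_eq1)
  have 4: "finite (S (\<lambda>a u v c. 0 < u \<and> u = v \<and> c = u)) \<and>
      sum kwt (S (\<lambda>a u v c. 0 < u \<and> u = v \<and> c = u)) = psum n (\<lambda>c d. 1) / 2"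
    unfolding S_def by (rule kset_eq2)
  have 5: "finite (S (\<lambda>a u v c. u < 0 \<and> 0 < v)) \<and> sum kwt (S (\<lambda>a u v c. u < 0 \<and> 0 < v)) =
      qsum n (\<lambda>a c x v. hv (v - x) * hv (2 * a + x - v) * hv (2 * c + x - v)) -
      qsum n (\<lambda>a c x v. of_bool (a = c \<and> v = x + 2 * a)) / 4"
    unfolding S_def by (rule kset_neg)
  have 6: "finite (S (\<lambda>a u v c. u = 0 \<and> v = 0)) \<and>
      sum kwt (S (\<lambda>a u v c. u = 0 \<and> v = 0)) = psum n (\<lambda>c d. 1) / 2"
    unfolding S_def by (rule kset_zero)
  have 7: "finite (S (\<lambda>a u v c. u = 0 \<and> 0 < v)) \<and> sum kwt (S (\<lambda>a u v c. u = 0 \<and> 0 < v)) =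
      2 * psum n (\<lambda>c d. real_of_int (min c d)) - psum n (\<lambda>c d. 1) / 2 - psum n (\<lambda>c d. of_bool (c = d)) / 2"
    unfolding S_def by (rule kset_axis)
  note 8 = swap[of "\<lambda>u v. 0 < u \<and> u < v", OF conjunct1[OF 1]]
  note 9 = swap[of "\<lambda>u v. u < 0 \<and> 0 < v", OF conjunct1[OF 5]]
  note 10 = swap[of "\<lambda>u v. u = 0 \<and> 0 < v", OF conjunct1[OF 7]]
  have cover: "kset n \<subseteq> S (\<lambda>a u v c. 0 < u \<and> u < v) \<union> S (\<lambda>a u v c. 0 < u \<and> u = v \<and> a \<noteq> u \<and> c \<noteq> u) \<union>
     S (\<lambda>a u v c. 0 < u \<and> u = v \<and> a = u) \<union> S (\<lambda>a u v c. 0 < u \<and> u = v \<and> c = u) \<union>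
     S (\<lambda>a u v c. u < 0 \<and> 0 < v) \<union> S (\<lambda>a u v c. u = 0 \<and> v = 0) \<union> S (\<lambda>a u v c. u = 0 \<and> 0 < v) \<union>
     S (\<lambda>a u v c. 0 < v \<and> v < u) \<union> S (\<lambda>a u v c. v < 0 \<and> 0 < u) \<union> S (\<lambda>a u v c. v = 0 \<and> 0 < u)"
  proof (rule subsetI)
    fix q assume "q \<in> kset n"
    moreover obtain a u v c where q: "q = (a, u, v, c)" by (cases q)
    ultimately have *: "(a, u, v, c) \<in> kset n" by simp
    then have "u + v \<ge> 0" by (simp add: kset_def)
    then have "(0 < u \<and> u < v) \<or> (0 < u \<and> u = v \<and> a \<noteq> u \<and> c \<noteq> u) \<or> (0 < u \<and> u = v \<and> a = u) \<or>
       (0 < u \<and> u = v \<and> c = u) \<or> (u < 0 \<and> 0 < v) \<or> (u = 0 \<and> v = 0) \<or> (u = 0 \<and> 0 < v) \<or>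
       (0 < v \<and> v < u) \<or> (v < 0 \<and> 0 < u) \<or> (v = 0 \<and> 0 < u)" by presburger
    with * show "q \<in> S (\<lambda>a u v c. 0 < u \<and> u < v) \<union> S (\<lambda>a u v c. 0 < u \<and> u = v \<and> a \<noteq> u \<and> c \<noteq> u) \<union>
     S (\<lambda>a u v c. 0 < u \<and> u = v \<and> a = u) \<union> S (\<lambda>a u v c. 0 < u \<and> u = v \<and> c = u) \<union>
     S (\<lambda>a u v c. u < 0 \<and> 0 < v) \<union> S (\<lambda>a u v c. u = 0 \<and> v = 0) \<union> S (\<lambda>a u v c. u = 0 \<and> 0 < v) \<union>
     S (\<lambda>a u v c. 0 < v \<and> v < u) \<union> S (\<lambda>a u v c. v < 0 \<and> 0 < u) \<union> S (\<lambda>a u v c. v = 0 \<and> 0 < u)"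
      unfolding q S_def Un_iff mem_Collect_eq prod.case by blast
  qed
  have fin: "finite (kset n)"
    by (rule finite_subset[OF cover]) (use 1 2 3 4 5 6 7 8 9 10 in auto)
  have S: "sum kwt (S P) = (\<Sum>(a, u, v, c)\<in>kset n. of_bool (P a u v c) * kwt (a, u, v, c))" for P
    unfolding S_def by (rule sum.mono_neutral_cong_left) (auto simp: fin)
  have "sum kwt (kset n) = (\<Sum>(a, u, v, c)\<in>kset n. of_bool (0 < u \<and> u < v) * kwt (a, u, v, c)
     + of_bool (0 < u \<and> u = v \<and> a \<noteq> u \<and> c \<noteq> u) * kwt (a, u, v, c)
     + of_bool (0 < u \<and> u = v \<and> a = u) * kwt (a, u, v, c)
     + of_bool (0 < u \<and> u = v \<and> c = u) * kwt (a, u, v, c)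
     + of_bool (u < 0 \<and> 0 < v) * kwt (a, u, v, c)
     + of_bool (u = 0 \<and> v = 0) * kwt (a, u, v, c)
     + of_bool (u = 0 \<and> 0 < v) * kwt (a, u, v, c)
     + of_bool (0 < v \<and> v < u) * kwt (a, u, v, c)
     + of_bool (v < 0 \<and> 0 < u) * kwt (a, u, v, c)
     + of_bool (v = 0 \<and> 0 < u) * kwt (a, u, v, c))"
  proof (rule sum.cong[OF refl], clarify)
    fix a u v c assume *: "(a, u, v, c) \<in> kset n"
    \<comment> \<open>If all four entries agreed, \<open>n\<close> would be 0 against
      \<open>(u - v)\<^sup>2 < 4 * n\<close>; so the two boundary pieces of the diagonal do not
      overlap.\<close>
    have "\<not> (u = v \<and> a = u \<and> c = u)" "u + v \<ge> 0" using * by (auto simp: kset_def)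
    then have "(of_bool (0 < u \<and> u < v) + of_bool (0 < u \<and> u = v \<and> a \<noteq> u \<and> c \<noteq> u)
     + of_bool (0 < u \<and> u = v \<and> a = u) + of_bool (0 < u \<and> u = v \<and> c = u)
     + of_bool (u < 0 \<and> 0 < v) + of_bool (u = 0 \<and> v = 0) + of_bool (u = 0 \<and> 0 < v)
     + of_bool (0 < v \<and> v < u) + of_bool (v < 0 \<and> 0 < u) + of_bool (v = 0 \<and> 0 < u)) = (1::real)"
      by (cases "0 < u"; cases "0 < v"; cases "u = v"; cases "u < v"; cases "u = 0"; cases "v = 0"; simp; linarith?)
    then show "kwt (a, u, v, c) = of_bool (0 < u \<and> u < v) * kwt (a, u, v, c)
     + of_bool (0 < u \<and> u = v \<and> a \<noteq> u \<and> c \<noteq> u) * kwt (a, u, v, c)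
     + of_bool (0 < u \<and> u = v \<and> a = u) * kwt (a, u, v, c)
     + of_bool (0 < u \<and> u = v \<and> c = u) * kwt (a, u, v, c)
     + of_bool (u < 0 \<and> 0 < v) * kwt (a, u, v, c)
     + of_bool (u = 0 \<and> v = 0) * kwt (a, u, v, c)
     + of_bool (u = 0 \<and> 0 < v) * kwt (a, u, v, c)
     + of_bool (0 < v \<and> v < u) * kwt (a, u, v, c)
     + of_bool (v < 0 \<and> 0 < u) * kwt (a, u, v, c)
     + of_bool (v = 0 \<and> 0 < u) * kwt (a, u, v, c)"
      unfolding distrib_right[symmetric] by simp
  qed
  also have "\<dots> = sum kwt (S (\<lambda>a u v c. 0 < u \<and> u < v)) + sum kwt (S (\<lambda>a u v c. 0 < u \<and> u = v \<and> a \<noteq> u \<and> c \<noteq> u)) +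
     sum kwt (S (\<lambda>a u v c. 0 < u \<and> u = v \<and> a = u)) + sum kwt (S (\<lambda>a u v c. 0 < u \<and> u = v \<and> c = u)) +
     sum kwt (S (\<lambda>a u v c. u < 0 \<and> 0 < v)) + sum kwt (S (\<lambda>a u v c. u = 0 \<and> v = 0)) + sum kwt (S (\<lambda>a u v c. u = 0 \<and> 0 < v)) +
     sum kwt (S (\<lambda>a u v c. 0 < v \<and> v < u)) + sum kwt (S (\<lambda>a u v c. v < 0 \<and> 0 < u)) + sum kwt (S (\<lambda>a u v c. v = 0 \<and> 0 < u))"
    unfolding S by (simp only: sum.distrib case_prod_unfold)
  finally have total: "sum kwt (kset n) = \<dots>" .
  have Ts: "qsum n T + qsum n (\<lambda>a c x v. hv (v - x) * hv (2 * a + x - v) * hv (2 * c + x - v)) =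
     2 * (psum n (\<lambda>c d. real_of_int d) - psum n (\<lambda>c d. 1))
     - 5/2 * (psum n (\<lambda>c d. real_of_int (min c d)) - psum n (\<lambda>c d. 1))
     - (psum n (\<lambda>c d. 1) - psum n (\<lambda>c d. of_bool (c = d))) / 2 / 2
     + 2 * ((psum n (\<lambda>c d. real_of_int d) - psum n (\<lambda>c d. real_of_int (min c d))
          - (psum n (\<lambda>c d. 1) - psum n (\<lambda>c d. of_bool (c = d))) / 2) / 2)
     + qsum n (\<lambda>a c x v. of_bool (a = c \<and> v = x + 2 * a)) / 4"
    unfolding E1_val[symmetric] E3_val[symmetric] psum_less[symmetric] T_def
    unfolding E2_val[symmetric] T_sum_eq using E0_val[of n] psum_less[of n] by simp
  have arith: "k = 6 * sg - 3 * m + q / 2"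
    if "k = s1 + s2 + s3 + s4 + s5 + s6 + s7 + s8 + s9 + s10" "s1 = A" "s2 = 2 * B" "s3 = t / 2" "s4 = t / 2"
      "s5 = T2 - E / 4" "s6 = t / 2" "s7 = 2 * m - t / 2 - q / 2" "s8 = s1" "s9 = s5" "s10 = s7" "T1 = A + B"
      "T1 + T2 = 2 * (sg - t) - 5/2 * (m - t) - (t - q) / 2 / 2 + 2 * ((sg - m - (t - q) / 2) / 2) + E / 4"
    for k s1 s2 s3 s4 s5 s6 s7 s8 s9 s10 A B t T1 T2 E m q sg :: real
    using that by (simp add: field_simps)
  have "sum kwt (kset n) = 6 * psum n (\<lambda>c d. real_of_int d) - 3 * psum n (\<lambda>c d. real_of_int (min c d))
    + psum n (\<lambda>c d. of_bool (c = d)) / 2"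
    by (rule arith[OF total conjunct2[OF 1] conjunct2[OF 2] conjunct2[OF 3] conjunct2[OF 4] conjunct2[OF 5]
          conjunct2[OF 6] conjunct2[OF 7] conjunct2[OF 8] conjunct2[OF 9] conjunct2[OF 10] T Ts])
  with fin show ?thesis by blast
qed

section \<open>Hurwitz class numbers as weighted counts of forms\<close>

definition mat2 :: "int \<Rightarrow> int \<Rightarrow> int \<Rightarrow> int \<Rightarrow> int^2^2" where
  "mat2 p q r s = (\<chi> i j. if i = 1 then (if j = 1 then p else q) else (if j = 1 then r else s))"

lemma mat2_nth [simp]: "mat2 p q r s $ 1 $ 1 = p" "mat2 p q r s $ 1 $ 2 = q"
  "mat2 p q r s $ 2 $ 1 = r" "mat2 p q r s $ 2 $ 2 = s"
  by (simp_all add: mat2_def)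

lemma mat2_eta: "A = mat2 (A $ 1 $ 1) (A $ 1 $ 2) (A $ 2 $ 1) (A $ 2 $ 2)"
  by (simp add: vec_eq_iff forall_2)

lemma mat2_eq_iff [simp]: "mat2 p q r s = mat2 p' q' r' s' \<longleftrightarrow> p = p' \<and> q = q' \<and> r = r' \<and> s = s'"
  by (auto simp: vec_eq_iff forall_2)

lemma mat2_mult: "mat2 p q r s ** mat2 p' q' r' s' =
    mat2 (p * p' + q * r') (p * q' + q * s') (r * p' + s * r') (r * q' + s * s')"
  by (simp add: vec_eq_iff forall_2 matrix_matrix_mult_def sum_2)

lemma mat2_uminus: "- mat2 p q r s = mat2 (- p) (- q) (- r) (- s)"
  by (simp add: vec_eq_iff forall_2)

lemma mat2_SL2Z [simp]: "mat2 p q r s \<in> SL2Z \<longleftrightarrow> p * s - q * r = 1"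
  by (simp add: SL2Z_def det_2)

lemma SL2Z_mat2: "SL2Z = {mat2 p q r s | p q r s. p * s - q * r = 1}"
proof (intro equalityI subsetI)
  fix A assume "A \<in> SL2Z"
  then show "A \<in> {mat2 p q r s | p q r s. p * s - q * r = 1}"
    using mat2_eta[of A] mat2_SL2Z by (metis (mono_tags, lifting) mem_Collect_eq)
qed auto

lemma bqf_act_mult: "bqf_act (bqf_act Q A) B = bqf_act Q (A ** B)"
proof -
  obtain a b c where Q: "Q = (a, b, c)" by (cases Q)
  obtain p q r s where A: "A = mat2 p q r s" using mat2_eta by blast
  obtain p' q' r' s' where B: "B = mat2 p' q' r' s'" using mat2_eta by blast
  show ?thesis unfolding Q A B mat2_mult
    by (simp add: Let_def power2_eq_square algebra_simps)
qed

lemma SL2Z_mult: "A \<in> SL2Z \<Longrightarrow> B \<in> SL2Z \<Longrightarrow> A ** B \<in> SL2Z"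
  by (simp add: SL2Z_def det_mul)

definition inv2 :: "int^2^2 \<Rightarrow> int^2^2" where
  "inv2 A = mat2 (A $ 2 $ 2) (- A $ 1 $ 2) (- A $ 2 $ 1) (A $ 1 $ 1)"

lemma inv2_mat2 [simp]: "inv2 (mat2 p q r s) = mat2 s (- q) (- r) p"
  by (simp add: inv2_def)

lemma mat1_mat2: "mat 1 = mat2 1 0 0 1"
  by (simp add: vec_eq_iff forall_2 mat_def)

lemma inv2_SL2Z: "A \<in> SL2Z \<Longrightarrow> inv2 A \<in> SL2Z"
  "A \<in> SL2Z \<Longrightarrow> A ** inv2 A = mat 1" "A \<in> SL2Z \<Longrightarrow> inv2 A ** A = mat 1"
  by (auto simp: SL2Z_mat2 mat2_mult mat1_mat2 algebra_simps)

lemma bqf_act_one [simp]: "bqf_act Q (mat 1) = Q"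
  by (cases Q) (simp add: mat1_mat2)

lemma bqf_act_disc: "A \<in> SL2Z \<Longrightarrow> bqf_disc (bqf_act Q A) = bqf_disc Q"
proof -
  assume "A \<in> SL2Z"
  then obtain p q r s where A: "A = mat2 p q r s" "p * s - q * r = 1" by (auto simp: SL2Z_mat2)
  obtain a b c where Q: "Q = (a, b, c)" by (cases Q)
  have "bqf_disc (bqf_act Q A) = (b\<^sup>2 - 4 * a * c) * (p * s - q * r)\<^sup>2"
    unfolding Q A(1) by (simp add: Let_def power2_eq_square algebra_simps)
  then show ?thesis using A Q by simp
qed

lemma bqf_pos_def_iff:
  assumes "bqf_disc (a, b, c) < 0"
  shows "bqf_pos_def (a, b, c) \<longleftrightarrow> a > 0"
proof
  assume "bqf_pos_def (a, b, c)"
  from this[unfolded bqf_pos_def_def, rule_format, of 1 0] show "a > 0" by simp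
next
  assume a: "a > 0"
  show "bqf_pos_def (a, b, c)"
    unfolding bqf_pos_def_def
  proof (intro allI impI)
    fix x y :: int assume xy: "(x, y) \<noteq> (0, 0)"
    have id: "4 * a * bqf_eval (a, b, c) x y = (2 * a * x + b * y)\<^sup>2 + (- bqf_disc (a, b, c)) * y\<^sup>2"
      by (simp add: power2_eq_square algebra_simps)
    have "4 * a * bqf_eval (a, b, c) x y > 0"
    proof (cases "y = 0")
      case True
      then show ?thesis unfolding id using xy a by simp
    next
      case False
      have "(- bqf_disc (a, b, c)) * y\<^sup>2 > 0" using assms False by (intro mult_pos_pos) auto
      then show ?thesis unfolding id using zero_le_power2[of "2 * a * x + b * y"] by linarith
    qed
    then show "bqf_eval (a, b, c) x y > 0" using a by (simp add: zero_less_mult_iff)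
  qed
qed

definition pd_forms :: "int \<Rightarrow> bqf set" where
  "pd_forms N = {Q \<in> bqf_set (- N). bqf_pos_def Q}"

lemma bqf_eval_act: "bqf_eval (bqf_act Q (mat2 p q r s)) x y = bqf_eval Q (p * x + q * y) (r * x + s * y)"
  by (cases Q) (simp add: Let_def power2_eq_square algebra_simps)

lemma pd_forms_act: "Q \<in> pd_forms N \<Longrightarrow> A \<in> SL2Z \<Longrightarrow> bqf_act Q A \<in> pd_forms N"
proof -
  assume Q: "Q \<in> pd_forms N" and A: "A \<in> SL2Z"
  then obtain p q r s where A2: "A = mat2 p q r s" "p * s - q * r = 1" by (auto simp: SL2Z_mat2)
  have "bqf_eval (bqf_act Q A) x y > 0" if "(x, y) \<noteq> (0, 0)" for x y
  proof -
    have "(p * x + q * y, r * x + s * y) \<noteq> (0, 0)"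
    proof
      assume "(p * x + q * y, r * x + s * y) = (0, 0)"
      then have "s * (p * x + q * y) - q * (r * x + s * y) = 0" "p * (r * x + s * y) - r * (p * x + q * y) = 0" by simp_all
      then have "(p * s - q * r) * x = 0" "(p * s - q * r) * y = 0" by (simp_all add: algebra_simps)
      then show False using A2 that by simp
    qed
    then show ?thesis using Q unfolding A2 bqf_eval_act by (simp add: pd_forms_def bqf_pos_def_def)
  qed
  then show ?thesis using Q A by (auto simp: pd_forms_def bqf_set_def bqf_act_disc bqf_pos_def_def)
qed

text \<open>The indicator of the ideal triangle with vertices \<open>0\<close>, \<open>-1\<close>,
  \<infinity>, taken at the root of the form in the upper half plane: \<open>b = 0\<close> and
  \<open>b = 2 * a\<close> are the vertical sides, \<open>b = 2 * c\<close> is the half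
  circle.\<close>

fun twt :: "bqf \<Rightarrow> real" where
  "twt (a, b, c) = hv b * hv (2 * a - b) * hv (2 * c - b)"

lemma twt_nonzero_iff: "twt (a, b, c) \<noteq> 0 \<longleftrightarrow> 0 \<le> b \<and> b \<le> 2 * a \<and> b \<le> 2 * c"
  by (auto simp: hv_def)

text \<open>If \<open>x * y < 0 < x' * y'\<close>, then \<open>x * y'\<close> and
  \<open>y * x'\<close> have opposite signs and their difference has absolute value at least
  2.\<close>

lemma unit_det_sign:
  fixes x y x' y' :: int
  assumes "\<bar>x * y' - y * x'\<bar> = 1" "x * y < 0"
  shows "x' * y' \<le> 0"
proof (rule ccontr)
  assume "\<not> x' * y' \<le> 0"
  then have "x' * y' > 0" by simp
  have "(x * y') * (y * x') < 0"
    using mult_neg_pos[OF assms(2) \<open>x' * y' > 0\<close>] by (simp add: algebra_simps)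
  then have "(x * y' > 0 \<and> y * x' < 0) \<or> (x * y' < 0 \<and> y * x' > 0)"
    by (rule mult_less_0_iff[THEN iffD1])
  then show False using assms(1) by linarith
qed

text \<open>The product of the three quantities is \<open>- (x * y * (x - y))\<^sup>2\<close>, so
  they cannot all be positive.\<close>

lemma row_boundary:
  fixes x y :: int
  assumes "x * y \<ge> 0" "x * (x - y) \<ge> 0" "y * (y - x) \<ge> 0"
  shows "x = 0 \<or> y = 0 \<or> x = y"
proof (rule ccontr)
  assume "\<not> ?thesis"
  then have ne: "x \<noteq> 0" "y \<noteq> 0" "x \<noteq> y" by auto
  then have "x * y > 0" using assms(1) by (simp add: order_less_le)
  have "x * (x - y) > 0" "y * (y - x) > 0" using assms(2,3) ne by (simp_all add: order_less_le)
  then have "(x * (x - y)) * (y * (y - x)) > 0" by (rule mult_pos_pos)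
  moreover have "(x * (x - y)) * (y * (y - x)) = - (x * y) * (x - y)\<^sup>2" by (simp add: power2_eq_square algebra_simps)
  moreover have "x * y * (x - y)\<^sup>2 > 0" by (rule mult_pos_pos[OF \<open>x * y > 0\<close>]) (use ne in simp)
  ultimately show False by simp
qed

text \<open>A negative product in the first row makes the products of the other two rows nonpositive
  by \<open>unit_det_sign\<close>, and the weighted sum would be negative.\<close>

lemma unimodular_rows_sign:
  fixes x1 y1 x2 y2 x3 y3 A B C :: int
  assumes d: "\<bar>x1 * y2 - y1 * x2\<bar> = 1" "\<bar>x1 * y3 - y1 * x3\<bar> = 1"
    and "A > 0" "B \<ge> 0" "C \<ge> 0"
    and s: "A * (x1 * y1) + B * (x2 * y2) + C * (x3 * y3) \<ge> 0"
  shows "x1 * y1 \<ge> 0"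
proof (rule ccontr)
  assume "\<not> x1 * y1 \<ge> 0"
  then have n: "x1 * y1 < 0" by simp
  have "x2 * y2 \<le> 0" "x3 * y3 \<le> 0" using unit_det_sign[OF d(1) n] unit_det_sign[OF d(2) n] by auto
  then have "B * (x2 * y2) \<le> 0" "C * (x3 * y3) \<le> 0" "A * (x1 * y1) < 0"
    using assms n by (simp_all add: mult_nonneg_nonpos mult_pos_neg)
  then show False using s by linarith
qed

lemma unimodular_row_boundary:
  fixes x1 y1 x2 y2 x3 y3 A B C :: int
  assumes d: "\<bar>x1 * y2 - y1 * x2\<bar> = 1" "\<bar>x1 * y3 - y1 * x3\<bar> = 1"
    and "A > 0" "B \<ge> 0" "C \<ge> 0"
    and s: "A * (x1 * y1) + B * (x2 * y2) + C * (x3 * y3) \<ge> 0"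
      "A * (x1 * (x1 - y1)) + B * (x2 * (x2 - y2)) + C * (x3 * (x3 - y3)) \<ge> 0"
      "A * (y1 * (y1 - x1)) + B * (y2 * (y2 - x2)) + C * (y3 * (y3 - x3)) \<ge> 0"
  shows "(x1, y1) \<in> {(1,0),(0,1),(1,1),(-1,0),(0,-1),(-1,-1)}"
proof -
  have "x1 * y1 \<ge> 0" by (rule unimodular_rows_sign[OF d assms(3-5) s(1)])
  moreover have "x1 * (x1 - y1) \<ge> 0"
    by (rule unimodular_rows_sign[OF _ _ assms(3-5) s(2)]) (use d in \<open>simp_all add: algebra_simps abs_minus_commute\<close>)
  moreover have "y1 * (y1 - x1) \<ge> 0"
    by (rule unimodular_rows_sign[OF _ _ assms(3-5) s(3)]) (use d in \<open>simp_all add: algebra_simps abs_minus_commute\<close>)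
  ultimately have "x1 = 0 \<or> y1 = 0 \<or> x1 = y1" by (rule row_boundary)
  moreover have unit: "\<bar>k\<bar> = 1" if "\<bar>k * m\<bar> = 1" for k m :: int
    using that by (rule abs_zmult_eq_1)
  moreover have "\<bar>y1\<bar> = 1" if "x1 = 0" using d(1) that unit[of y1 x2] by simp
  moreover have "\<bar>x1\<bar> = 1" if "y1 = 0" using d(1) that unit[of x1 y2] by simp
  moreover have "\<bar>x1\<bar> = 1" if "x1 = y1"
    using d(1) that unit[of x1 "y2 - x2"] by (simp add: right_diff_distrib)
  ultimately have "(x1 = 0 \<and> \<bar>y1\<bar> = 1) \<or> (y1 = 0 \<and> \<bar>x1\<bar> = 1) \<or> (x1 = y1 \<and> \<bar>x1\<bar> = 1)"
    by blast
  then show ?thesis by (auto simp: abs_if split: if_splits)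
qed

text \<open>Selling's parameters: twice the form is \<open>(2*a-b) * x\<^sup>2 + (2*c-b) * y\<^sup>2
  + b * (x+y)\<^sup>2\<close>. A substitution sends the three linear forms to the rows
  \<open>(p, q)\<close>, \<open>(r, s)\<close>, \<open>(p+r, q+s)\<close>, any two of determinant 1
  or -1. Lying in the triangle thus becomes nonnegativity of positive combinations of row
  products.\<close>

lemma act_selling:
  assumes "bqf_act (a, b, c) (mat2 p q r s) = (a', b', c')"
  shows "b' = (2*a-b) * (p * q) + (2*c-b) * (r * s) + b * ((p+r) * (q+s))"
    "2*a'-b' = (2*a-b) * (p * (p-q)) + (2*c-b) * (r * (r-s)) + b * ((p+r) * ((p+r)-(q+s)))"
    "2*c'-b' = (2*a-b) * (q * (q-p)) + (2*c-b) * (s * (s-r)) + b * ((q+s) * ((q+s)-(p+r)))"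
  using assms by (auto simp: Let_def power2_eq_square algebra_simps)

definition rot1 :: "int^2^2" where "rot1 = mat2 1 1 (-1) 0"

definition gset :: "bqf \<Rightarrow> (int^2^2) set" where
  "gset Q = {A \<in> SL2Z. twt (bqf_act Q A) \<noteq> 0}"

definition wsum :: "bqf \<Rightarrow> real" where
  "wsum Q = (\<Sum>A\<in>gset Q. twt (bqf_act Q A))"

text \<open>Each side of the triangle is one of the three inequalities of
  \<open>unimodular_row_boundary\<close>. That lemma needs a positive coefficient at the row in
  question; on the side \<open>b = 0\<close> this fails for the third row.\<close>

lemma gset_rows:
  assumes "0 \<le> b" "b < 2 * a" "b < 2 * c" "mat2 p q r s \<in> gset (a, b, c)"
  shows "p * s - q * r = 1" "(p, q) \<in> {(1,0),(0,1),(1,1),(-1,0),(0,-1),(-1,-1)}"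
    "(r, s) \<in> {(1,0),(0,1),(1,1),(-1,0),(0,-1),(-1,-1)}"
    "b > 0 \<Longrightarrow> (p + r, q + s) \<in> {(1,0),(0,1),(1,1),(-1,0),(0,-1),(-1,-1)}"
proof -
  obtain a' b' c' where act: "bqf_act (a, b, c) (mat2 p q r s) = (a', b', c')"
    by (metis prod_cases3)
  show det: "p * s - q * r = 1" using assms(4) by (simp add: gset_def)
  have "0 \<le> b'" "0 \<le> 2*a' - b'" "0 \<le> 2*c'-b'"
    using assms(4) unfolding gset_def mem_Collect_eq act twt_nonzero_iff by auto
  then have s: "0 \<le> (2*a-b) * (p * q) + (2*c-b) * (r * s) + b * ((p+r) * (q+s))"
    "0 \<le> (2*a-b) * (p * (p-q)) + (2*c-b) * (r * (r-s)) + b * ((p+r) * ((p+r)-(q+s)))"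
    "0 \<le> (2*a-b) * (q * (q-p)) + (2*c-b) * (s * (s-r)) + b * ((q+s) * ((q+s)-(p+r)))"
    using act_selling[OF act] by metis+
  have ineq: "2*a-b > 0" "2*c-b > 0" using assms by auto
  have d: "p * s - q * r = 1" "p * (q + s) - q * (p + r) = 1" "r * q - s * p = -1" "r * (q + s) - s * (p + r) = -1"
    "(p + r) * q - (q + s) * p = -1" "(p + r) * s - (q + s) * r = 1"
    using det by (simp_all add: algebra_simps)
  show "(p, q) \<in> {(1,0),(0,1),(1,1),(-1,0),(0,-1),(-1,-1)}"
    by (rule unimodular_row_boundary[OF _ _ ineq(1) less_imp_le[OF ineq(2)] assms(1) s]) (simp_all add: d)
  show "(r, s) \<in> {(1,0),(0,1),(1,1),(-1,0),(0,-1),(-1,-1)}"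
    by (rule unimodular_row_boundary[of r q s p "q + s" "p + r", OF _ _ ineq(2) less_imp_le[OF ineq(1)] assms(1)])
       ((simp add: d; fail) | (insert s, linarith))+
  show "(p + r, q + s) \<in> {(1,0),(0,1),(1,1),(-1,0),(0,-1),(-1,-1)}" if "b > 0"
    by (rule unimodular_row_boundary[of "p + r" q "q + s" p s r, OF _ _ that less_imp_le[OF ineq(1)] less_imp_le[OF ineq(2)]])
       ((simp add: d; fail) | (insert s, linarith))+
qed

text \<open>The matrices are, up to sign, the rotations of order three that permute the vertices of
  the triangle.\<close>

lemma gset_interior:
  assumes "0 < b" "b < 2 * a" "b < 2 * c"
  shows "gset (a, b, c) = {mat2 1 0 0 1, mat2 (-1) 0 0 (-1), mat2 1 1 (-1) 0, mat2 (-1) (-1) 1 0,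
            mat2 0 1 (-1) (-1), mat2 0 (-1) 1 1}" (is "_ = ?R")
proof (intro equalityI subsetI)
  fix M assume "M \<in> gset (a, b, c)"
  moreover obtain p q r s where M: "M = mat2 p q r s" using mat2_eta by blast
  ultimately have "mat2 p q r s \<in> gset (a, b, c)" by simp
  note * = gset_rows[OF less_imp_le[OF assms(1)] assms(2,3) this]
  show "M \<in> ?R" using *(2,3) unfolding insert_iff empty_iff prod.inject
    by (elim disjE conjE FalseE) (use *(1) *(4)[OF assms(1)] in \<open>simp_all add: M\<close>)
next
  fix M assume "M \<in> ?R"
  then show "M \<in> gset (a, b, c)" using assms by (auto simp: gset_def hv_def Let_def power2_eq_square)
qed

lemma wsum_interior:
  assumes "0 < b" "b < 2 * a" "b < 2 * c"
  shows "finite (gset (a, b, c))" "wsum (a, b, c) = 6"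
  unfolding wsum_def gset_interior[OF assms] using assms
  by (auto simp: hv_def Let_def power2_eq_square)

text \<open>A point on a side also belongs to the neighbouring triangle: twice as many matrices,
  each of weight 1/2, so the total is again 6.\<close>

lemma gset_edge:
  assumes "0 < a" "0 < c"
  shows "gset (a, 0, c) = {mat2 1 0 0 1, mat2 (-1) 0 0 (-1), mat2 1 1 (-1) 0, mat2 (-1) (-1) 1 0,
            mat2 0 1 (-1) (-1), mat2 0 (-1) 1 1, mat2 0 1 (-1) 0, mat2 0 (-1) 1 0,
            mat2 1 0 1 1, mat2 (-1) 0 (-1) (-1), mat2 1 1 0 1, mat2 (-1) (-1) 0 (-1)}" (is "_ = ?R")
proof (intro equalityI subsetI)
  fix M assume "M \<in> gset (a, 0, c)"
  moreover obtain p q r s where M: "M = mat2 p q r s" using mat2_eta by blast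
  ultimately have "mat2 p q r s \<in> gset (a, 0, c)" by simp
  note * = gset_rows[OF _ _ _ this]
  have "(p, q) \<in> {(1,0),(0,1),(1,1),(-1,0),(0,-1),(-1,-1)}"
    "(r, s) \<in> {(1,0),(0,1),(1,1),(-1,0),(0,-1),(-1,-1)}"
    by (rule *; use assms in simp)+
  moreover have "p * s - q * r = 1" by (rule *(1)) (use assms in auto)
  ultimately show "M \<in> ?R" unfolding insert_iff empty_iff prod.inject
    by (elim disjE conjE FalseE) (simp_all add: M)
next
  fix M assume "M \<in> ?R"
  then show "M \<in> gset (a, 0, c)" using assms by (auto simp: gset_def hv_def Let_def power2_eq_square)
qed

lemma wsum_edge:
  assumes "0 < a" "0 < c"
  shows "finite (gset (a, 0, c))" "wsum (a, 0, c) = 6"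
  unfolding wsum_def gset_edge[OF assms] using assms
  by (auto simp: hv_def Let_def power2_eq_square)

lemma gset_act:
  assumes "M \<in> SL2Z"
  shows "gset (bqf_act Q M) = (\<lambda>A. inv2 M ** A) ` gset Q"
    and "wsum (bqf_act Q M) = wsum Q" and "finite (gset (bqf_act Q M)) \<longleftrightarrow> finite (gset Q)"
proof -
  have 1: "M ** (inv2 M ** A) = A" "inv2 M ** (M ** A) = A" for A
    using inv2_SL2Z[OF assms] by (simp_all add: matrix_mul_assoc)
  show eq: "gset (bqf_act Q M) = (\<lambda>A. inv2 M ** A) ` gset Q"
  proof (intro equalityI subsetI)
    fix A assume "A \<in> gset (bqf_act Q M)"
    then have "M ** A \<in> gset Q" using assms by (auto simp: gset_def bqf_act_mult SL2Z_mult)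
    then show "A \<in> (\<lambda>A. inv2 M ** A) ` gset Q" using 1 by (metis image_eqI)
  next
    fix A assume "A \<in> (\<lambda>A. inv2 M ** A) ` gset Q"
    then obtain B where "B \<in> gset Q" "A = inv2 M ** B" by auto
    then show "A \<in> gset (bqf_act Q M)"
      using assms inv2_SL2Z(1)[OF assms] by (auto simp: gset_def bqf_act_mult SL2Z_mult 1)
  qed
  have inj: "inj_on (\<lambda>A. inv2 M ** A) (gset Q)"
    by (rule inj_onI) (metis 1(1))
  show "wsum (bqf_act Q M) = wsum Q"
    unfolding wsum_def eq sum.reindex[OF inj] by (simp add: bqf_act_mult 1)
  show "finite (gset (bqf_act Q M)) \<longleftrightarrow> finite (gset Q)"
    unfolding eq using inj by (simp add: finite_image_iff)
qed

text \<open>The sides \<open>b = 2 * a\<close> and \<open>b = 2 * c\<close> are moved to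
  \<open>b = 0\<close> by a unipotent matrix; negative discriminant keeps the outer coefficients
  positive.\<close>

lemma wsum_T:
  assumes "0 \<le> b" "b \<le> 2 * a" "b \<le> 2 * c" "b\<^sup>2 - 4 * a * c < 0"
  shows "finite (gset (a, b, c)) \<and> wsum (a, b, c) = 6"
proof -
  have ac: "a > 0" "c > 0" using assms by (auto simp: order_less_le)
  consider "0 < b" "b < 2 * a" "b < 2 * c" | "b = 0" | "b = 2 * a" | "b = 2 * c"
    using assms by linarith
  then show ?thesis
  proof cases
    case 1
    then show ?thesis using wsum_interior by blast
  next
    case 2
    then show ?thesis using wsum_edge[of a c] ac by simp
  next
    case 3
    have act: "bqf_act (a, b, c) (mat2 1 (-1) 0 1) = (a, 0, c - a)" using 3 by (simp add: Let_def)
    have "c > a" using assms ac 3 by (simp add: power2_eq_square)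
    then show ?thesis using wsum_edge[of a "c - a"] ac gset_act[of "mat2 1 (-1) 0 1" "(a, b, c)"] unfolding act by simp
  next
    case 4
    have act: "bqf_act (a, b, c) (mat2 1 0 (-1) 1) = (a - c, 0, c)" using 4 by (simp add: Let_def)
    have "c < a" using assms ac 4 by (simp add: power2_eq_square)
    then show ?thesis using wsum_edge[of "a - c" c] ac gset_act[of "mat2 1 0 (-1) 1" "(a, b, c)"] unfolding act by simp
  qed
qed

text \<open>Selling reduction. The sum \<open>2 * a + 2 * c - b\<close> of the parameters is the sum
  of the values at \<open>(1,0)\<close>, \<open>(0,1)\<close>, \<open>(1,-1)\<close>, hence
  positive, and a negative parameter allows a substitution that lowers it.\<close>

lemma exists_T:
  assumes "Q \<in> pd_forms N" "N > 0"
  shows "\<exists>M\<in>SL2Z. twt (bqf_act Q M) \<noteq> 0"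
proof -
  have "\<exists>M\<in>SL2Z. twt (bqf_act Q M) \<noteq> 0" if "Q \<in> pd_forms N" "nat (case Q of (a, b, c) \<Rightarrow> 2 * a + 2 * c - b) = k" for Q k
    using that
  proof (induction k arbitrary: Q rule: less_induct)
    case (less k)
    obtain a b c where Q: "Q = (a, b, c)" by (cases Q)
    have pos: "bqf_eval Q x y > 0" if "(x, y) \<noteq> (0, 0)" for x y
      using less.prems(1) that by (auto simp: pd_forms_def bqf_pos_def_def)
    have S: "2 * a + 2 * c - b > 0" using pos[of 1 0] pos[of 0 1] pos[of 1 "-1"] Q by simp
    show ?case
    proof (cases "twt Q = 0")
      case False
      then show ?thesis by (intro bexI[of _ "mat2 1 0 0 1"]) (simp_all flip: mat1_mat2, simp add: SL2Z_def)
    next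
      case True
      have step: ?thesis if M: "M \<in> SL2Z" "bqf_act Q M = (a', b', c')" "2 * a' + 2 * c' - b' < 2 * a + 2 * c - b" for M a' b' c'
      proof -
        have "(a', b', c') \<in> pd_forms N" using pd_forms_act[OF less.prems(1) M(1)] M by simp
        from less.IH[OF _ this refl] obtain M' where "M' \<in> SL2Z" "twt (bqf_act (a', b', c') M') \<noteq> 0"
          using M(3) less.prems(2) S Q by auto
        then show ?thesis using M SL2Z_mult[of M M'] bqf_act_mult[of Q M M'] by metis
      qed
      from True Q twt_nonzero_iff[of a b c] consider "b < 0" | "b > 2 * a" | "b > 2 * c" by fastforce
      then show ?thesis
      proof cases
        case 1
        show ?thesis by (rule step[of "mat2 0 (-1) 1 0" c "- b" a]) (use 1 Q in \<open>simp_all add: Let_def\<close>)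
      next
        case 2
        show ?thesis by (rule step[of "mat2 1 (-1) 0 1" a "b - 2 * a" "a + c - b"])
          (use 2 Q in \<open>simp_all add: Let_def\<close>)
      next
        case 3
        show ?thesis by (rule step[of "mat2 1 0 (-1) 1" "a + c - b" "b - 2 * c" c])
          (use 3 Q in \<open>simp_all add: Let_def\<close>)
      qed
    qed
  qed
  then show ?thesis using assms by blast
qed

lemma wsum_eq:
  assumes "Q \<in> pd_forms N" "N > 0"
  shows "finite (gset Q)" "wsum Q = 6"
proof -
  obtain M where M: "M \<in> SL2Z" "twt (bqf_act Q M) \<noteq> 0" using exists_T[OF assms] by blast
  obtain a b c where abc: "bqf_act Q M = (a, b, c)" by (metis prod_cases3)
  have "(a, b, c) \<in> pd_forms N" using pd_forms_act[OF assms(1) M(1)] abc by simp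
  then have "b\<^sup>2 - 4 * a * c < 0" using assms(2) by (simp add: pd_forms_def bqf_set_def)
  moreover have "0 \<le> b" "b \<le> 2 * a" "b \<le> 2 * c" using M(2) unfolding abc twt_nonzero_iff by auto
  ultimately have "finite (gset (a, b, c)) \<and> wsum (a, b, c) = 6" using wsum_T by blast
  then show "finite (gset Q)" "wsum Q = 6" using gset_act[OF M(1), of Q] abc by simp_all
qed

definition SLstab :: "bqf \<Rightarrow> (int^2^2) set" where
  "SLstab Q = {A \<in> SL2Z. bqf_act Q A = Q}"

lemma mat2_neg_act: "bqf_act Q (- A) = bqf_act Q A"
  by (cases Q) (simp add: Let_def)

lemma SL2Z_neg: "A \<in> SL2Z \<Longrightarrow> - A \<in> SL2Z" "A \<in> SL2Z \<Longrightarrow> - A \<noteq> A"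
proof -
  assume "A \<in> SL2Z"
  then obtain p q r s where A: "A = mat2 p q r s" "p * s - q * r = 1" by (auto simp: SL2Z_mat2)
  show "- A \<in> SL2Z" unfolding A(1) mat2_uminus using A(2) by simp
  show "- A \<noteq> A" unfolding A(1) mat2_uminus mat2_eq_iff using A(2) by auto
qed

lemma card_SLstab:
  assumes "finite (SLstab Q)"
  shows "card (SLstab Q) = 2 * card (PSL2Z_stabilizer Q)"
proof -
  have "card (SLstab Q) = (\<Sum>B\<in>PSL2Z_stabilizer Q. card {A \<in> SLstab Q. {A, - A} = B})"
  proof -
    have "(\<Sum>B\<in>PSL2Z_stabilizer Q. \<Sum>A\<in>{A \<in> SLstab Q. {A, - A} = B}. (1::nat)) = (\<Sum>A\<in>SLstab Q. 1)"
      by (rule sum.group[of "SLstab Q" "PSL2Z_stabilizer Q" "\<lambda>A. {A, - A}"])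
         (use assms in \<open>auto simp: PSL2Z_stabilizer_def SLstab_def\<close>)
    then show ?thesis by simp
  qed
  also have "\<dots> = (\<Sum>B\<in>PSL2Z_stabilizer Q. 2)"
  proof (rule sum.cong[OF refl])
    fix B assume "B \<in> PSL2Z_stabilizer Q"
    then obtain A where A: "A \<in> SLstab Q" "B = {A, - A}" by (auto simp: PSL2Z_stabilizer_def SLstab_def)
    have "{A' \<in> SLstab Q. {A', - A'} = B} = {A, - A}"
      using A SL2Z_neg(1) by (auto simp: SLstab_def mat2_neg_act doubleton_eq_iff)
    then show "card {A' \<in> SLstab Q. {A', - A'} = B} = 2"
      using SL2Z_neg(2)[of A] A by (auto simp: SLstab_def card_2_iff)
  qed
  finally show ?thesis by simp
qed

definition supp_forms :: "int \<Rightarrow> bqf set" where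
  "supp_forms N = {Q \<in> pd_forms N. twt Q \<noteq> 0}"

lemma finite_supp_forms: "N > 0 \<Longrightarrow> finite (supp_forms N)"
proof (rule finite_subset)
  assume N: "N > 0"
  show "supp_forms N \<subseteq> {0..N} \<times> {0..N} \<times> {0..N}"
  proof
    fix Q assume Q: "Q \<in> supp_forms N"
    obtain a b c where abc: "Q = (a, b, c)" by (cases Q)
    have *: "b\<^sup>2 - 4 * a * c = - N" "0 \<le> b" "b \<le> 2 * a" "b \<le> 2 * c"
      using Q twt_nonzero_iff[of a b c] unfolding abc by (auto simp: supp_forms_def pd_forms_def bqf_set_def)
    define A B where "A = 2 * a - b" and "B = 2 * c - b"
    have AB: "A \<ge> 0" "B \<ge> 0" using * by (auto simp: A_def B_def)
    \<comment> \<open>In Selling's parameters minus the discriminant is the second elementary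
      symmetric function. All three parameters are nonnegative and no two vanish together, so each
      is at most \<open>N\<close>.\<close>
    have eq: "A * B + b * (A + B) = N" using *(1) by (simp add: A_def B_def power2_eq_square algebra_simps)
    have prod: "A * B \<ge> 0" "b * A \<ge> 0" "b * B \<ge> 0" using AB * by auto
    have le: "x \<le> x * y" if "x \<ge> 0" "y > 0" for x y :: int using that by (simp add: mult_le_cancel_left1)
    have "A \<le> N \<and> B \<le> N \<and> b \<le> N"
    proof (intro conjI)
      have "b + B \<noteq> 0"
      proof
        assume "b + B = 0"
        then have "b = 0" "B = 0" using AB *(2) by linarith+
        then show False using eq N by simp
      qed
      then have "A \<le> A * (b + B)" using AB * by (intro le) auto
      then show "A \<le> N" using eq prod by (simp add: algebra_simps)
      have "b + A \<noteq> 0"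
      proof
        assume "b + A = 0"
        then have "b = 0" "A = 0" using AB *(2) by linarith+
        then show False using eq N by simp
      qed
      then have "B \<le> B * (b + A)" using AB * by (intro le) auto
      then show "B \<le> N" using eq prod by (simp add: algebra_simps)
      have "A + B \<noteq> 0"
      proof
        assume "A + B = 0"
        then have "A = 0" "B = 0" using AB *(2) by linarith+
        then show False using eq N by simp
      qed
      then have "b \<le> b * (A + B)" using AB * by (intro le) auto
      then show "b \<le> N" using eq prod by (simp add: algebra_simps)
    qed
    then show "Q \<in> {0..N} \<times> {0..N} \<times> {0..N}"
      unfolding abc using * by (auto simp: A_def B_def)
  qed
qed auto

lemma class_eq: "bqf_equiv `` {Q} = (\<lambda>A. bqf_act Q A) ` SL2Z"
  by (auto simp: bqf_equiv_def)

lemma class_act: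
  assumes "M \<in> SL2Z"
  shows "bqf_equiv `` {bqf_act Q M} = bqf_equiv `` {Q}"
  unfolding class_eq
proof (intro equalityI subsetI)
  fix x assume "x \<in> (\<lambda>A. bqf_act (bqf_act Q M) A) ` SL2Z"
  then show "x \<in> (\<lambda>A. bqf_act Q A) ` SL2Z" using assms SL2Z_mult by (auto simp: bqf_act_mult)
next
  fix x assume "x \<in> (\<lambda>A. bqf_act Q A) ` SL2Z"
  then obtain A where A: "A \<in> SL2Z" "x = bqf_act Q A" by auto
  have "bqf_act (bqf_act Q M) (inv2 M ** A) = x"
    using A inv2_SL2Z[OF assms] by (simp add: bqf_act_mult matrix_mul_assoc)
  then show "x \<in> (\<lambda>A. bqf_act (bqf_act Q M) A) ` SL2Z"
    using inv2_SL2Z(1)[OF assms] A SL2Z_mult by blast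
qed

text \<open>Orbit and stabilizer with weights: \<open>A\<close> to \<open>bqf_act Q A\<close> maps
  \<open>gset Q\<close> onto the forms of the class in the triangle, every fibre being a coset of
  the stabilizer in SL2(Z). Hence 6 is twice the order of the projective stabilizer times the
  weighted count.\<close>

lemma class_weight:
  assumes "Q \<in> pd_forms N" "N > 0"
  shows "1 / real (card (PSL2Z_stabilizer Q)) = (\<Sum>Q'\<in>{Q'\<in>supp_forms N. Q' \<in> bqf_equiv `` {Q}}. twt Q') / 3"
proof -
  let ?S = "{Q'\<in>supp_forms N. Q' \<in> bqf_equiv `` {Q}}"
  note fin = wsum_eq(1)[OF assms]
  have finS: "finite ?S" using finite_supp_forms[OF assms(2)] by simp
  have fib: "finite {A \<in> gset Q. bqf_act Q A = Q'} \<and> card {A \<in> gset Q. bqf_act Q A = Q'} = card (SLstab Q) \<and> finite (SLstab Q)"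
    if Q': "Q' \<in> ?S" for Q'
  proof -
    obtain M where M: "M \<in> SL2Z" "Q' = bqf_act Q M" using Q' by (auto simp: class_eq)
    have bij: "bij_betw (\<lambda>A. A ** M) (SLstab Q) {A \<in> gset Q. bqf_act Q A = Q'}"
    proof (rule bij_betwI[where g = "\<lambda>A. A ** inv2 M"])
      show "(\<lambda>A. A ** M) \<in> SLstab Q \<rightarrow> {A \<in> gset Q. bqf_act Q A = Q'}"
      proof (rule Pi_I)
        fix A assume "A \<in> SLstab Q"
        then have A: "A \<in> SL2Z" "bqf_act (bqf_act Q A) M = Q'" using M(2) by (auto simp: SLstab_def)
        then show "A ** M \<in> {A \<in> gset Q. bqf_act Q A = Q'}"
          using Q' M(1) by (simp add: bqf_act_mult gset_def SL2Z_mult supp_forms_def)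
      qed
      show "(\<lambda>A. A ** inv2 M) \<in> {A \<in> gset Q. bqf_act Q A = Q'} \<rightarrow> SLstab Q"
      proof (rule Pi_I)
        fix A assume "A \<in> {A \<in> gset Q. bqf_act Q A = Q'}"
        then have A: "A \<in> SL2Z" "bqf_act Q A = bqf_act Q M" using M(2) by (auto simp: gset_def)
        have "bqf_act Q (A ** inv2 M) = bqf_act (bqf_act Q A) (inv2 M)" by (simp only: bqf_act_mult)
        also have "\<dots> = Q" unfolding A(2) bqf_act_mult inv2_SL2Z(2)[OF M(1)] by simp
        finally show "A ** inv2 M \<in> SLstab Q"
          using A(1) inv2_SL2Z(1)[OF M(1)] by (simp add: SLstab_def SL2Z_mult)
      qed
      show "A ** M ** inv2 M = A" for A
        unfolding matrix_mul_assoc[symmetric] inv2_SL2Z(2)[OF M(1)] by (rule matrix_mul_rid)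
      show "A ** inv2 M ** M = A" for A
        unfolding matrix_mul_assoc[symmetric] inv2_SL2Z(3)[OF M(1)] by (rule matrix_mul_rid)
    qed
    have "finite {A \<in> gset Q. bqf_act Q A = Q'}" using fin by simp
    then show ?thesis using bij_betw_finite[OF bij] bij_betw_same_card[OF bij] by simp
  qed
  have "6 = (\<Sum>A\<in>gset Q. twt (bqf_act Q A))" using wsum_eq(2)[OF assms] by (simp add: wsum_def)
  also have "\<dots> = (\<Sum>Q'\<in>?S. \<Sum>A\<in>{A \<in> gset Q. bqf_act Q A = Q'}. twt (bqf_act Q A))"
  proof (rule sum.group[symmetric, OF fin finS])
    show "bqf_act Q ` gset Q \<subseteq> ?S"
      using pd_forms_act[OF assms(1)] by (auto simp: gset_def supp_forms_def class_eq)
  qed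
  also have "\<dots> = (\<Sum>Q'\<in>?S. real (card (SLstab Q)) * twt Q')"
    by (rule sum.cong[OF refl]) (use fib in auto)
  also have "\<dots> = real (card (SLstab Q)) * (\<Sum>Q'\<in>?S. twt Q')" by (simp add: sum_distrib_left)
  finally have eq: "real (card (SLstab Q)) * (\<Sum>Q'\<in>?S. twt Q') = 6" by simp
  \<comment> \<open>Finiteness of the stabilizer is read off a fibre inside the finite set
    \<open>gset Q\<close>, so one fibre has to exist.\<close>
  have "?S \<noteq> {}"
  proof
    assume e: "?S = {}"
    show False using eq unfolding e by simp
  qed
  then have "finite (SLstab Q)" using fib by blast
  then have "real (card (SLstab Q)) = 2 * real (card (PSL2Z_stabilizer Q))" using card_SLstab by simp
  then have e3: "real (card (PSL2Z_stabilizer Q)) * (\<Sum>Q'\<in>?S. twt Q') = 3" using eq by simp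
  have "real (card (PSL2Z_stabilizer Q)) \<noteq> 0"
  proof
    assume z: "real (card (PSL2Z_stabilizer Q)) = 0"
    show False using e3 unfolding z by simp
  qed
  with e3 show ?thesis by (simp add: field_simps)
qed

lemma class_some:
  assumes "Q \<in> pd_forms N"
  shows "(SOME Q'. Q' \<in> bqf_equiv `` {Q}) \<in> pd_forms N"
    "bqf_equiv `` {SOME Q'. Q' \<in> bqf_equiv `` {Q}} = bqf_equiv `` {Q}"
proof -
  have "Q \<in> bqf_equiv `` {Q}" by (auto simp: class_eq SL2Z_def intro!: image_eqI[of _ _ "mat 1"])
  then have "(SOME Q'. Q' \<in> bqf_equiv `` {Q}) \<in> bqf_equiv `` {Q}" by (rule someI)
  then obtain M where M: "M \<in> SL2Z" "(SOME Q'. Q' \<in> bqf_equiv `` {Q}) = bqf_act Q M" by (auto simp: class_eq)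
  show "(SOME Q'. Q' \<in> bqf_equiv `` {Q}) \<in> pd_forms N" using M pd_forms_act[OF assms] by simp
  show "bqf_equiv `` {SOME Q'. Q' \<in> bqf_equiv `` {Q}} = bqf_equiv `` {Q}" unfolding M(2) by (rule class_act[OF M(1)])
qed

theorem hurwitz_weighted:
  assumes "N > 0"
  shows "3 * hurwitz_class_number N = (\<Sum>Q\<in>supp_forms N. twt Q)"
proof -
  let ?g = "\<lambda>Q. bqf_equiv `` {Q}"
  let ?T = "pd_forms N // bqf_equiv"
  have T: "?T = ?g ` supp_forms N"
  proof (intro equalityI subsetI)
    fix X assume "X \<in> ?T"
    then obtain Q where Q: "Q \<in> pd_forms N" "X = ?g Q" by (auto simp: quotient_def)
    obtain M where M: "M \<in> SL2Z" "twt (bqf_act Q M) \<noteq> 0" using exists_T[OF Q(1) assms] by blast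
    let ?Q = "bqf_act Q M"
    have "?Q \<in> supp_forms N" using M pd_forms_act[OF Q(1)] by (simp add: supp_forms_def)
    moreover have "?g ?Q = ?g Q" by (rule class_act[OF M(1)])
    ultimately show "X \<in> ?g ` supp_forms N" using Q by auto
  qed (auto simp: supp_forms_def quotient_def)
  have "3 * hurwitz_class_number N = (\<Sum>X\<in>?T. 3 * (1 / real (card (PSL2Z_stabilizer (SOME Q. Q \<in> X)))))"
    using assms by (simp add: hurwitz_class_number_def pd_forms_def sum_distrib_left)
  also have "\<dots> = (\<Sum>X\<in>?T. \<Sum>Q\<in>{Q\<in>supp_forms N. ?g Q = X}. twt Q)"
  proof (rule sum.cong[OF refl])
    fix X assume "X \<in> ?T"
    then obtain Q where Q: "Q \<in> pd_forms N" "X = ?g Q" by (auto simp: quotient_def)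
    let ?Q = "SOME Q. Q \<in> X"
    have P: "?Q \<in> pd_forms N" "?g ?Q = X" using class_some[OF Q(1)] Q(2) by auto
    have "{Q'\<in>supp_forms N. Q' \<in> ?g ?Q} = {Q'\<in>supp_forms N. ?g Q' = X}"
    proof -
      have "Q' \<in> ?g ?Q \<longleftrightarrow> ?g Q' = X" for Q'
        unfolding P(2)
      proof
        assume "Q' \<in> X"
        then obtain M where M: "M \<in> SL2Z" "Q' = bqf_act Q M" using Q by (auto simp: class_eq)
        show "?g Q' = X" unfolding Q(2) M(2) by (rule class_act[OF M(1)])
      next
        assume "?g Q' = X"
        moreover have "Q' \<in> ?g Q'" by (auto simp: class_eq SL2Z_def intro!: image_eqI[of _ _ "mat 1"])
        ultimately show "Q' \<in> X" by simp
      qed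
      then show ?thesis by blast
    qed
    then show "3 * (1 / real (card (PSL2Z_stabilizer ?Q))) = (\<Sum>Q\<in>{Q\<in>supp_forms N. ?g Q = X}. twt Q)"
      using class_weight[OF P(1) assms] by simp
  qed
  also have "\<dots> = (\<Sum>Q\<in>supp_forms N. twt Q)"
  proof (rule sum.group[OF finite_supp_forms[OF assms]])
    show "finite ?T" unfolding T by (rule finite_imageI[OF finite_supp_forms[OF assms]])
    show "?g ` supp_forms N \<subseteq> ?T" unfolding T by (rule order_refl)
  qed
  finally show ?thesis .
qed

section \<open>The Kronecker--Hurwitz relation\<close>

lemma finite_square_less: "finite {t::int. t\<^sup>2 < n}"
proof (rule finite_subset)
  show "{t::int. t\<^sup>2 < n} \<subseteq> {-n..n}"
  proof
    fix t :: int assume "t \<in> {t. t\<^sup>2 < n}"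
    moreover have "\<bar>t\<bar> \<le> t\<^sup>2"
    proof (cases "t = 0")
      case False
      then have "\<bar>t\<bar> * 1 \<le> \<bar>t\<bar> * \<bar>t\<bar>" by (intro mult_left_mono) auto
      then show ?thesis by (simp add: power2_eq_square)
    qed simp
    ultimately show "t \<in> {-n..n}" unfolding mem_Collect_eq atLeastAtMost_iff by linarith
  qed
qed simp

text \<open>A form in the triangle and \<open>t\<close> determine the matrix by
  \<open>u = (b - t) / 2\<close>, \<open>v = (b + t) / 2\<close>; the parities agree because
  \<open>b\<^sup>2 - t\<^sup>2 = 4 * (a * c - n)\<close>.\<close>

lemma kset_forms:
  assumes "n > 0"
  shows "sum kwt (kset n) = (\<Sum>t\<in>{t. t\<^sup>2 < 4 * n}. \<Sum>Q\<in>supp_forms (4 * n - t\<^sup>2). twt Q)"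
proof -
  have "(\<Sum>t\<in>{t. t\<^sup>2 < 4 * n}. \<Sum>Q\<in>supp_forms (4 * n - t\<^sup>2). twt Q) =
      (\<Sum>(t, Q)\<in>Sigma {t. t\<^sup>2 < 4 * n} (\<lambda>t. supp_forms (4 * n - t\<^sup>2)). twt Q)"
    by (rule sum.Sigma) (auto simp: finite_square_less finite_supp_forms)
  also have "\<dots> = sum kwt (kset n)"
  proof (rule sum.reindex_bij_witness[of _ "\<lambda>(a, u, v, c). (v - u, (a, u + v, c))"
        "\<lambda>(t, (a, b, c)). (a, (b - t) div 2, (b + t) div 2, c)"])
    fix y assume "y \<in> Sigma {t. t\<^sup>2 < 4 * n} (\<lambda>t. supp_forms (4 * n - t\<^sup>2))"
    then obtain t a b c where y: "y = (t, (a, b, c))" and t: "t\<^sup>2 < 4 * n"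
      and Q: "(a, b, c) \<in> supp_forms (4 * n - t\<^sup>2)" by auto
    from Q have disc: "b\<^sup>2 - 4 * a * c = t\<^sup>2 - 4 * n" and w: "0 \<le> b" "b \<le> 2 * a" "b \<le> 2 * c"
      using twt_nonzero_iff[of a b c] by (auto simp: supp_forms_def pd_forms_def bqf_set_def)
    have pos: "bqf_pos_def (a, b, c)" using Q by (simp add: supp_forms_def pd_forms_def)
    have a: "a > 0" using bqf_pos_def_iff[of a b c] pos disc t by simp
    have "4 * a * c > 0" using disc t zero_le_power2[of b] by linarith
    then have c: "c > 0" using a by (simp add: zero_less_mult_iff)
    have "b\<^sup>2 - t\<^sup>2 = 2 * (2 * (a * c - n))" using disc by (simp add: algebra_simps)
    then have "even (b\<^sup>2 - t\<^sup>2)" by (metis dvd_triv_left)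
    then have ev: "even (b - t)" by simp
    then obtain u where u: "b - t = 2 * u" by blast
    define v where "v = u + t"
    have bt: "b = u + v" "t = v - u" using u by (auto simp: v_def)
    have uv: "(b - t) div 2 = u" "(b + t) div 2 = v" unfolding bt by simp_all
    have "4 * (a * c - u * v) = 4 * n" using disc unfolding bt by (simp add: power2_eq_square algebra_simps)
    then have "(a, u, v, c) \<in> kset n" using a c w t unfolding bt kset_def by (simp add: power2_commute)
    then show "(\<lambda>(t, (a, b, c)). (a, (b - t) div 2, (b + t) div 2, c)) y \<in> kset n"
      unfolding y prod.case uv .
    show "(\<lambda>(a, u, v, c). (v - u, (a, u + v, c))) ((\<lambda>(t, (a, b, c)). (a, (b - t) div 2, (b + t) div 2, c)) y) = y"
      unfolding y prod.case uv using bt by simp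
    show "kwt ((\<lambda>(t, (a, b, c)). (a, (b - t) div 2, (b + t) div 2, c)) y) = (case y of (t, Q) \<Rightarrow> twt Q)"
      unfolding y prod.case uv kwt_def using bt by (simp add: diff_diff_eq)
  next
    fix y assume "y \<in> kset n"
    then obtain a u v c where y: "y = (a, u, v, c)" and *: "a > 0" "c > 0" "a * c - u * v = n"
      "(u - v)\<^sup>2 < 4 * n" "0 \<le> u + v" "u + v \<le> 2 * a" "u + v \<le> 2 * c"
      by (auto simp: kset_def)
    have disc: "(u + v)\<^sup>2 - 4 * a * c = - (4 * n - (v - u)\<^sup>2)"
      using *(3) by (simp add: power2_eq_square algebra_simps)
    have "bqf_disc (a, u + v, c) < 0" using disc *(4) by (simp add: power2_commute)
    then have "bqf_pos_def (a, u + v, c)" using bqf_pos_def_iff *(1) by blast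
    moreover have "twt (a, u + v, c) \<noteq> 0" using * twt_nonzero_iff by blast
    ultimately have "(a, u + v, c) \<in> supp_forms (4 * n - (v - u)\<^sup>2)"
      using disc by (simp add: supp_forms_def pd_forms_def bqf_set_def)
    then show "(\<lambda>(a, u, v, c). (v - u, (a, u + v, c))) y \<in> Sigma {t. t\<^sup>2 < 4 * n} (\<lambda>t. supp_forms (4 * n - t\<^sup>2))"
      using *(4) unfolding y by (simp add: power2_commute)
    show "(\<lambda>(t, (a, b, c)). (a, (b - t) div 2, (b + t) div 2, c)) ((\<lambda>(a, u, v, c). (v - u, (a, u + v, c))) y) = y"
      unfolding y by simp
  qed
  finally show ?thesis by simp
qed

theorem hurwitz_relation:
  assumes "n > 0"
  shows "(\<Sum>t\<in>{t. t\<^sup>2 \<le> 4 * n}. hurwitz_class_number (4 * n - t\<^sup>2)) =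
    psum n (\<lambda>c d. 2 * real_of_int d - real_of_int (min c d))"
proof -
  have fin: "finite {t::int. t\<^sup>2 = 4 * n}" by (rule finite_subset[OF _ finite_square_less[of "4 * n + 1"]]) auto
  have un: "{t. t\<^sup>2 \<le> 4 * n} = {t. t\<^sup>2 < 4 * n} \<union> {t. t\<^sup>2 = 4 * n}" by auto
  have "(\<Sum>t\<in>{t. t\<^sup>2 \<le> 4 * n}. hurwitz_class_number (4 * n - t\<^sup>2)) =
    (\<Sum>t\<in>{t. t\<^sup>2 < 4 * n}. hurwitz_class_number (4 * n - t\<^sup>2)) + (\<Sum>t\<in>{t. t\<^sup>2 = 4 * n}. hurwitz_class_number (4 * n - t\<^sup>2))"
    unfolding un by (rule sum.union_disjoint) (auto simp: fin finite_square_less)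
  also have "(\<Sum>t\<in>{t. t\<^sup>2 < 4 * n}. hurwitz_class_number (4 * n - t\<^sup>2)) = sum kwt (kset n) / 3"
  proof -
    have "(\<Sum>t\<in>{t. t\<^sup>2 < 4 * n}. hurwitz_class_number (4 * n - t\<^sup>2)) =
       (\<Sum>t\<in>{t. t\<^sup>2 < 4 * n}. (\<Sum>Q\<in>supp_forms (4 * n - t\<^sup>2). twt Q) / 3)"
      by (rule sum.cong) (auto simp: hurwitz_weighted[symmetric])
    then show ?thesis unfolding kset_forms[OF assms] sum_divide_distrib .
  qed
  \<comment> \<open>The value -1/12 of H(0) occurs twice if \<open>n\<close> is a square and cancels
    the correction on \<open>c = d\<close> left over in \<open>kset_sum\<close>.\<close>
  also have "(\<Sum>t\<in>{t. t\<^sup>2 = 4 * n}. hurwitz_class_number (4 * n - t\<^sup>2)) = - psum n (\<lambda>c d. of_bool (c = d)) / 6"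
  proof -
    have "(\<Sum>t\<in>{t. t\<^sup>2 = 4 * n}. hurwitz_class_number (4 * n - t\<^sup>2)) = (\<Sum>t\<in>{t. t\<^sup>2 = 4 * n}. - 1 / 12)"
      by (rule sum.cong) (auto simp: hurwitz_class_number_def)
    also have "\<dots> = - real (card {t::int. t\<^sup>2 = 4 * n}) / 12" by simp
    also have "real (card {t::int. t\<^sup>2 = 4 * n}) = 2 * psum n (\<lambda>c d. of_bool (c = d))"
    proof (cases "\<exists>k>0. k * k = n")
      case True
      then obtain k where k: "k > 0" "k * k = n" by blast
      have "{t::int. t\<^sup>2 = 4 * n} = {2 * k, - 2 * k}"
      proof (intro equalityI subsetI)
        fix t assume "t \<in> {t. t\<^sup>2 = 4 * n}"
        then have "t\<^sup>2 = (2 * k)\<^sup>2" using k by (simp add: power2_eq_square)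
        then show "t \<in> {2 * k, - 2 * k}" unfolding power2_eq_iff by auto
      qed (use k in \<open>auto simp: power2_eq_square\<close>)
      moreover have "psum n (\<lambda>c d. of_bool (c = d)) = (\<Sum>(c, d)\<in>{(k, k)}. 1)"
        unfolding psum_def
      proof (rule sum.mono_neutral_cong_right)
        show "\<forall>i\<in>dpairs n - {(k, k)}. (case i of (c, d) \<Rightarrow> of_bool (c = d)) = (0::real)"
        proof (rule ballI)
          fix i assume i: "i \<in> dpairs n - {(k, k)}"
          obtain c d where cd: "i = (c, d)" by (cases i)
          have *: "(c, d) \<in> dpairs n" "(c, d) \<noteq> (k, k)" using i cd by auto
          have "c \<noteq> d"
          proof
            assume "c = d"
            then have "c\<^sup>2 = k\<^sup>2" "c > 0" using * k by (auto simp: dpairs_def power2_eq_square)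
            then have "c = k" using k by (simp add: power2_eq_iff)
            then show False using * \<open>c = d\<close> by simp
          qed
          then show "(case i of (c, d) \<Rightarrow> of_bool (c = d)) = (0::real)" by (simp add: cd)
        qed
      qed (use k in \<open>auto simp: finite_dpairs[unfolded dpairs_def] dpairs_def\<close>)
      ultimately show ?thesis using k by simp
    next
      case False
      have "t\<^sup>2 \<noteq> 4 * n" for t :: int
      proof
        assume t: "t\<^sup>2 = 4 * n"
        then have "even (t\<^sup>2)" by simp
        then have "even t" by simp
        then obtain k where "t = 2 * k" by blast
        then have "\<bar>k\<bar> * \<bar>k\<bar> = n" "\<bar>k\<bar> > 0" using t assms by (auto simp: power2_eq_square)
        then show False using False by blast
      qed
      then have "{t::int. t\<^sup>2 = 4 * n} = {}" by blast
      moreover have "psum n (\<lambda>c d. of_bool (c = d)) = psum n (\<lambda>c d. 0)"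
        by (rule psum_cong) (use False in auto)
      ultimately show ?thesis by (simp add: psum_def)
    qed
    finally show ?thesis by simp
  qed
  also have "sum kwt (kset n) / 3 + - psum n (\<lambda>c d. of_bool (c = d)) / 6 =
     2 * psum n (\<lambda>c d. real_of_int d) - psum n (\<lambda>c d. real_of_int (min c d))"
    unfolding conjunct2[OF kset_sum] by (simp add: field_simps)
  also have "\<dots> = psum n (\<lambda>c d. 2 * real_of_int d - real_of_int (min c d))"
    by (simp only: psum_diff psum_cmult)
  finally show ?thesis .
qed

section \<open>Values of periodic Dirichlet series at -1\<close>

text \<open>The bound is the absolute value of the binomial coefficient with exponent
  \<open>- W\<close>, so the binomial series of that exponent at -1/2 can serve as a majorant,
  uniformly in \<open>w\<close>.\<close>

lemma norm_gbinomial_le: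
  fixes w :: complex
  assumes "norm w \<le> W"
  shows "norm (w gchoose k) \<le> pochhammer W k / fact k"
proof -
  have "norm (w gchoose k) = norm (pochhammer (- w) k) / fact k"
    by (simp add: gbinomial_pochhammer norm_mult norm_divide norm_power)
  also have "norm (pochhammer (- w) k) \<le> pochhammer W k"
    unfolding pochhammer_prod
  proof -
    have "norm (\<Prod>i = 0..<k. - w + of_nat i) = (\<Prod>i = 0..<k. norm (- w + of_nat i))" by (rule prod_norm[symmetric])
    also have "\<dots> \<le> (\<Prod>i = 0..<k. W + of_nat i)"
    proof (rule prod_mono)
      fix i
      have "norm (- w + of_nat i) \<le> norm (- w) + norm (of_nat i :: complex)" by (rule norm_triangle_ineq)
      then show "0 \<le> norm (- w + of_nat i) \<and> norm (- w + of_nat i) \<le> W + of_nat i" using assms by simp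
    qed
    finally show "norm (\<Prod>i = 0..<k. - w + of_nat i) \<le> (\<Prod>i = 0..<k. W + of_nat i)" .
  qed
  finally show ?thesis by (simp add: divide_right_mono)
qed

definition binom_rem :: "nat \<Rightarrow> real \<Rightarrow> complex \<Rightarrow> complex" where
  "binom_rem r x s = of_real (x + 1) powr (1 - s) - (\<Sum>k\<le>r. ((1 - s) gchoose k) * of_real x powr (1 - s - of_nat k))"

text \<open>Factoring out \<open>x powr (1 - s)\<close> leaves a binomial tail in
  \<open>1 / x \<le> 1/2\<close>. The constant is uniform in \<open>x\<close> and in bounded
  \<open>s\<close>, and the exponent is summable over shifts of \<open>x\<close> for
  \<open>Re s > 1 - r\<close>: every further term of the expansion gains a strip of width 1.\<close>

lemma binom_rem_bound:
  assumes "B \<ge> 0"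
  obtains C where "C > 0" "\<And>x s. x \<ge> 2 \<Longrightarrow> norm s \<le> B \<Longrightarrow> norm (binom_rem r x s) \<le> C * x powr (- Re s - real r)"
proof -
  define W where "W = B + 1"
  define a where "a k = pochhammer W k / fact k * (1/2) ^ k" for k
  have "(\<lambda>k. ((- W) gchoose k) * (- 1/2) ^ k) sums (1 + (- 1/2)) powr (- W)"
    by (rule gen_binomial_real) simp
  moreover have "((- W) gchoose k) * (- 1/2) ^ k = a k" for k
  proof -
    have "((- W) gchoose k) * (- 1/2) ^ k = pochhammer W k / fact k * ((-1) ^ k * (- 1/2) ^ k)"
      by (simp add: gbinomial_pochhammer)
    also have "(-1) ^ k * (- 1/2) ^ k = (1/2 :: real) ^ k" by (simp flip: power_mult_distrib)
    finally show ?thesis by (simp add: a_def)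
  qed
  ultimately have sa: "summable a" by (simp add: sums_iff)
  have a0: "a k \<ge> 0" for k using assms by (simp add: a_def W_def pochhammer_nonneg)
  define C where "C = 2 ^ (r + 1) * suminf a + 1"
  have C: "C > 0" unfolding C_def using suminf_nonneg[OF sa a0] by (simp add: add_nonneg_pos)
  moreover have "norm (binom_rem r x s) \<le> C * x powr (- Re s - real r)" if x: "x \<ge> 2" and s: "norm s \<le> B" for x s
  proof -
    define y where "y = 1 / x"
    have y: "0 < y" "y \<le> 1/2" using x by (auto simp: y_def field_simps)
    let ?w = "1 - s"
    have w: "norm ?w \<le> W" using norm_triangle_ineq4[of 1 s] s by (simp add: W_def)
    define t where "t k = (?w gchoose k) * of_real y ^ k" for k
    have st: "t sums ((1 + of_real y) powr ?w)" unfolding t_def by (rule gen_binomial_complex) (use y in simp)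
    have tb: "norm (t (k + (r + 1))) \<le> (y ^ (r + 1) * 2 ^ (r + 1)) * a (k + (r + 1))" for k
    proof -
      have "norm (t (k + (r + 1))) \<le> pochhammer W (k + (r+1)) / fact (k + (r+1)) * y ^ (k + (r + 1))"
        unfolding t_def norm_mult norm_power using norm_gbinomial_le[OF w, of "k + (r+1)"] y assms
        by (intro mult_mono) (auto simp: W_def intro!: divide_nonneg_nonneg pochhammer_nonneg simp del: power_Suc)
      also have "\<dots> \<le> pochhammer W (k + (r+1)) / fact (k + (r+1)) * ((y ^ (r + 1) * 2 ^ (r + 1)) * (1/2) ^ (k + (r+1)))"
      proof (rule mult_left_mono)
        have "y ^ k * y ^ (r + 1) \<le> (1/2) ^ k * y ^ (r + 1)" using y by (intro mult_right_mono power_mono) auto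
        then show "y ^ (k + (r + 1)) \<le> (y ^ (r + 1) * 2 ^ (r + 1)) * (1/2) ^ (k + (r+1))"
          by (simp add: power_add power_divide field_simps)
        show "0 \<le> pochhammer W (k + (r+1)) / fact (k + (r+1))"
          using assms by (intro divide_nonneg_nonneg pochhammer_nonneg) (auto simp: W_def)
      qed
      also have "\<dots> = (y ^ (r + 1) * 2 ^ (r + 1)) * a (k + (r + 1))" by (simp only: a_def mult_ac)
      finally show ?thesis .
    qed
    have sa': "summable (\<lambda>k. a (k + (r + 1)))" using sa by (subst summable_iff_shift)
    have sb: "summable (\<lambda>k. (y ^ (r + 1) * 2 ^ (r + 1)) * a (k + (r + 1)))"
      by (rule summable_mult[OF sa'])
    have "(1 + of_real y) powr ?w - (\<Sum>k<r+1. t k) = (\<Sum>k. t (k + (r + 1)))"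
      using suminf_minus_initial_segment[of t "r+1"] st by (simp add: sums_iff)
    also have "norm \<dots> \<le> (\<Sum>k. (y ^ (r + 1) * 2 ^ (r + 1)) * a (k + (r + 1)))"
      by (rule norm_suminf_le[OF tb sb])
    also have "\<dots> = (y ^ (r + 1) * 2 ^ (r + 1)) * (\<Sum>k. a (k + (r + 1)))"
      by (rule suminf_mult[OF sa'])
    also have "\<dots> \<le> (y ^ (r + 1) * 2 ^ (r + 1)) * suminf a"
    proof (rule mult_left_mono)
      have "(\<Sum>k. a (k + (r + 1))) = suminf a - sum a {..<r+1}" by (rule suminf_minus_initial_segment[OF sa])
      moreover have "sum a {..<r+1} \<ge> 0" by (rule sum_nonneg) (rule a0)
      ultimately show "(\<Sum>k. a (k + (r + 1))) \<le> suminf a" by linarith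
    qed (use y in simp)
    finally have *: "norm ((1 + of_real y) powr ?w - (\<Sum>k<r+1. t k)) \<le> y ^ (r+1) * 2 ^ (r+1) * suminf a" .
    have fac: "binom_rem r x s = of_real x powr ?w * ((1 + of_real y) powr ?w - (\<Sum>k<r+1. t k))"
    proof -
      have "of_real (x + 1) = of_real x * (1 + of_real y :: complex)"
        using x by (simp add: y_def field_simps)
      moreover have "(of_real x * (1 + of_real y :: complex)) powr ?w = of_real x powr ?w * (1 + of_real y) powr ?w"
        using powr_times_real[of "of_real x" "1 + of_real y" ?w] x y by simp
      moreover have "of_real x powr (1 - s - of_nat k) = of_real x powr ?w * of_real y ^ k" for k
        using x by (simp add: powr_diff powr_nat' y_def power_divide)
      ultimately show ?thesis
        unfolding binom_rem_def t_def lessThan_Suc_atMost Suc_eq_plus1[symmetric]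
        by (simp add: right_diff_distrib sum_distrib_left mult_ac)
    qed
    have nx: "norm (of_real x powr ?w) = x powr (1 - Re s)"
      using x by (subst norm_powr_real_powr) auto
    have "norm (binom_rem r x s) \<le> x powr (1 - Re s) * (y ^ (r+1) * 2 ^ (r+1) * suminf a)"
      unfolding fac norm_mult nx by (rule mult_left_mono[OF *]) simp
    also have "\<dots> = (2 ^ (r+1) * suminf a) * (x powr (1 - Re s) * y ^ (r+1))" by simp
    also have "x powr (1 - Re s) * y ^ (r + 1) = x powr (- Re s - real r)"
    proof -
      have "y ^ (r+1) = x powr (- real (r+1))" using x powr_realpow[of x "r + 1"] by (simp only: y_def powr_minus power_one_over inverse_eq_divide)
      then show ?thesis by (simp add: powr_add[symmetric])
    qed
    also have "(2 ^ (r+1) * suminf a) * (x powr (- Re s - real r)) \<le> C * x powr (- Re s - real r)"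
      by (rule mult_right_mono) (simp_all add: C_def)
    finally show ?thesis .
  qed
  ultimately show thesis by (rule that)
qed

lemma summable_shifted_powr:
  fixes \<alpha> :: real
  assumes "\<alpha> > 0" "e < -1"
  shows "summable (\<lambda>n. (real n + \<alpha>) powr e)"
proof -
  have "summable (\<lambda>n. real (Suc n) powr e)"
    using summable_real_powr_iff[of e] assms summable_Suc_iff[of "\<lambda>n. real n powr e"] by simp
  then have "summable (\<lambda>n. real (n + 1) powr e)" by simp
  then have s: "summable (\<lambda>n. real n powr e)" using assms summable_real_powr_iff by blast
  have "summable (\<lambda>n. (real (n + 1) + \<alpha>) powr e)"
  proof (rule summable_comparison_test')
    show "summable (\<lambda>n. real (n + 1) powr e)" by fact
    fix n :: nat assume "n \<ge> 0"
    show "norm ((real (n + 1) + \<alpha>) powr e) \<le> real (n + 1) powr e"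
      using assms by (simp add: powr_mono2')
  qed
  then show ?thesis by (subst (asm) summable_iff_shift)
qed

lemma holomorphic_suminf_powr:
  fixes f :: "nat \<Rightarrow> complex \<Rightarrow> complex" and \<alpha> c :: real
  assumes "\<alpha> \<ge> 2"
    and hol: "\<And>n. f n holomorphic_on {s. Re s > c}"
    and bound: "\<And>B. B \<ge> 0 \<Longrightarrow> \<exists>C>0. \<forall>n s. norm s \<le> B \<longrightarrow> norm (f n s) \<le> C * (real n + \<alpha>) powr (c - 1 - Re s)"
  shows "(\<lambda>s. \<Sum>n. f n s) holomorphic_on {s. Re s > c}" "\<And>s. Re s > c \<Longrightarrow> summable (\<lambda>n. f n s)"
proof -
  have op: "open {s. Re s > c}" by (rule open_halfspace_Re_gt)
  show "(\<lambda>s. \<Sum>n. f n s) holomorphic_on {s. Re s > c}"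
  proof (rule holomorphic_uniform_sequence[OF op, of "\<lambda>N s. \<Sum>n<N. f n s"])
    show "(\<lambda>s. \<Sum>n<N. f n s) holomorphic_on {s. Re s > c}" for N
      by (intro holomorphic_intros hol)
    fix x assume x: "x \<in> {s. Re s > c}"
    define d where "d = (Re x - c) / 2"
    have d: "d > 0" using x by (simp add: d_def)
    have re: "Re s \<ge> c + d" if "s \<in> cball x d" for s
    proof -
      have "\<bar>Re x - Re s\<bar> \<le> d" using that abs_Re_le_cmod[of "x - s"] by (simp add: dist_norm)
      moreover have "Re x - c = 2 * d" by (simp add: d_def)
      ultimately show ?thesis by linarith
    qed
    have nb: "norm s \<le> norm x + d" if "s \<in> cball x d" for s
      using that norm_triangle_sub[of s x] by (simp add: dist_norm norm_minus_commute)
    obtain C where C: "C > 0" "\<And>n s. norm s \<le> norm x + d \<Longrightarrow> norm (f n s) \<le> C * (real n + \<alpha>) powr (c - 1 - Re s)"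
      using bound[of "norm x + d"] d by auto
    have "uniform_limit (cball x d) (\<lambda>N s. \<Sum>n<N. f n s) (\<lambda>s. \<Sum>n. f n s) sequentially"
    proof (rule Weierstrass_m_test)
      fix n s assume s: "s \<in> cball x d"
      have "norm (f n s) \<le> C * (real n + \<alpha>) powr (c - 1 - Re s)" by (rule C(2)[OF nb[OF s]])
      also have "\<dots> \<le> C * (real n + \<alpha>) powr (- 1 - d)"
        using C(1) re[OF s] assms(1) by (intro mult_left_mono powr_mono) auto
      finally show "norm (f n s) \<le> C * (real n + \<alpha>) powr (- 1 - d)" .
    qed (intro summable_mult summable_shifted_powr; use assms d in simp)
    moreover have "cball x d \<subseteq> {s. Re s > c}" using re d by (auto intro: less_le_trans[of c "c + d"])
    ultimately show "\<exists>d>0. cball x d \<subseteq> {s. Re s > c} \<and> uniform_limit (cball x d) (\<lambda>N s. \<Sum>n<N. f n s) (\<lambda>s. \<Sum>n. f n s) sequentially"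
      using d by blast
  qed
  show "summable (\<lambda>n. f n s)" if "Re s > c" for s
  proof -
    obtain C where C: "C > 0" "\<And>n. norm (f n s) \<le> C * (real n + \<alpha>) powr (c - 1 - Re s)"
      using bound[of "norm s"] by auto
    show ?thesis
      by (rule summable_comparison_test'[of "\<lambda>n. C * (real n + \<alpha>) powr (c - 1 - Re s)"])
         (use C assms that in \<open>auto intro!: summable_mult summable_shifted_powr\<close>)
  qed
qed

context
  fixes \<alpha> :: real
  assumes alpha: "\<alpha> \<ge> 2"
begin

text \<open>The Hurwitz zeta function. The assumption \<open>\<alpha> \<ge> 2\<close> puts all
  \<open>1 / (n + \<alpha>)\<close> in the range of \<open>binom_rem_bound\<close>.\<close>

definition hz :: "complex \<Rightarrow> complex" where
  "hz s = (\<Sum>n. of_real (real n + \<alpha>) powr (- s))"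

definition rho :: "nat \<Rightarrow> complex \<Rightarrow> complex" where
  "rho r s = (\<Sum>n. binom_rem r (real n + \<alpha>) s)"

lemma norm_alpha_powr: "norm (of_real (real n + \<alpha>) powr s) = (real n + \<alpha>) powr Re s"
  using alpha by (subst norm_powr_real_powr) auto

lemma hz_holomorphic: "hz holomorphic_on {s. Re s > 1}"
  and hz_sums: "Re s > 1 \<Longrightarrow> (\<lambda>n. of_real (real n + \<alpha>) powr (- s)) sums hz s"
proof -
  have "norm (of_real (real n + \<alpha>) powr (- s)) \<le> 1 * (real n + \<alpha>) powr (1 - 1 - Re s)" for n s
    unfolding norm_alpha_powr by simp
  then have ex: "\<exists>C>0. \<forall>n s. norm s \<le> B \<longrightarrow> norm (of_real (real n + \<alpha>) powr (- s)) \<le> C * (real n + \<alpha>) powr (1 - 1 - Re s)" for B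
    by (blast intro: zero_less_one)
  have hol: "(\<lambda>s. of_real (real n + \<alpha>) powr (- s)) holomorphic_on {s. Re s > 1}" for n
    by (intro holomorphic_intros)
  show "hz holomorphic_on {s. Re s > 1}" unfolding hz_def
    by (rule holomorphic_suminf_powr(1)[OF alpha hol ex])
  show "Re s > 1 \<Longrightarrow> (\<lambda>n. of_real (real n + \<alpha>) powr (- s)) sums hz s" unfolding hz_def
    by (rule summable_sums, rule holomorphic_suminf_powr(2)[OF alpha hol ex])
qed

lemma holomorphic_gbinomial [holomorphic_intros]:
  "f holomorphic_on A \<Longrightarrow> (\<lambda>s. f s gchoose k :: complex) holomorphic_on A"
  unfolding gbinomial_prod_rev by (intro holomorphic_intros) auto

lemma rho_holomorphic: "rho r holomorphic_on {s. Re s > 1 - real r}"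
  and rho_sums: "Re s > 1 - real r \<Longrightarrow> (\<lambda>n. binom_rem r (real n + \<alpha>) s) sums rho r s"
proof -
  have ex: "\<exists>C>0. \<forall>n s. norm s \<le> B \<longrightarrow> norm (binom_rem r (real n + \<alpha>) s) \<le> C * (real n + \<alpha>) powr (1 - real r - 1 - Re s)"
    if B: "B \<ge> 0" for B
  proof -
    obtain C where C: "C > 0" "\<And>x s. x \<ge> 2 \<Longrightarrow> norm s \<le> B \<Longrightarrow> norm (binom_rem r x s) \<le> C * x powr (- Re s - real r)"
      using binom_rem_bound[OF B] by blast
    have "norm (binom_rem r (real n + \<alpha>) s) \<le> C * (real n + \<alpha>) powr (1 - real r - 1 - Re s)" if "norm s \<le> B" for n s
    proof -
      have "1 - real r - 1 - Re s = - Re s - real r" by simp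
      moreover have "norm (binom_rem r (real n + \<alpha>) s) \<le> C * (real n + \<alpha>) powr (- Re s - real r)"
        by (rule C(2)) (use alpha that in auto)
      ultimately show ?thesis by (simp only:)
    qed
    then show ?thesis using C(1) by blast
  qed
  have hol: "binom_rem r (real n + \<alpha>) holomorphic_on {s. Re s > 1 - real r}" for n
    unfolding binom_rem_def using alpha by (auto intro!: holomorphic_intros)
  show "rho r holomorphic_on {s. Re s > 1 - real r}" unfolding rho_def
    by (rule holomorphic_suminf_powr(1)[OF alpha hol ex])
  show "Re s > 1 - real r \<Longrightarrow> (\<lambda>n. binom_rem r (real n + \<alpha>) s) sums rho r s" unfolding rho_def
    by (rule summable_sums, rule holomorphic_suminf_powr(2)[OF alpha hol ex])
qed

text \<open>The binomial coefficient of \<open>1 - s\<close> over \<open>k\<close> without its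
  factor \<open>s + k - 2\<close>; that factor is kept with \<open>hz (s + k - 1)\<close>, whose
  pole it cancels.\<close>

definition cpoly :: "nat \<Rightarrow> complex \<Rightarrow> complex" where
  "cpoly k s = - (\<Prod>i<k-1. 1 - s - of_nat i) / fact k"

lemma cpoly_gbinomial: "k \<ge> 1 \<Longrightarrow> (1 - s) gchoose k = cpoly k s * (s + of_nat k - 2)"
proof -
  assume "k \<ge> 1"
  then obtain m where m: "k = Suc m" by (cases k) auto
  have "(1 - s) gchoose k = (\<Prod>i<Suc m. 1 - s - of_nat i) / fact (Suc m)"
    unfolding m gbinomial_prod_rev by (simp add: atLeast0LessThan)
  also have "(\<Prod>i<Suc m. 1 - s - of_nat i) = (\<Prod>i<m. 1 - s - of_nat i) * (1 - s - of_nat m)"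
    by simp
  also have "1 - s - of_nat m = - (s + of_nat k - 2)" unfolding m by simp
  finally have "(1 - s) gchoose k = ((\<Prod>i<k-1. 1 - s - of_nat i) * - (s + of_nat k - 2)) / fact k"
    unfolding m by simp
  moreover have "(P * - X) / F = - P / F * X" for P X F :: complex by simp
  ultimately show ?thesis unfolding cpoly_def by (simp only:)
qed

lemma cpoly_holomorphic [holomorphic_intros]: "cpoly k holomorphic_on A"
  unfolding cpoly_def by (intro holomorphic_intros) auto

text \<open>The powers \<open>(n + \<alpha>) powr (1 - s)\<close> telescope, and each difference is
  expanded by the binomial series. The term \<open>k = 1\<close> is
  \<open>(1 - s) * hz s\<close>.\<close>

lemma hz_recursion:
  assumes "Re s > 1" "r \<ge> 1"
  shows "(s - 1) * hz s = of_real \<alpha> powr (1 - s) +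
    (\<Sum>k=2..r. cpoly k s * ((s + of_nat k - 1 - 1) * hz (s + of_nat k - 1))) + rho r s"
proof -
  let ?x = "\<lambda>n. of_real (real n + \<alpha>) :: complex"
  have tel: "(\<lambda>n. ?x (Suc n) powr (1 - s) - ?x n powr (1 - s)) sums (0 - ?x 0 powr (1 - s))"
  proof (rule telescope_sums)
    have "(\<lambda>n. (real n + \<alpha>) powr (1 - Re s)) \<longlonglongrightarrow> 0"
      by (intro tendsto_neg_powr) (use assms in \<open>auto intro!: filterlim_tendsto_add_at_top[OF tendsto_const filterlim_real_sequentially, of \<alpha>, unfolded add.commute[of \<alpha>]]\<close>)
    then have "(\<lambda>n. norm (?x n powr (1 - s))) \<longlonglongrightarrow> 0" by (simp only: norm_alpha_powr) simp
    then show "(\<lambda>n. ?x n powr (1 - s)) \<longlonglongrightarrow> 0" by (rule tendsto_norm_zero_cancel)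
  qed
  have hs: "(\<lambda>n. ((1 - s) gchoose k) * ?x n powr (1 - s - of_nat k)) sums (((1 - s) gchoose k) * hz (s + of_nat k - 1))"
    if "k \<ge> 1" for k
  proof -
    have "(\<lambda>n. ?x n powr (- (s + of_nat k - 1))) sums hz (s + of_nat k - 1)"
      by (rule hz_sums) (use assms that in simp)
    then show ?thesis by (intro sums_mult) (simp add: algebra_simps)
  qed
  have "(\<lambda>n. (\<Sum>k=1..r. ((1 - s) gchoose k) * ?x n powr (1 - s - of_nat k)) + binom_rem r (real n + \<alpha>) s) sums
      ((\<Sum>k=1..r. ((1 - s) gchoose k) * hz (s + of_nat k - 1)) + rho r s)"
    by (intro sums_add sums_sum hs rho_sums) (use assms in auto)
  moreover have "(\<Sum>k=1..r. ((1 - s) gchoose k) * ?x n powr (1 - s - of_nat k)) + binom_rem r (real n + \<alpha>) s =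
      ?x (Suc n) powr (1 - s) - ?x n powr (1 - s)" for n
  proof -
    have "{..r} = insert 0 {1..r}" by auto
    then show ?thesis unfolding binom_rem_def by (simp add: algebra_simps)
  qed
  ultimately have "(\<lambda>n. ?x (Suc n) powr (1 - s) - ?x n powr (1 - s)) sums
      ((\<Sum>k=1..r. ((1 - s) gchoose k) * hz (s + of_nat k - 1)) + rho r s)" by simp
  from sums_unique2[OF this tel]
  have *: "(\<Sum>k=1..r. ((1 - s) gchoose k) * hz (s + of_nat k - 1)) + rho r s = - (of_real \<alpha> powr (1 - s))" by simp
  have "{1..r} = insert 1 {2..r}" using assms by auto
  then have "(\<Sum>k=1..r. ((1 - s) gchoose k) * hz (s + of_nat k - 1)) =
      (1 - s) * hz s + (\<Sum>k=2..r. ((1 - s) gchoose k) * hz (s + of_nat k - 1))" by simp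
  also have "(\<Sum>k=2..r. ((1 - s) gchoose k) * hz (s + of_nat k - 1)) =
      (\<Sum>k=2..r. cpoly k s * ((s + of_nat k - 1 - 1) * hz (s + of_nat k - 1)))"
    by (rule sum.cong) (auto simp: cpoly_gbinomial algebra_simps)
  finally have "of_real \<alpha> powr (1 - s) = - ((1 - s) * hz s +
      (\<Sum>k=2..r. cpoly k s * ((s + of_nat k - 1 - 1) * hz (s + of_nat k - 1)))) - rho r s"
    using * by (metis add_diff_cancel_left' diff_minus_eq_add minus_add_distrib minus_minus add_uminus_conv_diff)
  then show ?thesis by (simp only:) (simp add: left_diff_distrib)
qed

lemma halfplane_eq:
  assumes "f holomorphic_on {s. Re s > a}" "g holomorphic_on {s. Re s > a}" "a \<le> 1"
    "\<And>s. Re s > 1 \<Longrightarrow> f s = g s" "Re z > a"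
  shows "f z = g z"
proof (rule analytic_continuation_open[of "{s. Re s > 1}" "{s. Re s > a}" f g])
  show "{s. 1 < Re s} \<noteq> {}" by (auto intro: exI[of _ 2])
  show "connected {s. a < Re s}" by (intro convex_connected convex_halfspace_Re_gt)
qed (use assms in \<open>auto simp: open_halfspace_Re_gt\<close>)

text \<open>With \<open>r = m + 1\<close> the recursion refers only to arguments moved right by at
  least 1 and to a remainder holomorphic one strip further left, so it can be taken as the
  definition there.\<close>

lemma hz_extend: "\<exists>h. h holomorphic_on {s. Re s > 1 - real m} \<and> (\<forall>s. Re s > 1 \<longrightarrow> h s = (s - 1) * hz s)"
proof (induction m)
  case 0
  show ?case by (rule exI[of _ "\<lambda>s. (s - 1) * hz s"]) (auto intro!: holomorphic_intros hz_holomorphic)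
next
  case (Suc m)
  then obtain h where h: "h holomorphic_on {s. Re s > 1 - real m}" "\<And>s. Re s > 1 \<Longrightarrow> h s = (s - 1) * hz s" by blast
  let ?r = "m + 1"
  define h' where "h' s = of_real \<alpha> powr (1 - s) + (\<Sum>k=2..?r. cpoly k s * h (s + of_nat k - 1)) + rho ?r s" for s
  have "h' holomorphic_on {s. Re s > 1 - real (Suc m)}"
    unfolding h'_def
  proof (intro holomorphic_intros)
    show "rho ?r holomorphic_on {s. Re s > 1 - real (Suc m)}"
      using rho_holomorphic[of ?r] by (simp add: add.commute)
    fix k assume k: "k \<in> {2..?r}"
    have "(h \<circ> (\<lambda>s. s + of_nat k - 1)) holomorphic_on {s. Re s > 1 - real (Suc m)}"
      by (rule holomorphic_on_compose_gen[OF _ h(1)]) (use k in \<open>auto intro!: holomorphic_intros\<close>)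
    then show "(\<lambda>s. h (s + of_nat k - 1)) holomorphic_on {s. Re s > 1 - real (Suc m)}" by (simp add: o_def)
  qed
  moreover have "h' s = (s - 1) * hz s" if "Re s > 1" for s
  proof -
    have "(\<Sum>k=2..?r. cpoly k s * h (s + of_nat k - 1)) = (\<Sum>k=2..?r. cpoly k s * ((s + of_nat k - 1 - 1) * hz (s + of_nat k - 1)))"
      by (rule sum.cong) (use that in \<open>auto simp: h(2)\<close>)
    then show ?thesis unfolding h'_def using hz_recursion[OF that, of ?r] by simp
  qed
  ultimately show ?case by blast
qed

text \<open>The extensions agree on common half planes by the identity theorem; \<open>h\<close>
  uses at each point one that is defined in a neighbourhood.\<close>

lemma hz_entire: "\<exists>h. h holomorphic_on UNIV \<and> (\<forall>s. Re s > 1 \<longrightarrow> h s = (s - 1) * hz s)"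
proof -
  obtain H where H: "\<And>m. H m holomorphic_on {s. Re s > 1 - real m}" "\<And>m s. Re s > 1 \<Longrightarrow> H m s = (s - 1) * hz s"
    using hz_extend by metis
  define h where "h s = H (nat \<lceil>2 - Re s\<rceil>) s" for s
  have eq: "h s = H m s" if "Re s > 1 - real m" for s m
  proof -
    let ?k = "nat \<lceil>2 - Re s\<rceil>"
    have k: "Re s > 1 - real ?k" using real_nat_ceiling_ge[of "2 - Re s"] by linarith
    let ?a = "max (1 - real m) (1 - real ?k)"
    have sub: "{s. Re s > ?a} \<subseteq> {s. Re s > 1 - real m}" "{s. Re s > ?a} \<subseteq> {s. Re s > 1 - real ?k}" by auto
    have "H ?k s = H m s"
      by (rule halfplane_eq[of _ ?a]) (use H holomorphic_on_subset[OF _ sub(1)] holomorphic_on_subset[OF _ sub(2)] k that in auto)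
    then show ?thesis by (simp add: h_def)
  qed
  have "h holomorphic_on UNIV"
  proof (subst holomorphic_on_open, simp, intro ballI)
    fix z :: complex
    let ?m = "nat \<lceil>2 - Re z\<rceil>"
    have z: "Re z > 1 - real ?m" using real_nat_ceiling_ge[of "2 - Re z"] by linarith
    have op: "open {s. Re s > 1 - real ?m}" by (rule open_halfspace_Re_gt)
    have "H ?m holomorphic_on {s. Re s > 1 - real ?m}" by (rule H)
    then have "h holomorphic_on {s. Re s > 1 - real ?m}"
      by (rule holomorphic_transform) (simp add: eq)
    then show "\<exists>f'. (h has_field_derivative f') (at z)"
      using holomorphic_on_open[OF op] z by blast
  qed
  moreover have "h s = (s - 1) * hz s" if "Re s > 1" for s
    using eq[of 0 s] H(2)[OF that, of 0] that by simp
  ultimately show ?thesis by blast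
qed

text \<open>The value is the second Bernoulli polynomial at \<open>\<alpha>\<close>, that is, -2
  times the Hurwitz zeta value at -1. With \<open>r = 3\<close> the remainder vanishes at 1, 0 and
  -1, since \<open>(x + 1) powr (1 - s)\<close> is there a polynomial of degree at most 2.\<close>

lemma hz_continuation:
  "\<exists>h. h holomorphic_on UNIV \<and> (\<forall>s. Re s > 1 \<longrightarrow> h s = (s - 1) * hz s) \<and>
     h (- 1) = of_real (\<alpha>\<^sup>2 - \<alpha> + 1 / 6)"
proof -
  obtain h where h: "h holomorphic_on UNIV" "\<And>s. Re s > 1 \<Longrightarrow> h s = (s - 1) * hz s"
    using hz_entire by auto
  define h' where "h' s = of_real \<alpha> powr (1 - s) + (\<Sum>k=2..3. cpoly k s * h (s + of_nat k - 1)) + rho 3 s" for s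
  have h'hol: "h' holomorphic_on {s. Re s > 1 - real 3}"
    unfolding h'_def
  proof (intro holomorphic_intros rho_holomorphic)
    fix k :: nat
    have "(h \<circ> (\<lambda>s. s + of_nat k - 1)) holomorphic_on {s. Re s > 1 - real 3}"
      by (rule holomorphic_on_compose_gen[OF _ h(1)]) (auto intro!: holomorphic_intros)
    then show "(\<lambda>s. h (s + of_nat k - 1)) holomorphic_on {s. Re s > 1 - real 3}" by (simp add: o_def)
  qed
  have rec: "h s = h' s" if "Re s > -2" for s
  proof (rule halfplane_eq[OF _ h'hol])
    show "h holomorphic_on {s. 1 - real 3 < Re s}" by (rule holomorphic_on_subset[OF h(1)]) auto
    fix s assume s: "Re s > 1"
    have "(\<Sum>k=2..3. cpoly k s * h (s + of_nat k - 1)) = (\<Sum>k=2..3. cpoly k s * ((s + of_nat k - 1 - 1) * hz (s + of_nat k - 1)))"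
      by (rule sum.cong) (use s in \<open>auto simp: h(2)\<close>)
    then show "h s = h' s" unfolding h'_def using hz_recursion[OF s, of 3] h(2)[OF s] by simp
  qed (use that in auto)
  have i23: "{2..3} = {2, 3 :: nat}" by auto
  have a3: "{..3} = {0, 1, 2, 3 :: nat}" by auto
  have g2: "(a gchoose 2) = a * (a - 1) / 2" "(a gchoose 3) = a * (a - 1) * (a - 2) / 6" for a :: complex
    by (simp_all add: gbinomial_prod_rev numeral_2_eq_2 numeral_3_eq_3 fact_numeral)
  have rho: "rho 3 s = 0" if "\<And>x. x \<ge> 2 \<Longrightarrow> binom_rem 3 x s = 0" for s
    unfolding rho_def using that alpha by simp
  have x: "of_real x \<noteq> (0::complex)" "of_real x + 1 \<noteq> (0::complex)" if "x \<ge> 2" for x :: real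
  proof -
    have "of_real (x + 1) \<noteq> (0::complex)" using that by (subst of_real_eq_0_iff) simp
    then show "of_real x \<noteq> (0::complex)" "of_real x + 1 \<noteq> (0::complex)" using that by simp_all
  qed
  have r1: "rho 3 1 = 0" by (rule rho) (use x in \<open>auto simp: binom_rem_def a3 g2\<close>)
  have r0: "rho 3 0 = 0" by (rule rho) (use x in \<open>auto simp: binom_rem_def a3 g2\<close>)
  have rm: "rho 3 (-1) = 0"
  proof (rule rho)
    fix x :: real assume "x \<ge> 2"
    then have x': "x > 0" by simp
    have p: "of_real y powr 2 = (of_real y :: complex)\<^sup>2" for y :: real
      using powr_nat[of "of_real y :: complex" 2] by (cases "y = 0") auto
    show "binom_rem 3 x (-1) = 0"
      unfolding binom_rem_def a3 using x[OF \<open>x \<ge> 2\<close>] by (simp add: g2 p power2_eq_square algebra_simps)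
  qed
  have c: "cpoly 2 s = - (1 - s) / 2" "cpoly 3 s = - ((1 - s) * (- s)) / 6" for s
    by (simp_all add: cpoly_def numeral_2_eq_2 numeral_3_eq_3 fact_numeral)
  \<comment> \<open>The recursion is evaluated at 1, 0, -1 in turn; \<open>h 1\<close> is the
    residue of the Hurwitz zeta function.\<close>
  have h1: "h 1 = 1" using rec[of 1] r1 alpha by (simp add: h'_def i23 c)
  have h0: "h 0 = of_real \<alpha> - h 1 / 2" using rec[of 0] r0 alpha by (simp add: h'_def i23 c)
  have hm: "h (- 1) = of_real \<alpha> powr 2 - h 0 - h 1 / 3" using rec[of "-1"] rm by (simp add: h'_def i23 c)
  have "(of_real \<alpha> :: complex) powr of_nat 2 = (of_real \<alpha>)\<^sup>2"
    unfolding powr_nat using alpha by simp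
  then have p2: "of_real \<alpha> powr 2 = (of_real \<alpha> :: complex)\<^sup>2" by (simp only: of_nat_numeral)
  have "h (- 1) = of_real (\<alpha>\<^sup>2 - \<alpha> + 1 / 6)"
    by (simp add: hm h0 h1 p2)
  with h show ?thesis by (intro exI[of _ h] conjI allI impI)
qed

end

text \<open>The first two terms are split off to reach \<open>\<alpha> + 2\<close>; their
  contribution at -1 turns the Bernoulli value at \<open>\<alpha> + 2\<close> into that at
  \<open>\<alpha>\<close>.\<close>

lemma hz_unit_continuation:
  fixes \<alpha> :: real
  assumes "\<alpha> > 0"
  shows "\<exists>G. G holomorphic_on (- {1}) \<and> (\<forall>z. Re z > 1 \<longrightarrow> (\<lambda>q. of_real (real q + \<alpha>) powr (- z)) sums G z) \<and>
      G (- 1) = - of_real (\<alpha>\<^sup>2 - \<alpha> + 1 / 6) / 2"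
proof -
  have a2: "\<alpha> + 2 \<ge> 2" using assms by simp
  obtain h where h: "h holomorphic_on UNIV" "\<And>s. Re s > 1 \<Longrightarrow> h s = (s - 1) * hz (\<alpha> + 2) s"
      "h (- 1) = of_real ((\<alpha> + 2)\<^sup>2 - (\<alpha> + 2) + 1 / 6)"
    using hz_continuation[OF a2] by auto
  define G where "G z = of_real \<alpha> powr (- z) + of_real (\<alpha> + 1) powr (- z) + h z / (z - 1)" for z
  have "G holomorphic_on (- {1})"
    unfolding G_def by (intro holomorphic_intros holomorphic_on_subset[OF h(1)]) auto
  moreover have "(\<lambda>q. of_real (real q + \<alpha>) powr (- z)) sums G z" if "Re z > 1" for z
  proof -
    have "z \<noteq> 1" using that by auto
    let ?f = "\<lambda>q. of_real (real q + \<alpha>) powr (- z) :: complex"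
    have "(\<lambda>q. ?f (q + 2)) sums hz (\<alpha> + 2) z"
      using hz_sums[OF a2 that] by (simp add: add_ac)
    then have "?f sums (hz (\<alpha> + 2) z + (\<Sum>i<2. ?f i))" by (rule sums_iff_shift[THEN iffD1])
    moreover have "hz (\<alpha> + 2) z + (\<Sum>i<2. ?f i) = G z"
      using h(2)[OF that] \<open>z \<noteq> 1\<close> by (simp add: G_def numeral_2_eq_2 add_ac)
    ultimately show ?thesis by simp
  qed
  moreover have "G (- 1) = - of_real (\<alpha>\<^sup>2 - \<alpha> + 1 / 6) / 2"
  proof -
    have "of_real (\<alpha> + 1) powr 1 = (of_real (\<alpha> + 1) :: complex)" "of_real \<alpha> powr 1 = (of_real \<alpha> :: complex)"
      by simp_all
    then have "G (- 1) = of_real (\<alpha> + (\<alpha> + 1) + ((\<alpha> + 2)\<^sup>2 - (\<alpha> + 2) + 1 / 6) / (- 2))"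
      unfolding G_def h(3) by simp
    also have "\<alpha> + (\<alpha> + 1) + ((\<alpha> + 2)\<^sup>2 - (\<alpha> + 2) + 1 / 6) / (- 2) = - (\<alpha>\<^sup>2 - \<alpha> + 1 / 6) / 2"
      by (simp add: power2_eq_square field_simps)
    finally show ?thesis by simp
  qed
  ultimately show ?thesis by blast
qed

lemma periodic_bounded:
  fixes ch :: "nat \<Rightarrow> complex"
  assumes "N > 0" "\<And>n. ch (n + N) = ch n"
  obtains M where "M > 0" "\<And>n. norm (ch n) \<le> M"
proof -
  have per: "ch (n + k * N) = ch n" for n k
    by (induction k) (auto simp: add.assoc[symmetric] assms(2) add.commute[of N])
  have "norm (ch n) \<le> (\<Sum>j<N. norm (ch j))" for n
  proof -
    have "ch n = ch (n mod N)" using per[of "n mod N" "n div N"] by simp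
    moreover have "norm (ch (n mod N)) \<le> (\<Sum>j<N. norm (ch j))"
      by (rule member_le_sum) (use assms in auto)
    ultimately show ?thesis by simp
  qed
  then have "norm (ch n) \<le> (\<Sum>j<N. norm (ch j)) + 1" for n by (meson add_increasing2 zero_le_one)
  moreover have "(\<Sum>j<N. norm (ch j)) + 1 > 0" by (simp add: add_nonneg_pos sum_nonneg)
  ultimately show thesis by (rule that[rotated])
qed

lemma dirichlet_series_summable:
  fixes ch :: "nat \<Rightarrow> complex"
  assumes "\<And>n. norm (ch n) \<le> M" "Re z > 1"
  shows "summable (\<lambda>n. norm (ch (Suc n) * of_nat (Suc n) powr (- z)))"
proof -
  have nrm: "norm (of_nat (Suc n) powr (- z) :: complex) = real (Suc n) powr (- Re z)" for n
    using norm_powr_real_powr[of "of_nat (Suc n)" "- z"] by (simp del: of_nat_Suc)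
  have "summable (\<lambda>n. (real n + 1) powr (- Re z))" by (rule summable_shifted_powr) (use assms in auto)
  then have s: "summable (\<lambda>n. M * real (Suc n) powr (- Re z))" by (intro summable_mult) (simp add: add.commute)
  have "M \<ge> 0" using assms(1)[of 0] norm_ge_zero order_trans by blast
  show ?thesis
    by (rule summable_comparison_test'[OF s]) (auto simp: norm_mult nrm assms intro!: mult_right_mono simp del: of_nat_Suc)
qed

text \<open>Sorting by residues modulo \<open>N\<close> gives Hurwitz zeta functions at
  \<open>j / N\<close>. Residues run over \<open>1..N\<close> rather than from 0 so that these
  parameters are positive.\<close>

lemma periodic_L_continuation:
  fixes ch :: "nat \<Rightarrow> complex"
  assumes N: "N > 0" and per: "\<And>n. ch (n + N) = ch n"
  shows "\<exists>F. F holomorphic_on (- {1}) \<and>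
     (\<forall>z. Re z > 1 \<longrightarrow> (\<lambda>n. ch (Suc n) * of_nat (Suc n) powr (- z)) sums F z) \<and>
     F (- 1) = - (of_nat N / 2) * (\<Sum>j=1..N. ch j * of_real ((real j / real N)\<^sup>2 - real j / real N + 1 / 6))"
proof -
  let ?a = "\<lambda>j. real j / real N"
  have "\<forall>j. \<exists>G. 0 < j \<longrightarrow> G holomorphic_on (- {1}) \<and> (\<forall>z. Re z > 1 \<longrightarrow> (\<lambda>q. of_real (real q + ?a j) powr (- z)) sums G z) \<and>
      G (- 1) = - of_real ((?a j)\<^sup>2 - ?a j + 1 / 6) / 2"
  proof
    fix j :: nat
    show "\<exists>G. 0 < j \<longrightarrow> G holomorphic_on (- {1}) \<and> (\<forall>z. Re z > 1 \<longrightarrow> (\<lambda>q. of_real (real q + ?a j) powr (- z)) sums G z) \<and>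
      G (- 1) = - of_real ((?a j)\<^sup>2 - ?a j + 1 / 6) / 2"
      using hz_unit_continuation[of "?a j"] N by (cases "j = 0") auto
  qed
  from choice[OF this] obtain G where G0: "\<forall>j. 0 < j \<longrightarrow> G j holomorphic_on (- {1}) \<and> (\<forall>z. Re z > 1 \<longrightarrow> (\<lambda>q. of_real (real q + ?a j) powr (- z)) sums G j z) \<and>
      G j (- 1) = - of_real ((?a j)\<^sup>2 - ?a j + 1 / 6) / 2" by blast
  have G: "\<And>j. 0 < j \<Longrightarrow> G j holomorphic_on (- {1})"
    "\<And>j z. 0 < j \<Longrightarrow> Re z > 1 \<Longrightarrow> (\<lambda>q. of_real (real q + ?a j) powr (- z)) sums G j z"
    "\<And>j. 0 < j \<Longrightarrow> G j (- 1) = - of_real ((?a j)\<^sup>2 - ?a j + 1 / 6) / 2"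
    using G0 by blast+
  define F where "F z = (\<Sum>j=1..N. ch j * of_nat N powr (- z) * G j z)" for z
  have "F holomorphic_on (- {1})" unfolding F_def
    by (intro holomorphic_intros G) auto
  moreover have "(\<lambda>n. ch (Suc n) * of_nat (Suc n) powr (- z)) sums F z" if z: "Re z > 1" for z
  proof -
    let ?f = "\<lambda>n. ch (Suc n) * of_nat (Suc n) powr (- z)"
    have perk: "ch (n + k * N) = ch n" for n k
      by (induction k) (auto simp: add.assoc[symmetric] per add.commute[of N])
    obtain M where M: "\<And>n. norm (ch n) \<le> M" using periodic_bounded[of N ch, OF N per] by blast
    have sf: "summable ?f" by (rule summable_norm_cancel[OF dirichlet_series_summable[OF M z]])
    have g1: "(\<lambda>q. sum ?f {q * N..<q * N + N}) sums suminf ?f"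
      by (rule sums_group[OF summable_sums[OF sf] N])
    have g2: "sum ?f {q * N..<q * N + N} = (\<Sum>j=1..N. ch j * of_nat N powr (- z) * of_real (real q + ?a j) powr (- z))" for q
    proof (rule sum.reindex_bij_witness[of _ "\<lambda>j. q * N + j - 1" "\<lambda>n. Suc n - q * N"])
      fix n assume n: "n \<in> {q * N..<q * N + N}"
      define j where "j = Suc n - q * N"
      have j: "Suc n = j + q * N" "j \<in> {1..N}" using n by (auto simp: j_def)
      have "real N * (real q + ?a j) = real (j + q * N)" using N by (simp add: field_simps)
      then have e: "of_nat (Suc n) = of_real (real N) * (of_real (real q + ?a j) :: complex)"
        unfolding j by (metis of_real_mult of_real_of_nat_eq)
      have "of_nat (Suc n) powr (- z) = of_real (real N) powr (- z) * of_real (real q + ?a j) powr (- z)"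
        unfolding e by (rule powr_times_real) auto
      then show "ch (Suc n - q * N) * of_nat N powr (- z) * of_real (real q + ?a (Suc n - q * N)) powr (- z) = ?f n"
        unfolding j_def[symmetric] unfolding j(1) perk by simp
    qed (use N in auto)
    have "(\<lambda>q. \<Sum>j=1..N. ch j * of_nat N powr (- z) * of_real (real q + ?a j) powr (- z)) sums F z"
      unfolding F_def by (intro sums_sum sums_mult G z) auto
    then have "suminf ?f = F z" using sums_unique2[OF g1] unfolding g2 by blast
    then show ?thesis using summable_sums[OF sf] by simp
  qed
  moreover have "F (- 1) = - (of_nat N / 2) * (\<Sum>j=1..N. ch j * of_real ((?a j)\<^sup>2 - ?a j + 1 / 6))"
  proof -
    have "F (- 1) = (\<Sum>j=1..N. ch j * of_nat N * (- of_real ((?a j)\<^sup>2 - ?a j + 1 / 6) / 2))"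
      unfolding F_def by (rule sum.cong) (use G(3) in \<open>simp_all add: powr_one'\<close>)
    also have "\<dots> = (\<Sum>j=1..N. - (of_nat N / 2) * (ch j * of_real ((?a j)\<^sup>2 - ?a j + 1 / 6)))"
      by (rule sum.cong) (simp_all add: field_simps)
    finally show ?thesis by (simp only: sum_distrib_left)
  qed
  ultimately show ?thesis by blast
qed

text \<open>The definite description is resolved by the identity theorem: the plane without 1 is
  connected and contains the half plane where the series fixes the function.\<close>

lemma dirichlet_L_eqI:
  assumes F: "F holomorphic_on (- {1})"
    "\<And>z. Re z > 1 \<Longrightarrow> (\<lambda>n. of_int (kronecker_symbol D (Suc n)) * of_nat (Suc n) powr (- z)) sums F z"
    and s: "s \<noteq> 1"
  shows "dirichlet_L D s = F s"
proof -
  have op: "open (- {1 :: complex})" by auto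
  have con: "connected (- {1 :: complex})"
    using connected_punctured_universe[of "1 :: complex"] by simp
  have lim: "(F \<longlongrightarrow> F s) (at s)"
    using holomorphic_on_imp_continuous_on[OF F(1)] s op continuous_on_eq_continuous_at isCont_def by blast
  show ?thesis unfolding dirichlet_L_def
  proof (rule the_equality)
    show "\<exists>G. G holomorphic_on - {1} \<and> (\<forall>z. Re z > 1 \<longrightarrow> (\<lambda>n. of_int (kronecker_symbol D (Suc n)) * of_nat (Suc n) powr (- z)) sums G z) \<and> (G \<longlongrightarrow> F s) (at s)"
      using F lim by blast
    fix v assume "\<exists>G. G holomorphic_on - {1} \<and> (\<forall>z. Re z > 1 \<longrightarrow> (\<lambda>n. of_int (kronecker_symbol D (Suc n)) * of_nat (Suc n) powr (- z)) sums G z) \<and> (G \<longlongrightarrow> v) (at s)"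
    then obtain G where G: "G holomorphic_on - {1}"
      "\<And>z. Re z > 1 \<Longrightarrow> (\<lambda>n. of_int (kronecker_symbol D (Suc n)) * of_nat (Suc n) powr (- z)) sums G z"
      "(G \<longlongrightarrow> v) (at s)" by blast
    have "G w = F w" if "w \<in> - {1}" for w
    proof (rule analytic_continuation_open[of "{z. Re z > 1}" "- {1}" G F])
      show "{z. 1 < Re z} \<noteq> {}" by (auto intro: exI[of _ 2])
      show "G z = F z" if "z \<in> {z. 1 < Re z}" for z
        using sums_unique2[OF G(2) F(2)] that by simp
    qed (use that G F op con in \<open>auto simp: open_halfspace_Re_gt\<close>)
    then have "G s = F s" using s by simp
    moreover have "(G \<longlongrightarrow> G s) (at s)"
      using holomorphic_on_imp_continuous_on[OF G(1)] s op continuous_on_eq_continuous_at isCont_def by blast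
    ultimately show "v = F s" using LIM_unique[OF G(3)] by simp
  qed
qed

section \<open>Gauss sums and the Kronecker symbol\<close>

text \<open>Both sides are congruent modulo \<open>p\<close> by Euler's criterion and differ by at
  most 2, which is less than \<open>p\<close>.\<close>

lemma legendre_mult:
  assumes p: "prime p" "2 < p"
  shows "Legendre (a * b) (int p) = Legendre a (int p) * Legendre b (int p)"
proof -
  have "[Legendre (a * b) p = (a * b) ^ ((p - 1) div 2)] (mod p)" by (rule euler_criterion[OF p])
  moreover have "[Legendre a p * Legendre b p = a ^ ((p - 1) div 2) * b ^ ((p - 1) div 2)] (mod p)"
    by (intro cong_mult euler_criterion[OF p])
  ultimately have "[Legendre (a * b) p = Legendre a p * Legendre b p] (mod p)"
    by (metis cong_sym cong_trans power_mult_distrib)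
  then have d: "int p dvd Legendre (a * b) p - Legendre a p * Legendre b p" by (simp add: cong_iff_dvd_diff)
  have v: "Legendre x y \<in> {-1, 0, 1}" for x y by (simp add: Legendre_def)
  have "\<bar>Legendre (a * b) p - Legendre a p * Legendre b p\<bar> \<le> 2"
    using v[of "a * b" p] v[of a p] v[of b p] by auto
  then show ?thesis using d p zdvd_imp_le[of "int p" "\<bar>Legendre (a * b) p - Legendre a p * Legendre b p\<bar>"]
    by (cases "Legendre (a * b) p - Legendre a p * Legendre b p = 0") auto
qed

lemma legendre_mod: "Legendre (a mod m) m = Legendre a m"
  by (simp add: Legendre_def QuadRes_def cong_def)

lemma legendre_square: "\<not> int p dvd a \<Longrightarrow> Legendre (a\<^sup>2) (int p) = 1"
  if "prime p" "2 < p" for p :: nat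
  using that by (auto simp: Legendre_def QuadRes_def cong_def mod_eq_0_iff_dvd prime_dvd_power_iff)

text \<open>Gauss's lemma: among \<open>2, 4, ..., 2 n\<close> with \<open>n = (p - 1) / 2\<close>,
  exactly \<open>n - n div 2\<close> exceed \<open>n\<close>, and the parity of that number depends
  on \<open>p\<close> modulo 8.\<close>

lemma legendre_two:
  assumes p: "prime p" "2 < p"
  shows "Legendre 2 (int p) = (if p mod 8 = 1 \<or> p mod 8 = 7 then 1 else - 1)"
proof -
  have odd: "odd p" using p prime_odd_nat by simp
  interpret G: GAUSS p 2
    by unfold_locales (use p in \<open>auto simp: cong_def\<close>)
  define n where "n = (int p - 1) div 2"
  have pn: "int p = 2 * n + 1" using odd by (auto simp: n_def elim!: oddE)
  have "G.C = (\<lambda>x. 2 * x) ` {0<..n}"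
    unfolding G.C_def G.B_def G.A_def n_def[symmetric] image_image
    by (rule image_cong) (use pn in \<open>auto simp: mod_pos_pos_trivial\<close>)
  then have "G.E = (\<lambda>x. 2 * x) ` {n div 2<..n}"
    unfolding G.E_def n_def[symmetric] using pn p by (auto simp: image_iff)
  then have "card G.E = card {n div 2<..n}" by (simp add: card_image inj_on_def)
  then have E: "card G.E = nat (n - n div 2)" by simp
  have L: "Legendre 2 p = (-1) ^ nat (n - n div 2)" using G.gauss_lemma E by simp
  have n0: "n \<ge> 0" using pn p by linarith
  have "even (nat (n - n div 2)) \<longleftrightarrow> even (n - n div 2)"
    using n0 by (subst even_nat_iff) auto
  also have "\<dots> \<longleftrightarrow> n mod 4 = 0 \<or> n mod 4 = 3" by presburger
  also have "\<dots> \<longleftrightarrow> int p mod 8 = 1 \<or> int p mod 8 = 7" unfolding pn by presburger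
  also have "int p mod 8 = int (p mod 8)" by (simp add: zmod_int)
  also have "int (p mod 8) = 1 \<or> int (p mod 8) = 7 \<longleftrightarrow> p mod 8 = 1 \<or> p mod 8 = 7" by auto
  finally show ?thesis unfolding L by (simp add: minus_one_power_iff)
qed

lemma legendre_minus_one:
  assumes p: "prime p" "2 < p"
  shows "Legendre (- 1) (int p) = (if p mod 4 = 1 then 1 else - 1)"
proof -
  have odd: "odd p" using p prime_odd_nat by simp
  have "[Legendre (- 1) p = (- 1) ^ ((p - 1) div 2)] (mod p)" by (rule euler_criterion[OF p])
  then have d: "int p dvd Legendre (- 1) p - (- 1) ^ ((p - 1) div 2)" by (simp add: cong_iff_dvd_diff)
  have v: "Legendre (-1) p \<in> {-1, 0, 1}" "(- 1 :: int) ^ ((p - 1) div 2) \<in> {-1, 1}"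
    by (auto simp: Legendre_def minus_one_power_iff)
  then have "\<bar>Legendre (- 1) p - (- 1) ^ ((p - 1) div 2)\<bar> \<le> 2" by auto
  then have "Legendre (- 1) p = (- 1) ^ ((p - 1) div 2)"
    using d p zdvd_imp_le[of "int p" "\<bar>Legendre (- 1) p - (- 1) ^ ((p - 1) div 2)\<bar>"]
    by (cases "Legendre (- 1) p - (- 1) ^ ((p - 1) div 2) = 0") auto
  moreover have "even ((p - 1) div 2) \<longleftrightarrow> p mod 4 = 1" using odd by presburger
  ultimately show ?thesis by (simp add: minus_one_power_iff)
qed

definition ez :: "nat \<Rightarrow> int \<Rightarrow> complex" where
  "ez N k = cis (2 * pi * real_of_int k / real N)"

lemma ez_add: "ez N (a + b) = ez N a * ez N b"
  by (simp add: ez_def cis_mult ring_distribs add_divide_distrib)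

lemma ez_0 [simp]: "ez N 0 = 1"
  by (simp add: ez_def)

lemma ez_nonzero [simp]: "ez N a \<noteq> 0"
  by (simp add: ez_def)

lemma ez_minus: "ez N (- a) = inverse (ez N a)"
  by (simp add: ez_def)

lemma ez_power: "ez N a ^ k = ez N (int k * a)"
  by (induction k) (simp_all add: ez_add[symmetric] distrib_right)

lemma ez_mult_self: "N > 0 \<Longrightarrow> ez N (int N * k) = 1"
proof -
  assume "N > 0"
  then have "2 * pi * real_of_int (int N * k) / real N = 2 * pi * real_of_int k" by (simp add: field_simps)
  then show ?thesis unfolding ez_def by (simp only: cis_multiple_2pi Ints_of_int)
qed

lemma ez_mod: "N > 0 \<Longrightarrow> ez N (k mod int N) = ez N k"
  using ez_add[of N "int N * (k div int N)" "k mod int N"] ez_mult_self[of N "k div int N"]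
  by simp

lemma ez_cong: "N > 0 \<Longrightarrow> [a = b] (mod int N) \<Longrightarrow> ez N a = ez N b"
  by (metis ez_mod cong_def)

lemma ez_eq_1_iff: "N > 0 \<Longrightarrow> ez N k = 1 \<longleftrightarrow> int N dvd k"
proof
  assume N: "N > 0" and "ez N k = 1"
  then have "cos (2 * pi * real_of_int k / real N) = 1"
    unfolding ez_def by (metis cis.simps(1) one_complex.simps(1))
  then obtain m :: int where "2 * pi * real_of_int k / real N = real_of_int m * 2 * pi"
    using cos_one_2pi_int by blast
  then have "real_of_int k = real_of_int (int N * m)" using N by (simp add: field_simps)
  then have "k = int N * m" by (simp only: of_int_eq_iff)
  then show "int N dvd k" by simp
next
  assume "N > 0" "int N dvd k"
  then show "ez N k = 1" using ez_mult_self by (auto elim!: dvdE)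
qed

lemma sum_ez: "N > 0 \<Longrightarrow> (\<Sum>j\<in>{0..<int N}. ez N (k * j)) = (if int N dvd k then of_nat N else 0)"
proof -
  assume N: "N > 0"
  have "(\<Sum>j\<in>{0..<int N}. ez N (k * j)) = (\<Sum>j<N. ez N (k * int j))"
    by (rule sum.reindex_bij_witness[of _ int nat]) auto
  also have "\<dots> = (\<Sum>j<N. ez N k ^ j)" by (simp add: ez_power mult.commute)
  also have "\<dots> = (if int N dvd k then of_nat N else 0)"
  proof (cases "int N dvd k")
    case True
    then show ?thesis using ez_eq_1_iff[OF N, of k] by simp
  next
    case False
    then have "ez N k \<noteq> 1" using ez_eq_1_iff[OF N] by simp
    moreover have "ez N k ^ N = 1" using N by (simp add: ez_power ez_mult_self)
    ultimately show ?thesis using False by (simp add: sum_gp_strict)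
  qed
  finally show ?thesis .
qed

text \<open>Real characters with separable Gauss sums. The last clause is demanded for every
  \<open>k\<close>, also one not coprime to \<open>N\<close>, which encodes primitivity; since
  \<open>\<psi>\<close> is real no conjugate appears on its right side.\<close>

definition gauss_char :: "nat \<Rightarrow> (int \<Rightarrow> int) \<Rightarrow> complex \<Rightarrow> bool" where
  "gauss_char N \<psi> g \<longleftrightarrow> N > 0 \<and> \<psi> 1 = 1 \<and> (\<forall>x y. \<psi> (x * y) = \<psi> x * \<psi> y) \<and>
     (\<forall>x. \<psi> (x mod int N) = \<psi> x) \<and>
     (\<forall>k. (\<Sum>j\<in>{0..<int N}. of_int (\<psi> j) * ez N (k * j)) = of_int (\<psi> k) * g)"

lemma sum_times_times:
  fixes c :: "'a :: comm_semiring_0"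
  shows "(\<Sum>(x, y)\<in>A \<times> B. c * (f x * g y)) = c * ((\<Sum>x\<in>A. f x) * (\<Sum>y\<in>B. g y))"
proof -
  have "(\<Sum>(x, y)\<in>A \<times> B. c * (f x * g y)) = (\<Sum>x\<in>A. \<Sum>y\<in>B. c * (f x * g y))"
    by (rule sum.cartesian_product[symmetric])
  also have "\<dots> = c * (\<Sum>x\<in>A. \<Sum>y\<in>B. f x * g y)" by (simp only: sum_distrib_left)
  finally show ?thesis by (simp only: sum_product)
qed

text \<open>Residues modulo \<open>M * N\<close> are written as \<open>x * N + y * M\<close>. Then
  \<open>\<psi>1\<close> sees only \<open>x * N\<close> and \<open>\<psi>2\<close> only
  \<open>y * M\<close>, which produces the cross factors; reciprocity later compensates
  them.\<close>

lemma gauss_char_mult: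
  assumes 1: "gauss_char M \<psi>1 g1" and 2: "gauss_char N \<psi>2 g2" and co: "coprime M N"
  shows "gauss_char (M * N) (\<lambda>x. \<psi>1 x * \<psi>2 x) (of_int (\<psi>1 (int N)) * of_int (\<psi>2 (int M)) * g1 * g2)"
proof -
  note d1 = 1[unfolded gauss_char_def] and d2 = 2[unfolded gauss_char_def]
  have pos: "M > 0" "N > 0" using d1 d2 by auto
  have per1: "\<psi>1 (x mod int (M * N)) = \<psi>1 x" for x
    using d1 by (metis mod_mod_cancel dvd_triv_left of_nat_dvd_iff)
  have per2: "\<psi>2 (x mod int (M * N)) = \<psi>2 x" for x
    using d2 by (metis mod_mod_cancel dvd_triv_right of_nat_dvd_iff)
  have addm1: "\<psi>1 (x + int M * y) = \<psi>1 x" for x y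
    using d1 by (metis mod_mult_self2)
  have addm2: "\<psi>2 (x + int N * y) = \<psi>2 x" for x y
    using d2 by (metis mod_mult_self2)
  let ?S = "{0..<int M} \<times> {0..<int N}"
  let ?f = "\<lambda>(x, y). (x * int N + y * int M) mod int (M * N)"
  have inj: "inj_on ?f ?S"
  proof (rule inj_onI, clarify)
    fix x y x' y' assume xy: "x \<in> {0..<int M}" "y \<in> {0..<int N}" "x' \<in> {0..<int M}" "y' \<in> {0..<int N}"
      and "(x * int N + y * int M) mod int (M * N) = (x' * int N + y' * int M) mod int (M * N)"
    then have "int (M * N) dvd (x * int N + y * int M) - (x' * int N + y' * int M)"
      by (simp add: mod_eq_dvd_iff)
    then have dv: "int M * int N dvd (x - x') * int N + (y - y') * int M" by (simp add: algebra_simps)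
    then have "int M dvd (x - x') * int N + (y - y') * int M" using dvd_mult_left by blast
    then have "int M dvd (x - x') * int N" by (simp add: dvd_add_left_iff)
    then have "int M dvd x - x'" using co by (simp add: coprime_dvd_mult_left_iff)
    then have "x mod int M = x' mod int M" by (simp add: mod_eq_dvd_iff)
    moreover have "int N dvd (x - x') * int N + (y - y') * int M" using dv dvd_mult_right by blast
    then have "int N dvd (y - y') * int M" by (simp add: dvd_add_right_iff)
    then have "int N dvd y - y'" using co by (simp add: coprime_dvd_mult_left_iff coprime_commute)
    then have "y mod int N = y' mod int N" by (simp add: mod_eq_dvd_iff)
    ultimately show "x = x' \<and> y = y'" using xy by simp
  qed
  have img: "?f ` ?S = {0..<int (M * N)}"
  proof (rule card_subset_eq)
    show "?f ` ?S \<subseteq> {0..<int (M * N)}" using pos by (auto simp del: of_nat_mult)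
    show "card (?f ` ?S) = card {0..<int (M * N)}"
      using card_image[OF inj] by (simp add: nat_mult_distrib)
  qed simp
  have "(\<Sum>j\<in>{0..<int (M * N)}. of_int (\<psi>1 j * \<psi>2 j) * ez (M * N) (k * j)) =
      of_int (\<psi>1 k * \<psi>2 k) * (of_int (\<psi>1 (int N)) * of_int (\<psi>2 (int M)) * g1 * g2)" for k
  proof -
    have "(\<Sum>j\<in>{0..<int (M * N)}. of_int (\<psi>1 j * \<psi>2 j) * ez (M * N) (k * j)) =
       (\<Sum>z\<in>?S. of_int (\<psi>1 (?f z) * \<psi>2 (?f z)) * ez (M * N) (k * ?f z))"
      unfolding img[symmetric] sum.reindex[OF inj] o_def ..
    also have "\<dots> = (\<Sum>(x, y)\<in>?S. (of_int (\<psi>1 (int N)) * of_int (\<psi>2 (int M))) *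
         ((of_int (\<psi>1 x) * ez M (k * x)) * (of_int (\<psi>2 y) * ez N (k * y))))"
    proof (rule sum.cong[OF refl], clarify)
      fix x y
      have "\<psi>1 (x * int N + y * int M) = \<psi>1 x * \<psi>1 (int N)"
        using addm1[of "x * int N" y] d1 by (simp add: mult.commute)
      moreover have "\<psi>2 (x * int N + y * int M) = \<psi>2 y * \<psi>2 (int M)"
        using addm2[of "y * int M" x] d2 by (simp add: mult.commute add.commute)
      moreover have "ez (M * N) (k * ((x * int N + y * int M) mod int (M * N))) = ez M (k * x) * ez N (k * y)"
      proof -
        have "ez (M * N) (k * ((x * int N + y * int M) mod int (M * N))) = ez (M * N) (k * (x * int N + y * int M))"
          by (rule ez_cong) (use pos in \<open>simp_all add: cong_def mod_mult_right_eq del: of_nat_mult\<close>)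
        also have "\<dots> = ez (M * N) (k * x * int N) * ez (M * N) (k * y * int M)"
          by (simp add: ez_add[symmetric] algebra_simps)
        also have "ez (M * N) (k * x * int N) = ez M (k * x)" using pos by (simp add: ez_def field_simps)
        also have "ez (M * N) (k * y * int M) = ez N (k * y)" using pos by (simp add: ez_def field_simps)
        finally show ?thesis .
      qed
      ultimately show "of_int (\<psi>1 ((x * int N + y * int M) mod int (M * N)) * \<psi>2 ((x * int N + y * int M) mod int (M * N)))
          * ez (M * N) (k * ((x * int N + y * int M) mod int (M * N))) =
         (of_int (\<psi>1 (int N)) * of_int (\<psi>2 (int M))) *
         ((of_int (\<psi>1 x) * ez M (k * x)) * (of_int (\<psi>2 y) * ez N (k * y)))"
        unfolding per1 per2 by simp
    qed
    also have "\<dots> = (of_int (\<psi>1 (int N)) * of_int (\<psi>2 (int M))) *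
       ((\<Sum>x\<in>{0..<int M}. of_int (\<psi>1 x) * ez M (k * x)) * (\<Sum>y\<in>{0..<int N}. of_int (\<psi>2 y) * ez N (k * y)))"
      by (rule sum_times_times)
    also have "\<dots> = of_int (\<psi>1 k * \<psi>2 k) * (of_int (\<psi>1 (int N)) * of_int (\<psi>2 (int M)) * g1 * g2)"
      using d1 d2 by simp
    finally show ?thesis .
  qed
  then show ?thesis using d1 d2 per1 per2 unfolding gauss_char_def by (simp add: algebra_simps del: of_nat_mult)
qed

text \<open>The sum of \<open>\<psi> k * g * ez N (- k)\<close> is computed twice: by separability
  at -1, and by expanding \<open>\<psi> k * g\<close> and using orthogonality, which keeps only
  \<open>j = 1\<close>.\<close>

lemma gauss_char_square:
  assumes "gauss_char N \<psi> g"
  shows "g\<^sup>2 = of_int (\<psi> (- 1)) * of_nat N"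
proof -
  note d = assms[unfolded gauss_char_def]
  have N: "N > 0" using d by blast
  have G: "(\<Sum>j\<in>{0..<int N}. of_int (\<psi> j) * ez N (k * j)) = of_int (\<psi> k) * g" for k using d by blast
  have "(\<Sum>k\<in>{0..<int N}. of_int (\<psi> k) * g * ez N (k * (-1))) =
      (\<Sum>k\<in>{0..<int N}. \<Sum>j\<in>{0..<int N}. of_int (\<psi> j) * ez N ((j - 1) * k))"
  proof (rule sum.cong[OF refl])
    fix k
    have "ez N ((j - 1) * k) = ez N (k * j) * ez N (k * (- 1))" for j
      unfolding ez_add[symmetric] by (simp add: algebra_simps)
    then show "of_int (\<psi> k) * g * ez N (k * (-1)) = (\<Sum>j\<in>{0..<int N}. of_int (\<psi> j) * ez N ((j - 1) * k))"
      unfolding G[symmetric] sum_distrib_right by (simp add: mult.assoc)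
  qed
  also have "\<dots> = (\<Sum>j\<in>{0..<int N}. of_int (\<psi> j) * (\<Sum>k\<in>{0..<int N}. ez N ((j - 1) * k)))"
    by (subst sum.swap) (simp add: sum_distrib_left)
  also have "\<dots> = (\<Sum>j\<in>{0..<int N}. of_int (\<psi> j) * (if int N dvd j - 1 then of_nat N else 0))"
    by (simp only: sum_ez[OF N])
  also have "\<dots> = (\<Sum>j\<in>{1 mod int N}. of_int (\<psi> j) * of_nat N)"
  proof (rule sum.mono_neutral_cong_right)
    have "j = 1 mod int N" if "0 \<le> j" "j < int N" "int N dvd j - 1" for j
      using that by (metis mod_eq_dvd_iff mod_pos_pos_trivial)
    then show "\<forall>i\<in>{0..<int N} - {1 mod int N}. of_int (\<psi> i) * (if int N dvd i - 1 then of_nat N else 0) = (0::complex)"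
      by auto
    have "int N dvd 1 mod int N - 1" by (metis mod_eq_dvd_iff mod_mod_trivial)
    then show "\<And>x. x \<in> {1 mod int N} \<Longrightarrow> of_int (\<psi> x) * (if int N dvd x - 1 then of_nat N else 0) = of_int (\<psi> x) * (of_nat N :: complex)"
      by simp
  qed (use N in auto)
  also have "\<dots> = of_nat N" using d by simp
  also have "(\<Sum>k\<in>{0..<int N}. of_int (\<psi> k) * g * ez N (k * (-1))) = g * (\<Sum>k\<in>{0..<int N}. of_int (\<psi> k) * ez N ((-1) * k))"
    by (simp add: sum_distrib_left mult_ac)
  also have "\<dots> = of_int (\<psi> (- 1)) * g\<^sup>2" by (simp only: G power2_eq_square) (simp add: mult_ac)
  finally have e: "of_int (\<psi> (- 1)) * g\<^sup>2 = of_nat N" .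
  have "\<psi> (-1) * \<psi> (-1) = 1" using d by (metis mult_minus1 minus_minus)
  then have "of_int (\<psi> (- 1)) * of_int (\<psi> (- 1)) = (1::complex)" by (metis of_int_1 of_int_mult)
  then show ?thesis using e by (metis mult.assoc mult.commute mult.right_neutral)
qed


section \<open>Gauss's determination of the sign of the quadratic Gauss sum by Gaussian binomial
  coefficients\<close>

definition gnum :: "complex \<Rightarrow> nat \<Rightarrow> nat \<Rightarrow> complex" where
  "gnum q m j = (\<Prod>i<j. 1 - q ^ (m - i))"

definition gden :: "complex \<Rightarrow> nat \<Rightarrow> complex" where
  "gden q j = (\<Prod>i<j. 1 - q ^ Suc i)"

definition gbin :: "complex \<Rightarrow> nat \<Rightarrow> nat \<Rightarrow> complex" where
  "gbin q m j = gnum q m j / gden q j"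

lemma gnum_Suc_Suc: "gnum q (Suc m) (Suc j) = (1 - q ^ Suc m) * gnum q m j"
  unfolding gnum_def prod.lessThan_Suc_shift by simp

lemma gbin_0 [simp]: "gbin q m 0 = 1"
  by (simp add: gbin_def gnum_def gden_def)

lemma gbin_gt [simp]: "j > m \<Longrightarrow> gbin q m j = 0"
proof -
  assume "j > m"
  then have "gnum q m j = 0" unfolding gnum_def by (intro prod_zero bexI[of _ m]) auto
  then show ?thesis by (simp add: gbin_def)
qed

lemma gbin_pascal:
  assumes "j \<le> m" "q ^ Suc j \<noteq> 1"
  shows "gbin q (Suc m) (Suc j) = gbin q m (Suc j) + q ^ (m - j) * gbin q m j"
proof -
  let ?d = "1 - q ^ Suc j"
  have d: "?d \<noteq> 0" using assms(2) by simp
  have 1: "gbin q (Suc m) (Suc j) = (1 - q ^ Suc m) / ?d * gbin q m j"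
    unfolding gbin_def gnum_Suc_Suc by (simp add: gden_def del: power_Suc)
  have 2: "gbin q m (Suc j) = (1 - q ^ (m - j)) / ?d * gbin q m j"
    by (simp add: gbin_def gden_def gnum_def mult_ac del: power_Suc)
  have "q ^ (m - j) * q ^ Suc j = q ^ Suc m"
    using assms(1) by (simp flip: power_add)
  then have "(1 - q ^ Suc m) = (1 - q ^ (m - j)) + q ^ (m - j) * ?d" by (simp add: algebra_simps del: power_Suc)
  then have "(1 - q ^ Suc m) / ?d = ((1 - q ^ (m - j)) + q ^ (m - j) * ?d) / ?d" by (rule arg_cong)
  also have "\<dots> = (1 - q ^ (m - j)) / ?d + q ^ (m - j)"
    by (simp only: add_divide_distrib nonzero_mult_div_cancel_right[OF d])
  finally show ?thesis unfolding 1 2 distrib_right[symmetric] by (rule arg_cong)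
qed

lemma gbin_shift: "(1 - q ^ (Suc m - j)) * gbin q (Suc m) j = (1 - q ^ Suc m) * gbin q m j"
proof -
  have "gnum q (Suc m) (Suc j) = gnum q (Suc m) j * (1 - q ^ (Suc m - j))"
    by (simp add: gnum_def)
  then show ?thesis unfolding gnum_Suc_Suc gbin_def by (simp add: mult_ac)
qed

definition galt :: "complex \<Rightarrow> nat \<Rightarrow> complex" where
  "galt q m = (\<Sum>j\<le>m. (- 1) ^ j * gbin q m j)"

text \<open>Gauss's recursion for the alternating sum of Gaussian binomial coefficients.\<close>
lemma galt_step:
  assumes "\<And>i. 0 < i \<Longrightarrow> i < N \<Longrightarrow> q ^ i \<noteq> 1" "Suc (Suc m) < N"
  shows "galt q (Suc (Suc m)) = (1 - q ^ Suc m) * galt q m"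
proof -
  let ?s = "\<lambda>j. (- 1) ^ j :: complex"
  have "galt q (Suc (Suc m)) = 1 + (\<Sum>j\<le>Suc m. ?s (Suc j) * gbin q (Suc (Suc m)) (Suc j))"
    unfolding galt_def sum.atMost_Suc_shift[of _ "Suc m"] by simp
  also have "(\<Sum>j\<le>Suc m. ?s (Suc j) * gbin q (Suc (Suc m)) (Suc j)) =
     (\<Sum>j\<le>Suc m. ?s (Suc j) * gbin q (Suc m) (Suc j) - ?s j * (q ^ (Suc m - j) * gbin q (Suc m) j))"
  proof (rule sum.cong[OF refl])
    fix j assume "j \<in> {..Suc m}"
    then have "gbin q (Suc (Suc m)) (Suc j) = gbin q (Suc m) (Suc j) + q ^ (Suc m - j) * gbin q (Suc m) j"
      by (intro gbin_pascal assms) (use assms(2) in auto)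
    then show "?s (Suc j) * gbin q (Suc (Suc m)) (Suc j) =
        ?s (Suc j) * gbin q (Suc m) (Suc j) - ?s j * (q ^ (Suc m - j) * gbin q (Suc m) j)"
      by (simp add: ring_distribs)
  qed
  also have "\<dots> = (\<Sum>j\<le>Suc m. ?s (Suc j) * gbin q (Suc m) (Suc j)) - (\<Sum>j\<le>Suc m. ?s j * (q ^ (Suc m - j) * gbin q (Suc m) j))"
    by (rule sum_subtractf)
  also have "(\<Sum>j\<le>Suc m. ?s (Suc j) * gbin q (Suc m) (Suc j)) = galt q (Suc m) - 1"
  proof -
    have "galt q (Suc m) = 1 + (\<Sum>j\<le>m. ?s (Suc j) * gbin q (Suc m) (Suc j))"
      unfolding galt_def sum.atMost_Suc_shift[of _ m] by simp
    then show ?thesis by simp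
  qed
  finally have "galt q (Suc (Suc m)) = galt q (Suc m) - (\<Sum>j\<le>Suc m. ?s j * (q ^ (Suc m - j) * gbin q (Suc m) j))"
    by simp
  also have "\<dots> = (\<Sum>j\<le>Suc m. ?s j * ((1 - q ^ (Suc m - j)) * gbin q (Suc m) j))"
    unfolding galt_def sum_subtractf[symmetric] by (rule sum.cong) (simp_all add: algebra_simps)
  also have "\<dots> = (\<Sum>j\<le>Suc m. (1 - q ^ Suc m) * (?s j * gbin q m j))"
    unfolding gbin_shift by (simp only: mult.left_commute)
  also have "\<dots> = (1 - q ^ Suc m) * galt q m"
    unfolding galt_def by (simp add: sum_distrib_left del: power_Suc)
  finally show ?thesis .
qed

lemma galt_even:
  assumes "\<And>i. 0 < i \<Longrightarrow> i < N \<Longrightarrow> q ^ i \<noteq> 1" "2 * l < N"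
  shows "galt q (2 * l) = (\<Prod>i<l. 1 - q ^ (2 * i + 1))"
  using assms(2)
proof (induction l)
  case 0
  then show ?case by (simp add: galt_def)
next
  case (Suc l)
  have "galt q (2 * Suc l) = (1 - q ^ Suc (2 * l)) * galt q (2 * l)"
    using galt_step[OF assms(1), of N "2 * l"] Suc.prems by simp
  then show ?case using Suc by (simp add: mult.commute)
qed

text \<open>At the root of unity \<open>q = ez N (- 2)\<close> the quotient of consecutive
  coefficients \<open>gbin q (N - 1)\<close> collapses to minus a power of \<open>q\<close>. The
  alternating sum of the coefficients is then a sum of values of \<open>ez\<close> at
  \<open>j * (j + 1)\<close>, while \<open>galt_even\<close> evaluates it as a product.\<close>

lemma gauss_product:
  assumes N: "odd N" "N > 0"
  shows "(\<Sum>j<N. ez N (int j * (int j + 1))) = (\<Prod>i<N div 2. 1 - ez N (- 2 * (2 * int i + 1)))"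
proof -
  define q where "q = ez N (- 2)"
  have qp: "q ^ k = ez N (- 2 * int k)" for k by (simp add: q_def ez_power mult.commute)
  have q1: "q ^ i \<noteq> 1" if "0 < i" "i < N" for i
  proof
    assume "q ^ i = 1"
    then have "int N dvd - 2 * int i" unfolding qp using ez_eq_1_iff[OF N(2)] by blast
    then have "N dvd 2 * i" by (metis dvd_minus_iff int_dvd_int_iff mult_minus_left of_nat_mult of_nat_numeral)
    then have "N dvd i" using N(1) by (simp add: coprime_dvd_mult_right_iff)
    then show False using that by (simp add: nat_dvd_not_less)
  qed
  have gb: "(- 1) ^ j * gbin q (N - 1) j = ez N (int j * (int j + 1))" if "j < N" for j
    using that
  proof (induction j)
    case (Suc j)
    have "gbin q (N - 1) (Suc j) = gbin q (N - 1) j * ((1 - q ^ (N - 1 - j)) / (1 - q ^ Suc j))"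
      by (simp add: gbin_def gnum_def gden_def)
    also have "(1 - q ^ (N - 1 - j)) / (1 - q ^ Suc j) = - ez N (2 * (int j + 1))"
    proof -
      have e: "q ^ (N - 1 - j) = ez N (2 * (int j + 1))"
      proof -
        have "- 2 * int (N - 1 - j) = 2 * (int j + 1) + int N * (- 2)" using Suc.prems by simp
        then show ?thesis unfolding qp by (simp only: ez_add ez_mult_self[OF N(2)]) simp
      qed
      have f: "q ^ Suc j = inverse (ez N (2 * (int j + 1)))"
        unfolding qp ez_minus[symmetric] by (simp add: algebra_simps)
      have "1 - q ^ Suc j \<noteq> 0" using q1[of "Suc j"] Suc.prems by simp
      moreover have "1 - q ^ (N - 1 - j) = - ez N (2 * (int j + 1)) * (1 - q ^ Suc j)"
        unfolding e f by (simp add: algebra_simps)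
      ultimately show ?thesis by (simp add: field_simps del: power_Suc)
    qed
    finally have "(- 1) ^ Suc j * gbin q (N - 1) (Suc j) = ((- 1) ^ j * gbin q (N - 1) j) * ez N (2 * (int j + 1))"
      by simp
    also have "\<dots> = ez N (int (Suc j) * (int (Suc j) + 1))"
      using Suc by (simp add: ez_add[symmetric] algebra_simps)
    finally show ?case .
  qed simp
  obtain l where l: "N = 2 * l + 1" using N(1) by (elim oddE)
  have "{..<N} = {..N - 1}" using N(2) by auto
  then have "(\<Sum>j<N. ez N (int j * (int j + 1))) = (\<Sum>j\<le>N - 1. (- 1) ^ j * gbin q (N - 1) j)"
    using gb N(2) by (intro sum.cong) auto
  also have "\<dots> = galt q (2 * l)" using l by (simp add: galt_def)
  also have "\<dots> = (\<Prod>i<l. 1 - q ^ (2 * i + 1))" by (rule galt_even[OF q1]) (use l in auto)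
  also have "\<dots> = (\<Prod>i<N div 2. 1 - ez N (- 2 * (2 * int i + 1)))"
    unfolding qp using l by (simp add: add.commute)
  finally show ?thesis .
qed

lemma sum_odd_squares: "(\<Sum>i<n. 2 * int i + 1) = (int n)\<^sup>2"
  by (induction n) (auto simp: power2_eq_square algebra_simps)

lemma ez_sum: "(\<Prod>i\<in>A. ez N (f i)) = ez N (\<Sum>i\<in>A. f i)"
  by (induction A rule: infinite_finite_induct) (auto simp: ez_add)

text \<open>For \<open>N = 2 * n + 1\<close> the square is completed by
  \<open>x = j + n + 1\<close>. The factor \<open>ez N (n\<^sup>2)\<close> cancels when each
  \<open>1 - ez N (- 2 * k)\<close> is made a sine, because the first \<open>n\<close> odd numbers
  add up to \<open>n\<^sup>2\<close>.\<close>

lemma gauss_sum_product: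
  assumes N: "odd N" "N > 0"
  shows "(\<Sum>x\<in>{0..<int N}. ez N (x\<^sup>2)) = (\<Prod>i<N div 2. 2 * \<i> * of_real (sin (2 * pi * (2 * real i + 1) / real N)))"
proof -
  obtain n where n: "N = 2 * n + 1" using N(1) by (elim oddE)
  have "(\<Sum>x\<in>{0..<int N}. ez N (x\<^sup>2)) = (\<Sum>j<N. ez N (int j * (int j + 1) + (int n)\<^sup>2))"
  proof (rule sum.reindex_bij_witness[of _ "\<lambda>j. (int j + int n + 1) mod int N" "\<lambda>x. nat ((x - int n - 1) mod int N)"])
    fix x assume x: "x \<in> {0..<int N}"
    define j where "j = nat ((x - int n - 1) mod int N)"
    have j: "int j = (x - int n - 1) mod int N" using N by (simp add: j_def)
    have "(int j + int n + 1) mod int N = x mod int N"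
      unfolding j by (metis add.assoc diff_diff_eq diff_add_cancel mod_add_left_eq)
    then show "(int (nat ((x - int n - 1) mod int N)) + int n + 1) mod int N = x"
      using x unfolding j_def by simp
    have "j < N" using j N by (metis of_nat_less_iff pos_mod_bound of_nat_0_less_iff)
    then show "nat ((x - int n - 1) mod int N) \<in> {..<N}" by (simp add: j_def)
    have "[x = int j + int n + 1] (mod int N)"
      using \<open>(int j + int n + 1) mod int N = x mod int N\<close> by (simp add: cong_def)
    then have "[x\<^sup>2 = (int j + int n + 1)\<^sup>2] (mod int N)" by (rule cong_pow)
    moreover have "(int j + int n + 1)\<^sup>2 = int j * (int j + 1) + (int n)\<^sup>2 + int N * (int j + 1)"
      unfolding n by (simp add: power2_eq_square algebra_simps)
    ultimately have "[int j * (int j + 1) + (int n)\<^sup>2 = x\<^sup>2] (mod int N)"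
      by (simp add: cong_def)
    then show "ez N (int (nat ((x - int n - 1) mod int N)) * (int (nat ((x - int n - 1) mod int N)) + 1) + (int n)\<^sup>2) = ez N (x\<^sup>2)"
      unfolding j_def[symmetric] by (rule ez_cong[OF N(2)])
  next
    fix j assume j: "j \<in> {..<N}"
    have "((int j + int n + 1) mod int N - int n - 1) mod int N = int j mod int N"
      by (metis (no_types, opaque_lifting) add_diff_cancel_right' diff_diff_eq mod_diff_left_eq add.assoc)
    then show "nat (((int j + int n + 1) mod int N - int n - 1) mod int N) = j" using j by simp
  qed (use N in auto)
  also have "\<dots> = ez N ((int n)\<^sup>2) * (\<Prod>i<n. 1 - ez N (- 2 * (2 * int i + 1)))"
    unfolding ez_add sum_distrib_right[symmetric] gauss_product[OF N] using n by (simp add: mult.commute)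
  also have "(\<Prod>i<n. 1 - ez N (- 2 * (2 * int i + 1))) =
     (\<Prod>i<n. ez N (- (2 * int i + 1)) * (2 * \<i> * of_real (sin (2 * pi * (2 * real i + 1) / real N))))"
  proof (rule prod.cong[OF refl])
    fix i
    let ?a = "2 * int i + 1"
    have "ez N ?a - ez N (- ?a) = 2 * \<i> * of_real (sin (2 * pi * (2 * real i + 1) / real N))"
    proof -
      have "ez N ?a = cis (2 * pi * (2 * real i + 1) / real N)" by (simp add: ez_def)
      then show ?thesis unfolding ez_minus by (simp add: complex_eq_iff)
    qed
    moreover have "1 - ez N (- 2 * ?a) = ez N (- ?a) * (ez N ?a - ez N (- ?a))"
      by (simp add: right_diff_distrib ez_add[symmetric])
    ultimately show "1 - ez N (- 2 * ?a) = ez N (- ?a) * (2 * \<i> * of_real (sin (2 * pi * (2 * real i + 1) / real N)))"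
      by simp
  qed
  also have "\<dots> = ez N (- ((int n)\<^sup>2)) * (\<Prod>i<n. 2 * \<i> * of_real (sin (2 * pi * (2 * real i + 1) / real N)))"
    unfolding prod.distrib ez_sum sum_negf sum_odd_squares ..
  finally show ?thesis using n by (simp add: mult.assoc[symmetric] ez_minus)
qed

text \<open>The sine is negative exactly when \<open>2 * (2 * i + 1) > N\<close>, which happens for
  the last \<open>N div 4\<close> indices.\<close>

lemma prod_sin_sign:
  assumes N: "odd N" "N > 0"
  shows "(- 1) ^ (N div 4) * (\<Prod>i<N div 2. sin (2 * pi * (2 * real i + 1) / real N)) > 0"
proof -
  let ?n = "N div 2" and ?k = "N div 4"
  let ?t = "\<lambda>i. 2 * pi * (2 * real i + 1) / real N"
  have "N mod 4 = 1 \<or> N mod 4 = 3" using N(1) by presburger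
  then obtain k where k: "N = 4 * k + 1 \<and> ?n = 2 * k \<and> ?k = k \<or> N = 4 * k + 3 \<and> ?n = 2 * k + 1 \<and> ?k = k"
  proof
    assume "N mod 4 = 1"
    then have "N = 4 * (N div 4) + 1 \<and> N div 2 = 2 * (N div 4) \<and> N div 4 = N div 4" by presburger
    then show ?thesis using that by blast
  next
    assume "N mod 4 = 3"
    then have "N = 4 * (N div 4) + 3 \<and> N div 2 = 2 * (N div 4) + 1 \<and> N div 4 = N div 4" by presburger
    then show ?thesis using that by blast
  qed
  have "(\<Prod>i<?n. (if i < ?n - ?k then 1 else - 1) * sin (?t i)) > 0"
  proof (rule prod_pos)
    fix i assume i: "i \<in> {..<?n}"
    show "(if i < ?n - ?k then 1 else - 1) * sin (?t i) > 0"
    proof (cases "i < ?n - ?k")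
      case True
      then have "2 * (2 * i + 1) < N" using k by auto
      then have "real (2 * (2 * i + 1)) < real N" by (simp only: of_nat_less_iff)
      then have "2 * (2 * real i + 1) < real N" by simp
      then have "pi * (2 * (2 * real i + 1)) < pi * real N" by (rule mult_strict_left_mono) simp
      then have "?t i < pi" using N(2) by (simp add: pos_divide_less_eq mult_ac)
      moreover have "?t i > 0" using N(2) by simp
      ultimately show ?thesis using True sin_gt_zero by simp
    next
      case False
      then have "2 * (2 * i + 1) > N" "2 * i + 1 < N" using k i by auto
      then have "real (2 * (2 * i + 1)) > real N" "real (2 * i + 1) < real N" by (simp_all only: of_nat_less_iff)
      then have "2 * (2 * real i + 1) > real N" "2 * real i + 1 < real N" by simp_all
      then have "pi * (2 * (2 * real i + 1)) > pi * real N" "(2 * pi) * (2 * real i + 1) < (2 * pi) * real N"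
        by (auto intro!: mult_strict_left_mono)
      then have "?t i > pi" "?t i < 2 * pi" using N(2) by (simp_all add: pos_divide_less_eq pos_less_divide_eq mult_ac)
      then show ?thesis using False sin_lt_zero by simp
    qed
  qed
  moreover have "(\<Prod>i<?n. (if i < ?n - ?k then 1 else - 1 :: real)) = (- 1) ^ ?k"
  proof -
    have "?k \<le> ?n" using k by auto
    have "(\<Prod>i<?n. (if i < ?n - ?k then 1 else - 1 :: real)) = (\<Prod>i\<in>{?n - ?k..<?n}. - 1)"
      by (rule prod.mono_neutral_cong_right) auto
    then show ?thesis using \<open>?k \<le> ?n\<close> by simp
  qed
  ultimately show ?thesis by (simp add: prod.distrib)
qed

lemma card_square_roots_mod_prime:
  assumes p: "prime p" "2 < p" and j: "j \<in> {0..<int p}"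
  shows "int (card {x \<in> {0..<int p}. x\<^sup>2 mod int p = j}) = 1 + Legendre j (int p)"
proof -
  have pint: "prime (int p)" using p by simp
  have odd: "odd p" using p prime_odd_nat by simp
  show ?thesis
  proof (cases "j = 0")
    case True
    have "{x \<in> {0..<int p}. x\<^sup>2 mod int p = j} = {0}"
    proof (intro equalityI subsetI)
      fix x assume "x \<in> {x \<in> {0..<int p}. x\<^sup>2 mod int p = j}"
      then have x: "0 \<le> x" "x < int p" "int p dvd x\<^sup>2" using True by (auto simp: mod_eq_0_iff_dvd)
      then have "int p dvd x" using pint prime_dvd_power by blast
      then show "x \<in> {0}" using x zdvd_not_zless[of x "int p"] by (cases "x = 0") auto
    qed (use True p in auto)
    then show ?thesis using True by (simp add: Legendre_def cong_def)
  next
    case False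
    have nd: "\<not> int p dvd j" using j False zdvd_not_zless[of j "int p"] by auto
    show ?thesis
    proof (cases "QuadRes (int p) j")
      case True
      then obtain y where y: "[y\<^sup>2 = j] (mod int p)" by (auto simp: QuadRes_def)
      define x where "x = y mod int p"
      have x: "x\<^sup>2 mod int p = j" using y j by (simp add: x_def cong_def power_mod)
      have x0: "0 < x" "x < int p"
      proof -
        have "x \<noteq> 0" using x False by auto
        moreover have "0 \<le> x" using p by (simp add: x_def)
        ultimately show "0 < x" by simp
        show "x < int p" using p by (simp add: x_def)
      qed
      have "{x' \<in> {0..<int p}. x'\<^sup>2 mod int p = j} = {x, int p - x}"
      proof (intro equalityI subsetI)
        fix z assume "z \<in> {x' \<in> {0..<int p}. x'\<^sup>2 mod int p = j}"
        then have z: "0 \<le> z" "z < int p" "z\<^sup>2 mod int p = x\<^sup>2 mod int p" using x by auto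
        then have "int p dvd z\<^sup>2 - x\<^sup>2" by (simp add: mod_eq_dvd_iff)
        then have "int p dvd (z - x) * (z + x)" by (simp add: power2_eq_square algebra_simps)
        then have "int p dvd z - x \<or> int p dvd z + x" using pint prime_dvd_mult_iff by blast
        then show "z \<in> {x, int p - x}"
        proof
          assume "int p dvd z - x"
          then have "z mod int p = x mod int p" by (simp add: mod_eq_dvd_iff)
          then show ?thesis using z x0 by simp
        next
          assume d: "int p dvd z + x"
          then obtain k where k: "z + x = int p * k" by (auto elim: dvdE)
          have "int p * k > 0" "int p * k < int p * 2" using k z x0 by linarith+
          then have "k = 1" using p by (simp add: zero_less_mult_iff)
          then show ?thesis using k by simp
        qed
      next
        fix z assume "z \<in> {x, int p - x}"
        moreover have "(int p - x)\<^sup>2 mod int p = x\<^sup>2 mod int p"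
        proof -
          have "(int p - x)\<^sup>2 = x\<^sup>2 + int p * (int p - 2 * x)" by (simp add: power2_eq_square algebra_simps)
          then show ?thesis by simp
        qed
        ultimately show "z \<in> {x' \<in> {0..<int p}. x'\<^sup>2 mod int p = j}" using x x0 by auto
      qed
      moreover have "x \<noteq> int p - x" using odd by presburger
      ultimately show ?thesis using nd True by (simp add: Legendre_def cong_0_iff)
    next
      case nq: False
      then have e: "{x \<in> {0..<int p}. x\<^sup>2 mod int p = j} = {}"
        using j by (auto simp: QuadRes_def cong_def)
      show ?thesis unfolding e using nd nq by (simp add: Legendre_def cong_0_iff)
    qed
  qed
qed

text \<open>A residue \<open>j\<close> has \<open>1 + Legendre j p\<close> square roots, so the
  exponential sum over squares is the Gauss sum of the Legendre symbol. For \<open>k\<close> prime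
  to \<open>p\<close> separability follows by reindexing with \<open>k * j\<close>.\<close>

lemma gauss_char_prime:
  assumes p: "prime p" "2 < p"
  shows "gauss_char p (\<lambda>x. Legendre x (int p)) (\<Sum>x\<in>{0..<int p}. ez p (x\<^sup>2))"
proof -
  have odd: "odd p" using p prime_odd_nat by simp
  have pos: "p > 0" using p by simp
  let ?L = "\<lambda>x. Legendre x (int p)"
  have count: "(\<Sum>x\<in>{0..<int p}. h (x\<^sup>2 mod int p)) = (\<Sum>j\<in>{0..<int p}. of_int (1 + ?L j) * h j)" for h :: "int \<Rightarrow> complex"
  proof -
    have "(\<Sum>x\<in>{0..<int p}. h (x\<^sup>2 mod int p)) =
       (\<Sum>j\<in>{0..<int p}. \<Sum>x\<in>{x \<in> {0..<int p}. x\<^sup>2 mod int p = j}. h (x\<^sup>2 mod int p))"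
      by (rule sum.group[symmetric]) (use pos in auto)
    also have "\<dots> = (\<Sum>j\<in>{0..<int p}. of_int (1 + ?L j) * h j)"
    proof (rule sum.cong[OF refl])
      fix j assume j: "j \<in> {0..<int p}"
      have "(\<Sum>x\<in>{x \<in> {0..<int p}. x\<^sup>2 mod int p = j}. h (x\<^sup>2 mod int p)) = of_nat (card {x \<in> {0..<int p}. x\<^sup>2 mod int p = j}) * h j"
        by simp
      also have "of_nat (card {x \<in> {0..<int p}. x\<^sup>2 mod int p = j}) = (of_int (1 + ?L j) :: complex)"
        unfolding card_square_roots_mod_prime[OF p j, symmetric] by simp
      finally show "(\<Sum>x\<in>{x \<in> {0..<int p}. x\<^sup>2 mod int p = j}. h (x\<^sup>2 mod int p)) = of_int (1 + ?L j) * h j" .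
    qed
    finally show ?thesis .
  qed
  have T: "(\<Sum>j\<in>{0..<int p}. of_int (?L j) * ez p (k * j)) =
      (\<Sum>x\<in>{0..<int p}. ez p (k * x\<^sup>2)) - (if int p dvd k then of_nat p else 0)" for k
  proof -
    have "(\<Sum>x\<in>{0..<int p}. ez p (k * (x\<^sup>2 mod int p))) = (\<Sum>j\<in>{0..<int p}. of_int (1 + ?L j) * ez p (k * j))"
      by (rule count)
    moreover have "ez p (k * (x\<^sup>2 mod int p)) = ez p (k * x\<^sup>2)" for x
      by (rule ez_cong[OF pos]) (simp add: cong_def mod_mult_right_eq)
    ultimately show ?thesis using sum_ez[OF pos, of k] by (simp add: ring_distribs sum.distrib)
  qed
  have mod: "?L (x mod int p) = ?L x" for x by (rule legendre_mod)
  have "(\<Sum>j\<in>{0..<int p}. of_int (?L j) * ez p (k * j)) = of_int (?L k) * (\<Sum>x\<in>{0..<int p}. ez p (x\<^sup>2))" for k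
  proof (cases "int p dvd k")
    case True
    then have "ez p (k * x) = 1" for x using ez_eq_1_iff[OF pos] by simp
    then have "(\<Sum>j\<in>{0..<int p}. of_int (?L j) * ez p (k * j)) = 0" using True unfolding T by simp
    moreover have "?L k = 0" using True by (simp add: Legendre_def cong_0_iff)
    ultimately show ?thesis by simp
  next
    case False
    have co: "coprime k (int p)" using False p by (metis coprime_commute prime_imp_coprime prime_nat_int_transfer)
    have Lk: "?L k * ?L k = 1"
      using legendre_square[OF p False] legendre_mult[OF p, of k k] by (simp add: power2_eq_square)
    have inj: "inj_on (\<lambda>j. k * j mod int p) {0..<int p}"
    proof (rule inj_onI)
      fix x y assume xy: "x \<in> {0..<int p}" "y \<in> {0..<int p}" "k * x mod int p = k * y mod int p"
      then have "int p dvd k * (x - y)" by (simp add: mod_eq_dvd_iff right_diff_distrib)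
      then have "int p dvd x - y" using co by (simp add: coprime_commute coprime_dvd_mult_right_iff)
      then have "x mod int p = y mod int p" by (simp add: mod_eq_dvd_iff)
      then show "x = y" using xy by simp
    qed
    have img: "(\<lambda>j. k * j mod int p) ` {0..<int p} = {0..<int p}"
      by (rule card_subset_eq) (use pos card_image[OF inj] in auto)
    have "(\<Sum>j\<in>{0..<int p}. of_int (?L j) * ez p (1 * j)) =
       (\<Sum>j\<in>{0..<int p}. of_int (?L (k * j mod int p)) * ez p (1 * (k * j mod int p)))"
      by (subst (1) img[symmetric]) (simp add: sum.reindex[OF inj])
    also have "\<dots> = (\<Sum>j\<in>{0..<int p}. of_int (?L k) * (of_int (?L j) * ez p (k * j)))"
      by (simp add: mod legendre_mult[OF p] ez_mod[OF pos] mult.assoc)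
    finally have "(\<Sum>x\<in>{0..<int p}. ez p (x\<^sup>2)) = of_int (?L k) * (\<Sum>j\<in>{0..<int p}. of_int (?L j) * ez p (k * j))"
      unfolding T[of 1] using p by (simp add: sum_distrib_left)
    then have "of_int (?L k) * (\<Sum>x\<in>{0..<int p}. ez p (x\<^sup>2)) = of_int (?L k * ?L k) * (\<Sum>j\<in>{0..<int p}. of_int (?L j) * ez p (k * j))"
      by simp
    then show ?thesis unfolding Lk by simp
  qed
  moreover have "?L 1 = 1" using p by (auto simp: Legendre_def QuadRes_def cong_def intro: exI[of _ 1])
  ultimately show ?thesis unfolding gauss_char_def using pos mod legendre_mult[OF p] by blast
qed

text \<open>Agreement at primes is enough, since \<open>\<psi>\<close> is completely multiplicative.
  The Gauss sum is prescribed with its sign, not just its square. Negative \<open>D\<close> are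
  included because a positive discriminant may have negative prime discriminants as factors.\<close>

definition good_disc :: "int \<Rightarrow> bool" where
  "good_disc D \<longleftrightarrow> (\<exists>\<psi>. gauss_char (nat \<bar>D\<bar>) \<psi> ((if D > 0 then 1 else \<i>) * of_real (sqrt \<bar>real_of_int D\<bar>)) \<and>
     (\<forall>q. prime q \<longrightarrow> \<psi> (int q) = kronecker_prime D q))"

text \<open>The product formula gives the direction with a positive factor \<open>R\<close>; the
  modulus follows from \<open>gauss_char_square\<close>.\<close>

lemma gauss_sum_prime_value:
  assumes p: "prime p" "2 < p"
  shows "(\<Sum>x\<in>{0..<int p}. ez p (x\<^sup>2)) = (if p mod 4 = 1 then 1 else \<i>) * of_real (sqrt (real p))"
proof -
  let ?S = "\<Sum>x\<in>{0..<int p}. ez p (x\<^sup>2)"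
  have odd: "odd p" "p > 0" using p prime_odd_nat by auto
  define R where "R = 2 ^ (p div 2) * ((- 1) ^ (p div 4) * (\<Prod>i<p div 2. sin (2 * pi * (2 * real i + 1) / real p)))"
  have R: "R > 0" unfolding R_def by (rule mult_pos_pos[OF _ prod_sin_sign[OF odd]]) simp
  have kk: "(- 1) ^ k * (- 1) ^ k = (1 :: complex)" for k by (cases "even k") auto
  have kk': "(- 1) ^ k * ((- 1) ^ k * x) = (x :: complex)" for k x by (simp add: kk flip: mult.assoc)
  have S: "?S = (\<i> ^ (p div 2) * (- 1) ^ (p div 4)) * of_real R"
  proof -
    have "?S = 2 ^ (p div 2) * \<i> ^ (p div 2) * of_real (\<Prod>i<p div 2. sin (2 * pi * (2 * real i + 1) / real p))"
      unfolding gauss_sum_product[OF odd] prod.distrib of_real_prod by (simp add: prod_constant)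
    also have "\<dots> = (\<i> ^ (p div 2) * (- 1) ^ (p div 4)) * of_real R"
    proof -
      show ?thesis unfolding R_def by (simp add: mult_ac kk')
    qed
    finally show ?thesis .
  qed
  have i: "\<i> ^ (p div 2) * (- 1) ^ (p div 4) = (if p mod 4 = 1 then 1 else \<i>)"
  proof -
    have "p mod 4 = 1 \<or> p mod 4 = 3" using odd by presburger
    then have "(p mod 4 = 1 \<and> p div 2 = 2 * (p div 4)) \<or> (p mod 4 = 3 \<and> p div 2 = Suc (2 * (p div 4)))" by presburger
    then consider "p mod 4 = 1" "p div 2 = 2 * (p div 4)" | "p mod 4 = 3" "p div 2 = Suc (2 * (p div 4))" by blast
    then show ?thesis
    proof cases
      case 1
      have "\<i> ^ (p div 2) = (- 1) ^ (p div 4)" unfolding 1(2) power_mult by simp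
      then show ?thesis using 1(1) by (simp add: kk)
    next
      case 2
      have "\<i> ^ (p div 2) = \<i> * (- 1) ^ (p div 4)" unfolding 2(2) power_Suc power_mult by simp
      then show ?thesis using 2(1) by (simp add: mult.assoc kk)
    qed
  qed
  have sq: "?S\<^sup>2 = of_int (Legendre (- 1) p) * of_nat p"
    by (rule gauss_char_square[OF gauss_char_prime[OF p]])
  have "(of_real R)\<^sup>2 = (of_nat p :: complex)"
    using sq unfolding S i legendre_minus_one[OF p] by (auto simp: power_mult_distrib split: if_splits)
  then have "of_real (R\<^sup>2) = (of_real (real p) :: complex)" by simp
  then have "R\<^sup>2 = real p" by (simp only: of_real_eq_iff)
  then have "R = sqrt (real p)" using R by (simp add: real_sqrt_unique)
  then show ?thesis using S i by simp
qed

text \<open>Quadratic reciprocity for the prime discriminant \<open>ps\<close>, the choice of sign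
  that is 1 modulo 4. It absorbs the sign of the usual law; for \<open>q = 2\<close> both sides
  depend on \<open>p\<close> modulo 8.\<close>

lemma kronecker_prime_star:
  assumes p: "prime p" "2 < p" and q: "prime q"
  defines "ps \<equiv> (if p mod 4 = 1 then int p else - int p)"
  shows "Legendre (int q) (int p) = kronecker_prime ps q"
proof (cases "q = 2")
  case True
  have "odd p" using p prime_odd_nat by simp
  then have "p mod 2 = 1" by presburger
  have "p mod 4 = 1 \<or> p mod 4 = 3" using \<open>p mod 2 = 1\<close> by presburger
  moreover have "odd ps" using \<open>p mod 2 = 1\<close> by (auto simp: ps_def odd_iff_mod_2_eq_one[symmetric])
  moreover have "ps mod 8 = 1 \<or> ps mod 8 = 7 \<longleftrightarrow> p mod 8 = 1 \<or> p mod 8 = 7"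
  proof -
    have "(- int p) mod 8 = 1 \<or> (- int p) mod 8 = 7 \<longleftrightarrow> int p mod 8 = 1 \<or> int p mod 8 = 7" by presburger
    moreover have "int p mod 8 = int (p mod 8)" by (simp add: zmod_int)
    ultimately show ?thesis unfolding ps_def by (cases "p mod 4 = 1") auto
  qed
  ultimately show ?thesis using True legendre_two[OF p] by (simp add: kronecker_prime_def)
next
  case False
  then have q2: "2 < q" using q prime_ge_2_nat[of q] by simp
  show ?thesis
  proof (cases "p = q")
    case True
    then show ?thesis using False by (simp add: kronecker_prime_def ps_def Legendre_def cong_0_iff)
  next
    case ne: False
    have odd: "odd p" "odd q" using p q q2 prime_odd_nat by auto
    have QR: "Legendre p q * Legendre q p = (-1) ^ nat ((int p - 1) div 2 * ((int q - 1) div 2))"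
      using Quadratic_Reciprocity_int[of "int p" "int q"] p q q2 ne by simp
    have ndvd: "\<not> int q dvd int p" using p q ne primes_dvd_imp_eq[of q p] by auto
    have one: "Legendre p q * Legendre p q = 1"
      using legendre_square[OF q q2 ndvd] legendre_mult[OF q q2, of p p] by (simp add: power2_eq_square)
    have Lq: "Legendre q p = Legendre p q * (-1) ^ nat ((int p - 1) div 2 * ((int q - 1) div 2))"
      unfolding QR[symmetric] by (simp only: mult.assoc[symmetric] one mult_1_left)
    have "Legendre ps q = Legendre p q * (-1) ^ nat ((int p - 1) div 2 * ((int q - 1) div 2))"
    proof (cases "p mod 4 = 1")
      case True
      then have "p = 4 * (p div 4) + 1" by presburger
      then obtain k where k: "p = 4 * k + 1" by blast
      have "(int p - 1) div 2 = 2 * int k" using k by simp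
      then have "even (nat ((int p - 1) div 2 * ((int q - 1) div 2)))"
        by (simp add: nat_mult_distrib)
      then show ?thesis using True by (simp add: ps_def)
    next
      case False
      then have "p mod 4 = 3" using odd by presburger
      then have "p = 4 * (p div 4) + 3" by presburger
      then obtain k where k: "p = 4 * k + 3" by blast
      obtain l where l: "q = 2 * l + 1" using odd by (elim oddE)
      have "(int p - 1) div 2 * ((int q - 1) div 2) = (2 * int k + 1) * int l" using k l by simp
      then have "nat ((int p - 1) div 2 * ((int q - 1) div 2)) = (2 * k + 1) * l"
        by (simp add: nat_mult_distrib nat_add_distrib)
      then have e: "(-1 :: int) ^ nat ((int p - 1) div 2 * ((int q - 1) div 2)) = (-1) ^ l"
        by (simp add: power_mult power_add)
      have "Legendre ps q = Legendre (- 1) q * Legendre p q"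
        using legendre_mult[OF q q2, of "- 1" "int p"] False by (simp add: ps_def)
      also have "Legendre (- 1) q = (-1) ^ l"
      proof -
        have "q mod 4 = 1 \<longleftrightarrow> even l" using l by presburger
        then show ?thesis unfolding legendre_minus_one[OF q q2] by (simp add: minus_one_power_iff)
      qed
      finally show ?thesis using e by simp
    qed
    then show ?thesis using Lq False by (simp add: kronecker_prime_def)
  qed
qed


lemma prime_star_mod_4:
  fixes p :: nat
  assumes "odd p"
  shows "(if p mod 4 = 1 then int p else - int p) mod 4 = 1"
proof -
  have "p mod 4 = 1 \<or> p mod 4 = 3" using assms by presburger
  moreover have "int p mod 4 = int (p mod 4)" by (simp add: zmod_int)
  moreover have "(- int p) mod 4 = 1" if "int p mod 4 = 3" using that by presburger
  ultimately show ?thesis by auto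
qed

lemma kronecker_prime_mult:
  assumes q: "prime q" and "D1 mod 4 = 1" "D2 mod 4 = 0 \<or> D2 mod 4 = 1"
  shows "kronecker_prime (D1 * D2) q = kronecker_prime D1 q * kronecker_prime D2 q"
proof (cases "q = 2")
  case True
  show ?thesis
  proof (cases "even D2")
    case True
    then show ?thesis using \<open>q = 2\<close> by (simp add: kronecker_prime_def)
  next
    case False
    then have "D2 mod 8 = 1 \<or> D2 mod 8 = 5" "D1 mod 8 = 1 \<or> D1 mod 8 = 5" "odd D1" using assms by presburger+
    moreover have "(D1 * D2) mod 8 = ((D1 mod 8) * (D2 mod 8)) mod 8" by (simp add: mod_mult_eq)
    ultimately show ?thesis using True False by (auto simp: kronecker_prime_def)
  qed
next
  case False
  then have "2 < q" using q prime_ge_2_nat[of q] by simp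
  then show ?thesis using False legendre_mult[OF q] by (simp add: kronecker_prime_def)
qed

text \<open>Multiplying by a prime discriminant keeps the Gauss sum in normal form: the cross
  factors of \<open>gauss_char_mult\<close> make up for the product of two factors \<i>.\<close>

lemma good_disc_step:
  assumes p: "prime p" "2 < p" and D2: "good_disc D2" "D2 mod 4 = 0 \<or> D2 mod 4 = 1" "\<not> int p dvd D2"
  defines "ps \<equiv> (if p mod 4 = 1 then int p else - int p)"
  shows "good_disc (ps * D2)"
proof -
  have odd: "odd p" using p prime_odd_nat by simp
  then have p4: "p mod 4 = 1 \<or> p mod 4 = 3" by presburger
  have ps4: "ps mod 4 = 1" unfolding ps_def by (rule prime_star_mod_4[OF odd])
  have D0: "D2 \<noteq> 0" using D2(3) by auto
  obtain \<psi> where \<psi>: "gauss_char (nat \<bar>D2\<bar>) \<psi> ((if D2 > 0 then 1 else \<i>) * of_real (sqrt \<bar>real_of_int D2\<bar>))"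
    "\<And>q. prime q \<Longrightarrow> \<psi> (int q) = kronecker_prime D2 q"
    using D2(1) unfolding good_disc_def by blast
  let ?L = "\<lambda>x. Legendre x (int p)"
  have co: "coprime p (nat \<bar>D2\<bar>)"
  proof (rule prime_imp_coprime[OF p(1)])
    show "\<not> p dvd nat \<bar>D2\<bar>" using D2(3) by (simp add: int_dvd_int_iff[symmetric])
  qed
  have *: "gauss_char (p * nat \<bar>D2\<bar>) (\<lambda>x. ?L x * \<psi> x)
      (of_int (?L (int (nat \<bar>D2\<bar>))) * of_int (\<psi> (int p)) * ((if p mod 4 = 1 then 1 else \<i>) * of_real (sqrt (real p)))
        * ((if D2 > 0 then 1 else \<i>) * of_real (sqrt \<bar>real_of_int D2\<bar>)))"
    using gauss_char_mult[OF gauss_char_prime[OF p] \<psi>(1) co] unfolding gauss_sum_prime_value[OF p] .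
  have \<psi>p: "\<psi> (int p) = ?L D2" using \<psi>(2)[OF p(1)] p by (simp add: kronecker_prime_def)
  have LL: "?L D2 * ?L D2 = 1"
    using legendre_square[OF p D2(3)] legendre_mult[OF p, of D2 D2] by (simp add: power2_eq_square)
  \<comment> \<open>The sign is -1 precisely if \<open>D2 < 0\<close> and \<open>p\<close> is 3
    modulo 4, when both Gauss sums carry \<i> and the product of the discriminants is
    positive.\<close>
  have s: "?L (int (nat \<bar>D2\<bar>)) * ?L D2 = (if D2 > 0 \<or> p mod 4 = 1 then 1 else - 1)"
  proof (cases "D2 > 0")
    case True
    then show ?thesis using LL by simp
  next
    case False
    then have "?L (int (nat \<bar>D2\<bar>)) = ?L (- 1) * ?L D2" using legendre_mult[OF p, of "- 1" D2] by simp
    then show ?thesis using LL False legendre_minus_one[OF p] by (simp add: mult.assoc)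
  qed
  have c: "of_int (?L (int (nat \<bar>D2\<bar>))) * of_int (\<psi> (int p)) = (of_int (if D2 > 0 \<or> p mod 4 = 1 then 1 else - 1) :: complex)"
    unfolding \<psi>p s[symmetric] by simp
  have N: "nat \<bar>ps * D2\<bar> = p * nat \<bar>D2\<bar>" by (simp add: ps_def abs_mult nat_mult_distrib)
  have sg: "ps * D2 > 0 \<longleftrightarrow> (p mod 4 = 1 \<longleftrightarrow> D2 > 0)"
    using D0 p by (auto simp: ps_def zero_less_mult_iff mult_less_0_iff)
  have sq: "sqrt \<bar>real_of_int (ps * D2)\<bar> = sqrt (real p) * sqrt \<bar>real_of_int D2\<bar>"
    by (simp add: ps_def abs_mult real_sqrt_mult)
  have g: "of_int (?L (int (nat \<bar>D2\<bar>))) * of_int (\<psi> (int p)) * ((if p mod 4 = 1 then 1 else \<i>) * of_real (sqrt (real p)))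
        * ((if D2 > 0 then 1 else \<i>) * of_real (sqrt \<bar>real_of_int D2\<bar>)) =
      (if ps * D2 > 0 then 1 else \<i>) * of_real (sqrt \<bar>real_of_int (ps * D2)\<bar>)"
    unfolding c sq of_real_mult sg by simp
  have "?L (int q) * \<psi> (int q) = kronecker_prime (ps * D2) q" if "prime q" for q
    unfolding kronecker_prime_mult[OF that ps4 D2(2)] \<psi>(2)[OF that]
    using kronecker_prime_star[OF p that] unfolding ps_def by simp
  then show ?thesis unfolding good_disc_def N using * unfolding g by blast
qed

lemma legendre_1: "prime q \<Longrightarrow> 2 < q \<Longrightarrow> Legendre 1 (int q) = 1"
  by (auto simp: Legendre_def QuadRes_def cong_def intro: exI[of _ 1])

lemma legendre_4: "prime q \<Longrightarrow> 2 < q \<Longrightarrow> Legendre 4 (int q) = 1"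
proof -
  assume q: "prime q" "2 < q"
  have "\<not> int q dvd 2" using q zdvd_imp_le[of "int q" 2] by auto
  then show ?thesis using legendre_square[OF q, of 2] by simp
qed

lemma good_disc_1: "good_disc 1"
  unfolding good_disc_def
proof (intro exI[of _ "\<lambda>_. 1"] conjI allI impI)
  show "gauss_char (nat \<bar>1\<bar>) (\<lambda>_. 1) ((if (1::int) > 0 then 1 else \<i>) * of_real (sqrt \<bar>real_of_int 1\<bar>))"
  proof -
    have "{0..<1 :: int} = {0}" by auto
    then show ?thesis by (simp add: gauss_char_def)
  qed
  show "1 = kronecker_prime 1 q" if "prime q" for q
    using legendre_1[OF that] prime_ge_2_nat[OF that] by (simp add: kronecker_prime_def)
qed

text \<open>A function on residues modulo 8, given by its values at 3, 5, 7. The six equations of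
  \<open>psi8_mult\<close> are the group law of the units modulo 8; the values -1, 1, -1 give the
  character modulo 4.\<close>

definition psi8 :: "int \<Rightarrow> int \<Rightarrow> int \<Rightarrow> int \<Rightarrow> int" where
  "psi8 a b c x = (\<lambda>r. if r = 1 then 1 else if r = 3 then a else if r = 5 then b else if r = 7 then c else 0) (x mod 8)"

lemma psi8_mult:
  assumes "a * b = c" "a * c = b" "b * c = a" "a * a = 1" "b * b = 1" "c * c = 1"
  shows "psi8 a b c (x * y) = psi8 a b c x * psi8 a b c y"
proof -
  have "(x * y) mod 8 = ((x mod 8) * (y mod 8)) mod 8" by (simp add: mod_mult_eq)
  moreover have "x mod 8 = 0 \<or> x mod 8 = 1 \<or> x mod 8 = 2 \<or> x mod 8 = 3 \<or> x mod 8 = 4 \<or> x mod 8 = 5 \<or> x mod 8 = 6 \<or> x mod 8 = 7"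
    "y mod 8 = 0 \<or> y mod 8 = 1 \<or> y mod 8 = 2 \<or> y mod 8 = 3 \<or> y mod 8 = 4 \<or> y mod 8 = 5 \<or> y mod 8 = 6 \<or> y mod 8 = 7"
    by presburger+
  ultimately show ?thesis
    unfolding psi8_def using assms by (elim disjE) (simp_all add: mult.commute)
qed

lemma ez8_values: "ez 8 1 = (1 + \<i>) * of_real (sqrt 2 / 2)"
proof -
  have "2 * pi * real_of_int 1 / real 8 = pi / 4" by simp
  then show ?thesis unfolding ez_def by (simp add: complex_eq_iff cos_45 sin_45)
qed

lemma set_0_8: "{0..<int 8} = {0, 1, 2, 3, 4, 5, 6, 7}" and set_0_4: "{0..<int 4} = {0, 1, 2, 3}"
  by auto

lemma ez_pow: "j \<ge> 0 \<Longrightarrow> ez N (k * j) = ez N k ^ nat j"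
  by (simp add: ez_power mult.commute)

lemma gauss_char_8:
  assumes "a = 1 \<and> b = - 1 \<and> c = - 1 \<and> g = \<i> * of_real (sqrt 8) \<or> a = - 1 \<and> b = - 1 \<and> c = 1 \<and> g = of_real (sqrt 8)"
  shows "gauss_char 8 (psi8 a b c) g"
proof -
  let ?z = "ez 8 1"
  have s8: "sqrt 8 = 2 * sqrt 2" using real_sqrt_mult[of 4 2] by simp
  have ss: "of_real (sqrt 2) * of_real (sqrt 2) = (2 :: complex)"
    by (metis of_real_mult of_real_numeral real_sqrt_mult_self abs_numeral)
  have z2: "?z ^ 2 = \<i>"
    unfolding ez8_values power2_eq_square using ss by (simp add: algebra_simps)
  have z4: "?z ^ 4 = - 1" using z2 by (metis i_squared power2_eq_square power_mult mult_2 numeral_Bit0)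
  have z3: "?z ^ 3 = \<i> * ?z" using z2 by (simp add: power3_eq_cube power2_eq_square)
  have sum: "(\<Sum>j\<in>{0..<int 8}. of_int (psi8 a b c j) * ez 8 (k * j)) =
     ez 8 k + of_int a * ez 8 k ^ 3 + of_int b * ez 8 k ^ 5 + of_int c * ez 8 k ^ 7" for k
    unfolding set_0_8 by (simp add: psi8_def ez_pow)
  define a' where "a' = (of_int a :: complex)"
  have aa: "a' * a' = 1" using assms by (auto simp: a'_def)
  have bc: "of_int b = (- 1 :: complex)" "of_int c = - a'" using assms by (auto simp: a'_def)
  have K: "g = 2 * (?z + a' * (\<i> * ?z))"
  proof -
    have "?z - \<i> * ?z = of_real (sqrt 2)" "?z + \<i> * ?z = \<i> * of_real (sqrt 2)"
      unfolding ez8_values by (simp_all add: complex_eq_iff)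
    moreover have "(of_real (sqrt 8) :: complex) = 2 * of_real (sqrt 2)" unfolding s8 by simp
    moreover have "?z + a' * (\<i> * ?z) = (if a = 1 then \<i> * of_real (sqrt 2) else of_real (sqrt 2))"
      using assms calculation by (auto simp: a'_def)
    ultimately show ?thesis using assms by auto
  qed
  have main: "(\<Sum>j\<in>{0..<int 8}. of_int (psi8 a b c j) * ez 8 (k * j)) = of_int (psi8 a b c k) * g" for k
  proof -
    define r where "r = k mod 8"
    define v where "v = ez 8 k"
    have "ez 8 k = ez 8 (k mod int 8)" by (rule ez_mod[symmetric]) simp
    then have "ez 8 k = ez 8 (1 * r)" by (simp add: r_def)
    then have v: "v = ?z ^ nat r" using ez_pow[of r 8 1] by (simp add: r_def v_def)
    have r: "r = 0 \<or> r = 1 \<or> r = 2 \<or> r = 3 \<or> r = 4 \<or> r = 5 \<or> r = 6 \<or> r = 7"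
      unfolding r_def by presburger
    have "v ^ 4 = (?z ^ 4) ^ nat r" unfolding v by (simp only: power_mult[symmetric] mult.commute[of "nat r"])
    then have v4: "v ^ 4 = (- 1) ^ nat r" unfolding z4 .
    have "v ^ 5 = v * v ^ 4" "v ^ 7 = v ^ 3 * v ^ 4"
      using power_add[of v 1 4] power_add[of v 3 4] by simp_all
    \<comment> \<open>Since \<open>b = - 1\<close> and \<open>c = - a\<close>, the sum factors; the
      factor \<open>1 - v ^ 4\<close> kills all even \<open>k\<close>.\<close>
    then have S: "(\<Sum>j\<in>{0..<int 8}. of_int (psi8 a b c j) * ez 8 (k * j)) = (1 - v ^ 4) * (v + a' * v ^ 3)"
      unfolding sum bc v_def[symmetric] a'_def[symmetric] by (simp add: algebra_simps)
    have "\<i> ^ 3 = - \<i>" by (simp add: power3_eq_cube)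
    then have cube: "(\<i> * x) ^ 3 = - (\<i> * x ^ 3)" "(- x) ^ 3 = - (x ^ 3)" for x :: complex
      unfolding power_mult_distrib by simp_all
    have aa': "a' * (a' * x) = x" for x using aa by (metis mult.assoc mult_1)
    have ii: "\<i> * (\<i> * x) = - x" for x by (simp add: complex_eq_iff)
    have p: "?z ^ 5 = - ?z" "?z ^ 7 = - (\<i> * ?z)"
      using power_add[of ?z 4 1] power_add[of ?z 4 3] by (simp_all add: z4 z3)
    have 1: "v + a' * v ^ 3 = ?z + a' * (\<i> * ?z)" if "r = 1" using that by (simp add: v z3)
    have 3: "v + a' * v ^ 3 = a' * (?z + a' * (\<i> * ?z))" if "r = 3"
      using that by (simp add: v z3 cube distrib_left aa' ii)
    have 5: "v + a' * v ^ 3 = - (?z + a' * (\<i> * ?z))" if "r = 5" using that by (simp add: v p cube z3)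
    have 7: "v + a' * v ^ 3 = - a' * (?z + a' * (\<i> * ?z))" if "r = 7"
      using that by (simp add: v p cube z3 distrib_left aa' ii)
    have W: "1 - v ^ 4 = (if r = 1 \<or> r = 3 \<or> r = 5 \<or> r = 7 then 2 else 0)"
      using r unfolding v4 by (elim disjE) simp_all
    have "(1 - v ^ 4) * (v + a' * v ^ 3) =
        (if r = 1 then 1 else if r = 3 then a' else if r = 5 then - 1 else if r = 7 then - a' else 0) * g"
      unfolding W K using r by (elim disjE) (simp_all only: 1 3 5 7, simp_all)
    also have "(if r = 1 then 1 else if r = 3 then a' else if r = 5 then - 1 else if r = 7 then - a' else 0) = of_int (psi8 a b c k)"
      using bc unfolding psi8_def r_def[symmetric] a'_def by simp
    finally show ?thesis unfolding S .
  qed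
  have "a * b = c" "a * c = b" "b * c = a" "a * a = 1" "b * b = 1" "c * c = 1" using assms by auto
  from psi8_mult[OF this] have "\<forall>x y. psi8 a b c (x * y) = psi8 a b c x * psi8 a b c y" by blast
  moreover have "psi8 a b c (x mod int 8) = psi8 a b c x" for x by (simp add: psi8_def)
  moreover have "psi8 a b c 1 = 1" by (simp add: psi8_def)
  ultimately show ?thesis unfolding gauss_char_def using main by simp
qed

lemma psi8_mod_4: "psi8 (- 1) 1 (- 1) x = (if x mod 4 = 1 then 1 else if x mod 4 = 3 then - 1 else 0)"
proof -
  have "x mod 8 = 0 \<or> x mod 8 = 1 \<or> x mod 8 = 2 \<or> x mod 8 = 3 \<or> x mod 8 = 4 \<or> x mod 8 = 5 \<or> x mod 8 = 6 \<or> x mod 8 = 7"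
    by presburger
  moreover have "x mod 4 = (x mod 8) mod 4" by (simp add: mod_mod_cancel)
  ultimately show ?thesis unfolding psi8_def by (elim disjE) simp_all
qed

lemma gauss_char_4: "gauss_char 4 (psi8 (- 1) 1 (- 1)) (2 * \<i>)"
proof -
  have main: "(\<Sum>j\<in>{0..<int 4}. of_int (psi8 (- 1) 1 (- 1) j) * ez 4 (k * j)) = of_int (psi8 (- 1) 1 (- 1) k) * (2 * \<i>)" for k
  proof -
    have i: "ez 4 1 = \<i>"
    proof -
      have "2 * pi * real_of_int 1 / real 4 = pi / 2" by simp
      then show ?thesis unfolding ez_def by (simp add: complex_eq_iff)
    qed
    define r where "r = k mod 4"
    have "ez 4 k = ez 4 (k mod int 4)" by (rule ez_mod[symmetric]) simp
    then have "ez 4 k = ez 4 (1 * r)" by (simp add: r_def)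
    then have v: "ez 4 k = \<i> ^ nat r" using ez_pow[of r 4 1] i by (simp add: r_def)
    have r: "r = 0 \<or> r = 1 \<or> r = 2 \<or> r = 3" unfolding r_def by presburger
    have p: "psi8 (- 1) 1 (- 1) k = (if r = 1 then 1 else if r = 3 then - 1 else 0)"
      unfolding psi8_mod_4 r_def ..
    have "(\<Sum>j\<in>{0..<int 4}. of_int (psi8 (- 1) 1 (- 1) j) * ez 4 (k * j)) = ez 4 k - ez 4 k ^ 3"
      unfolding set_0_4 by (simp add: psi8_def ez_pow)
    then show ?thesis unfolding p v using r
      by (elim disjE) (simp_all add: power3_eq_cube power2_eq_square numeral_2_eq_2 numeral_3_eq_3)
  qed
  have "psi8 (- 1) 1 (- 1) (x mod int 4) = psi8 (- 1) 1 (- 1) x" for x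
    unfolding psi8_mod_4 by simp
  moreover have "psi8 (- 1) 1 (- 1) 1 = 1" by (simp add: psi8_def)
  moreover have "\<forall>x y. psi8 (- 1) 1 (- 1) (x * y) = psi8 (- 1) 1 (- 1) x * psi8 (- 1) 1 (- 1) y"
    by (intro allI psi8_mult) simp_all
  ultimately show ?thesis unfolding gauss_char_def using main by simp
qed

lemma psi8_prime_cases: "prime q \<Longrightarrow> q \<noteq> 2 \<Longrightarrow> int q mod 8 = int (q mod 8) \<and> (q mod 8 = 1 \<or> q mod 8 = 3 \<or> q mod 8 = 5 \<or> q mod 8 = 7) \<and> 2 < q"
proof -
  assume q: "prime q" "q \<noteq> 2"
  then have "2 < q" using prime_ge_2_nat[of q] by simp
  then have "odd q" using q prime_odd_nat by simp
  then show ?thesis using \<open>2 < q\<close> by (auto simp: zmod_int) presburger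
qed

lemma good_disc_even: "good_disc (- 4)" "good_disc 8" "good_disc (- 8)"
proof -
  show "good_disc (- 4)" unfolding good_disc_def
  proof (intro exI[of _ "psi8 (- 1) 1 (- 1)"] conjI allI impI)
    show "gauss_char (nat \<bar>- 4\<bar>) (psi8 (- 1) 1 (- 1)) ((if (- 4 :: int) > 0 then 1 else \<i>) * of_real (sqrt \<bar>real_of_int (- 4)\<bar>))"
      using gauss_char_4 by (simp add: mult.commute)
    fix q :: nat assume q: "prime q"
    show "psi8 (- 1) 1 (- 1) (int q) = kronecker_prime (- 4) q"
    proof (cases "q = 2")
      case False
      note c = psi8_prime_cases[OF q False]
      have "Legendre (- 4) q = Legendre (- 1) q"
        using legendre_mult[OF q, of "- 1" 4] legendre_4[OF q] c by simp
      moreover have "q mod 4 = (q mod 8) mod 4" by (simp add: mod_mod_cancel)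
      ultimately show ?thesis using c False legendre_minus_one[OF q] by (auto simp: psi8_def kronecker_prime_def)
    qed (simp add: psi8_def kronecker_prime_def)
  qed
  show "good_disc 8" unfolding good_disc_def
  proof (intro exI[of _ "psi8 (- 1) (- 1) 1"] conjI allI impI)
    show "gauss_char (nat \<bar>8\<bar>) (psi8 (- 1) (- 1) 1) ((if (8 :: int) > 0 then 1 else \<i>) * of_real (sqrt \<bar>real_of_int 8\<bar>))"
      using gauss_char_8 by simp
    fix q :: nat assume q: "prime q"
    show "psi8 (- 1) (- 1) 1 (int q) = kronecker_prime 8 q"
    proof (cases "q = 2")
      case False
      note c = psi8_prime_cases[OF q False]
      have "Legendre 8 q = Legendre 2 q"
        using legendre_mult[OF q, of 2 4] legendre_4[OF q] c by simp
      then show ?thesis using c False legendre_two[OF q] by (auto simp: psi8_def kronecker_prime_def)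
    qed (simp add: psi8_def kronecker_prime_def)
  qed
  show "good_disc (- 8)" unfolding good_disc_def
  proof (intro exI[of _ "psi8 1 (- 1) (- 1)"] conjI allI impI)
    show "gauss_char (nat \<bar>- 8\<bar>) (psi8 1 (- 1) (- 1)) ((if (- 8 :: int) > 0 then 1 else \<i>) * of_real (sqrt \<bar>real_of_int (- 8)\<bar>))"
      using gauss_char_8 by simp
    fix q :: nat assume q: "prime q"
    show "psi8 1 (- 1) (- 1) (int q) = kronecker_prime (- 8) q"
    proof (cases "q = 2")
      case False
      note c = psi8_prime_cases[OF q False]
      have "Legendre (- 8) q = Legendre (- 1) q * Legendre 2 q"
        using legendre_mult[OF q, of "- 2" 4] legendre_mult[OF q, of "- 1" 2] legendre_4[OF q] c by simp
      moreover have "q mod 4 = (q mod 8) mod 4" by (simp add: mod_mod_cancel)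
      ultimately show ?thesis using c False legendre_two[OF q] legendre_minus_one[OF q] by (auto simp: psi8_def kronecker_prime_def)
    qed (simp add: psi8_def kronecker_prime_def)
  qed
qed

lemma odd_int_no_odd_prime:
  fixes m :: int
  assumes "odd m" "\<And>p :: nat. prime p \<Longrightarrow> 2 < p \<Longrightarrow> \<not> int p dvd m"
  shows "m = 1 \<or> m = - 1"
proof (rule ccontr)
  assume "\<not> ?thesis"
  then have "nat \<bar>m\<bar> \<noteq> 1" by auto
  then obtain p where p: "prime p" "p dvd nat \<bar>m\<bar>" using prime_factor_nat by blast
  then have pm: "int p dvd m" by (simp add: int_dvd_int_iff[symmetric])
  have "p \<noteq> 2" using pm assms(1) by auto
  then have "2 < p" using p(1) prime_ge_2_nat[of p] by simp
  then show False using assms(2) p(1) pm by blast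
qed

lemma fundamental_cases: "fundamental_discriminant D \<Longrightarrow> D mod 4 = 0 \<or> D mod 4 = 1" "fundamental_discriminant D \<Longrightarrow> D \<noteq> 0"
  by (auto simp: fundamental_discriminant_def)

text \<open>Odd primes are stripped off one at a time with the sign that makes them 1 modulo 4. What
  has no odd prime factor is one of 1, -4, 8, -8.\<close>

lemma good_disc_fundamental:
  assumes "fundamental_discriminant D"
  shows "good_disc D"
  using assms
proof (induction "nat \<bar>D\<bar>" arbitrary: D rule: less_induct)
  case less
  show ?case
  proof (cases "\<exists>p :: nat. prime p \<and> 2 < p \<and> int p dvd D")
    case True
    then obtain p :: nat where p: "prime p" "2 < p" "int p dvd D" by blast
    define ps where "ps = (if p mod 4 = 1 then int p else - int p)"
    have odd: "odd p" using p prime_odd_nat by simp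
    then have ps4: "ps mod 4 = 1" unfolding ps_def by (rule prime_star_mod_4)
    have "ps dvd D" using p(3) by (simp add: ps_def)
    then obtain E where E: "D = ps * E" by (auto elim: dvdE)
    have pp: "\<not> int p dvd e" if "squarefree (ps * e)" for e
    proof
      assume "int p dvd e"
      then have "int p * int p dvd ps * e" by (intro mult_dvd_mono) (auto simp: ps_def)
      then have "is_unit (int p)" using that unfolding squarefree_def power2_eq_square by blast
      then show False using p by simp
    qed
    have main: "fundamental_discriminant E \<and> \<not> int p dvd E"
    proof (cases "D mod 4 = 1 \<and> squarefree D")
      case True
      have "E mod 4 = 1"
      proof -
        have "(ps * E) mod 4 = ((ps mod 4) * (E mod 4)) mod 4" by (simp add: mod_mult_eq)
        then show ?thesis using True ps4 E by simp
      qed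
      moreover have "squarefree E" using True unfolding E by (metis squarefree_mono dvd_triv_right)
      ultimately show ?thesis using True pp[of E] E by (auto simp: fundamental_discriminant_def)
    next
      case False
      then obtain m where m: "D = 4 * m" "m mod 4 = 2 \<or> m mod 4 = 3" "squarefree m"
        using less.prems by (auto simp: fundamental_discriminant_def)
      have co: "coprime ps 4"
      proof -
        have "odd ps" using odd by (simp add: ps_def)
        then have "coprime ps 2" by simp
        then have "coprime ps (2 * 2)" by (simp only: coprime_mult_right_iff)
        then show ?thesis by simp
      qed
      have "ps dvd m * 4" using \<open>ps dvd D\<close> m by (simp add: mult.commute)
      then have "ps dvd m" using co by (simp add: coprime_dvd_mult_left_iff)
      then obtain e where e: "m = ps * e" by (auto elim: dvdE)
      have "ps \<noteq> 0" using p by (simp add: ps_def)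
      then have E4: "E = 4 * e" using E m e by (metis mult.left_commute mult_left_cancel)
      have "(ps * e) mod 4 = ((ps mod 4) * (e mod 4)) mod 4" by (simp add: mod_mult_eq)
      then have "e mod 4 = m mod 4" using ps4 e by simp
      moreover have "squarefree e" using m(3) unfolding e by (metis squarefree_mono dvd_triv_right)
      ultimately have "fundamental_discriminant E" using m E4 by (auto simp: fundamental_discriminant_def)
      moreover have "\<not> int p dvd E"
      proof
        assume "int p dvd E"
        then have "int p dvd 4 * e" using E4 by simp
        moreover have "coprime (int p) 4" using co by (simp add: ps_def split: if_splits)
        ultimately have "int p dvd e" by (simp add: coprime_dvd_mult_right_iff)
        then show False using pp[of e] m e by simp
      qed
      ultimately show ?thesis by blast
    qed
    have "nat \<bar>E\<bar> < nat \<bar>D\<bar>"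
    proof -
      have "\<bar>D\<bar> = int p * \<bar>E\<bar>" by (simp add: E abs_mult ps_def)
      moreover have "\<bar>E\<bar> > 0" using main by auto
      moreover have "1 * \<bar>E\<bar> < int p * \<bar>E\<bar>" using p calculation by (intro mult_strict_right_mono) auto
      ultimately show ?thesis by simp
    qed
    then have "good_disc E" using less.hyps main by blast
    then show ?thesis unfolding E ps_def using good_disc_step[OF p(1,2)] fundamental_cases(1) main by blast
  next
    case no: False
    show ?thesis
    proof (cases "D mod 4 = 1 \<and> squarefree D")
      case True
      then have "D mod 4 = 1" by simp
      then have "odd D" by presburger
      then have "D = 1 \<or> D = - 1" using no by (intro odd_int_no_odd_prime) auto
      then have "D = 1" using True by auto
      then show ?thesis using good_disc_1 by simp
    next
      case False
      then obtain m where m: "D = 4 * m" "m mod 4 = 2 \<or> m mod 4 = 3"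
        using less.prems by (auto simp: fundamental_discriminant_def)
      show ?thesis
      proof (cases "m mod 4 = 3")
        case True
        then have "odd m" by presburger
        then have "m = 1 \<or> m = - 1" using no m by (intro odd_int_no_odd_prime) auto
        then have "m = - 1" using True by auto
        then show ?thesis using good_disc_even m by simp
      next
        case False
        then have "m mod 4 = 2" using m by simp
        then have "even m" by presburger
        then obtain k where k: "m = 2 * k" by blast
        then have "odd k" using \<open>m mod 4 = 2\<close> by presburger
        then have "k = 1 \<or> k = - 1" using no m k by (intro odd_int_no_odd_prime) auto
        then show ?thesis using good_disc_even m k by auto
      qed
    qed
  qed
qed

theorem kronecker_character:
  assumes "fundamental_discriminant D" "D > 0"
  obtains \<psi> where "gauss_char (nat D) \<psi> (of_real (sqrt (real_of_int D)))"
    "\<And>n. n > 0 \<Longrightarrow> kronecker_symbol D n = \<psi> (int n)"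
proof -
  obtain \<psi> where \<psi>: "gauss_char (nat \<bar>D\<bar>) \<psi> ((if D > 0 then 1 else \<i>) * of_real (sqrt \<bar>real_of_int D\<bar>))"
    "\<And>q. prime q \<Longrightarrow> \<psi> (int q) = kronecker_prime D q"
    using good_disc_fundamental[OF assms(1)] unfolding good_disc_def by blast
  have G: "gauss_char (nat D) \<psi> (of_real (sqrt (real_of_int D)))" using \<psi>(1) assms(2) by simp
  have \<psi>m: "\<psi> (x * y) = \<psi> x * \<psi> y" "\<psi> 1 = 1" for x y using G by (auto simp: gauss_char_def)
  have pm: "\<psi> (int (prod_mset M)) = prod_mset (image_mset (\<lambda>p. \<psi> (int p)) M)" for M :: "nat multiset"
    by (induction M) (auto simp: \<psi>m)
  have "kronecker_symbol D n = \<psi> (int n)" if "n > 0" for n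
  proof -
    have "image_mset (kronecker_prime D) (prime_factorization n) = image_mset (\<lambda>p. \<psi> (int p)) (prime_factorization n)"
      by (rule image_mset_cong) (use \<psi>(2) in \<open>auto simp: in_prime_factors_iff\<close>)
    then have "kronecker_symbol D n = \<psi> (int (prod_mset (prime_factorization n)))"
      using that unfolding pm by (simp add: kronecker_symbol_def)
    then show ?thesis using that by (simp add: prod_mset_prime_factorization_nat)
  qed
  with G show thesis by (rule that)
qed

section \<open>The value of the L-function at -1\<close>

text \<open>Differentiating the reflection formula of \<open>rGamma\<close> gives the cotangent as a
  difference of digamma values on the open interval; differentiating once more gives the
  claim.\<close>

lemma Polygamma_1_reflection:
  fixes x :: real
  assumes "0 < x" "x < 1"
  shows "Polygamma 1 x + Polygamma 1 (1 - x) = pi\<^sup>2 / (sin (pi * x))\<^sup>2"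
proof -
  have nonpos: "y \<notin> \<int>\<^sub>\<le>\<^sub>0" if "y > 0" for y :: real using that by (auto dest: nonpos_Ints_nonpos)
  have sin_pos: "sin (pi * y) > 0" if "0 < y" "y < 1" for y
    using that by (intro sin_gt_zero) auto
  have reflect: "rGamma y * rGamma (1 - y) = sin (pi * y) / pi" for y :: real
  proof -
    have "complex_of_real (rGamma y * rGamma (1 - y)) = rGamma (of_real y) * rGamma (1 - of_real y)"
      unfolding of_real_mult rGamma_complex_of_real[symmetric] of_real_diff of_real_1 ..
    also have "\<dots> = sin (of_real pi * of_real y) / of_real pi"
      by (rule rGamma_reflection_complex)
    also have "\<dots> = complex_of_real (sin (pi * y) / pi)"
      unfolding of_real_divide sin_of_real[symmetric] of_real_mult ..
    finally have "complex_of_real (rGamma y * rGamma (1 - y)) = complex_of_real (sin (pi * y) / pi)" .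
    then show ?thesis by (simp only: of_real_eq_iff)
  qed
  have D: "Digamma (1 - y) - Digamma y = pi * cos (pi * y) / sin (pi * y)" if y: "0 < y" "y < 1" for y :: real
  proof -
    have "((\<lambda>y. rGamma y * rGamma (1 - y)) has_real_derivative
        (- rGamma y * Digamma y) * rGamma (1 - y) + rGamma y * (rGamma (1 - y) * Digamma (1 - y))) (at y)"
      using y nonpos by (auto intro!: derivative_eq_intros simp: algebra_simps)
    moreover have "((\<lambda>y. rGamma y * rGamma (1 - y)) has_real_derivative cos (pi * y)) (at y)"
      unfolding reflect by (auto intro!: derivative_eq_intros)
    ultimately have "(- rGamma y * Digamma y) * rGamma (1 - y) + rGamma y * (rGamma (1 - y) * Digamma (1 - y)) = cos (pi * y)"
      by (rule DERIV_unique)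
    then have "(rGamma y * rGamma (1 - y)) * (Digamma (1 - y) - Digamma y) = cos (pi * y)"
      by (simp add: algebra_simps)
    then show ?thesis unfolding reflect using sin_pos[OF y] by (simp add: field_simps)
  qed
  have d1: "((\<lambda>y. Digamma (1 - y) - Digamma y) has_real_derivative (- Polygamma 1 (1 - x) - Polygamma 1 x)) (at x)"
    using assms nonpos by (auto intro!: derivative_eq_intros)
  have d2: "((\<lambda>y. pi * cos (pi * y) / sin (pi * y)) has_real_derivative
      (- pi * (pi * sin (pi * x)) * sin (pi * x) - pi * cos (pi * x) * (pi * cos (pi * x))) / (sin (pi * x) * sin (pi * x))) (at x)"
    using sin_pos[OF assms] by (auto intro!: derivative_eq_intros)
  have "\<forall>\<^sub>F y in nhds x. y \<in> {0<..<1}"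
    using assms by (intro eventually_nhds_in_open) auto
  then have "\<forall>\<^sub>F y in nhds x. Digamma (1 - y) - Digamma y = pi * cos (pi * y) / sin (pi * y)"
    by eventually_elim (use D in auto)
  then have "((\<lambda>y. Digamma (1 - y) - Digamma y) has_real_derivative
      (- pi * (pi * sin (pi * x)) * sin (pi * x) - pi * cos (pi * x) * (pi * cos (pi * x))) / (sin (pi * x) * sin (pi * x))) (at x)"
    using d2 by (rule iffD2[OF DERIV_cong_ev[OF refl _ refl]])
  from DERIV_unique[OF d1 this]
  have "Polygamma 1 x + Polygamma 1 (1 - x) =
      - ((- pi * (pi * sin (pi * x)) * sin (pi * x) - pi * cos (pi * x) * (pi * cos (pi * x))) / (sin (pi * x) * sin (pi * x)))"
    by linarith
  also have "\<dots> = pi\<^sup>2 * ((sin (pi * x))\<^sup>2 + (cos (pi * x))\<^sup>2) / (sin (pi * x))\<^sup>2"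
  proof -
    have "- pi * (pi * s) * s - pi * c * (pi * c) = - (pi\<^sup>2 * (s\<^sup>2 + c\<^sup>2))" for s c
      by (simp add: algebra_simps power2_eq_square)
    from this[of "sin (pi * x)" "cos (pi * x)"] show ?thesis
      by (simp only: minus_divide_left minus_minus power2_eq_square)
  qed
  finally show ?thesis by simp
qed

lemma Polygamma_1_sums:
  fixes x :: real
  assumes "x > 0"
  shows "(\<lambda>k. 1 / (real k + x)\<^sup>2) sums Polygamma 1 x"
proof -
  have nz: "x \<notin> \<int>\<^sub>\<le>\<^sub>0" using assms by (auto dest: nonpos_Ints_nonpos)
  have "(\<lambda>k. inverse ((x + of_nat k) ^ Suc 1)) sums Polygamma 1 x"
    using Polygamma_LIMSEQ[of x 1] nz assms by simp
  then show ?thesis by (simp add: power2_eq_square inverse_eq_divide add.commute)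
qed

lemma sum_root_of_unity:
  fixes z :: complex
  assumes "z \<noteq> 1" "z ^ N = 1" "N > 0"
  shows "(\<Sum>k<N. z ^ k) = 0" "(\<Sum>k<N. of_nat k * z ^ k) = of_nat N / (z - 1)"
    "(\<Sum>k<N. (of_nat k)\<^sup>2 * z ^ k) = (of_nat N)\<^sup>2 / (z - 1) - 2 * of_nat N * z / (z - 1)\<^sup>2"
proof -
  have z1: "z - 1 \<noteq> 0" using assms by simp
  have A: "(\<Sum>k<M. z ^ k) * (z - 1) = z ^ M - 1" for M
    by (induction M) (simp_all add: algebra_simps)
  have B: "(\<Sum>k<M. of_nat k * z ^ k) * (z - 1) = of_nat M * z ^ M - z * (\<Sum>k<M. z ^ k)" for M
    by (induction M) (simp_all add: algebra_simps)
  have C: "(\<Sum>k<M. (of_nat k)\<^sup>2 * z ^ k) * (z - 1) = (of_nat M)\<^sup>2 * z ^ M - z * (2 * (\<Sum>k<M. of_nat k * z ^ k) + (\<Sum>k<M. z ^ k))" for M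
    by (induction M) (simp_all add: algebra_simps power2_eq_square)
  show 1: "(\<Sum>k<N. z ^ k) = 0" using A[of N] assms by simp
  show 2: "(\<Sum>k<N. of_nat k * z ^ k) = of_nat N / (z - 1)"
    using B[of N] 1 assms z1 by (simp add: field_simps)
  have "(\<Sum>k<N. (of_nat k)\<^sup>2 * z ^ k) * (z - 1) = (of_nat N)\<^sup>2 - 2 * z * (of_nat N / (z - 1))"
    using C[of N] 1 2 assms by simp
  then have "(\<Sum>k<N. (of_nat k)\<^sup>2 * z ^ k) = ((of_nat N)\<^sup>2 - 2 * z * (of_nat N / (z - 1))) / (z - 1)"
    using z1 by (simp add: eq_divide_eq)
  also have "\<dots> = (of_nat N)\<^sup>2 / (z - 1) - 2 * of_nat N * z / (z - 1)\<^sup>2"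
    by (simp add: diff_divide_distrib power2_eq_square mult_ac)
  finally show "(\<Sum>k<N. (of_nat k)\<^sup>2 * z ^ k) = (of_nat N)\<^sup>2 / (z - 1) - 2 * of_nat N * z / (z - 1)\<^sup>2" .
qed

definition bern2 :: "real \<Rightarrow> real" where
  "bern2 x = x\<^sup>2 - x + 1 / 6"

text \<open>The transform of the second Bernoulli polynomial is again the 1/sin^2 of the trigamma
  reflection, which links the values at -1 and at 2.\<close>

lemma bern2_fourier:
  assumes N: "N > 0" and j: "0 < j" "j < int N"
  shows "(\<Sum>k\<in>{0..<int N}. of_real (bern2 (real_of_int k / real N)) * ez N (j * k)) =
     of_real (1 / (2 * real N * (sin (pi * real_of_int j / real N))\<^sup>2))"
proof -
  define z where "z = ez N j"
  have zN: "z ^ N = 1" using N by (simp add: z_def ez_power ez_mult_self)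
  have "\<not> int N dvd j" using j zdvd_not_zless by blast
  then have z1: "z \<noteq> 1" using ez_eq_1_iff[OF N] by (simp add: z_def)
  note S = sum_root_of_unity[OF z1 zN N]
  have N0: "(of_nat N :: complex) \<noteq> 0" using N by simp
  have "(\<Sum>k\<in>{0..<int N}. of_real (bern2 (real_of_int k / real N)) * ez N (j * k)) =
      (\<Sum>k<N. of_real (bern2 (real k / real N)) * z ^ k)"
    by (rule sum.reindex_bij_witness[of _ int nat]) (auto simp: z_def ez_power mult.commute)
  also have "\<dots> = (\<Sum>k<N. (1 / (of_nat N)\<^sup>2) * ((of_nat k)\<^sup>2 * z ^ k) - (1 / of_nat N) * (of_nat k * z ^ k) + (1 / 6) * z ^ k)"
    by (rule sum.cong) (simp_all add: bern2_def power_divide algebra_simps)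
  also have "\<dots> = (1 / (of_nat N)\<^sup>2) * (\<Sum>k<N. (of_nat k)\<^sup>2 * z ^ k) - (1 / of_nat N) * (\<Sum>k<N. of_nat k * z ^ k) + (1 / 6) * (\<Sum>k<N. z ^ k)"
    by (simp only: sum.distrib sum_subtractf sum_distrib_left)
  also have "\<dots> = - 2 * (z / (z - 1)\<^sup>2) / of_nat N"
  proof -
    have "1 / n\<^sup>2 * (n\<^sup>2 / w - 2 * n * z / w\<^sup>2) - 1 / n * (n / w) + 1 / 6 * 0 = - 2 * (z / w\<^sup>2) / n"
      if "n \<noteq> 0" for n w :: complex
    proof -
      have "1 / n\<^sup>2 * (n\<^sup>2 / w) = 1 / w" "1 / n * (n / w) = 1 / w" using that by simp_all
      moreover have "1 / n\<^sup>2 * (2 * n * z / w\<^sup>2) = 2 * (z / w\<^sup>2) / n"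
        using that by (simp add: power2_eq_square)
      ultimately show ?thesis by (simp only: right_diff_distrib) simp
    qed
    from this[OF N0, of "z - 1"] show ?thesis unfolding S .
  qed
  also have "z / (z - 1)\<^sup>2 = of_real (- 1 / (4 * (sin (pi * real_of_int j / real N))\<^sup>2))"
  proof -
    let ?t = "pi * real_of_int j / real N"
    have zt: "z = cis (2 * ?t)" unfolding z_def ez_def by (simp add: mult.assoc)
    have "z - 1 = cis ?t * (2 * \<i> * of_real (sin ?t))"
    proof -
      have "z = cis ?t * cis ?t" unfolding zt by (simp add: cis_mult)
      moreover have "1 = cis ?t * cis (- ?t)" by (simp add: cis_mult)
      ultimately have "z - 1 = cis ?t * (cis ?t - cis (- ?t))" by (simp add: right_diff_distrib)
      also have "cis ?t - cis (- ?t) = 2 * \<i> * of_real (sin ?t)" by (simp add: complex_eq_iff)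
      finally show ?thesis .
    qed
    then have "(z - 1)\<^sup>2 = z * (- 4 * (of_real (sin ?t))\<^sup>2)"
      unfolding zt by (simp add: power_mult_distrib cis_mult power2_eq_square)
    then have "z / (z - 1)\<^sup>2 = z / (z * (- 4 * (of_real (sin ?t))\<^sup>2))" by simp
    also have "\<dots> = 1 / (- 4 * (of_real (sin ?t))\<^sup>2)" using zt by simp
    finally show ?thesis by simp
  qed
  finally show ?thesis by simp
qed

text \<open>By residues the series is a combination of trigamma values, and evenness of
  \<open>\<psi>\<close> symmetrizes these to 1/sin^2. On the left, separability replaces
  \<open>\<psi> k * sqrt N\<close> by a transform, and \<open>bern2_fourier\<close> produces the
  same sum.\<close>

lemma gauss_char_bern2:
  assumes G: "gauss_char N \<psi> (of_real (sqrt (real N)))"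
  shows "(\<Sum>j=1..N. real_of_int (\<psi> (int j)) * bern2 (real j / real N)) =
     sqrt (real N) / pi\<^sup>2 * (\<Sum>n. real_of_int (\<psi> (int (Suc n))) / (real (Suc n))\<^sup>2)"
proof -
  note d = G[unfolded gauss_char_def]
  have N: "N > 0" using d by blast
  have gs: "(\<Sum>j\<in>{0..<int N}. of_int (\<psi> j) * ez N (k * j)) = of_int (\<psi> k) * of_real (sqrt (real N))" for k
    using d by blast
  have per: "\<psi> (x mod int N) = \<psi> x" for x using d by blast
  have mult: "\<psi> (x * y) = \<psi> x * \<psi> y" for x y using d by blast
  have L2: "(\<lambda>n. real_of_int (\<psi> (int (Suc n))) / (real (Suc n))\<^sup>2) sums
     (\<Sum>j=1..N. real_of_int (\<psi> (int j)) / (real N)\<^sup>2 * Polygamma 1 (real j / real N))"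
    (is "?f sums ?S")
  proof -
    obtain M where M: "M > 0" "\<And>n. norm (complex_of_int (\<psi> (int n))) \<le> M"
    proof (rule periodic_bounded[of N "\<lambda>n. of_int (\<psi> (int n))", OF N])
      show "complex_of_int (\<psi> (int (n + N))) = of_int (\<psi> (int n))" for n
        using per[of "int (n + N)"] per[of "int n"] by simp
    qed blast
    have "summable (\<lambda>n. M * (1 / (real n + 1)\<^sup>2))"
      using Polygamma_1_sums[of 1] by (intro summable_mult) (simp add: sums_iff)
    then have sf: "summable ?f"
      by (rule summable_comparison_test'[where N = 0])
         (use M(2) in \<open>auto simp: abs_mult divide_right_mono add.commute simp del: of_nat_Suc simp flip: of_nat_Suc\<close>)
    have g1: "(\<lambda>q. sum ?f {q * N..<q * N + N}) sums suminf ?f"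
      by (rule sums_group[OF summable_sums[OF sf] N])
    have g2: "sum ?f {q * N..<q * N + N} = (\<Sum>j=1..N. real_of_int (\<psi> (int j)) / (real N)\<^sup>2 * (1 / (real q + real j / real N)\<^sup>2))" for q
    proof (rule sum.reindex_bij_witness[of _ "\<lambda>j. q * N + j - 1" "\<lambda>n. Suc n - q * N"])
      fix n assume n: "n \<in> {q * N..<q * N + N}"
      define j where "j = Suc n - q * N"
      have j: "Suc n = j + q * N" "j \<in> {1..N}" using n by (auto simp: j_def)
      have p: "\<psi> (int (Suc n)) = \<psi> (int j)" unfolding j using per[of "int (j + q * N)"] per[of "int j"] by simp
      have e: "real (Suc n) = real N * (real q + real j / real N)" unfolding j using N by (simp add: field_simps)
      show "real_of_int (\<psi> (int (Suc n - q * N))) / (real N)\<^sup>2 * (1 / (real q + real (Suc n - q * N) / real N)\<^sup>2) = ?f n"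
        unfolding j_def[symmetric] p e power_mult_distrib by simp
    qed (use N in auto)
    have "(\<lambda>q. \<Sum>j=1..N. real_of_int (\<psi> (int j)) / (real N)\<^sup>2 * (1 / (real q + real j / real N)\<^sup>2)) sums ?S"
      using N by (intro sums_sum sums_mult Polygamma_1_sums) auto
    then have "suminf ?f = ?S" using sums_unique2[OF g1] unfolding g2 by blast
    then show ?thesis using summable_sums[OF sf] by simp
  qed
  show ?thesis
  proof (cases "N = 1")
    case True
    \<comment> \<open>For \<open>N = 1\<close> the character does not vanish at 0, so the term
      \<open>j = N\<close> survives; the claim is zeta(2) = pi^2/6.\<close>
    have "\<psi> x = 1" for x using per[of x] per[of 1] d unfolding True by simp
    moreover have "Polygamma 1 (1::real) = pi\<^sup>2 / 6"
      using sums_unique2[OF Polygamma_1_sums[of 1]] inverse_squares_sums by (simp add: add.commute)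
    ultimately show ?thesis using sums_unique[OF L2] True by (simp add: bern2_def)
  next
    case False
    \<comment> \<open>Otherwise \<open>\<psi>\<close> is constantly 1 and its Gauss sum at 1 is a
      vanishing sum of roots of unity.\<close>
    have \<psi>0: "\<psi> 0 = 0"
    proof (rule ccontr)
      assume "\<psi> 0 \<noteq> 0"
      then have one: "\<psi> x = 1" for x using mult[of 0 x] by simp
      have "\<not> int N dvd 1" using False N by simp
      then have "of_real (sqrt (real N)) = (0 :: complex)"
        using gs[of 1] sum_ez[OF N, of 1] by (simp add: one)
      then show False using N by simp
    qed
    then have \<psi>N: "\<psi> (int N) = 0" using per[of "int N"] by simp
    \<comment> \<open>The Gauss sum is real, so its square is \<open>N\<close>; compared with
      \<open>gauss_char_square\<close> this forces an even character.\<close>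
    have even: "\<psi> (- 1) = 1"
    proof -
      have "(of_real (sqrt (real N)))\<^sup>2 = (of_int (\<psi> (- 1)) * of_nat N :: complex)" by (rule gauss_char_square[OF G])
      moreover have "(of_real (sqrt (real N)))\<^sup>2 = (of_nat N :: complex)"
        by (simp flip: of_real_power)
      ultimately have "of_int (\<psi> (- 1)) = (1 :: complex)" using N by simp
      then show ?thesis by simp
    qed
    have reflect: "\<psi> (int N - x) = \<psi> x" for x
    proof -
      have "\<psi> (int N - x) = \<psi> (- x)" using per[of "int N - x"] per[of "- x"] by (simp add: minus_mod_self1)
      then show ?thesis using mult[of "- 1" x] even by simp
    qed
    let ?T = "\<Sum>j=1..<N. real_of_int (\<psi> (int j)) * Polygamma 1 (real j / real N)"
    let ?R = "\<Sum>j=1..<N. real_of_int (\<psi> (int j)) * (pi\<^sup>2 / (sin (pi * real j / real N))\<^sup>2)"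
    have T1: "(\<Sum>j=1..N. real_of_int (\<psi> (int j)) / (real N)\<^sup>2 * Polygamma 1 (real j / real N)) = ?T / (real N)\<^sup>2"
    proof -
      have "{1..N} = insert N {1..<N}" using N by auto
      then show ?thesis using \<psi>N by (simp add: sum_divide_distrib)
    qed
    have "?T = (\<Sum>j=1..<N. real_of_int (\<psi> (int j)) * Polygamma 1 (1 - real j / real N))"
    proof (rule sum.reindex_bij_witness[of _ "\<lambda>j. N - j" "\<lambda>j. N - j"])
      fix j assume j: "j \<in> {1..<N}"
      have "\<psi> (int (N - j)) = \<psi> (int j)" using reflect[of "int j"] j by (simp add: of_nat_diff)
      moreover have "1 - real (N - j) / real N = real j / real N" using j N by (simp add: of_nat_diff field_simps)
      ultimately show "real_of_int (\<psi> (int (N - j))) * Polygamma 1 (1 - real (N - j) / real N) = real_of_int (\<psi> (int j)) * Polygamma 1 (real j / real N)"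
        by simp
    qed auto
    then have "2 * ?T = (\<Sum>j=1..<N. real_of_int (\<psi> (int j)) * (Polygamma 1 (real j / real N) + Polygamma 1 (1 - real j / real N)))"
      by (simp add: distrib_left sum.distrib)
    also have "\<dots> = ?R"
    proof (rule sum.cong)
      fix j assume "j \<in> {1..<N}"
      then have "0 < real j / real N" "real j / real N < 1" by auto
      from Polygamma_1_reflection[OF this]
      show "real_of_int (\<psi> (int j)) * (Polygamma 1 (real j / real N) + Polygamma 1 (1 - real j / real N)) =
        real_of_int (\<psi> (int j)) * (pi\<^sup>2 / (sin (pi * real j / real N))\<^sup>2)" by simp
    qed simp
    finally have "2 * ?T = ?R" .
    then have TR: "?T = ?R / 2" by simp
    have "suminf ?f = ?R / 2 / (real N)\<^sup>2"
      using sums_unique[OF L2] unfolding T1 TR by (rule sym)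
    then have L: "suminf ?f = ?R / (2 * (real N)\<^sup>2)" by (simp only: divide_divide_eq_left)
    have "(\<Sum>k\<in>{0..<int N}. of_real (bern2 (real_of_int k / real N)) * (of_int (\<psi> k) * of_real (sqrt (real N)))) =
       (\<Sum>k\<in>{0..<int N}. \<Sum>j\<in>{0..<int N}. of_int (\<psi> j) * (of_real (bern2 (real_of_int k / real N)) * ez N (j * k)))"
      unfolding gs[symmetric] sum_distrib_left by (simp add: mult_ac)
    also have "\<dots> = (\<Sum>j\<in>{0..<int N}. of_int (\<psi> j) * (\<Sum>k\<in>{0..<int N}. of_real (bern2 (real_of_int k / real N)) * ez N (j * k)))"
      by (subst sum.swap) (simp only: sum_distrib_left)
    also have "\<dots> = (\<Sum>j\<in>{1..<int N}. of_int (\<psi> j) * of_real (1 / (2 * real N * (sin (pi * real_of_int j / real N))\<^sup>2)))"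
    proof (rule sum.mono_neutral_cong_right)
      show "\<forall>i\<in>{0..<int N} - {1..<int N}. of_int (\<psi> i) * (\<Sum>k\<in>{0..<int N}. of_real (bern2 (real_of_int k / real N)) * ez N (i * k)) = (0 :: complex)"
      proof
        fix i assume "i \<in> {0..<int N} - {1..<int N}"
        then have "i = 0" by auto
        then show "of_int (\<psi> i) * (\<Sum>k\<in>{0..<int N}. of_real (bern2 (real_of_int k / real N)) * ez N (i * k)) = (0 :: complex)"
          using \<psi>0 by simp
      qed
    qed (use bern2_fourier[OF N] in auto)
    also have "\<dots> = (\<Sum>j=1..<N. of_int (\<psi> (int j)) * of_real (1 / (2 * real N * (sin (pi * real j / real N))\<^sup>2)))"
      by (rule sum.reindex_bij_witness[of _ int nat]) auto
    also have "\<dots> = of_real (?R / (2 * real N * pi\<^sup>2))"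
      by (simp add: sum_divide_distrib field_simps)
    also have "(\<Sum>k\<in>{0..<int N}. of_real (bern2 (real_of_int k / real N)) * (of_int (\<psi> k) * of_real (sqrt (real N)))) =
       complex_of_real (sqrt (real N) * (\<Sum>k\<in>{0..<int N}. real_of_int (\<psi> k) * bern2 (real_of_int k / real N)))"
      by (simp add: sum_distrib_left mult_ac)
    finally have key: "sqrt (real N) * (\<Sum>k\<in>{0..<int N}. real_of_int (\<psi> k) * bern2 (real_of_int k / real N)) = ?R / (2 * real N * pi\<^sup>2)"
      by (simp only: of_real_eq_iff)
    have "(\<Sum>k\<in>{0..<int N}. real_of_int (\<psi> k) * bern2 (real_of_int k / real N)) = (\<Sum>j=1..N. real_of_int (\<psi> (int j)) * bern2 (real j / real N))"
    proof -
      have "(\<Sum>k\<in>{0..<int N}. real_of_int (\<psi> k) * bern2 (real_of_int k / real N)) = (\<Sum>k\<in>{1..<int N}. real_of_int (\<psi> k) * bern2 (real_of_int k / real N))"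
      proof (rule sum.mono_neutral_right)
        show "\<forall>i\<in>{0..<int N} - {1..<int N}. real_of_int (\<psi> i) * bern2 (real_of_int i / real N) = 0"
        proof
          fix i assume "i \<in> {0..<int N} - {1..<int N}"
          then have "i = 0" by auto
          then show "real_of_int (\<psi> i) * bern2 (real_of_int i / real N) = 0" using \<psi>0 by simp
        qed
      qed auto
      also have "\<dots> = (\<Sum>j=1..<N. real_of_int (\<psi> (int j)) * bern2 (real j / real N))"
        by (rule sum.reindex_bij_witness[of _ int nat]) auto
      also have "\<dots> = (\<Sum>j=1..N. real_of_int (\<psi> (int j)) * bern2 (real j / real N))"
        by (rule sum.mono_neutral_left) (use \<psi>N in \<open>auto simp: not_less le_antisym\<close>)
      finally show ?thesis .
    qed
    then have "sqrt (real N) * (\<Sum>j=1..N. real_of_int (\<psi> (int j)) * bern2 (real j / real N)) = ?R / (2 * real N * pi\<^sup>2)"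
      using key by simp
    also have "?R / (2 * real N * pi\<^sup>2) = sqrt (real N) * (sqrt (real N) / pi\<^sup>2 * suminf ?f)"
    proof -
      have "R / (2 * n * P) = r * (r / P * (R / (2 * n\<^sup>2)))" if "r * r = n" "n > 0" for r n P R :: real
      proof -
        have "r * (r / P * (R / (2 * n\<^sup>2))) = (r * r) * R / (2 * n\<^sup>2 * P)" by (simp add: mult_ac)
        then show ?thesis using that by (simp add: power2_eq_square)
      qed
      then show ?thesis unfolding L using N by simp
    qed
    finally have "sqrt (real N) * (\<Sum>j=1..N. real_of_int (\<psi> (int j)) * bern2 (real j / real N)) = sqrt (real N) * (sqrt (real N) / pi\<^sup>2 * suminf ?f)" .
    then show ?thesis
      by (rule iffD1[OF mult_left_cancel, rotated]) (use N in simp)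
  qed
qed

theorem dirichlet_L_minus_one:
  assumes D: "fundamental_discriminant D" "D > 0"
  shows "dirichlet_L D (- 1) = of_real (- (real_of_int D * sqrt (real_of_int D)) / (2 * pi\<^sup>2) *
     (\<Sum>n. real_of_int (kronecker_symbol D (Suc n)) / (real (Suc n))\<^sup>2))"
proof -
  obtain \<psi> where \<psi>: "gauss_char (nat D) \<psi> (of_real (sqrt (real_of_int D)))"
    "\<And>n. n > 0 \<Longrightarrow> kronecker_symbol D n = \<psi> (int n)" by (rule kronecker_character[OF D]) blast
  define N where "N = nat D"
  have N: "real N = real_of_int D" "N > 0" using D by (auto simp: N_def)
  have G: "gauss_char N \<psi> (of_real (sqrt (real N)))" using \<psi>(1) D by (simp add: N_def)
  have per: "of_int (\<psi> (int (n + N))) = (of_int (\<psi> (int n)) :: complex)" for n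
  proof -
    have "\<psi> (x mod int N) = \<psi> x" for x using G unfolding gauss_char_def by blast
    from this[of "int (n + N)"] this[of "int n"] show ?thesis by simp
  qed
  obtain F where F: "F holomorphic_on (- {1})"
     "\<And>z. Re z > 1 \<Longrightarrow> (\<lambda>n. of_int (\<psi> (int (Suc n))) * of_nat (Suc n) powr (- z)) sums F z"
     "F (- 1) = - (of_nat N / 2) * (\<Sum>j=1..N. of_int (\<psi> (int j)) * of_real ((real j / real N)\<^sup>2 - real j / real N + 1 / 6))"
    using periodic_L_continuation[of N "\<lambda>n. of_int (\<psi> (int n))", OF N(2) per] by auto
  have "dirichlet_L D (- 1) = F (- 1)"
    by (rule dirichlet_L_eqI[OF F(1)]) (use F(2) \<psi>(2) in simp_all)
  also have "\<dots> = of_real (- (real N / 2) * (\<Sum>j=1..N. real_of_int (\<psi> (int j)) * bern2 (real j / real N)))"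
    unfolding F(3) bern2_def by simp
  also have "(\<Sum>j=1..N. real_of_int (\<psi> (int j)) * bern2 (real j / real N)) =
     sqrt (real N) / pi\<^sup>2 * (\<Sum>n. real_of_int (\<psi> (int (Suc n))) / (real (Suc n))\<^sup>2)"
    by (rule gauss_char_bern2[OF G])
  finally show ?thesis unfolding N(1) using \<psi>(2) by (simp add: mult_ac)
qed

section \<open>Sums of values of quadratic polynomials\<close>

text \<open>The predicate concerns the outer coefficients only, since all decompositions go by the
  signs of \<open>a\<close> and \<open>c\<close>.\<close>

definition vforms :: "int \<Rightarrow> (int \<Rightarrow> int \<Rightarrow> bool) \<Rightarrow> bqf set" where
  "vforms D P = {(a, b, c). b\<^sup>2 - 4 * a * c = D \<and> P a c}"

definition hpos :: "real \<Rightarrow> bqf \<Rightarrow> real" where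
  "hpos x = (\<lambda>(a, b, c). max 0 (of_int a * x\<^sup>2 + of_int b * x + of_int c))"

definition cyc_F :: "int \<Rightarrow> real \<Rightarrow> real" where
  "cyc_F D x = (\<Sum>\<^sub>\<infinity>Q\<in>vforms D (\<lambda>a c. a < 0). hpos x Q)"

definition cyc_alpha :: "int \<Rightarrow> real" where
  "cyc_alpha D = (\<Sum>(a, b, c)\<in>vforms D (\<lambda>a c. a < 0 \<and> c > 0). of_int c)"

definition theta :: "real \<Rightarrow> real" where
  "theta y = frac y * (1 - frac y)"

text \<open>The oscillating part of the sums over forms with \<open>a = 0\<close> or
  \<open>c = 0\<close>. Adding it to \<open>cyc_F\<close> makes the functional equation homogeneous
  up to the constant \<open>cyc_K\<close>.\<close>

definition cyc_tau :: "int \<Rightarrow> real \<Rightarrow> real" where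
  "cyc_tau D x = (if is_square D then theta (sqrt (of_int D) * x) / 2 else 0)"

definition cyc_K :: "int \<Rightarrow> real" where
  "cyc_K D = cyc_alpha D + of_bool (is_square D) * of_int D / 2"

lemma abs_le_square_int: "\<bar>t\<bar> \<le> t\<^sup>2" for t :: int
proof (cases "t = 0")
  case False
  then have "\<bar>t\<bar> * 1 \<le> \<bar>t\<bar> * \<bar>t\<bar>" by (intro mult_left_mono) auto
  then show ?thesis by (simp add: power2_eq_square)
qed simp

lemma hpos_nonneg: "hpos x Q \<ge> 0"
  by (cases Q) (simp add: hpos_def)

lemma theta_bounds: "0 \<le> theta y" "theta y \<le> 1"
proof -
  have f: "0 \<le> frac y" "frac y < 1" by (simp_all add: frac_lt_1)
  then show "0 \<le> theta y" unfolding theta_def by simp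
  show "theta y \<le> 1" unfolding theta_def using f mult_mono[of "frac y" 1 "1 - frac y" 1] by simp
qed

lemma finite_indef: "finite (vforms D (\<lambda>a c. a < 0 \<and> c > 0))"
proof (rule finite_subset)
  show "vforms D (\<lambda>a c. a < 0 \<and> c > 0) \<subseteq> {- D..D} \<times> {- D..D} \<times> {- D..D}"
  proof
    fix Q assume Q: "Q \<in> vforms D (\<lambda>a c. a < 0 \<and> c > 0)"
    obtain a b c where abc: "Q = (a, b, c)" by (cases Q)
    from Q have d: "b\<^sup>2 - 4 * a * c = D" and a: "a < 0" and c: "c > 0" by (auto simp: vforms_def abc)
    have "(- a) * 1 \<le> (- a) * c" "1 * c \<le> (- a) * c" using a c by (auto intro!: mult_left_mono mult_right_mono simp del: mult_minus_left)
    moreover have "\<bar>b\<bar> \<le> b\<^sup>2" by (rule abs_le_square_int)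
    moreover have "b\<^sup>2 + 4 * ((- a) * c) = D" using d by simp
    moreover have "0 \<le> b\<^sup>2" by simp
    ultimately have "- a \<le> D" "c \<le> D" "\<bar>b\<bar> \<le> D" using a c by linarith+
    then show "Q \<in> {- D..D} \<times> {- D..D} \<times> {- D..D}" using a c by (auto simp: abc)
  qed
qed simp

text \<open>Negating forms turns the difference into values without truncation, as
  \<open>max 0 t - max 0 (- t) = t\<close>. The middle coefficients cancel under \<open>b\<close> to
  \<open>- b\<close>, and \<open>a\<close> to \<open>- c\<close> identifies the sum of
  \<open>a\<close> with minus that of \<open>c\<close>.\<close>

lemma indef_sum:
  "(\<Sum>Q\<in>vforms D (\<lambda>a c. a < 0 \<and> c > 0). hpos x Q) - (\<Sum>Q\<in>vforms D (\<lambda>a c. a > 0 \<and> c < 0). hpos x Q) =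
    cyc_alpha D * (1 - x\<^sup>2)"
proof -
  let ?V = "vforms D (\<lambda>a c. a < 0 \<and> c > 0)"
  have "(\<Sum>Q\<in>vforms D (\<lambda>a c. a > 0 \<and> c < 0). hpos x Q) = (\<Sum>(a, b, c)\<in>?V. max 0 (- (of_int a * x\<^sup>2 + of_int b * x + of_int c)))"
    by (rule sum.reindex_bij_witness[of _ "\<lambda>(a, b, c). (- a, - b, - c)" "\<lambda>(a, b, c). (- a, - b, - c)"])
       (auto simp: vforms_def hpos_def)
  then have "(\<Sum>Q\<in>?V. hpos x Q) - (\<Sum>Q\<in>vforms D (\<lambda>a c. a > 0 \<and> c < 0). hpos x Q) =
      (\<Sum>(a, b, c)\<in>?V. of_int a * x\<^sup>2 + of_int b * x + of_int c)"
    unfolding sum_subtractf[symmetric] by (auto simp: sum_subtractf[symmetric] hpos_def intro!: sum.cong)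
  also have "\<dots> = (\<Sum>(a, b, c)\<in>?V. of_int a) * x\<^sup>2 + (\<Sum>(a, b, c)\<in>?V. of_int b) * x + (\<Sum>(a, b, c)\<in>?V. of_int c)"
    by (simp add: case_prod_unfold sum.distrib sum_distrib_right)
  also have "(\<Sum>(a, b, c)\<in>?V. of_int b) = (0::real)"
  proof -
    have "(\<Sum>(a, b, c)\<in>?V. of_int b) = (\<Sum>(a, b, c)\<in>?V. - of_int b :: real)"
      by (rule sum.reindex_bij_witness[of _ "\<lambda>(a, b, c). (a, - b, c)" "\<lambda>(a, b, c). (a, - b, c)"])
         (auto simp: vforms_def)
    then show ?thesis by (simp add: case_prod_unfold sum_negf)
  qed
  also have "(\<Sum>(a, b, c)\<in>?V. of_int a) = - cyc_alpha D"
  proof -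
    have "(\<Sum>(a, b, c)\<in>?V. of_int a) = (\<Sum>(a, b, c)\<in>?V. - of_int c :: real)"
      by (rule sum.reindex_bij_witness[of _ "\<lambda>(a, b, c). (- c, b, - a)" "\<lambda>(a, b, c). (- c, b, - a)"])
         (auto simp: vforms_def mult.commute)
    then show ?thesis by (simp add: case_prod_unfold sum_negf cyc_alpha_def)
  qed
  finally show ?thesis by (simp add: cyc_alpha_def algebra_simps)
qed

text \<open>\<open>theta\<close> measures the deviation from the polynomial that gives the value at
  integers \<open>y\<close>.\<close>

lemma sum_linear_theta:
  fixes y :: real
  assumes "y \<ge> 0"
  shows "(\<Sum>k\<in>{1..\<lfloor>y\<rfloor>}. y - of_int k) = (y\<^sup>2 - y + theta y) / 2"
proof -
  define N where "N = nat \<lfloor>y\<rfloor>"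
  have N: "\<lfloor>y\<rfloor> = int N" using assms by (simp add: N_def)
  have "(\<Sum>k\<in>{1..\<lfloor>y\<rfloor>}. y - of_int k) = (\<Sum>k=1..N. y - real k)"
    unfolding N by (rule sum.reindex_bij_witness[of _ int nat]) auto
  also have "2 * (\<Sum>k=1..M. y - real k) = real M * (2 * y - real M - 1)" for M
    by (induction M) (simp_all add: algebra_simps)
  then have "(\<Sum>k=1..N. y - real k) = real N * (2 * y - real N - 1) / 2" by (simp add: field_simps)
  also have "real N = y - frac y" unfolding frac_def N by simp
  finally show ?thesis by (simp add: theta_def power2_eq_square algebra_simps)
qed

lemma is_square_int_root:
  assumes "is_square (D::int)" "D > 0"
  obtains m where "m > 0" "D = m\<^sup>2" "sqrt (of_int D) = of_int m"
proof -
  obtain r where r: "D = r\<^sup>2" using assms(1) by (auto simp: is_nth_power_def)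
  show ?thesis
    by (rule that[of "\<bar>r\<bar>"]) (use r assms(2) in \<open>auto simp: power2_eq_square\<close>)
qed

text \<open>For \<open>D = m\<^sup>2\<close> only \<open>(- k, m, 0)\<close> with
  \<open>k \<le> m / x\<close> and \<open>(0, m, - k)\<close> with \<open>k \<le> m * x\<close> have
  positive value; both are sums of linear terms. The terms \<open>m * x\<close> cancel in the
  difference.\<close>

lemma degenerate_sums:
  assumes "x > 0" "D > 0"
  shows "(\<Sum>\<^sub>\<infinity>Q\<in>vforms D (\<lambda>a c. a < 0 \<and> c = 0). hpos x Q) - (\<Sum>\<^sub>\<infinity>Q\<in>vforms D (\<lambda>a c. a = 0 \<and> c < 0). hpos x Q)
     = of_bool (is_square D) * of_int D / 2 * (1 - x\<^sup>2) + x\<^sup>2 * cyc_tau D (1 / x) - cyc_tau D x"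
proof (cases "is_square D")
  case True
  obtain m where m: "m > 0" "D = m\<^sup>2" "sqrt (of_int D) = of_int m" using is_square_int_root[OF True assms(2)] .
  let ?y = "of_int m / x"
  have "(\<Sum>\<^sub>\<infinity>Q\<in>vforms D (\<lambda>a c. a < 0 \<and> c = 0). hpos x Q) = (\<Sum>\<^sub>\<infinity>Q\<in>(\<lambda>k. (- k, m, 0)) ` {1..\<lfloor>?y\<rfloor>}. hpos x Q)"
  proof (rule infsum_cong_neutral)
    fix Q assume Q: "Q \<in> vforms D (\<lambda>a c. a < 0 \<and> c = 0) - (\<lambda>k. (- k, m, 0)) ` {1..\<lfloor>?y\<rfloor>}"
    obtain a b c where abc: "Q = (a, b, c)" by (cases Q)
    have v: "b\<^sup>2 = m\<^sup>2" "a < 0" "c = 0" using Q m by (auto simp: abc vforms_def)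
    have "b = m \<or> b = - m" using v(1) by (simp add: power2_eq_iff)
    then show "hpos x Q = 0"
    proof
      assume b: "b = m"
      have "\<not> - a \<le> \<lfloor>?y\<rfloor>"
      proof
        assume "- a \<le> \<lfloor>?y\<rfloor>"
        then have "- a \<in> {1..\<lfloor>?y\<rfloor>}" using v by simp
        then have "Q \<in> (\<lambda>k. (- k, m, 0)) ` {1..\<lfloor>?y\<rfloor>}" unfolding abc b v(3) by (rule image_eqI[rotated]) simp
        then show False using Q by simp
      qed
      then have "of_int m / x < of_int (- a)" by linarith
      then have "of_int m < of_int (- a) * x" using assms(1) by (simp add: pos_divide_less_eq)
      then have "of_int m * x \<le> (of_int (- a) * x) * x" using assms(1) by (intro mult_right_mono) auto
      then show ?thesis by (simp add: abc hpos_def b v power2_eq_square)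
    next
      assume b: "b = - m"
      have "of_int a * x\<^sup>2 \<le> 0" "of_int m * x \<ge> 0" using v m assms(1) by (auto simp: mult_nonpos_nonneg)
      then show ?thesis by (simp add: abc hpos_def b v)
    qed
  qed (auto simp: vforms_def m(2))
  also have "\<dots> = (\<Sum>Q\<in>(\<lambda>k. (- k, m, 0)) ` {1..\<lfloor>?y\<rfloor>}. hpos x Q)" by simp
  also have "\<dots> = (\<Sum>k\<in>{1..\<lfloor>?y\<rfloor>}. x\<^sup>2 * (?y - of_int k))"
  proof (subst sum.reindex)
    show "inj_on (\<lambda>k. (- k, m, 0)) {1..\<lfloor>?y\<rfloor>}" by (auto simp: inj_on_def)
    show "sum (hpos x \<circ> (\<lambda>k. (- k, m, 0))) {1..\<lfloor>?y\<rfloor>} = (\<Sum>k\<in>{1..\<lfloor>?y\<rfloor>}. x\<^sup>2 * (?y - of_int k))"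
    proof (rule sum.cong)
      fix k assume "k \<in> {1..\<lfloor>?y\<rfloor>}"
      then have "of_int k \<le> ?y" by (auto simp: le_floor_iff)
      then have "0 \<le> x\<^sup>2 * (?y - of_int k)" by simp
      moreover have "x\<^sup>2 * (?y - of_int k) = of_int (- k) * x\<^sup>2 + of_int m * x + of_int 0"
        using assms(1) by (simp add: power2_eq_square right_diff_distrib)
      ultimately show "(hpos x \<circ> (\<lambda>k. (- k, m, 0))) k = x\<^sup>2 * (?y - of_int k)"
        by (simp add: hpos_def)
    qed simp
  qed
  also have "\<dots> = x\<^sup>2 * ((?y\<^sup>2 - ?y + theta ?y) / 2)"
    unfolding sum_distrib_left[symmetric] by (subst sum_linear_theta) (use m assms in auto)
  also have "\<dots> = (of_int D - of_int m * x + x\<^sup>2 * theta ?y) / 2"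
    using assms(1) unfolding m(2) by (simp add: power_divide right_diff_distrib distrib_left power2_eq_square)
  finally have S1: "(\<Sum>\<^sub>\<infinity>Q\<in>vforms D (\<lambda>a c. a < 0 \<and> c = 0). hpos x Q) = (of_int D - of_int m * x + x\<^sup>2 * theta ?y) / 2" .
  let ?z = "of_int m * x"
  have "(\<Sum>\<^sub>\<infinity>Q\<in>vforms D (\<lambda>a c. a = 0 \<and> c < 0). hpos x Q) = (\<Sum>\<^sub>\<infinity>Q\<in>(\<lambda>k. (0, m, - k)) ` {1..\<lfloor>?z\<rfloor>}. hpos x Q)"
  proof (rule infsum_cong_neutral)
    fix Q assume Q: "Q \<in> vforms D (\<lambda>a c. a = 0 \<and> c < 0) - (\<lambda>k. (0, m, - k)) ` {1..\<lfloor>?z\<rfloor>}"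
    obtain a b c where abc: "Q = (a, b, c)" by (cases Q)
    have v: "b\<^sup>2 = m\<^sup>2" "a = 0" "c < 0" using Q m by (auto simp: abc vforms_def)
    have "b = m \<or> b = - m" using v(1) by (simp add: power2_eq_iff)
    then show "hpos x Q = 0"
    proof
      assume b: "b = m"
      have "\<not> - c \<le> \<lfloor>?z\<rfloor>"
      proof
        assume "- c \<le> \<lfloor>?z\<rfloor>"
        then have "- c \<in> {1..\<lfloor>?z\<rfloor>}" using v by simp
        then have "Q \<in> (\<lambda>k. (0, m, - k)) ` {1..\<lfloor>?z\<rfloor>}" unfolding abc b v(2) by (rule image_eqI[rotated]) simp
        then show False using Q by simp
      qed
      then have "?z < of_int (- c)" by linarith
      then show ?thesis by (simp add: abc hpos_def b v)
    next
      assume b: "b = - m"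
      have "of_int m * x \<ge> 0" using m assms(1) by auto
      then show ?thesis using v by (simp add: abc hpos_def b)
    qed
  qed (auto simp: vforms_def m(2))
  also have "\<dots> = (\<Sum>Q\<in>(\<lambda>k. (0, m, - k)) ` {1..\<lfloor>?z\<rfloor>}. hpos x Q)" by simp
  also have "\<dots> = (\<Sum>k\<in>{1..\<lfloor>?z\<rfloor>}. ?z - of_int k)"
  proof (subst sum.reindex)
    show "inj_on (\<lambda>k. (0, m, - k)) {1..\<lfloor>?z\<rfloor>}" by (auto simp: inj_on_def)
    show "sum (hpos x \<circ> (\<lambda>k. (0, m, - k))) {1..\<lfloor>?z\<rfloor>} = (\<Sum>k\<in>{1..\<lfloor>?z\<rfloor>}. ?z - of_int k)"
      by (rule sum.cong) (auto simp: hpos_def le_floor_iff)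
  qed
  also have "\<dots> = (?z\<^sup>2 - ?z + theta ?z) / 2"
    by (subst sum_linear_theta) (use m assms in auto)
  finally have S2: "(\<Sum>\<^sub>\<infinity>Q\<in>vforms D (\<lambda>a c. a = 0 \<and> c < 0). hpos x Q) = (?z\<^sup>2 - ?z + theta ?z) / 2" .
  have zz: "?z\<^sup>2 = of_int D * x\<^sup>2" unfolding m(2) by (simp add: power_mult_distrib)
  show ?thesis unfolding S1 S2 zz cyc_tau_def using True m(3) by (simp add: field_simps)
next
  case False
  have ns: "b\<^sup>2 \<noteq> D" for b using False by auto
  have empty: "vforms D P = {}" if "\<And>a c. P a c \<Longrightarrow> a * c = 0" for P
  proof (rule equals0I)
    fix Q assume Q: "Q \<in> vforms D P"
    obtain a b c where abc: "Q = (a, b, c)" by (cases Q)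
    have "b\<^sup>2 - 4 * (a * c) = D" "P a c" using Q by (simp_all add: abc vforms_def mult.assoc)
    then have "b\<^sup>2 = D" using that by simp
    then show False using ns by blast
  qed
  have "vforms D (\<lambda>a c. a < 0 \<and> c = 0) = {}" "vforms D (\<lambda>a c. a = 0 \<and> c < 0) = {}"
    by (rule empty; simp)+
  then show ?thesis using False by (simp add: cyc_tau_def)
qed

lemma cyc_F_swap:
  assumes "x > 0"
  shows "x\<^sup>2 * cyc_F D (1 / x) = (\<Sum>\<^sub>\<infinity>Q\<in>vforms D (\<lambda>a c. c < 0). hpos x Q)"
    and "hpos (1 / x) summable_on vforms D (\<lambda>a c. a < 0) \<Longrightarrow> hpos x summable_on vforms D (\<lambda>a c. c < 0)"
proof -
  have bij: "bij_betw (\<lambda>(a, b, c). (c, b, a)) (vforms D (\<lambda>a c. a < 0)) (vforms D (\<lambda>a c. c < 0))"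
    by (rule bij_betw_byWitness[of _ "\<lambda>(a, b, c). (c, b, a)"]) (auto simp: vforms_def mult_ac)
  have h: "x\<^sup>2 * hpos (1 / x) (a, b, c) = hpos x (c, b, a)" for a b c
  proof -
    have "x\<^sup>2 * (of_int a * (1 / x)\<^sup>2 + of_int b * (1 / x) + of_int c) = of_int c * x\<^sup>2 + of_int b * x + of_int a"
      using assms by (simp add: power2_eq_square distrib_left)
    moreover have "x\<^sup>2 * max 0 u = max 0 (x\<^sup>2 * u)" for u
      using assms by (simp add: max_def zero_le_mult_iff)
    ultimately show ?thesis unfolding hpos_def prod.case by simp
  qed
  have e: "x\<^sup>2 * hpos (1 / x) Q = hpos x (case Q of (a, b, c) \<Rightarrow> (c, b, a))" for Q
    by (cases Q) (simp only: prod.case h)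
  have "x\<^sup>2 * cyc_F D (1 / x) = (\<Sum>\<^sub>\<infinity>Q\<in>vforms D (\<lambda>a c. a < 0). hpos x (case Q of (a, b, c) \<Rightarrow> (c, b, a)))"
    unfolding cyc_F_def e[symmetric] by (rule infsum_cmult_right'[symmetric])
  also have "\<dots> = (\<Sum>\<^sub>\<infinity>Q\<in>vforms D (\<lambda>a c. c < 0). hpos x Q)"
    by (rule infsum_reindex_bij_betw[OF bij])
  finally show "x\<^sup>2 * cyc_F D (1 / x) = (\<Sum>\<^sub>\<infinity>Q\<in>vforms D (\<lambda>a c. c < 0). hpos x Q)" .
  show "hpos x summable_on vforms D (\<lambda>a c. c < 0)" if "hpos (1 / x) summable_on vforms D (\<lambda>a c. a < 0)"
  proof -
    have "(\<lambda>Q. x\<^sup>2 * hpos (1 / x) Q) summable_on vforms D (\<lambda>a c. a < 0)"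
      using that by (rule summable_on_cmult_right)
    then show ?thesis unfolding e summable_on_reindex_bij_betw[OF bij] .
  qed
qed

text \<open>Summability is a hypothesis because at first it is known only at rational points, and
  the equation at those points is what proves it elsewhere.\<close>

lemma cyc_functional_equation:
  assumes x: "x > 0" and D: "D > 0"
    and s1: "hpos x summable_on vforms D (\<lambda>a c. a < 0)"
    and s2: "hpos (1 / x) summable_on vforms D (\<lambda>a c. a < 0)"
  shows "cyc_F D x + cyc_tau D x = x\<^sup>2 * (cyc_F D (1 / x) + cyc_tau D (1 / x)) + (1 - x\<^sup>2) * cyc_K D"
proof -
  note s3 = cyc_F_swap(2)[OF x s2]
  have sub: "hpos x summable_on vforms D P" if "\<And>a c. P a c \<Longrightarrow> a < 0" for P
    by (rule summable_on_subset_banach[OF s1]) (use that in \<open>auto simp: vforms_def\<close>)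
  have sub': "hpos x summable_on vforms D P" if "\<And>a c. P a c \<Longrightarrow> c < 0" for P
    by (rule summable_on_subset_banach[OF s3]) (use that in \<open>auto simp: vforms_def\<close>)
  have split: "infsum (hpos x) (vforms D P) = infsum (hpos x) (vforms D Q) + infsum (hpos x) (vforms D R)"
    if "hpos x summable_on vforms D Q" "hpos x summable_on vforms D R"
      "\<And>a c. P a c \<longleftrightarrow> Q a c \<or> R a c" "\<And>a c. \<not> (Q a c \<and> R a c)" for P Q R
  proof -
    have "vforms D P = vforms D Q \<union> vforms D R" "vforms D Q \<inter> vforms D R = {}"
      using that(3,4) by (auto simp: vforms_def)
    then show ?thesis using infsum_Un_disjoint[OF that(1,2)] by simp
  qed
  have fin': "finite (vforms D (\<lambda>a c. a > 0 \<and> c < 0))"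
  proof -
    have "bij_betw (\<lambda>(a, b, c). (- a, - b, - c)) (vforms D (\<lambda>a c. a < 0 \<and> c > 0)) (vforms D (\<lambda>a c. a > 0 \<and> c < 0))"
      by (rule bij_betw_byWitness[of _ "\<lambda>(a, b, c). (- a, - b, - c)"]) (auto simp: vforms_def)
    then show ?thesis using finite_indef bij_betw_finite by blast
  qed
  have "cyc_F D x = infsum (hpos x) (vforms D (\<lambda>a c. a < 0 \<and> c < 0)) +
      (infsum (hpos x) (vforms D (\<lambda>a c. a < 0 \<and> c = 0)) + infsum (hpos x) (vforms D (\<lambda>a c. a < 0 \<and> c > 0)))"
    unfolding cyc_F_def
    by (subst split[of "\<lambda>a c. a < 0 \<and> c < 0" "\<lambda>a c. a < 0 \<and> c \<ge> 0"],
        (rule sub; simp)+, auto intro!: split sub)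
  moreover have "x\<^sup>2 * cyc_F D (1 / x) = infsum (hpos x) (vforms D (\<lambda>a c. a < 0 \<and> c < 0)) +
      (infsum (hpos x) (vforms D (\<lambda>a c. a = 0 \<and> c < 0)) + infsum (hpos x) (vforms D (\<lambda>a c. a > 0 \<and> c < 0)))"
    unfolding cyc_F_swap(1)[OF x]
    by (subst split[of "\<lambda>a c. a < 0 \<and> c < 0" "\<lambda>a c. a \<ge> 0 \<and> c < 0"],
        (rule sub'; simp)+, auto intro!: split sub')
  moreover note degenerate_sums[OF x D]
  moreover have "infsum (hpos x) (vforms D (\<lambda>a c. a < 0 \<and> c > 0)) - infsum (hpos x) (vforms D (\<lambda>a c. a > 0 \<and> c < 0)) =
     cyc_alpha D * (1 - x\<^sup>2)"
    using indef_sum[of x D] finite_indef fin' by simp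
  ultimately have "cyc_F D x - x\<^sup>2 * cyc_F D (1 / x) = cyc_alpha D * (1 - x\<^sup>2) +
      (of_bool (is_square D) * of_int D / 2 * (1 - x\<^sup>2) + x\<^sup>2 * cyc_tau D (1 / x) - cyc_tau D x)"
    by linarith
  then show ?thesis unfolding cyc_K_def by (simp add: algebra_simps)
qed

lemma cyc_periodic:
  assumes "D > 0"
  shows "cyc_F D (x + 1) = cyc_F D x" "cyc_tau D (x + 1) = cyc_tau D x"
proof -
  have bij: "bij_betw (\<lambda>(a, b, c). (a, b + 2 * a, a + b + c)) (vforms D (\<lambda>a c. a < 0)) (vforms D (\<lambda>a c. a < 0))"
    by (rule bij_betw_byWitness[of _ "\<lambda>(a, b, c). (a, b - 2 * a, a - b + c)"])
       (auto simp: vforms_def power2_eq_square algebra_simps)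
  have e: "hpos (x + 1) Q = hpos x (case Q of (a, b, c) \<Rightarrow> (a, b + 2 * a, a + b + c))" for Q
    by (cases Q) (simp add: hpos_def power2_eq_square algebra_simps)
  show "cyc_F D (x + 1) = cyc_F D x"
    unfolding cyc_F_def e by (rule infsum_reindex_bij_betw[OF bij])
  show "cyc_tau D (x + 1) = cyc_tau D x"
  proof (cases "is_square D")
    case True
    obtain m where m: "sqrt (of_int D) = of_int m" using is_square_int_root[OF True assms] by blast
    have "frac (of_int m * x + of_int m) = frac (of_int m * x)" by (simp add: frac_def)
    then show ?thesis using True by (simp add: cyc_tau_def m theta_def distrib_left)
  qed (simp add: cyc_tau_def)
qed

lemma cyc_alpha_nonneg: "cyc_alpha D \<ge> 0"
  unfolding cyc_alpha_def by (rule sum_nonneg) (auto simp: vforms_def)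

text \<open>At \<open>p / q\<close> a positive value times \<open>q\<^sup>2\<close> is an integer
  \<open>n \<ge> 1\<close>, and
  \<open>(2 * a * p + b * q)\<^sup>2 + 4 * (- a) * n = D * q\<^sup>2\<close> leaves finitely many
  coefficients.\<close>

lemma cyc_rational_finite:
  assumes "q > 0" "x = of_int p / of_int q" "D > 0"
  shows "finite {Q \<in> vforms D (\<lambda>a c. a < 0). hpos x Q \<noteq> 0}"
proof -
  define A where "A = D * q\<^sup>2"
  define B where "B = D + 2 * A * (\<bar>p\<bar> + 1) + 1"
  have "{Q \<in> vforms D (\<lambda>a c. a < 0). hpos x Q \<noteq> 0} \<subseteq> {- A..A} \<times> {- B..B} \<times> {- (B\<^sup>2 + D)..B\<^sup>2 + D}"
  proof
    fix Q assume Q: "Q \<in> {Q \<in> vforms D (\<lambda>a c. a < 0). hpos x Q \<noteq> 0}"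
    obtain a b c where abc: "Q = (a, b, c)" by (cases Q)
    have d: "b\<^sup>2 - 4 * a * c = D" and a: "a < 0" using Q by (auto simp: abc vforms_def)
    have pos: "of_int a * x\<^sup>2 + of_int b * x + of_int c > 0" using Q by (auto simp: abc hpos_def max_def split: if_splits)
    define n where "n = a * p\<^sup>2 + b * p * q + c * q\<^sup>2"
    have "of_int n = (of_int q)\<^sup>2 * (of_int a * x\<^sup>2 + of_int b * x + of_int c)"
      using assms(1) unfolding n_def assms(2) by (simp add: power2_eq_square field_simps)
    then have "of_int n > (0::real)" using pos assms(1) by simp
    then have n: "n > 0" by simp
    have id: "(2 * a * p + b * q)\<^sup>2 + 4 * ((- a) * n) = D * q\<^sup>2"
      unfolding n_def d[symmetric] by (simp add: power2_eq_square algebra_simps)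
    have an: "- a \<le> (- a) * n" using mult_left_mono[of 1 n "- a"] a n by simp
    have sq: "\<bar>2 * a * p + b * q\<bar> \<le> (2 * a * p + b * q)\<^sup>2" by (rule abs_le_square_int)
    have aA: "- a \<le> A" "\<bar>2 * a * p + b * q\<bar> \<le> A"
      using id an sq a zero_le_power2[of "2 * a * p + b * q"] unfolding A_def by linarith+
    have "\<bar>b\<bar> * 1 \<le> \<bar>b\<bar> * q" using assms(1) by (intro mult_left_mono) auto
    then have "\<bar>b\<bar> \<le> \<bar>b * q\<bar>" using assms(1) by (simp add: abs_mult)
    also have "\<dots> \<le> A + \<bar>2 * a * p\<bar>" using aA(2) by linarith
    also have "\<bar>2 * a * p\<bar> = 2 * ((- a) * \<bar>p\<bar>)" using a by (simp add: abs_mult)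
    also have "(- a) * \<bar>p\<bar> \<le> A * \<bar>p\<bar>" using aA(1) by (rule mult_right_mono) simp
    finally have "\<bar>b\<bar> \<le> A + 2 * (A * \<bar>p\<bar>)" by simp
    then have b: "\<bar>b\<bar> \<le> B" using aA(1) a assms(3) by (simp add: B_def algebra_simps)
    have "b\<^sup>2 \<le> B\<^sup>2" using b by (simp add: abs_le_square_iff[symmetric])
    moreover have "\<bar>c\<bar> \<le> \<bar>4 * a * c\<bar>" using mult_right_mono[of 1 "4 * (- a)" "\<bar>c\<bar>"] a by (simp add: abs_mult)
    ultimately have c: "\<bar>c\<bar> \<le> B\<^sup>2 + D" using d assms(3) zero_le_power2[of b] by linarith
    show "Q \<in> {- A..A} \<times> {- B..B} \<times> {- (B\<^sup>2 + D)..B\<^sup>2 + D}"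
      unfolding abc using aA(1) a b c by auto
  qed
  then show ?thesis by (rule finite_subset) simp
qed

lemma cyc_rational_summable:
  assumes "q > 0" "x = of_int p / of_int q" "D > 0"
  shows "hpos x summable_on vforms D (\<lambda>a c. a < 0)"
proof -
  have "hpos x summable_on {Q \<in> vforms D (\<lambda>a c. a < 0). hpos x Q \<noteq> 0}"
    using cyc_rational_finite[OF assms] by simp
  then show ?thesis by (rule iffD1[OF summable_on_cong_neutral, rotated -1]) auto
qed

text \<open>For \<open>0 < x < 1\<close> the functional equation makes the value at \<open>x\<close>
  a convex combination of the value at \<open>1 / x\<close> and \<open>cyc_K D\<close>. Reducing
  modulo 1 and inverting lowers the denominator until 0 is reached, where the value is
  \<open>cyc_alpha D\<close>.\<close>

lemma cyc_rational_le:
  assumes "D > 0"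
  shows "cyc_F D (real p / real (Suc q)) + cyc_tau D (real p / real (Suc q)) \<le> cyc_K D"
proof (induction q arbitrary: p rule: less_induct)
  case (less q)
  let ?G = "\<lambda>x. cyc_F D x + cyc_tau D x"
  have per: "?G (x + real n) = ?G x" for x n
  proof (induction n)
    case (Suc n)
    have "?G (x + real n + 1) = ?G (x + real n)" by (simp only: cyc_periodic[OF assms])
    then show ?case using Suc by (simp add: add_ac)
  qed simp
  define r where "r = p mod Suc q"
  have "real p = real (Suc q) * real (p div Suc q) + real r"
    unfolding r_def by (metis mult_div_mod_eq of_nat_add of_nat_mult)
  then have "real p / real (Suc q) = real r / real (Suc q) + real (p div Suc q)"
    by (simp add: field_simps del: of_nat_Suc)
  then have eq: "?G (real p / real (Suc q)) = ?G (real r / real (Suc q))" using per by metis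
  show ?case
  proof (cases r)
    case 0
    have "cyc_F D 0 = cyc_alpha D"
    proof -
      have "cyc_F D 0 = infsum (hpos 0) (vforms D (\<lambda>a c. a < 0 \<and> c > 0))"
        unfolding cyc_F_def by (rule infsum_cong_neutral) (auto simp: vforms_def hpos_def)
      also have "\<dots> = sum (hpos 0) (vforms D (\<lambda>a c. a < 0 \<and> c > 0))" using finite_indef by simp
      also have "\<dots> = cyc_alpha D" unfolding cyc_alpha_def by (rule sum.cong) (auto simp: vforms_def hpos_def)
      finally show ?thesis .
    qed
    then show ?thesis unfolding eq 0 using assms by (simp add: cyc_tau_def theta_def cyc_K_def)
  next
    case (Suc s)
    have rq: "r < Suc q" unfolding r_def by simp
    let ?x = "real r / real (Suc q)"
    have x: "?x > 0" "?x < 1" using Suc rq by auto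
    have inv: "1 / ?x = real (Suc q) / real (Suc s)" using Suc by simp
    have "hpos ?x summable_on vforms D (\<lambda>a c. a < 0)"
      by (rule cyc_rational_summable[of "int (Suc q)" _ "int r"]) (use assms in auto)
    moreover have "hpos (1 / ?x) summable_on vforms D (\<lambda>a c. a < 0)"
      unfolding inv by (rule cyc_rational_summable[of "int (Suc s)" _ "int (Suc q)"]) (use assms in auto)
    ultimately have "?G ?x = ?x\<^sup>2 * ?G (1 / ?x) + (1 - ?x\<^sup>2) * cyc_K D"
      by (rule cyc_functional_equation[OF x(1) assms])
    also have "?G (1 / ?x) \<le> cyc_K D"
      unfolding inv by (rule less.IH) (use Suc rq in simp)
    then have "?x\<^sup>2 * ?G (1 / ?x) + (1 - ?x\<^sup>2) * cyc_K D \<le> ?x\<^sup>2 * cyc_K D + (1 - ?x\<^sup>2) * cyc_K D"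
      by (intro add_right_mono mult_left_mono) auto
    also have "\<dots> = cyc_K D" by (simp add: left_diff_distrib)
    finally show ?thesis unfolding eq .
  qed
qed

lemma cyc_tau_bounds: "0 \<le> cyc_tau D x" "cyc_tau D x \<le> 1"
  using theta_bounds[of "sqrt (of_int D) * x"] by (auto simp: cyc_tau_def)

text \<open>A finite partial sum is continuous in \<open>x\<close>, so exceeding the bound at
  \<open>x\<close> would mean exceeding it at a nearby rational point. This bound yields convergence
  at all \<open>x \<ge> 0\<close>.\<close>

lemma cyc_finite_le:
  assumes "D > 0" "x \<ge> 0" "finite S" "S \<subseteq> vforms D (\<lambda>a c. a < 0)"
  shows "sum (hpos x) S \<le> cyc_K D"
proof (rule ccontr)
  assume "\<not> ?thesis"
  then have gt: "sum (hpos x) S > cyc_K D" by simp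
  have "isCont (\<lambda>x. sum (hpos x) S) x"
    unfolding hpos_def case_prod_unfold by (intro continuous_intros)
  then have "((\<lambda>x. sum (hpos x) S) \<longlongrightarrow> sum (hpos x) S) (at x)" by (simp add: isCont_def)
  then have "\<forall>\<^sub>F y in at x. sum (hpos y) S > cyc_K D" using gt by (rule order_tendstoD)
  then obtain d where d: "d > 0" "\<And>y. y \<noteq> x \<Longrightarrow> dist y x < d \<Longrightarrow> sum (hpos y) S > cyc_K D"
    unfolding eventually_at by auto
  obtain r where r: "r \<in> \<rat>" "x < r" "r < x + d" using Rats_dense_in_real[of x "x + d"] d by auto
  obtain m n where mn: "n > 0" "r = of_int m / of_int n" using r(1) by (rule Rats_cases')
  have "real_of_int m / real_of_int n > 0" using r(2) assms(2) unfolding mn by linarith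
  then have "m > 0" using mn(1) by (simp add: zero_less_divide_iff)
  then have rr: "r = real (nat m) / real (Suc (nat n - 1))" using mn by simp
  have sm: "hpos r summable_on vforms D (\<lambda>a c. a < 0)" by (rule cyc_rational_summable[OF mn assms(1)])
  have "cyc_K D < sum (hpos r) S" by (rule d) (use r in \<open>auto simp: dist_real_def\<close>)
  also have "\<dots> \<le> cyc_F D r" unfolding cyc_F_def
    by (rule finite_sum_le_infsum[OF sm assms(3,4)]) (simp add: hpos_nonneg)
  also have "\<dots> \<le> cyc_K D" using cyc_rational_le[OF assms(1), of "nat m" "nat n - 1"] cyc_tau_bounds(1)[of D r]
    unfolding rr[symmetric] by linarith
  finally show False by simp
qed

lemma cyc_summable:
  assumes "D > 0" "x \<ge> 0"
  shows "hpos x summable_on vforms D (\<lambda>a c. a < 0)" "cyc_F D x \<le> cyc_K D" "cyc_F D x \<ge> 0"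
proof -
  show s: "hpos x summable_on vforms D (\<lambda>a c. a < 0)"
  proof (rule nonneg_bdd_above_summable_on)
    show "bdd_above (sum (hpos x) ` {F. F \<subseteq> vforms D (\<lambda>a c. a < 0) \<and> finite F})"
      using cyc_finite_le[OF assms] by (intro bdd_aboveI[of _ "cyc_K D"]) auto
  qed (simp add: hpos_nonneg)
  show "cyc_F D x \<le> cyc_K D" unfolding cyc_F_def
    by (rule infsum_le_finite_sums[OF s]) (use cyc_finite_le[OF assms] in auto)
  show "cyc_F D x \<ge> 0" unfolding cyc_F_def by (rule infsum_nonneg) (simp add: hpos_nonneg)
qed

text \<open>One inversion gains the factor \<open>u\<^sup>2\<close>, which is not bounded away from
  1. For \<open>u > 1/2\<close> a second inversion is made at once, and the pair gains at least a
  factor 4 in any case. Irrational points never reach 0, so the step can be repeated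
  forever.\<close>

lemma contracting_cocycle_zero:
  fixes g :: "real \<Rightarrow> real"
  assumes per: "\<And>x. x > 0 \<Longrightarrow> g (x + 1) = g x"
    and inv: "\<And>x. x > 0 \<Longrightarrow> g x = x\<^sup>2 * g (1 / x)"
    and bdd: "\<And>x. x > 0 \<Longrightarrow> \<bar>g x\<bar> \<le> M"
    and x: "x > 0" "x \<notin> \<rat>"
  shows "g x = 0"
proof -
  have pern: "g (x + real n) = g x" if "x > 0" for x n
  proof (induction n)
    case (Suc n)
    have "g (x + real n + 1) = g (x + real n)" using that by (intro per) auto
    then show ?case using Suc by (simp add: add_ac)
  qed simp
  have frac: "\<exists>y. 0 < y \<and> y < 1 \<and> y \<notin> \<rat> \<and> g y = g x" if "x > 0" "x \<notin> \<rat>" for x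
  proof (intro exI conjI)
    have "x \<notin> \<int>" using that(2) Ints_subset_Rats by blast
    then show f: "0 < frac x" by (simp add: frac_gt_0_iff)
    show "frac x < 1" by (rule frac_lt_1)
    show "frac x \<notin> \<rat>"
    proof
      assume "frac x \<in> \<rat>"
      then have "frac x + of_int \<lfloor>x\<rfloor> \<in> \<rat>" by (intro Rats_add) auto
      then show False using that(2) by (simp add: frac_def)
    qed
    have "frac x + real (nat \<lfloor>x\<rfloor>) = x" using that(1) by (simp add: frac_def)
    then show "g (frac x) = g x" using pern[OF f, of "nat \<lfloor>x\<rfloor>"] by simp
  qed
  have irr: "1 / y \<notin> \<rat>" if "y \<notin> \<rat>" for y :: real
  proof
    assume "1 / y \<in> \<rat>"
    from Rats_divide[OF Rats_1 this] show False using that by simp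
  qed
  have step: "\<exists>z>0. z \<notin> \<rat> \<and> \<bar>g y\<bar> \<le> \<bar>g z\<bar> / 4" if y: "y > 0" "y \<notin> \<rat>" for y
  proof -
    obtain u where u: "0 < u" "u < 1" "u \<notin> \<rat>" "g u = g y" using frac[OF y] by blast
    have quarter: "w\<^sup>2 * \<bar>t\<bar> \<le> \<bar>t\<bar> / 4" if "0 \<le> w" "w \<le> 1 / 2" for w t :: real
    proof -
      have "w\<^sup>2 \<le> (1 / 2)\<^sup>2" using that by (intro power_mono) auto
      then have "w\<^sup>2 * \<bar>t\<bar> \<le> (1 / 2)\<^sup>2 * \<bar>t\<bar>" by (intro mult_right_mono) auto
      then show ?thesis by (simp add: power2_eq_square)
    qed
    show ?thesis
    proof (cases "u \<le> 1 / 2")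
      case True
      have "\<bar>g y\<bar> = u\<^sup>2 * \<bar>g (1 / u)\<bar>" using inv[OF u(1)] u(4) by (simp add: abs_mult)
      then have "\<bar>g y\<bar> \<le> \<bar>g (1 / u)\<bar> / 4" using quarter[of u "g (1 / u)"] u True by simp
      then show ?thesis using irr[OF u(3)] u(1) by (intro exI[of _ "1 / u"]) auto
    next
      case False
      \<comment> \<open>\<open>v\<close> is the fractional part of \<open>1 / u\<close>, and
        \<open>u * v = 1 - u < 1/2\<close> is the combined factor.\<close>
      define v where "v = 1 / u - 1"
      have v: "v > 0" "v \<notin> \<rat>" "u * v = 1 - u"
      proof -
        show "v > 0" "u * v = 1 - u" using u by (simp_all add: v_def right_diff_distrib)
        show "v \<notin> \<rat>"
        proof
          assume "v \<in> \<rat>"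
          then have "v + 1 \<in> \<rat>" by (intro Rats_add) auto
          then show False using irr[OF u(3)] by (simp add: v_def)
        qed
      qed
      have "g y = u\<^sup>2 * g (v + 1)" using inv[OF u(1)] u(4) by (simp add: v_def)
      also have "\<dots> = u\<^sup>2 * (v\<^sup>2 * g (1 / v))" using per[OF v(1)] inv[OF v(1)] by simp
      also have "\<dots> = (1 - u)\<^sup>2 * g (1 / v)" using v(3) by (simp flip: power_mult_distrib mult.assoc)
      finally have "\<bar>g y\<bar> = (1 - u)\<^sup>2 * \<bar>g (1 / v)\<bar>" by (simp add: abs_mult)
      then have "\<bar>g y\<bar> \<le> \<bar>g (1 / v)\<bar> / 4" using quarter[of "1 - u" "g (1 / v)"] u False by simp
      then show ?thesis using irr[OF v(2)] v(1) by (intro exI[of _ "1 / v"]) auto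
    qed
  qed
  have bound: "\<bar>g y\<bar> \<le> M / 4 ^ n" if "y > 0" "y \<notin> \<rat>" for y n
    using that
  proof (induction n arbitrary: y)
    case 0
    then show ?case using bdd by simp
  next
    case (Suc n)
    obtain z where z: "z > 0" "z \<notin> \<rat>" "\<bar>g y\<bar> \<le> \<bar>g z\<bar> / 4" using step[OF Suc.prems] by blast
    then show ?case using Suc.IH[OF z(1,2)] by simp
  qed
  have "(\<lambda>n. M * (1 / 4) ^ n) \<longlonglongrightarrow> M * 0" by (intro tendsto_mult_left LIMSEQ_realpow_zero) auto
  then have "(\<lambda>n. M / 4 ^ n) \<longlonglongrightarrow> 0" by (simp add: power_one_over)
  then have "\<bar>g x\<bar> \<le> 0" by (rule tendsto_lowerbound) (use bound[OF x] in auto)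
  then show ?thesis by simp
qed

theorem cyc_F_irrational:
  assumes "D > 0" "x > 0" "x \<notin> \<rat>"
  shows "cyc_F D x = cyc_K D - cyc_tau D x"
proof -
  have "cyc_F D x + cyc_tau D x - cyc_K D = 0"
  proof (rule contracting_cocycle_zero[of "\<lambda>x. cyc_F D x + cyc_tau D x - cyc_K D"])
    fix x :: real assume x: "x > 0"
    show "cyc_F D (x + 1) + cyc_tau D (x + 1) - cyc_K D = cyc_F D x + cyc_tau D x - cyc_K D"
      by (simp add: cyc_periodic[OF assms(1)])
    have "cyc_F D x + cyc_tau D x = x\<^sup>2 * (cyc_F D (1 / x) + cyc_tau D (1 / x)) + (1 - x\<^sup>2) * cyc_K D"
      by (rule cyc_functional_equation[OF x assms(1)]; rule cyc_summable) (use x assms(1) in auto)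
    then show "cyc_F D x + cyc_tau D x - cyc_K D = x\<^sup>2 * (cyc_F D (1 / x) + cyc_tau D (1 / x) - cyc_K D)"
      by (simp add: algebra_simps)
    show "\<bar>cyc_F D x + cyc_tau D x - cyc_K D\<bar> \<le> cyc_K D + 1"
      using cyc_summable(2,3)[of D x] cyc_tau_bounds[of D x] assms(1) x by (simp add: abs_le_iff)
  qed (use assms in auto)
  then show ?thesis by simp
qed

section \<open>Integration over a period\<close>

text \<open>The middle coefficients of forms with leading coefficient \<open>- n\<close>.
  Translation by 1 changes \<open>b\<close> by \<open>2 * n\<close>, so \<open>root_count\<close>
  counts these forms up to translation.\<close>

definition root_set :: "int \<Rightarrow> nat \<Rightarrow> int set" where
  "root_set D n = {b. 4 * int n dvd b\<^sup>2 - D}"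

definition root_count :: "int \<Rightarrow> nat \<Rightarrow> nat" where
  "root_count D n = card (root_set D n \<inter> {0..<2 * int n})"

text \<open>The truncated value of such a form after completing the square, with
  \<open>y = x - b / (2 * n)\<close>.\<close>

definition bump :: "int \<Rightarrow> nat \<Rightarrow> real \<Rightarrow> real" where
  "bump D n y = max 0 (of_int D / (4 * real n) - real n * y\<^sup>2)"

lemma bump_measurable [measurable]: "bump D n \<in> borel_measurable borel"
  unfolding bump_def by measurable

lemma root_set_shift:
  "b + 2 * int n * j \<in> root_set D n \<longleftrightarrow> b \<in> root_set D n"
proof -
  have eq: "(b + 2 * int n * j)\<^sup>2 - D = (b\<^sup>2 - D) + 4 * int n * (b * j + int n * j\<^sup>2)"
    by (simp add: power2_eq_square algebra_simps)
  show ?thesis unfolding root_set_def mem_Collect_eq eq by (rule dvd_add_left_iff) (rule dvd_triv_left)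
qed

text \<open>A parabolic segment: two thirds of the height \<open>D / (4 * n)\<close> times the width
  \<open>sqrt D / n\<close>.\<close>

lemma bump_integral:
  assumes "D > 0" "n > 0"
  shows "(\<integral>\<^sup>+y. ennreal (bump D n y) \<partial>lborel) = ennreal (of_int D * sqrt (of_int D) / (6 * (real n)\<^sup>2))"
proof -
  define s where "s = sqrt (real_of_int D)"
  have s: "s > 0" "real_of_int D = s\<^sup>2" using assms by (simp_all add: s_def)
  define r where "r = s / (2 * real n)"
  have r: "r > 0" using s assms by (simp add: r_def)
  have ds: "real_of_int D / (4 * real n) = real n * r\<^sup>2"
    using assms by (simp add: s r_def power_divide power2_eq_square)
  define f where "f y = real n * r\<^sup>2 - real n * y\<^sup>2" for y
  have "(f has_integral (real n * r\<^sup>2 * r - real n * r ^ 3 / 3) - (real n * r\<^sup>2 * (- r) - real n * (- r) ^ 3 / 3)) {- r..r}"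
  proof (rule fundamental_theorem_of_calculus)
    fix y assume "y \<in> {- r..r}"
    have "((\<lambda>y. real n * r\<^sup>2 * y - real n * y ^ 3 / 3) has_real_derivative f y) (at y within {- r..r})"
      unfolding f_def by (auto intro!: derivative_eq_intros)
    then show "((\<lambda>y. real n * r\<^sup>2 * y - real n * y ^ 3 / 3) has_vector_derivative f y) (at y within {- r..r})"
      by (simp add: has_real_derivative_iff_has_vector_derivative)
  qed (use r in auto)
  also have "(real n * r\<^sup>2 * r - real n * r ^ 3 / 3) - (real n * r\<^sup>2 * (- r) - real n * (- r) ^ 3 / 3) = 4 / 3 * real n * r ^ 3"
    by (simp add: power2_eq_square power3_eq_cube)
  also have "\<dots> = of_int D * sqrt (of_int D) / (6 * (real n)\<^sup>2)"
    using assms s(1) unfolding s_def[symmetric] s(2) r_def by (simp add: power_divide power2_eq_square power3_eq_cube)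
  finally have hi: "(f has_integral of_int D * sqrt (of_int D) / (6 * (real n)\<^sup>2)) {- r..r}" .
  have le: "y\<^sup>2 \<le> r\<^sup>2 \<longleftrightarrow> y \<in> {- r..r}" for y
    using r abs_le_square_iff[of y r] by (auto simp: abs_le_iff)
  have b: "bump D n y = max 0 (f y)" for y unfolding bump_def ds f_def ..
  have f0: "f y \<ge> 0 \<longleftrightarrow> y \<in> {- r..r}" for y
    using assms le[of y] by (simp add: f_def flip: right_diff_distrib) (auto simp: zero_le_mult_iff)
  have "(\<integral>\<^sup>+y. ennreal (bump D n y) \<partial>lborel) = (\<integral>\<^sup>+y. ennreal (f y) * indicator {- r..r} y \<partial>lborel)"
  proof (rule nn_integral_cong)
    fix y
    show "ennreal (bump D n y) = ennreal (f y) * indicator {- r..r} y"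
      using f0[of y] by (auto simp: b max_def indicator_def)
  qed
  also have "\<dots> = ennreal (of_int D * sqrt (of_int D) / (6 * (real n)\<^sup>2))"
    by (rule nn_integral_has_integral_lebesgue'[OF _ hi]) (use f0 in auto)
  finally show ?thesis .
qed

text \<open>Summing over integer translates unfolds the unit interval to the line. Nonnegative
  integrals are used so that the exchange needs no convergence.\<close>

lemma bump_unfold:
  assumes "n > 0"
  shows "(\<integral>\<^sup>+j. (\<integral>\<^sup>+x. ennreal (bump D n (x - t - of_int j)) * indicator {0..<1} x \<partial>lborel) \<partial>count_space UNIV) =
    (\<integral>\<^sup>+y. ennreal (bump D n y) \<partial>lborel)"
proof -
  have "(\<integral>\<^sup>+x. ennreal (bump D n (x - t - of_int j)) * indicator {0..<1} x \<partial>lborel) =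
      (\<integral>\<^sup>+x. ennreal (bump D n (x - t)) * indicator {0..<1} (of_int j + x) \<partial>lborel)" for j :: int
    by (subst nn_integral_real_affine[where t = "of_int j" and c = 1]) simp_all
  then have "(\<integral>\<^sup>+j. (\<integral>\<^sup>+x. ennreal (bump D n (x - t - of_int j)) * indicator {0..<1} x \<partial>lborel) \<partial>count_space UNIV) =
     (\<integral>\<^sup>+j. (\<integral>\<^sup>+x. ennreal (bump D n (x - t)) * indicator {0..<1} (of_int j + x) \<partial>lborel) \<partial>count_space UNIV)"
    by simp
  also have "\<dots> = (\<integral>\<^sup>+x. (\<integral>\<^sup>+j. ennreal (bump D n (x - t)) * indicator {0..<1} (of_int j + x) \<partial>count_space UNIV) \<partial>lborel)"
    by (rule nn_integral_count_space_nn_integral[symmetric]) auto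
  also have "\<dots> = (\<integral>\<^sup>+x. ennreal (bump D n (x - t)) \<partial>lborel)"
  proof (rule nn_integral_cong)
    fix x :: real
    have "indicator {0..<1} (of_int j + x) = (indicator {- \<lfloor>x\<rfloor>} j :: ennreal)" for j :: int
    proof -
      have "of_int j + x \<in> {0..<1} \<longleftrightarrow> j = - \<lfloor>x\<rfloor>"
        unfolding atLeastLessThan_iff eq_commute[of j] minus_equation_iff[of "\<lfloor>x\<rfloor>"] eq_commute[of _ "\<lfloor>x\<rfloor>"] floor_eq_iff
        by auto
      then show ?thesis by (auto simp: indicator_def)
    qed
    then have "(\<integral>\<^sup>+j. ennreal (bump D n (x - t)) * indicator {0..<1} (of_int j + x) \<partial>count_space UNIV) =
       (\<integral>\<^sup>+j. ennreal (bump D n (x - t)) * indicator {- \<lfloor>x\<rfloor>} j \<partial>count_space UNIV)" by simp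
    also have "\<dots> = ennreal (bump D n (x - t))"
      by (subst nn_integral_count_space_indicator[symmetric]) (simp_all add: nn_integral_count_space_finite)
    finally show "(\<integral>\<^sup>+j. ennreal (bump D n (x - t)) * indicator {0..<1} (of_int j + x) \<partial>count_space UNIV) = ennreal (bump D n (x - t))" .
  qed
  also have "\<dots> = (\<integral>\<^sup>+y. ennreal (bump D n y) \<partial>lborel)"
    by (subst nn_integral_real_affine[where t = t and c = 1]) simp_all
  finally show ?thesis .
qed

text \<open>Within a residue class modulo \<open>2 * n\<close> the centres
  \<open>b / (2 * n)\<close> differ by integers, so each class contributes one full bump.\<close>

lemma root_set_unfold:
  assumes "n > 0"
  shows "(\<integral>\<^sup>+b. (\<integral>\<^sup>+x. ennreal (bump D n (x - of_int b / (2 * real n))) * indicator {0..<1} x \<partial>lborel) * indicator (root_set D n) b \<partial>count_space UNIV) =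
    of_nat (root_count D n) * (\<integral>\<^sup>+y. ennreal (bump D n y) \<partial>lborel)"
proof -
  let ?J = "\<lambda>b::int. \<integral>\<^sup>+x. ennreal (bump D n (x - of_int b / (2 * real n))) * indicator {0..<1} x \<partial>lborel"
  let ?N = "2 * int n"
  let ?I = "\<integral>\<^sup>+y. ennreal (bump D n y) \<partial>lborel"
  have ind: "1 = (\<Sum>r\<in>{0..<?N}. indicator {b. b mod ?N = r} b :: ennreal)" for b
  proof -
    have "(\<Sum>r\<in>{0..<?N}. indicator {b. b mod ?N = r} b :: ennreal) = (\<Sum>r\<in>{b mod ?N}. 1)"
      by (rule sum.mono_neutral_cong_right) (use assms in \<open>auto simp: indicator_def\<close>)
    then show ?thesis by simp
  qed
  have "(\<integral>\<^sup>+b. ?J b * indicator (root_set D n) b \<partial>count_space UNIV) =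
     (\<integral>\<^sup>+b. (\<Sum>r\<in>{0..<?N}. ?J b * indicator (root_set D n) b * indicator {b. b mod ?N = r} b) \<partial>count_space UNIV)"
    unfolding sum_distrib_left[symmetric] ind[symmetric] by simp
  also have "\<dots> = (\<Sum>r\<in>{0..<?N}. \<integral>\<^sup>+b. ?J b * indicator (root_set D n) b * indicator {b. b mod ?N = r} b \<partial>count_space UNIV)"
    by (rule nn_integral_sum) simp
  also have "\<dots> = (\<Sum>r\<in>{0..<?N}. ?I * indicator (root_set D n) r)"
  proof (rule sum.cong)
    fix r assume r: "r \<in> {0..<?N}"
    have bij: "bij_betw (\<lambda>j. r + ?N * j) UNIV {b. b mod ?N = r}"
      by (rule bij_betw_byWitness[of _ "\<lambda>b. b div ?N"]) (use r in \<open>auto simp: div_add1_eq\<close>)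
    have "(\<integral>\<^sup>+b. ?J b * indicator (root_set D n) b * indicator {b. b mod ?N = r} b \<partial>count_space UNIV) =
       (\<integral>\<^sup>+b. ?J b * indicator (root_set D n) b \<partial>count_space {b. b mod ?N = r})"
      by (rule nn_integral_count_space_indicator[symmetric]) simp
    also have "\<dots> = (\<integral>\<^sup>+j. ?J (r + ?N * j) * indicator (root_set D n) (r + ?N * j) \<partial>count_space UNIV)"
      by (rule nn_integral_bij_count_space[OF bij, symmetric])
    also have "\<dots> = (\<integral>\<^sup>+j. ?J (r + ?N * j) * indicator (root_set D n) r \<partial>count_space UNIV)"
      by (simp add: indicator_def root_set_shift)
    also have "\<dots> = (\<integral>\<^sup>+j. ?J (r + ?N * j) \<partial>count_space UNIV) * indicator (root_set D n) r"
      by (rule nn_integral_multc) simp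
    also have "(\<integral>\<^sup>+j. ?J (r + ?N * j) \<partial>count_space UNIV) = ?I"
    proof -
      have eq: "x - of_int (r + ?N * j) / (2 * real n) = x - of_int r / (2 * real n) - of_int j" for x j
        using assms by (simp add: field_simps)
      show ?thesis unfolding eq by (rule bump_unfold[OF assms])
    qed
    finally show "(\<integral>\<^sup>+b. ?J b * indicator (root_set D n) b * indicator {b. b mod ?N = r} b \<partial>count_space UNIV) = ?I * indicator (root_set D n) r" .
  qed simp
  also have "\<dots> = ?I * (\<Sum>r\<in>{0..<?N}. indicator (root_set D n) r)" by (rule sum_distrib_left[symmetric])
  also have "(\<Sum>r\<in>{0..<?N}. indicator (root_set D n) r :: ennreal) = of_nat (root_count D n)"
    by (simp add: root_count_def sum_indicator_eq_card Int_commute indicator_def of_nat_sum flip: sum.inter_filter)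
  finally show ?thesis by (simp add: mult.commute)
qed

text \<open>Index \<open>n\<close> stands for \<open>a = - Suc n\<close>; then \<open>c\<close> is
  determined by \<open>b\<close>, and it is an integer exactly for \<open>b\<close> in the root
  set.\<close>

lemma cyc_F_nn_integral:
  assumes "D > 0" "x \<ge> 0"
  shows "ennreal (cyc_F D x) = (\<integral>\<^sup>+n. (\<integral>\<^sup>+b. ennreal (bump D (Suc n) (x - of_int b / (2 * real (Suc n)))) *
      indicator (root_set D (Suc n)) b \<partial>count_space UNIV) \<partial>count_space UNIV)"
proof -
  let ?V = "vforms D (\<lambda>a c. a < 0)"
  let ?A = "{(n, b). b \<in> root_set D (Suc n)}"
  let ?g = "\<lambda>(n, b). (- int (Suc n), b, (D - b\<^sup>2) div (4 * int (Suc n)))"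
  have s: "hpos x summable_on ?V" by (rule cyc_summable(1)[OF assms])
  have "Infinite_Sum.abs_summable_on (hpos x) ?V" using s by (simp add: hpos_nonneg)
  then have as: "Infinite_Set_Sum.abs_summable_on (hpos x) ?V" unfolding abs_summable_equivalent .
  have bij: "bij_betw ?g ?A ?V"
  proof (rule bij_betw_byWitness[of _ "\<lambda>(a, b, c). (nat (- a) - 1, b)"])
    have key: "b\<^sup>2 + 4 * int (Suc n) * ((D - b\<^sup>2) div (4 * int (Suc n))) = D" if "b \<in> root_set D (Suc n)" for n b
    proof -
      have "4 * int (Suc n) dvd D - b\<^sup>2" using that by (simp add: root_set_def dvd_diff_commute del: of_nat_Suc)
      then show ?thesis by (simp del: of_nat_Suc)
    qed
    show "\<forall>a\<in>?A. (case ?g a of (a, b, c) \<Rightarrow> (nat (- a) - 1, b)) = a"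
      by (auto simp: nat_add_distrib)
    show "?g ` ?A \<subseteq> ?V"
      using key by (force simp: vforms_def simp del: of_nat_Suc)
    have inv: "?g (nat (- a) - 1, b) = (a, b, c) \<and> (nat (- a) - 1, b) \<in> ?A" if "(a, b, c) \<in> ?V" for a b c
    proof -
      have v: "b\<^sup>2 - 4 * a * c = D" "a < 0" using that by (auto simp: vforms_def)
      have n: "int (Suc (nat (- a) - 1)) = - a" using v(2) by linarith
      have e: "b\<^sup>2 - D = 4 * (- a) * (- c)" "D - b\<^sup>2 = 4 * (- a) * c" using v(1) by simp_all
      have "(D - b\<^sup>2) div (4 * (- a)) = c" unfolding e(2) using v(2) by simp
      moreover have "4 * (- a) dvd b\<^sup>2 - D" unfolding e(1) by (rule dvd_triv_left)
      ultimately show ?thesis unfolding prod.case mem_Collect_eq root_set_def n by simp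
    qed
    show "\<forall>a'\<in>?V. ?g (case a' of (a, b, c) \<Rightarrow> (nat (- a) - 1, b)) = a'"
      using inv by fastforce
    show "(\<lambda>(a, b, c). (nat (- a) - 1, b)) ` ?V \<subseteq> ?A"
      using inv by fastforce
  qed
  have h: "hpos x (?g (n, b)) = bump D (Suc n) (x - of_int b / (2 * real (Suc n)))" if "b \<in> root_set D (Suc n)" for n b
  proof -
    define N where "N = real (Suc n)"
    have N: "N > 0" by (simp add: N_def)
    have "4 * int (Suc n) dvd D - b\<^sup>2" using that by (simp add: root_set_def dvd_diff_commute del: of_nat_Suc)
    then have "real_of_int ((D - b\<^sup>2) div (4 * int (Suc n))) = (of_int D - (of_int b)\<^sup>2) / (4 * N)"
      by (simp add: real_of_int_div N_def del: of_nat_Suc)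
    moreover have "of_int D / (4 * N) - N * (x - of_int b / (2 * N))\<^sup>2 = - N * x\<^sup>2 + of_int b * x + (of_int D - (of_int b)\<^sup>2) / (4 * N)"
      using N by (simp add: power2_eq_square field_simps)
    ultimately show ?thesis by (simp add: hpos_def bump_def N_def del: of_nat_Suc)
  qed
  have "ennreal (cyc_F D x) = (\<integral>\<^sup>+Q. ennreal (hpos x Q) \<partial>count_space ?V)"
    unfolding cyc_F_def infsetsum_infsum[OF as, symmetric]
    by (rule nn_integral_conv_infsetsum[OF as, symmetric]) (rule hpos_nonneg)
  also have "\<dots> = (\<integral>\<^sup>+p. ennreal (hpos x (?g p)) \<partial>count_space ?A)"
    by (rule nn_integral_bij_count_space[OF bij, symmetric])
  also have "\<dots> = (\<integral>\<^sup>+p. ennreal (hpos x (?g p)) * indicator ?A p \<partial>count_space UNIV)"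
    by (rule nn_integral_count_space_indicator) simp
  also have "\<dots> = (\<integral>\<^sup>+p. (case p of (n, b) \<Rightarrow> ennreal (bump D (Suc n) (x - of_int b / (2 * real (Suc n)))) *
      indicator (root_set D (Suc n)) b) \<partial>count_space UNIV)"
  proof (rule nn_integral_cong)
    fix p :: "nat \<times> int"
    obtain n b where p: "p = (n, b)" by (cases p)
    show "ennreal (hpos x (?g p)) * indicator ?A p = (case p of (n, b) \<Rightarrow> ennreal (bump D (Suc n) (x - of_int b / (2 * real (Suc n)))) *
      indicator (root_set D (Suc n)) b)"
    proof (cases "b \<in> root_set D (Suc n)")
      case True
      then show ?thesis using h[OF True] unfolding p prod.case by (simp only: indicator_simps mem_Collect_eq prod.case)
    next
      case False
      then show ?thesis unfolding p by simp
    qed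
  qed
  finally show ?thesis by (simp only: nn_integral_fst_count_space[symmetric] prod.case)
qed

lemma cyc_F_integral:
  assumes "D > 0"
  shows "(\<integral>\<^sup>+x. ennreal (cyc_F D x) * indicator {0..<1} x \<partial>lborel) =
     (\<Sum>n. ennreal (real (root_count D (Suc n)) * (of_int D * sqrt (of_int D) / (6 * (real (Suc n))\<^sup>2))))"
proof -
  let ?h = "\<lambda>n b x. ennreal (bump D (Suc n) (x - of_int b / (2 * real (Suc n))))"
  let ?R = "\<lambda>n. indicator (root_set D (Suc n)) :: int \<Rightarrow> ennreal"
  let ?U = "indicator {0..<1} :: real \<Rightarrow> ennreal"
  have "(\<integral>\<^sup>+x. ennreal (cyc_F D x) * ?U x \<partial>lborel) =
    (\<integral>\<^sup>+x. (\<integral>\<^sup>+n. (\<integral>\<^sup>+b. ?h n b x * ?R n b * ?U x \<partial>count_space UNIV) \<partial>count_space UNIV) \<partial>lborel)"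
  proof (rule nn_integral_cong)
    fix x
    show "ennreal (cyc_F D x) * ?U x = (\<integral>\<^sup>+n. (\<integral>\<^sup>+b. ?h n b x * ?R n b * ?U x \<partial>count_space UNIV) \<partial>count_space UNIV)"
    proof (cases "x \<in> {0..<1}")
      case True
      then show ?thesis using cyc_F_nn_integral[OF assms, of x] by simp
    qed simp
  qed
  also have "\<dots> = (\<integral>\<^sup>+n. (\<integral>\<^sup>+x. (\<integral>\<^sup>+b. ?h n b x * ?R n b * ?U x \<partial>count_space UNIV) \<partial>lborel) \<partial>count_space UNIV)"
  proof (rule nn_integral_count_space_nn_integral)
    fix n
    \<comment> \<open>Measurability in \<open>x\<close> of the integral over the integers: an
      enumeration of the integers turns it into a countable sum.\<close>
    have "(\<lambda>x. \<Sum>k. ?h n (from_nat_into UNIV k) x * ?R n (from_nat_into UNIV k) * ?U x) \<in> borel_measurable lborel"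
      by measurable
    also have "(\<lambda>x. \<Sum>k. ?h n (from_nat_into UNIV k) x * ?R n (from_nat_into UNIV k) * ?U x) =
       (\<lambda>x. \<integral>\<^sup>+b. ?h n b x * ?R n b * ?U x \<partial>count_space UNIV)"
    proof
      fix x
      show "(\<Sum>k. ?h n (from_nat_into UNIV k) x * ?R n (from_nat_into UNIV k) * ?U x) =
       (\<integral>\<^sup>+b. ?h n b x * ?R n b * ?U x \<partial>count_space UNIV)"
        unfolding nn_integral_count_space_nat[symmetric]
        by (rule nn_integral_bij_count_space[of "from_nat_into UNIV" UNIV UNIV "\<lambda>b. ?h n b x * ?R n b * ?U x"])
           (rule bij_betw_from_nat_into; simp add: infinite_UNIV_int)
    qed
    finally show "(\<lambda>x. \<integral>\<^sup>+b. ?h n b x * ?R n b * ?U x \<partial>count_space UNIV) \<in> borel_measurable lborel" .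
  qed simp
  also have "\<dots> = (\<integral>\<^sup>+n. (\<integral>\<^sup>+b. (\<integral>\<^sup>+x. ?h n b x * ?R n b * ?U x \<partial>lborel) \<partial>count_space UNIV) \<partial>count_space UNIV)"
    by (intro nn_integral_cong nn_integral_count_space_nn_integral) auto
  also have "\<dots> = (\<integral>\<^sup>+n. (\<integral>\<^sup>+b. (\<integral>\<^sup>+x. ?h n b x * ?U x \<partial>lborel) * ?R n b \<partial>count_space UNIV) \<partial>count_space UNIV)"
  proof (intro nn_integral_cong)
    fix n b
    have "(\<integral>\<^sup>+x. ?h n b x * ?R n b * ?U x \<partial>lborel) = (\<integral>\<^sup>+x. (?h n b x * ?U x) * ?R n b \<partial>lborel)"
      by (simp add: mult_ac)
    also have "\<dots> = (\<integral>\<^sup>+x. ?h n b x * ?U x \<partial>lborel) * ?R n b"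
      by (rule nn_integral_multc) measurable
    finally show "(\<integral>\<^sup>+x. ?h n b x * ?R n b * ?U x \<partial>lborel) = (\<integral>\<^sup>+x. ?h n b x * ?U x \<partial>lborel) * ?R n b" .
  qed
  also have "\<dots> = (\<integral>\<^sup>+n. ennreal (real (root_count D (Suc n)) * (of_int D * sqrt (of_int D) / (6 * (real (Suc n))\<^sup>2))) \<partial>count_space UNIV)"
  proof (rule nn_integral_cong)
    fix n
    have "(\<integral>\<^sup>+b. (\<integral>\<^sup>+x. ?h n b x * ?U x \<partial>lborel) * ?R n b \<partial>count_space UNIV) =
       of_nat (root_count D (Suc n)) * ennreal (of_int D * sqrt (of_int D) / (6 * (real (Suc n))\<^sup>2))"
      using root_set_unfold[of "Suc n" D] bump_integral[OF assms, of "Suc n"] by simp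
    also have "\<dots> = ennreal (real (root_count D (Suc n)) * (of_int D * sqrt (of_int D) / (6 * (real (Suc n))\<^sup>2)))"
      using assms by (subst ennreal_mult) (auto simp: ennreal_of_nat_eq_real_of_nat)
    finally show "(\<integral>\<^sup>+b. (\<integral>\<^sup>+x. ?h n b x * ?U x \<partial>lborel) * ?R n b \<partial>count_space UNIV) =
       ennreal (real (root_count D (Suc n)) * (of_int D * sqrt (of_int D) / (6 * (real (Suc n))\<^sup>2)))" .
  qed
  finally show ?thesis unfolding nn_integral_count_space_nat .
qed

text \<open>There are \<open>m\<close> periods of \<open>t * (1 - t)\<close>, each with integral
  \<open>1 / (6 * m)\<close>.\<close>

lemma theta_has_integral:
  assumes "m > (0::nat)"
  shows "((\<lambda>x. theta (real m * x)) has_integral 1 / 6) {0..1}"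
proof -
  have piece: "((\<lambda>x. theta (real m * x)) has_integral 1 / (6 * real m)) {real k / real m..real (Suc k) / real m}" for k
  proof -
    let ?I = "{real k / real m..real (Suc k) / real m}"
    let ?u = "\<lambda>x. real m * x - real k"
    let ?P = "\<lambda>x. (?u x ^ 2 / 2 - ?u x ^ 3 / 3) / real m"
    have "((\<lambda>x. ?u x * (1 - ?u x)) has_integral ?P (real (Suc k) / real m) - ?P (real k / real m)) ?I"
    proof (rule fundamental_theorem_of_calculus)
      fix x assume "x \<in> ?I"
      have "(?P has_real_derivative ?u x * (1 - ?u x)) (at x within ?I)"
        using assms by (auto intro!: derivative_eq_intros simp: field_simps power2_eq_square)
      then show "(?P has_vector_derivative ?u x * (1 - ?u x)) (at x within ?I)"
        by (simp add: has_real_derivative_iff_has_vector_derivative)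
    qed (use assms in \<open>auto simp: divide_right_mono\<close>)
    moreover have "?P (real (Suc k) / real m) - ?P (real k / real m) = 1 / (6 * real m)"
      using assms by (simp add: field_simps)
    moreover have "?u x * (1 - ?u x) = theta (real m * x)" if "x \<in> ?I" for x
    proof -
      have x: "real k \<le> real m * x" "real m * x \<le> real k + 1"
        using that assms by (simp_all add: field_simps)
      \<comment> \<open>At the right end the fractional part drops to 0, but
        \<open>t * (1 - t)\<close> vanishes at both ends, so the polynomial is valid on the closed
        interval.\<close>
      show ?thesis
      proof (cases "real m * x = real k + 1")
        case True
        then show ?thesis by (simp add: theta_def frac_def)
      next
        case False
        then have "\<lfloor>real m * x\<rfloor> = int k" using x by (intro floor_unique) auto
        then show ?thesis by (simp add: theta_def frac_def)
      qed
    qed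
    ultimately show ?thesis using has_integral_cong[of ?I "\<lambda>x. ?u x * (1 - ?u x)" "\<lambda>x. theta (real m * x)"] by simp
  qed
  have "((\<lambda>x. theta (real m * x)) has_integral real k / (6 * real m)) {0..real k / real m}" for k
  proof (induction k)
    case (Suc k)
    have "((\<lambda>x. theta (real m * x)) has_integral real k / (6 * real m) + 1 / (6 * real m)) {0..real (Suc k) / real m}"
      by (rule has_integral_combine[OF _ _ Suc piece]) (auto simp: divide_right_mono)
    then show ?case by (simp add: add_divide_distrib add.commute)
  qed (simp add: has_integral_refl)
  from this[of m] show ?thesis using assms by simp
qed

lemma cyc_tau_has_integral:
  assumes "D > 0"
  shows "((\<lambda>x. cyc_K D - cyc_tau D x) has_integral cyc_K D - of_bool (is_square D) / 12) {0..1}"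
proof -
  have "(cyc_tau D has_integral of_bool (is_square D) / 12) {0..1}"
  proof (cases "is_square D")
    case True
    obtain m where m: "m > 0" "sqrt (of_int D) = of_int m" using is_square_int_root[OF True assms] by blast
    have "((\<lambda>x. theta (real (nat m) * x)) has_integral 1 / 6) {0..1}"
      by (rule theta_has_integral) (use m in simp)
    then have "((\<lambda>x. theta (real (nat m) * x) / 2) has_integral 1 / 6 / 2) {0..1}"
      by (rule has_integral_divide)
    moreover have "real (nat m) = of_int m" using m by simp
    moreover have "cyc_tau D = (\<lambda>x. theta (of_int m * x) / 2)" using True m(2) by (auto simp: cyc_tau_def)
    ultimately show ?thesis using True by simp
  next
    case False
    then have "cyc_tau D = (\<lambda>x. 0)" by (auto simp: cyc_tau_def)
    then show ?thesis using False by simp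
  qed
  moreover have "((\<lambda>x::real. cyc_K D) has_integral cyc_K D) {0..1}"
    using has_integral_const_real[of "cyc_K D" 0 1] by simp
  ultimately show ?thesis by (rule has_integral_diff[rotated])
qed

lemma cyc_K_ge_tau: "cyc_K D \<ge> cyc_tau D x" if "D > 0"
proof (cases "is_square D")
  case True
  have "theta (sqrt (of_int D) * x) \<le> 1" by (rule theta_bounds)
  moreover have "real_of_int D \<ge> 1" using that by simp
  ultimately have "theta (sqrt (of_int D) * x) / 2 \<le> cyc_alpha D + of_int D / 2"
    using cyc_alpha_nonneg[of D] by linarith
  then show ?thesis using True unfolding cyc_K_def cyc_tau_def by simp
qed (use cyc_alpha_nonneg[of D] in \<open>simp add: cyc_K_def cyc_tau_def\<close>)

text \<open>The integral over a period is computed twice: termwise by unfolding, and from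
  \<open>cyc_K D - cyc_tau D x\<close>, which is known off the rationals and therefore almost
  everywhere.\<close>

theorem root_count_sums:
  assumes "D > 0"
  shows "(\<lambda>n. real (root_count D (Suc n)) / (real (Suc n))\<^sup>2) sums
     (6 / (of_int D * sqrt (of_int D)) * (cyc_K D - of_bool (is_square D) / 12))"
proof -
  let ?C = "of_int D * sqrt (of_int D) :: real"
  have C: "?C > 0" using assms by simp
  define f where "f n = real (root_count D (Suc n)) * (?C / (6 * (real (Suc n))\<^sup>2))" for n
  have f0: "f n \<ge> 0" for n using assms by (simp add: f_def)
  have "(\<Sum>n. ennreal (f n)) = (\<integral>\<^sup>+x. ennreal (cyc_F D x) * indicator {0..<1} x \<partial>lborel)"
    unfolding f_def by (rule cyc_F_integral[OF assms, symmetric])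
  also have "\<dots> = (\<integral>\<^sup>+x. ennreal (cyc_K D - cyc_tau D x) * indicator {0..1} x \<partial>lborel)"
  proof (rule nn_integral_cong_AE)
    have "AE x in lborel. x \<notin> (\<rat> :: real set)"
      by (intro AE_not_in countable_imp_null_set_lborel countable_rat)
    then show "AE x in lborel. ennreal (cyc_F D x) * indicator {0..<1} x = ennreal (cyc_K D - cyc_tau D x) * indicator {0..1} x"
    proof (rule AE_mp, intro AE_I2 impI)
      fix x :: real assume x: "x \<notin> \<rat>"
      then have "x \<noteq> 0" "x \<noteq> 1" by auto
      then show "ennreal (cyc_F D x) * indicator {0..<1} x = ennreal (cyc_K D - cyc_tau D x) * indicator {0..1} x"
        using cyc_F_irrational[OF assms _ x] by (auto simp: indicator_def)
    qed
  qed
  also have "\<dots> = ennreal (cyc_K D - of_bool (is_square D) / 12)"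
    by (rule nn_integral_has_integral_lebesgue'[OF _ cyc_tau_has_integral[OF assms]])
       (use cyc_K_ge_tau[OF assms] in auto)
  finally have e: "(\<Sum>n. ennreal (f n)) = ennreal (cyc_K D - of_bool (is_square D) / 12)" .
  have nn: "cyc_K D - of_bool (is_square D) / 12 \<ge> 0"
    by (rule has_integral_nonneg[OF cyc_tau_has_integral[OF assms]]) (use cyc_K_ge_tau[OF assms] in auto)
  have sm: "summable f" by (rule summable_suminf_not_top[OF f0]) (simp add: e)
  have "(\<Sum>n. ennreal (f n)) = ennreal (suminf f)" by (rule suminf_ennreal2[OF f0 sm])
  then have "suminf f = cyc_K D - of_bool (is_square D) / 12"
    using e nn suminf_nonneg[OF sm f0] by simp
  then have "f sums (cyc_K D - of_bool (is_square D) / 12)" using summable_sums[OF sm] by simp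
  then have "(\<lambda>n. 6 / ?C * f n) sums (6 / ?C * (cyc_K D - of_bool (is_square D) / 12))" by (rule sums_mult)
  moreover have "6 / ?C * f n = real (root_count D (Suc n)) / (real (Suc n))\<^sup>2" for n
    using C assms unfolding f_def by (simp add: field_simps)
  ultimately show ?thesis by simp
qed

section \<open>Square roots of D modulo 4n\<close>

lemma bij_betw_filter:
  assumes "bij_betw f A B" "\<And>x. x \<in> A \<Longrightarrow> P x \<longleftrightarrow> Q (f x)"
  shows "bij_betw f {x \<in> A. P x} {y \<in> B. Q y}"
  using assms unfolding bij_betw_def by (auto intro: inj_on_subset)

lemma affine_card:
  fixes c t n :: int
  assumes n: "n > 0" and co: "coprime c n" and per: "\<And>y. P (y mod n) = P y"
  shows "card {w\<in>{0..<n}. P (c * w + t)} = card {y\<in>{0..<n}. P y}"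
proof -
  let ?f = "\<lambda>w. (c * w + t) mod n"
  have inj: "inj_on ?f {0..<n}"
  proof (rule inj_onI)
    fix x y assume xy: "x \<in> {0..<n}" "y \<in> {0..<n}" "?f x = ?f y"
    then have "[c * x + t = c * y + t] (mod n)" by (simp add: cong_def)
    then have "[c * x = c * y] (mod n)" by (simp add: cong_add_rcancel)
    then have "[x = y] (mod n)" using co by (simp add: cong_mult_lcancel)
    then show "x = y" using xy by (simp add: cong_def)
  qed
  have "?f ` {0..<n} = {0..<n}"
    by (rule card_subset_eq) (use n inj in \<open>auto simp: card_image\<close>)
  then have bij: "bij_betw ?f {0..<n} {0..<n}" using inj by (simp add: bij_betw_def)
  have "bij_betw ?f {w\<in>{0..<n}. P (c * w + t)} {y\<in>{0..<n}. P y}"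
    by (rule bij_betw_filter[OF bij]) (simp add: per)
  then show ?thesis by (rule bij_betw_same_card)
qed

lemma periodic_card:
  fixes m k :: int
  assumes m: "m > 0" and k: "k \<ge> 0" and per: "\<And>y. P (y mod m) = P y"
  shows "card {x\<in>{0..<k * m}. P x} = nat k * card {x\<in>{0..<m}. P x}"
proof -
  have "bij_betw (\<lambda>(j, x). x + m * j) ({0..<k} \<times> {x\<in>{0..<m}. P x}) {x\<in>{0..<k * m}. P x}"
  proof (rule bij_betw_byWitness[of _ "\<lambda>y. (y div m, y mod m)"])
    show "(\<lambda>(j, x). x + m * j) ` ({0..<k} \<times> {x\<in>{0..<m}. P x}) \<subseteq> {x\<in>{0..<k * m}. P x}"
    proof safe
      fix j x assume j: "j \<in> {0..<k}" and x: "x \<in> {0..<m}" "P x"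
      have "m * (j + 1) \<le> m * k" using j m by (intro mult_left_mono) auto
      moreover have "0 \<le> m * j" using j m by simp
      ultimately show "x + m * j \<in> {0..<k * m}" using x by (simp add: algebra_simps)
      have "P ((x + m * j) mod m)" using x by simp
      then show "P (x + m * j)" by (simp only: per)
    qed
    have "y div m < k" if "y < k * m" for y
    proof (rule ccontr)
      assume "\<not> y div m < k"
      then have "m * k \<le> m * (y div m)" using m by (intro mult_left_mono) auto
      moreover have "m * (y div m) + y mod m = y" by simp
      moreover have "0 \<le> y mod m" using m by simp
      ultimately show False using that by (simp add: mult.commute)
    qed
    then show "(\<lambda>y. (y div m, y mod m)) ` {x\<in>{0..<k * m}. P x} \<subseteq> {0..<k} \<times> {x\<in>{0..<m}. P x}"
      using m by (auto simp: per pos_imp_zdiv_nonneg_iff)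
  qed (use m in auto)
  then have "card {x\<in>{0..<k * m}. P x} = card ({0..<k} \<times> {x\<in>{0..<m}. P x})"
    by (rule bij_betw_same_card[symmetric])
  then show ?thesis by (simp add: card_cartesian_product)
qed

lemma quadratic_cong:
  "[x = y] (mod n) \<Longrightarrow> (n dvd x\<^sup>2 + \<beta> * x + \<gamma>) = (n dvd y\<^sup>2 + \<beta> * y + \<gamma>)" for n x y \<beta> \<gamma> :: int
  by (intro cong_dvd_iff cong_add cong_mult cong_pow) auto

lemma quadratic_mod:
  "(n dvd (x mod n)\<^sup>2 + \<beta> * (x mod n) + \<gamma>) = (n dvd x\<^sup>2 + \<beta> * x + \<gamma>)" for n x \<beta> \<gamma> :: int
  by (rule quadratic_cong) (simp add: cong_def)

lemma square_mod_4: "x\<^sup>2 mod 4 = 0 \<or> x\<^sup>2 mod 4 = 1" for x :: int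
proof (cases "even x")
  case True
  then obtain k where "x = 2 * k" by blast
  then show ?thesis by (simp add: power_mult_distrib)
next
  case False
  then obtain k where "x = 2 * k + 1" by (elim oddE)
  then have "x\<^sup>2 = 1 + 4 * (k\<^sup>2 + k)" by (simp add: power2_eq_square algebra_simps)
  then have "x\<^sup>2 mod 4 = 1 mod 4" by (simp only: mod_mult_self2)
  then show ?thesis by simp
qed

lemma disc_quadratic:
  fixes D :: int
  assumes "D mod 4 = 0 \<or> D mod 4 = 1"
  obtains \<beta> \<gamma> where "\<beta>\<^sup>2 - 4 * \<gamma> = D"
proof -
  have "(D mod 4)\<^sup>2 - 4 * (- (D div 4)) = D" using assms
  proof
    assume *: "D mod 4 = 0"
    then have "4 * (D div 4) = D" using mult_div_mod_eq[of 4 D] by simp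
    then show ?thesis using * by simp
  next
    assume *: "D mod 4 = 1"
    then have "4 * (D div 4) + 1 = D" using mult_div_mod_eq[of 4 D] by simp
    then show ?thesis using * by simp
  qed
  then show ?thesis by (rule that)
qed

text \<open>With \<open>b = 2 * w + \<beta>\<close> one has
  \<open>b\<^sup>2 - D = 4 * (w\<^sup>2 + \<beta> * w + \<gamma>)\<close>. This removes the modulus
  \<open>4 n\<close> and with it most of the special role of the prime 2.\<close>

lemma root_count_quadratic:
  assumes n: "n > 0" and D: "\<beta>\<^sup>2 - 4 * \<gamma> = D"
  shows "root_count D n = card {w\<in>{0..<int n}. int n dvd w\<^sup>2 + \<beta> * w + \<gamma>}"
proof -
  have r: "2 * w + \<beta> \<in> root_set D n \<longleftrightarrow> int n dvd w\<^sup>2 + \<beta> * w + \<gamma>" for w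
  proof -
    have eq: "(2 * w + \<beta>)\<^sup>2 - D = 4 * (w\<^sup>2 + \<beta> * w + \<gamma>)"
      unfolding D[symmetric] by (simp add: power2_eq_square algebra_simps)
    show ?thesis unfolding root_set_def mem_Collect_eq eq by (simp only: dvd_mult_cancel_left) simp
  qed
  have rm: "b mod (2 * int n) \<in> root_set D n \<longleftrightarrow> b \<in> root_set D n" for b
    using root_set_shift[of "b mod (2 * int n)" n "b div (2 * int n)" D] by simp
  have ev: "\<exists>u. b = 2 * u + \<beta>" if "b \<in> root_set D n" for b
  proof -
    have "4 dvd b\<^sup>2 - D" using that unfolding root_set_def by (auto dest: dvd_mult_left)
    then have "4 dvd (b\<^sup>2 - D) - 4 * \<gamma>" by (rule dvd_diff) simp
    also have "(b\<^sup>2 - D) - 4 * \<gamma> = b\<^sup>2 - \<beta>\<^sup>2" using D by linarith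
    finally have "4 dvd b\<^sup>2 - \<beta>\<^sup>2" .
    then have "even (b\<^sup>2 - \<beta>\<^sup>2)" by (rule dvd_trans[rotated]) simp
    then have "even (b - \<beta>)" by simp
    then obtain u where "b - \<beta> = 2 * u" by blast
    then show ?thesis by (intro exI[of _ u]) simp
  qed
  have shift: "(x - m * k) mod m = x mod m" for x m k :: int by (simp add: mod_eq_dvd_iff)
  have "bij_betw (\<lambda>w. (2 * w + \<beta>) mod (2 * int n)) {w\<in>{0..<int n}. int n dvd w\<^sup>2 + \<beta> * w + \<gamma>} (root_set D n \<inter> {0..<2 * int n})"
  proof (rule bij_betw_byWitness[of _ "\<lambda>b. ((b - \<beta>) div 2) mod int n"])
    show "\<forall>w\<in>{w\<in>{0..<int n}. int n dvd w\<^sup>2 + \<beta> * w + \<gamma>}. (((2 * w + \<beta>) mod (2 * int n) - \<beta>) div 2) mod int n = w"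
    proof
      fix w assume w: "w \<in> {w\<in>{0..<int n}. int n dvd w\<^sup>2 + \<beta> * w + \<gamma>}"
      define k where "k = (2 * w + \<beta>) div (2 * int n)"
      have "(2 * w + \<beta>) mod (2 * int n) = 2 * w + \<beta> - 2 * int n * k" by (simp add: k_def minus_mult_div_eq_mod)
      then have "(2 * w + \<beta>) mod (2 * int n) - \<beta> = 2 * (w - int n * k)" by (simp add: algebra_simps)
      then have "((2 * w + \<beta>) mod (2 * int n) - \<beta>) div 2 = w - int n * k" by simp
      then show "(((2 * w + \<beta>) mod (2 * int n) - \<beta>) div 2) mod int n = w"
        using w shift[of w "int n" k] by simp
    qed
    have inv: "(2 * (((b - \<beta>) div 2) mod int n) + \<beta>) mod (2 * int n) = b \<and>
       ((b - \<beta>) div 2) mod int n \<in> {w\<in>{0..<int n}. int n dvd w\<^sup>2 + \<beta> * w + \<gamma>}"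
      if b: "b \<in> root_set D n" "0 \<le> b" "b < 2 * int n" for b
    proof -
      obtain u where u: "b = 2 * u + \<beta>" using ev[OF b(1)] by blast
      have d: "(b - \<beta>) div 2 = u" unfolding u by simp
      have "int n dvd u\<^sup>2 + \<beta> * u + \<gamma>" using b(1) unfolding u r .
      then have "u mod int n \<in> {w\<in>{0..<int n}. int n dvd w\<^sup>2 + \<beta> * w + \<gamma>}" using n by (simp add: quadratic_mod)
      moreover have "2 * (u mod int n) + \<beta> = b - 2 * int n * (u div int n)"
        unfolding u by (simp add: minus_mult_div_eq_mod[symmetric] algebra_simps)
      then have "(2 * (u mod int n) + \<beta>) mod (2 * int n) = b mod (2 * int n)"
        by (simp only: shift)
      ultimately show ?thesis unfolding d using b by simp
    qed
    show "\<forall>b\<in>root_set D n \<inter> {0..<2 * int n}. (2 * (((b - \<beta>) div 2) mod int n) + \<beta>) mod (2 * int n) = b"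
    proof
      fix b assume "b \<in> root_set D n \<inter> {0..<2 * int n}"
      then have "b \<in> root_set D n" "0 \<le> b" "b < 2 * int n" by simp_all
      from inv[OF this] show "(2 * (((b - \<beta>) div 2) mod int n) + \<beta>) mod (2 * int n) = b" ..
    qed
    show "(\<lambda>b. ((b - \<beta>) div 2) mod int n) ` (root_set D n \<inter> {0..<2 * int n}) \<subseteq> {w\<in>{0..<int n}. int n dvd w\<^sup>2 + \<beta> * w + \<gamma>}"
    proof (rule image_subsetI)
      fix b assume "b \<in> root_set D n \<inter> {0..<2 * int n}"
      then have "b \<in> root_set D n" "0 \<le> b" "b < 2 * int n" by simp_all
      from inv[OF this] show "((b - \<beta>) div 2) mod int n \<in> {w\<in>{0..<int n}. int n dvd w\<^sup>2 + \<beta> * w + \<gamma>}" ..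
    qed
    show "(\<lambda>w. (2 * w + \<beta>) mod (2 * int n)) ` {w\<in>{0..<int n}. int n dvd w\<^sup>2 + \<beta> * w + \<gamma>} \<subseteq> root_set D n \<inter> {0..<2 * int n}"
    proof (rule image_subsetI)
      fix w assume "w \<in> {w\<in>{0..<int n}. int n dvd w\<^sup>2 + \<beta> * w + \<gamma>}"
      then have "2 * w + \<beta> \<in> root_set D n" unfolding r by simp
      then have "(2 * w + \<beta>) mod (2 * int n) \<in> root_set D n" unfolding rm .
      then show "(2 * w + \<beta>) mod (2 * int n) \<in> root_set D n \<inter> {0..<2 * int n}" using n by simp
    qed
  qed
  then show ?thesis unfolding root_count_def by (rule bij_betw_same_card[symmetric])
qed

lemma root_count_scale:
  assumes "n > 0" "D mod 4 = 0 \<or> D mod 4 = 1" "coprime l (int n)"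
  shows "root_count (D * l\<^sup>2) n = root_count D n"
proof -
  obtain \<beta> \<gamma> where D: "\<beta>\<^sup>2 - 4 * \<gamma> = D" using disc_quadratic[OF assms(2)] .
  have scale: "(int n dvd (l * w + 0)\<^sup>2 + (l * \<beta>) * (l * w + 0) + l\<^sup>2 * \<gamma>) = (int n dvd w\<^sup>2 + \<beta> * w + \<gamma>)" for w
  proof -
    have "(l * w + 0)\<^sup>2 + (l * \<beta>) * (l * w + 0) + l\<^sup>2 * \<gamma> = l\<^sup>2 * (w\<^sup>2 + \<beta> * w + \<gamma>)"
      by (simp add: power2_eq_square algebra_simps)
    moreover have "coprime (int n) (l\<^sup>2)" using assms(3) by (simp add: coprime_commute)
    ultimately show ?thesis by (simp only: coprime_dvd_mult_right_iff)
  qed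
  have "(l * \<beta>)\<^sup>2 - 4 * (l\<^sup>2 * \<gamma>) = D * l\<^sup>2" unfolding D[symmetric] by (simp add: power_mult_distrib algebra_simps)
  then have "root_count (D * l\<^sup>2) n = card {y\<in>{0..<int n}. int n dvd y\<^sup>2 + (l * \<beta>) * y + l\<^sup>2 * \<gamma>}"
    by (rule root_count_quadratic[OF assms(1)])
  also have "\<dots> = card {w\<in>{0..<int n}. int n dvd (l * w + 0)\<^sup>2 + (l * \<beta>) * (l * w + 0) + l\<^sup>2 * \<gamma>}"
    by (rule affine_card[symmetric]) (use assms quadratic_mod in auto)
  also have "\<dots> = root_count D n"
    unfolding scale by (rule root_count_quadratic[OF assms(1) D, symmetric])
  finally show ?thesis .
qed

text \<open>A root \<open>y\<close> satisfies \<open>p dvd y\<^sup>2\<close>, hence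
  \<open>y = p * x\<close>; two factors \<open>p\<close> come out of the polynomial, and one of them
  is used up by the modulus.\<close>

lemma root_count_scale_prime:
  assumes p: "prime p" and n: "n > 0" and D: "\<beta>\<^sup>2 - 4 * \<gamma> = D"
  shows "root_count (D * (int p)\<^sup>2) (p * n) = card {x\<in>{0..<int n}. int n dvd int p * (x\<^sup>2 + \<beta> * x + \<gamma>)}"
proof -
  have p0: "int p > 0" using p prime_gt_0_nat by simp
  have "(int p * \<beta>)\<^sup>2 - 4 * ((int p)\<^sup>2 * \<gamma>) = D * (int p)\<^sup>2" unfolding D[symmetric] by (simp add: power_mult_distrib algebra_simps)
  then have 1: "root_count (D * (int p)\<^sup>2) (p * n) = card {y\<in>{0..<int (p * n)}. int (p * n) dvd y\<^sup>2 + (int p * \<beta>) * y + (int p)\<^sup>2 * \<gamma>}"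
    by (intro root_count_quadratic) (use n p prime_gt_0_nat in auto)
  have key: "int (p * n) dvd (int p * x)\<^sup>2 + (int p * \<beta>) * (int p * x) + (int p)\<^sup>2 * \<gamma> \<longleftrightarrow> int n dvd int p * (x\<^sup>2 + \<beta> * x + \<gamma>)" for x
  proof -
    have "(int p * x)\<^sup>2 + (int p * \<beta>) * (int p * x) + (int p)\<^sup>2 * \<gamma> = int p * (int p * (x\<^sup>2 + \<beta> * x + \<gamma>))"
      by (simp add: power2_eq_square algebra_simps)
    then show ?thesis using p0 by simp
  qed
  have "bij_betw (\<lambda>x. int p * x) {x\<in>{0..<int n}. int n dvd int p * (x\<^sup>2 + \<beta> * x + \<gamma>)}
      {y\<in>{0..<int (p * n)}. int (p * n) dvd y\<^sup>2 + (int p * \<beta>) * y + (int p)\<^sup>2 * \<gamma>}"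
  proof (rule bij_betw_byWitness[of _ "\<lambda>y. y div int p"])
    have dvd: "\<exists>x. y = int p * x" if "int (p * n) dvd y\<^sup>2 + (int p * \<beta>) * y + (int p)\<^sup>2 * \<gamma>" for y
    proof -
      have "int p dvd y\<^sup>2 + (int p * \<beta>) * y + (int p)\<^sup>2 * \<gamma>" using that by (metis dvd_mult_left of_nat_mult)
      moreover have "int p dvd int p * (\<beta> * y + int p * \<gamma>)" by simp
      ultimately have "int p dvd (y\<^sup>2 + (int p * \<beta>) * y + (int p)\<^sup>2 * \<gamma>) - int p * (\<beta> * y + int p * \<gamma>)"
        by (rule dvd_diff)
      then have "int p dvd y\<^sup>2" by (simp add: power2_eq_square algebra_simps)
      then have "int p dvd y" using p prime_dvd_power[of "int p" y 2] by simp
      then show ?thesis by blast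
    qed
    show "\<forall>y\<in>{y\<in>{0..<int (p * n)}. int (p * n) dvd y\<^sup>2 + (int p * \<beta>) * y + (int p)\<^sup>2 * \<gamma>}. int p * (y div int p) = y"
    proof
      fix y assume "y \<in> {y\<in>{0..<int (p * n)}. int (p * n) dvd y\<^sup>2 + (int p * \<beta>) * y + (int p)\<^sup>2 * \<gamma>}"
      then obtain z where "y = int p * z" using dvd[of y] by auto
      then show "int p * (y div int p) = y" using p0 by simp
    qed
    show "(\<lambda>y. y div int p) ` {y\<in>{0..<int (p * n)}. int (p * n) dvd y\<^sup>2 + (int p * \<beta>) * y + (int p)\<^sup>2 * \<gamma>} \<subseteq>
       {x\<in>{0..<int n}. int n dvd int p * (x\<^sup>2 + \<beta> * x + \<gamma>)}"
    proof
      fix x assume "x \<in> (\<lambda>y. y div int p) ` {y\<in>{0..<int (p * n)}. int (p * n) dvd y\<^sup>2 + (int p * \<beta>) * y + (int p)\<^sup>2 * \<gamma>}"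
      then obtain y where y: "x = y div int p" "0 \<le> y" "y < int (p * n)" "int (p * n) dvd y\<^sup>2 + (int p * \<beta>) * y + (int p)\<^sup>2 * \<gamma>"
        by auto
      obtain z where z: "y = int p * z" using dvd[OF y(4)] by blast
      have xz: "x = z" using y(1) z p0 by simp
      have "0 \<le> z" "z < int n" using y(2,3) p0 unfolding z by (simp_all add: zero_le_mult_iff)
      then show "x \<in> {x\<in>{0..<int n}. int n dvd int p * (x\<^sup>2 + \<beta> * x + \<gamma>)}" using y(4) unfolding z key xz by simp
    qed
    show "(\<lambda>x. int p * x) ` {x\<in>{0..<int n}. int n dvd int p * (x\<^sup>2 + \<beta> * x + \<gamma>)} \<subseteq>
      {y\<in>{0..<int (p * n)}. int (p * n) dvd y\<^sup>2 + (int p * \<beta>) * y + (int p)\<^sup>2 * \<gamma>}"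
    proof (rule image_subsetI)
      fix x assume x: "x \<in> {x\<in>{0..<int n}. int n dvd int p * (x\<^sup>2 + \<beta> * x + \<gamma>)}"
      then have "int p * x < int p * int n" using p0 by simp
      then show "int p * x \<in> {y\<in>{0..<int (p * n)}. int (p * n) dvd y\<^sup>2 + (int p * \<beta>) * y + (int p)\<^sup>2 * \<gamma>}"
        using x p0 unfolding mem_Collect_eq key by simp
    qed
  qed (use p0 in auto)
  then show ?thesis unfolding 1 by (rule bij_betw_same_card[symmetric])
qed

lemma root_count_scale_prime_coprime:
  assumes p: "prime p" and n: "n > 0" "\<not> p dvd n" and D: "D mod 4 = 0 \<or> D mod 4 = 1"
  shows "root_count (D * (int p)\<^sup>2) (p * n) = root_count D n"
proof -
  obtain \<beta> \<gamma> where bg: "\<beta>\<^sup>2 - 4 * \<gamma> = D" using disc_quadratic[OF D] .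
  have "coprime (int n) (int p)" using prime_imp_coprime[OF p n(2)] by (simp add: coprime_commute)
  then show ?thesis unfolding root_count_scale_prime[OF p n(1) bg] root_count_quadratic[OF n(1) bg]
    by (simp add: coprime_dvd_mult_right_iff)
qed

lemma root_count_scale_prime_mult:
  assumes p: "prime p" and n: "n > 0" and D: "D mod 4 = 0 \<or> D mod 4 = 1"
  shows "root_count (D * (int p)\<^sup>2) (p * (p * n)) = p * root_count D n"
proof -
  obtain \<beta> \<gamma> where bg: "\<beta>\<^sup>2 - 4 * \<gamma> = D" using disc_quadratic[OF D] .
  have p0: "p > 0" using p prime_gt_0_nat by blast
  have "root_count (D * (int p)\<^sup>2) (p * (p * n)) = card {x\<in>{0..<int (p * n)}. int (p * n) dvd int p * (x\<^sup>2 + \<beta> * x + \<gamma>)}"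
    by (rule root_count_scale_prime[OF p _ bg]) (use n p0 in simp)
  also have "\<dots> = card {x\<in>{0..<int p * int n}. int n dvd x\<^sup>2 + \<beta> * x + \<gamma>}" using p0 by simp
  also have "\<dots> = nat (int p) * card {x\<in>{0..<int n}. int n dvd x\<^sup>2 + \<beta> * x + \<gamma>}"
    by (rule periodic_card) (use n quadratic_mod in auto)
  finally show ?thesis unfolding root_count_quadratic[OF n bg] by simp
qed

lemma root_count_coprime_mult:
  assumes mn: "m > 0" "n > 0" "coprime m n" and D: "D mod 4 = 0 \<or> D mod 4 = 1"
  shows "root_count D (m * n) = root_count D m * root_count D n"
proof -
  obtain \<beta> \<gamma> where bg: "\<beta>\<^sup>2 - 4 * \<gamma> = D" using disc_quadratic[OF D] .
  let ?q = "\<lambda>w. w\<^sup>2 + \<beta> * w + \<gamma>"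
  let ?f = "\<lambda>x. (x mod int m, x mod int n)"
  have co: "coprime (int m) (int n)" using mn(3) by simp
  have inj: "inj_on ?f {0..<int (m * n)}"
  proof (rule inj_onI)
    fix x y assume xy: "x \<in> {0..<int (m * n)}" "y \<in> {0..<int (m * n)}" "?f x = ?f y"
    then have "[x = y] (mod int m)" "[x = y] (mod int n)" by (simp_all add: cong_def)
    then have "[x = y] (mod (int m * int n))" using co by (rule coprime_cong_mult)
    then show "x = y" using xy by (simp add: cong_def)
  qed
  have "?f ` {0..<int (m * n)} = {0..<int m} \<times> {0..<int n}"
    by (rule card_subset_eq) (use mn inj in \<open>auto simp: card_image card_cartesian_product nat_mult_distrib\<close>)
  then have bij: "bij_betw ?f {0..<int (m * n)} ({0..<int m} \<times> {0..<int n})" using inj by (simp add: bij_betw_def)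
  have "bij_betw ?f {x\<in>{0..<int (m * n)}. int (m * n) dvd ?q x}
      {z\<in>{0..<int m} \<times> {0..<int n}. int m dvd ?q (fst z) \<and> int n dvd ?q (snd z)}"
  proof (rule bij_betw_filter[OF bij])
    fix x
    have "int (m * n) dvd ?q x \<longleftrightarrow> int m dvd ?q x \<and> int n dvd ?q x"
      using co divides_mult[of "int m" "?q x" "int n"] by (auto dest: dvd_mult_left dvd_mult_right)
    then show "int (m * n) dvd ?q x \<longleftrightarrow> int m dvd ?q (fst (?f x)) \<and> int n dvd ?q (snd (?f x))"
      by (simp only: fst_conv snd_conv quadratic_mod)
  qed
  note b1 = bij_betw_same_card[OF this]
  have e: "{z\<in>{0..<int m} \<times> {0..<int n}. int m dvd ?q (fst z) \<and> int n dvd ?q (snd z)} =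
     {x\<in>{0..<int m}. int m dvd ?q x} \<times> {y\<in>{0..<int n}. int n dvd ?q y}" by auto
  have "card {x\<in>{0..<int (m * n)}. int (m * n) dvd ?q x} = card ({x\<in>{0..<int m}. int m dvd ?q x} \<times> {y\<in>{0..<int n}. int n dvd ?q y})"
    using b1 unfolding e .
  then show ?thesis using mn root_count_quadratic[OF _ bg] by (simp add: card_cartesian_product)
qed

lemma root_count_eq_0_dvd:
  assumes "m dvd n" "n > 0" "root_count D m = 0" and D: "D mod 4 = 0 \<or> D mod 4 = 1"
  shows "root_count D n = 0"
proof -
  obtain \<beta> \<gamma> where bg: "\<beta>\<^sup>2 - 4 * \<gamma> = D" using disc_quadratic[OF D] .
  have m: "m > 0" using assms(1,2) by (meson dvd_pos_nat)
  have none: "\<not> int m dvd w\<^sup>2 + \<beta> * w + \<gamma>" for w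
  proof
    assume "int m dvd w\<^sup>2 + \<beta> * w + \<gamma>"
    then have "w mod int m \<in> {w\<in>{0..<int m}. int m dvd w\<^sup>2 + \<beta> * w + \<gamma>}" using m by (simp add: quadratic_mod)
    then have "{w\<in>{0..<int m}. int m dvd w\<^sup>2 + \<beta> * w + \<gamma>} \<noteq> {}" by blast
    moreover have "finite {w\<in>{0..<int m}. int m dvd w\<^sup>2 + \<beta> * w + \<gamma>}"
      by (rule finite_subset[of _ "{0..<int m}"]) auto
    ultimately have "card {w\<in>{0..<int m}. int m dvd w\<^sup>2 + \<beta> * w + \<gamma>} \<noteq> 0"
      using card_0_eq by blast
    then show False using assms(3) unfolding root_count_quadratic[OF m bg] by blast
  qed
  have "\<not> int n dvd w\<^sup>2 + \<beta> * w + \<gamma>" for w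
    using none[of w] assms(1) dvd_trans[of "int m" "int n"] by auto
  then show ?thesis unfolding root_count_quadratic[OF assms(2) bg] by simp
qed

text \<open>At a root the derivative satisfies
  \<open>(2 * x + \<beta>)\<^sup>2 = 4 * q x + D\<close>, where \<open>q\<close> is the quadratic
  polynomial, so it is a unit modulo \<open>p\<close>, also for \<open>p = 2\<close>. Every root
  modulo \<open>a\<close> then lifts uniquely.\<close>

lemma root_count_hensel:
  assumes p: "prime p" "\<not> int p dvd D" and a: "a > 0" "p dvd a" and D: "D mod 4 = 0 \<or> D mod 4 = 1"
  shows "root_count D (p * a) = root_count D a"
proof -
  obtain \<beta> \<gamma> where bg: "\<beta>\<^sup>2 - 4 * \<gamma> = D" using disc_quadratic[OF D] .
  let ?q = "\<lambda>w. w\<^sup>2 + \<beta> * w + \<gamma>"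
  have p0: "int p > 0" and pp: "prime (int p)" and a0: "int a > 0" using p(1) prime_gt_0_nat a by auto
  have pa: "int p dvd int a" using a(2) by simp
  have unit: "\<not> int p dvd 2 * x + \<beta>" if "int a dvd ?q x" for x
  proof
    assume "int p dvd 2 * x + \<beta>"
    then have "int p dvd (2 * x + \<beta>)\<^sup>2" by (simp add: power2_eq_square)
    moreover have "int p dvd 4 * ?q x" using that pa by (meson dvd_mult dvd_trans)
    ultimately have "int p dvd (2 * x + \<beta>)\<^sup>2 - 4 * ?q x" by (rule dvd_diff)
    also have "(2 * x + \<beta>)\<^sup>2 - 4 * ?q x = D" unfolding bg[symmetric] by (simp add: power2_eq_square algebra_simps)
    finally show False using p(2) by blast
  qed
  have exp: "?q (x + int a * j) = ?q x + int a * (j * (2 * x + \<beta>)) + int a * int a * j\<^sup>2" for x j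
    by (simp add: power2_eq_square algebra_simps)
  let ?A = "{y\<in>{0..<int (p * a)}. int (p * a) dvd ?q y}"
  let ?B = "{x\<in>{0..<int a}. int a dvd ?q x}"
  have "inj_on (\<lambda>y. y mod int a) ?A"
  proof (rule inj_onI)
    fix y z assume y: "y \<in> ?A" and z: "z \<in> ?A" and e: "y mod int a = z mod int a"
    have "int a dvd z - y" using e by (simp add: mod_eq_dvd_iff[symmetric])
    then obtain k where "z - y = int a * k" by blast
    then have k: "z = y + int a * k" by simp
    have y1: "int (p * a) dvd ?q y" using y by simp
    have "int (p * a) dvd ?q z - ?q y" using y z by (intro dvd_diff) auto
    also have "?q z - ?q y = int a * (k * (2 * y + \<beta>) + int a * k\<^sup>2)" unfolding k exp by (simp add: algebra_simps)
    finally have "int p dvd k * (2 * y + \<beta>) + int a * k\<^sup>2" using a0 by (simp add: mult.commute[of "int p"])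
    moreover have "int p dvd int a * k\<^sup>2" using pa by simp
    ultimately have "int p dvd k * (2 * y + \<beta>)" by (simp add: dvd_add_left_iff)
    moreover have "int a dvd ?q y" using y1 by (metis dvd_mult_right of_nat_mult)
    ultimately have "int p dvd k" using unit prime_dvd_mult_iff[OF pp] by blast
    then have "int p * int a dvd k * int a" by (rule mult_dvd_mono) simp
    then have "int (p * a) dvd z - y" unfolding k by (simp add: mult.commute)
    then have "z mod int (p * a) = y mod int (p * a)" by (simp only: mod_eq_dvd_iff)
    then show "y = z" using y z by simp
  qed
  moreover have "(\<lambda>y. y mod int a) ` ?A = ?B"
  proof (intro equalityI subsetI)
    fix x assume "x \<in> (\<lambda>y. y mod int a) ` ?A"
    then obtain y where y: "x = y mod int a" "int (p * a) dvd ?q y" by auto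
    have "int a dvd ?q y" using y(2) by (metis dvd_mult_right of_nat_mult)
    then show "x \<in> ?B" unfolding y(1) using a0 by (simp add: quadratic_mod)
  next
    fix x assume x: "x \<in> ?B"
    then obtain e where e: "?q x = int a * e" by auto
    have "coprime (2 * x + \<beta>) (int p)"
      by (subst coprime_commute, rule prime_imp_coprime[OF pp unit]) (use x in simp)
    \<comment> \<open>The lift \<open>x + a * j\<close> requires
      \<open>e + j * (2 * x + \<beta>)\<close> to vanish modulo \<open>p\<close>, solved by
      \<open>j = - e * v\<close>; the quadratic term drops out because
      \<open>p dvd a\<close>.\<close>
    then obtain v where v: "[(2 * x + \<beta>) * v = 1] (mod int p)" using cong_solve_coprime_int by blast
    then have "int p dvd (2 * x + \<beta>) * v - 1" by (simp add: cong_iff_dvd_diff)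
    then have "int p dvd - e * ((2 * x + \<beta>) * v - 1)" by (rule dvd_mult)
    then have "int p dvd e + (- e * v) * (2 * x + \<beta>)" by (simp add: algebra_simps)
    moreover have "int p dvd int a * (- e * v)\<^sup>2" using pa by (rule dvd_mult2)
    ultimately have "int p dvd (e + (- e * v) * (2 * x + \<beta>)) + int a * (- e * v)\<^sup>2"
      by (rule dvd_add)
    then have d: "int a * int p dvd int a * ((e + (- e * v) * (2 * x + \<beta>)) + int a * (- e * v)\<^sup>2)"
      by (intro mult_dvd_mono) auto
    define y where "y = x + int a * (- e * v)"
    have "?q y = int a * ((e + (- e * v) * (2 * x + \<beta>)) + int a * (- e * v)\<^sup>2)"
      unfolding y_def exp e by (simp only: distrib_left mult.assoc)
    then have "int (p * a) dvd ?q y" using d by (simp add: mult.commute)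
    then have "y mod int (p * a) \<in> ?A" using p0 a0 quadratic_mod[of "int (p * a)" y] by (simp add: p(1) prime_gt_0_nat)
    moreover have "(y mod int (p * a)) mod int a = x"
    proof -
      have "(y mod int (p * a)) mod int a = y mod int a" by (rule mod_mod_cancel) simp
      also have "\<dots> = x mod int a" unfolding y_def by (rule mod_mult_self2)
      also have "\<dots> = x" using x by simp
      finally show ?thesis .
    qed
    ultimately show "x \<in> (\<lambda>y. y mod int a) ` ?A" by (intro image_eqI[OF sym])
  qed
  ultimately have "card ?A = card ?B" using card_image[of "\<lambda>y. y mod int a" ?A] by simp
  then show ?thesis using root_count_quadratic[OF a(1) bg] root_count_quadratic[OF _ bg, of "p * a"] p0 a by simp
qed

text \<open>For \<open>p = 2\<close> the four candidates \<open>b\<close> are checked modulo 8; for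
  odd \<open>p\<close> completing the square leaves the count of square roots of
  \<open>D\<close>.\<close>

lemma root_count_prime:
  assumes p: "prime p" and D: "D mod 4 = 0 \<or> D mod 4 = 1"
  shows "int (root_count D p) = 1 + kronecker_prime D p"
proof (cases "p = 2")
  case True
  have set: "{0..<2 * int 2} = {0, 1, 2, 3::int}" by auto
  have "int (root_count D 2) = of_bool (8 dvd 0 - D) + of_bool (8 dvd 1 - D) + of_bool (8 dvd 4 - D) + of_bool (8 dvd 9 - D)"
    unfolding root_count_def root_set_def set by (simp add: Int_insert_right)
  moreover have "D mod 8 = 0 \<or> D mod 8 = 4 \<or> D mod 8 = 1 \<or> D mod 8 = 5" using D by presburger
  moreover have "(8 dvd 0 - D) = (D mod 8 = 0)" "(8 dvd 1 - D) = (D mod 8 = 1)" "(8 dvd 4 - D) = (D mod 8 = 4)" "(8 dvd 9 - D) = (D mod 8 = 1)"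
    "even D = (D mod 8 = 0 \<or> D mod 8 = 4 \<or> D mod 8 = 2 \<or> D mod 8 = 6)"
    by presburger+
  ultimately show ?thesis unfolding True kronecker_prime_def by (elim disjE) simp_all
next
  case False
  then have p2: "2 < p" using p prime_ge_2_nat[of p] by simp
  have pp: "prime (int p)" using p by simp
  have co: "coprime 2 (int p)" using p p2 prime_odd_nat by (simp add: coprime_left_2_iff_odd)
  obtain \<beta> \<gamma> where bg: "\<beta>\<^sup>2 - 4 * \<gamma> = D" using disc_quadratic[OF D] .
  have sq: "(int p dvd w\<^sup>2 + \<beta> * w + \<gamma>) = ((2 * w + \<beta>)\<^sup>2 mod int p = D mod int p)" for w
  proof -
    have "odd p" using p p2 prime_odd_nat by simp
    then have "coprime (int p) 2" by (simp add: coprime_right_2_iff_odd)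
    then have "coprime (int p) 4" using coprime_power_right_iff[of "int p" 2 2] by simp
    then have "int p dvd w\<^sup>2 + \<beta> * w + \<gamma> \<longleftrightarrow> int p dvd 4 * (w\<^sup>2 + \<beta> * w + \<gamma>)"
      by (simp only: coprime_dvd_mult_right_iff)
    also have "4 * (w\<^sup>2 + \<beta> * w + \<gamma>) = (2 * w + \<beta>)\<^sup>2 - D"
      unfolding bg[symmetric] by (simp add: power2_eq_square algebra_simps)
    finally show ?thesis by (simp only: mod_eq_dvd_iff)
  qed
  have "root_count D p = card {w\<in>{0..<int p}. int p dvd w\<^sup>2 + \<beta> * w + \<gamma>}"
    by (rule root_count_quadratic[OF _ bg]) (use p2 in simp)
  also have "\<dots> = card {w\<in>{0..<int p}. (2 * w + \<beta>)\<^sup>2 mod int p = D mod int p}" unfolding sq ..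
  also have "\<dots> = card {y\<in>{0..<int p}. y\<^sup>2 mod int p = D mod int p}"
    by (rule affine_card) (use p2 co in \<open>auto simp: power_mod\<close>)
  finally have "int (root_count D p) = int (card {y\<in>{0..<int p}. y\<^sup>2 mod int p = D mod int p})" by simp
  also have "\<dots> = 1 + Legendre (D mod int p) (int p)"
    by (rule card_square_roots_mod_prime[OF p p2]) (use p2 in simp)
  finally show ?thesis using False by (simp add: legendre_mod kronecker_prime_def)
qed

text \<open>A root would have \<open>p dvd b\<close>, making \<open>D\<close> divisible by
  \<open>p\<^sup>2\<close>, or for \<open>p = 2\<close> making \<open>D div 4\<close> a square
  modulo 4; both contradict that \<open>D\<close> is fundamental.\<close>

lemma root_count_prime_square:
  assumes p: "prime p" "int p dvd D" and D: "fundamental_discriminant D"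
  shows "root_count D (p * p) = 0"
proof -
  have pp: "prime (int p)" using p by simp
  have "b \<notin> root_set D (p * p)" for b
  proof
    assume "b \<in> root_set D (p * p)"
    then have b: "4 * (int p * int p) dvd b\<^sup>2 - D" by (simp add: root_set_def)
    show False
    proof (cases "p = 2")
      case True
      then have "even D" using p(2) by simp
      then have "D mod 4 \<noteq> 1" by presburger
      then obtain m where m: "D = 4 * m" "m mod 4 = 2 \<or> m mod 4 = 3"
        using D unfolding fundamental_discriminant_def by auto
      have "16 dvd b\<^sup>2 - 4 * m" using b True m by simp
      then obtain k where "b\<^sup>2 - 4 * m = 16 * k" by blast
      then have "b\<^sup>2 = 2 * (8 * k + 2 * m)" by simp
      then have "even (b\<^sup>2)" by simp
      then obtain c where c: "b = 2 * c" by auto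
      have "16 dvd 4 * (c\<^sup>2 - m)" using \<open>16 dvd b\<^sup>2 - 4 * m\<close> unfolding c by (simp add: power_mult_distrib right_diff_distrib)
      then obtain l where "4 * (c\<^sup>2 - m) = 16 * l" by blast
      then have "c\<^sup>2 - m = 4 * l" by simp
      then have "4 dvd c\<^sup>2 - m" by simp
      then have "c\<^sup>2 mod 4 = m mod 4" by (simp only: mod_eq_dvd_iff)
      then show False using m(2) square_mod_4[of c] by linarith
    next
      case False
      have co: "coprime (int p) 4"
      proof -
        have "odd p" using False p(1) prime_odd_nat[of p] prime_ge_2_nat[of p] by simp
        then have "coprime (int p) 2" by (simp add: coprime_right_2_iff_odd)
        then show ?thesis using coprime_power_right_iff[of "int p" 2 2] by simp
      qed
      have bD: "int p * int p dvd b\<^sup>2 - D" using b by (rule dvd_mult_right)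
      then have "int p dvd b\<^sup>2 - D" by (rule dvd_mult_right)
      then have "int p dvd (b\<^sup>2 - D) + D" using p(2) by (rule dvd_add)
      then have "int p dvd b" using pp prime_dvd_power[of "int p" b 2] by simp
      then have "int p * int p dvd b\<^sup>2" unfolding power2_eq_square by (intro mult_dvd_mono)
      then have "int p * int p dvd b\<^sup>2 - (b\<^sup>2 - D)" using bD by (rule dvd_diff)
      then have ppD: "(int p)\<^sup>2 dvd D" by (simp add: power2_eq_square)
      have nu: "\<not> int p dvd 1" using pp not_prime_unit by blast
      consider "squarefree D" | m where "D = 4 * m" "squarefree m" using D unfolding fundamental_discriminant_def by blast
      then show False
      proof cases
        case 1
        then show False using squarefreeD[OF 1 ppD] nu by blast
      next
        case 2
        have "coprime ((int p)\<^sup>2) 4" using co by simp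
        then have "(int p)\<^sup>2 dvd m" using ppD unfolding 2(1) by (simp only: coprime_dvd_mult_right_iff)
        then show False using squarefreeD[OF 2(2)] nu by blast
      qed
    qed
  qed
  then have "root_set D (p * p) = {}" by blast
  then show ?thesis by (simp add: root_count_def)
qed

lemma kronecker_prime_values:
  assumes "prime p"
  shows "\<bar>kronecker_prime D p\<bar> \<le> 1" "kronecker_prime D p = 0 \<longleftrightarrow> int p dvd D"
  by (auto simp: kronecker_prime_def Legendre_def cong_0_iff)

text \<open>The recursion behind the Euler factor (1 + p^-s) / (1 - chi(p) p^-s). For
  \<open>p dvd a\<close> the three values of the symbol correspond to unique lifting, to no root
  modulo \<open>p\<close>, and to no root modulo \<open>p * p\<close>.\<close>

theorem root_count_rec:
  assumes p: "prime p" "coprime h (int p)" and D0: "fundamental_discriminant D0" and a: "a > 0"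
  shows "int (root_count (D0 * h\<^sup>2) (p * a)) =
    kronecker_prime D0 p * int (root_count (D0 * h\<^sup>2) a) + of_bool (\<not> p dvd a) * int (root_count (D0 * h\<^sup>2) a)"
proof -
  have p0: "p > 0" using p prime_gt_0_nat by blast
  have D0': "D0 mod 4 = 0 \<or> D0 mod 4 = 1" by (rule fundamental_cases(1)[OF D0])
  define D where "D = D0 * h\<^sup>2"
  have D: "D mod 4 = 0 \<or> D mod 4 = 1"
  proof -
    obtain \<beta> \<gamma> where bg: "\<beta>\<^sup>2 - 4 * \<gamma> = D0" using disc_quadratic[OF D0'] .
    have "D = (\<beta> * h)\<^sup>2 - 4 * (\<gamma> * h\<^sup>2)" unfolding D_def bg[symmetric] by (simp add: power_mult_distrib algebra_simps)
    moreover have "s mod 4 = 0 \<or> s mod 4 = 1 \<Longrightarrow> (s - 4 * z) mod 4 = 0 \<or> (s - 4 * z) mod 4 = 1" for s z :: int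
      by presburger
    ultimately show ?thesis using square_mod_4[of "\<beta> * h"] by simp
  qed
  have np: "int (root_count D p) = 1 + kronecker_prime D0 p"
    unfolding D_def root_count_scale[OF p0 D0' p(2)] by (rule root_count_prime[OF p(1) D0'])
  show ?thesis
  proof (cases "p dvd a")
    case False
    then have "coprime p a" using p by (simp add: prime_imp_coprime)
    then have "int (root_count D (p * a)) = int (root_count D p) * int (root_count D a)"
      using root_count_coprime_mult[OF p0 a _ D] by simp
    then show ?thesis unfolding np using False by (simp add: D_def[symmetric] algebra_simps)
  next
    case True
    show ?thesis
    proof (cases "int p dvd D0")
      case False
      have pp: "prime (int p)" using p(1) by simp
      have nh: "\<not> int p dvd h"
      proof
        assume "int p dvd h"
        from coprime_common_divisor[OF p(2) this dvd_refl] have "p = 1" by simp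
        then show False using p(1) by simp
      qed
      have "\<not> int p dvd D"
      proof
        assume "int p dvd D"
        then have "int p dvd D0 \<or> int p dvd h\<^sup>2" unfolding D_def prime_dvd_mult_iff[OF pp] .
        then show False using False nh prime_dvd_power[OF pp] by blast
      qed
      then have h: "root_count D (p * a) = root_count D a" using root_count_hensel[OF p(1) _ a True D] by blast
      have "kronecker_prime D0 p = 1 \<or> kronecker_prime D0 p = - 1"
        using kronecker_prime_values[OF p(1), of D0] False by linarith
      then show ?thesis
      proof
        assume "kronecker_prime D0 p = - 1"
        then have "root_count D p = 0" using np by simp
        then have "root_count D a = 0" using root_count_eq_0_dvd[OF True a _ D] by blast
        then show ?thesis using h by (simp add: D_def[symmetric])
      qed (use h True in \<open>simp add: D_def[symmetric]\<close>)
    next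
      case dvd: True
      have k: "kronecker_prime D0 p = 0" using kronecker_prime_values[OF p(1)] dvd by blast
      have "root_count D (p * p) = root_count D0 (p * p)"
        unfolding D_def by (rule root_count_scale) (use p0 p D0' in auto)
      then have "root_count D (p * p) = 0" using root_count_prime_square[OF p(1) dvd D0] by simp
      then have "root_count D (p * a) = 0"
        using root_count_eq_0_dvd[of "p * p" "p * a", OF _ _ _ D] True a p0 by simp
      then show ?thesis using k True by (simp add: D_def[symmetric])
    qed
  qed
qed

section \<open>The Dirichlet series of the root counts at 2 and its dependence on the
  conductor\<close>

definition root_term :: "int \<Rightarrow> nat \<Rightarrow> real" where
  "root_term D n = real (root_count D n) / (real n)\<^sup>2"

definition root_zeta :: "int \<Rightarrow> real" where
  "root_zeta D = infsum (root_term D) UNIV"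

lemma root_term_has_sum:
  assumes "D > 0"
  shows "(root_term D has_sum 6 / (of_int D * sqrt (of_int D)) * (cyc_K D - of_bool (is_square D) / 12)) UNIV"
proof (rule sums_nonneg_imp_has_sum)
  show "root_term D sums (6 / (of_int D * sqrt (of_int D)) * (cyc_K D - of_bool (is_square D) / 12))"
    by (rule sums_Suc_imp) (use root_count_sums[OF assms] in \<open>simp_all add: root_term_def\<close>)
qed (simp add: root_term_def)

lemma root_zeta_eq:
  "D > 0 \<Longrightarrow> root_zeta D = 6 / (of_int D * sqrt (of_int D)) * (cyc_K D - of_bool (is_square D) / 12)"
  unfolding root_zeta_def by (rule infsumI[OF root_term_has_sum])

lemma root_term_summable: "D > 0 \<Longrightarrow> root_term D summable_on A"
  by (rule summable_on_subset_banach[OF has_sum_imp_summable[OF root_term_has_sum]]) auto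

lemma infsum_split_multiples:
  fixes f :: "nat \<Rightarrow> real"
  assumes "f summable_on UNIV" "p > 0"
  shows "infsum f UNIV = infsum f {n. \<not> p dvd n} + (\<Sum>\<^sub>\<infinity>n. f (p * n))"
proof -
  have "infsum f ({n. \<not> p dvd n} \<union> {n. p dvd n}) = infsum f {n. \<not> p dvd n} + infsum f {n. p dvd n}"
    by (rule infsum_Un_disjoint) (auto intro: summable_on_subset_banach[OF assms(1)])
  moreover have "{n. \<not> p dvd n} \<union> {n. p dvd n} = UNIV" by auto
  moreover have "bij_betw (\<lambda>n. p * n) UNIV {n. p dvd n}"
    by (rule bij_betw_byWitness[of _ "\<lambda>n. n div p"]) (use assms(2) in auto)
  then have "infsum f {n. p dvd n} = (\<Sum>\<^sub>\<infinity>n. f (p * n))"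
    by (rule infsum_reindex_bij_betw[symmetric])
  ultimately show ?thesis by simp
qed

text \<open>The Euler factor at \<open>p\<close> is isolated without an Euler product: the sum is
  split by divisibility of \<open>n\<close> by \<open>p\<close> and \<open>root_count_rec\<close> is
  applied to the multiples.\<close>

lemma root_zeta_rec:
  assumes p: "prime p" "coprime h (int p)" and D0: "fundamental_discriminant D0" and D: "D = D0 * h\<^sup>2" "D > 0"
  shows "(1 + 1 / (real p)\<^sup>2) * infsum (root_term D) {n. \<not> p dvd n} =
     (1 - of_int (kronecker_prime D0 p) / (real p)\<^sup>2) * root_zeta D"
proof -
  have p0: "p > 0" using p prime_gt_0_nat by blast
  let ?c = "real_of_int (kronecker_prime D0 p)"
  have t: "root_term D (p * n) = ?c / (real p)\<^sup>2 * root_term D n + 1 / (real p)\<^sup>2 * (of_bool (\<not> p dvd n) * root_term D n)" for n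
  proof (cases "n = 0")
    case False
    have "real_of_int (int (root_count D (p * n))) = ?c * real (root_count D n) + of_bool (\<not> p dvd n) * real (root_count D n)"
      using root_count_rec[OF p D0, of n] False unfolding D(1) by (simp del: of_nat_mult)
    then have "real (root_count D (p * n)) = ?c * real (root_count D n) + of_bool (\<not> p dvd n) * real (root_count D n)" by simp
    then show ?thesis unfolding root_term_def of_nat_mult power_mult_distrib by (simp add: add_divide_distrib)
  qed (simp add: root_term_def)
  have "(\<lambda>n. of_bool (\<not> p dvd n) * root_term D n) summable_on UNIV \<longleftrightarrow> root_term D summable_on {n. \<not> p dvd n}"
    by (rule summable_on_cong_neutral) auto
  then have s: "(\<lambda>n. of_bool (\<not> p dvd n) * root_term D n) summable_on UNIV" using root_term_summable[OF D(2)] by blast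
  have "(\<Sum>\<^sub>\<infinity>n. root_term D (p * n)) = (\<Sum>\<^sub>\<infinity>n. ?c / (real p)\<^sup>2 * root_term D n) + (\<Sum>\<^sub>\<infinity>n. 1 / (real p)\<^sup>2 * (of_bool (\<not> p dvd n) * root_term D n))"
    unfolding t by (intro infsum_add summable_on_cmult_right s root_term_summable D)
  also have "(\<Sum>\<^sub>\<infinity>n. ?c / (real p)\<^sup>2 * root_term D n) = ?c / (real p)\<^sup>2 * root_zeta D"
    unfolding root_zeta_def by (rule infsum_cmult_right')
  also have "(\<Sum>\<^sub>\<infinity>n. 1 / (real p)\<^sup>2 * (of_bool (\<not> p dvd n) * root_term D n)) = 1 / (real p)\<^sup>2 * (\<Sum>\<^sub>\<infinity>n. of_bool (\<not> p dvd n) * root_term D n)"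
    by (rule infsum_cmult_right')
  also have "(\<Sum>\<^sub>\<infinity>n. of_bool (\<not> p dvd n) * root_term D n) = infsum (root_term D) {n. \<not> p dvd n}"
    by (rule infsum_cong_neutral) auto
  finally have "root_zeta D = infsum (root_term D) {n. \<not> p dvd n} + (?c / (real p)\<^sup>2 * root_zeta D + 1 / (real p)\<^sup>2 * infsum (root_term D) {n. \<not> p dvd n})"
    using infsum_split_multiples[OF root_term_summable[OF D(2)] p0] unfolding root_zeta_def by simp
  then show ?thesis by (simp add: distrib_right left_diff_distrib)
qed

text \<open>Indices prime to \<open>p\<close>, exactly divisible by \<open>p\<close>, and divisible
  by \<open>p * p\<close> contribute with the factors 1, p^-2 and p * p^-4.\<close>

lemma root_zeta_scale_prime:
  assumes p: "prime p" and D: "D > 0" "D mod 4 = 0 \<or> D mod 4 = 1"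
  shows "root_zeta (D * (int p)\<^sup>2) = (1 + 1 / (real p)\<^sup>2) * infsum (root_term D) {n. \<not> p dvd n} + 1 / real p ^ 3 * root_zeta D"
proof -
  have p0: "p > 0" using p prime_gt_0_nat by blast
  let ?D = "D * (int p)\<^sup>2"
  have D': "?D > 0" using D(1) p0 by simp
  have sp: "(\<lambda>n. root_term ?D (p * n)) summable_on UNIV"
  proof -
    have "root_term ?D summable_on range (\<lambda>n. p * n)" by (rule root_term_summable[OF D'])
    moreover have "inj (\<lambda>n. p * n)" using p0 by (simp add: inj_on_def)
    ultimately show ?thesis by (simp add: summable_on_reindex o_def)
  qed
  have "root_zeta ?D = infsum (root_term ?D) {n. \<not> p dvd n} + (\<Sum>\<^sub>\<infinity>n. root_term ?D (p * n))"
    unfolding root_zeta_def by (rule infsum_split_multiples[OF root_term_summable[OF D'] p0])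
  also have "(\<Sum>\<^sub>\<infinity>n. root_term ?D (p * n)) = infsum (\<lambda>n. root_term ?D (p * n)) {n. \<not> p dvd n} + (\<Sum>\<^sub>\<infinity>n. root_term ?D (p * (p * n)))"
    by (rule infsum_split_multiples[OF sp p0])
  also have "infsum (root_term ?D) {n. \<not> p dvd n} = infsum (root_term D) {n. \<not> p dvd n}"
  proof (rule infsum_cong)
    fix n assume "n \<in> {n. \<not> p dvd n}"
    then have n: "\<not> p dvd n" by simp
    then have "n > 0" by (auto intro: gr0I)
    moreover have "coprime (int p) (int n)" using prime_imp_coprime[OF p n] by simp
    ultimately show "root_term ?D n = root_term D n"
      unfolding root_term_def using root_count_scale[OF _ D(2)] by simp
  qed
  also have "infsum (\<lambda>n. root_term ?D (p * n)) {n. \<not> p dvd n} = (\<Sum>\<^sub>\<infinity>n\<in>{n. \<not> p dvd n}. 1 / (real p)\<^sup>2 * root_term D n)"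
  proof (rule infsum_cong)
    fix n assume "n \<in> {n. \<not> p dvd n}"
    then have n: "\<not> p dvd n" by simp
    then have "n > 0" by (auto intro: gr0I)
    then show "root_term ?D (p * n) = 1 / (real p)\<^sup>2 * root_term D n"
      unfolding root_term_def using root_count_scale_prime_coprime[OF p _ n D(2)] by (simp add: power_mult_distrib)
  qed
  also have "\<dots> = 1 / (real p)\<^sup>2 * infsum (root_term D) {n. \<not> p dvd n}" by (rule infsum_cmult_right')
  also have "(\<Sum>\<^sub>\<infinity>n. root_term ?D (p * (p * n))) = (\<Sum>\<^sub>\<infinity>n. 1 / real p ^ 3 * root_term D n)"
  proof (rule infsum_cong)
    fix n
    show "root_term ?D (p * (p * n)) = 1 / real p ^ 3 * root_term D n"
    proof (cases "n = 0")
      case False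
      then have "root_count ?D (p * (p * n)) = p * root_count D n" using root_count_scale_prime_mult[OF p _ D(2)] by simp
      then show ?thesis unfolding root_term_def using p0 False by (simp add: power2_eq_square power3_eq_cube)
    qed (simp add: root_term_def)
  qed
  also have "\<dots> = 1 / real p ^ 3 * root_zeta D" unfolding root_zeta_def by (rule infsum_cmult_right')
  finally show ?thesis by (simp add: distrib_right)
qed

lemma sum_divisors_prime_power:
  fixes F :: "nat \<Rightarrow> 'a::comm_monoid_add"
  assumes p: "prime p" and h: "h > 0" "\<not> p dvd h"
  shows "(\<Sum>d | d dvd p ^ k * h. F d) = (\<Sum>i\<le>k. \<Sum>d | d dvd h. F (p ^ i * d))"
proof -
  have p0: "p > 0" using p prime_gt_0_nat by blast
  have fin: "finite {d. d dvd h}" using h by simp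
  have inj: "inj_on (\<lambda>(i, d). p ^ i * d) ({..k} \<times> {d. d dvd h})"
  proof -
    have le: "i \<le> j" if "p ^ i * d = p ^ j * e" "d dvd h" "e dvd h" for i j d e
    proof (rule ccontr)
      assume "\<not> i \<le> j"
      then obtain l where l: "i = j + Suc l" using less_iff_Suc_add[of j i] by auto
      have "p ^ j * (p * (p ^ l * d)) = p ^ j * e" using that(1) unfolding l by (simp add: power_add mult_ac)
      then have "p * (p ^ l * d) = e" using p0 by simp
      then have "p dvd e" by (metis dvd_triv_left)
      then show False using that(3) h(2) dvd_trans by blast
    qed
    show ?thesis
    proof (rule inj_onI, clarify)
      fix i d j e assume *: "i \<le> k" "d dvd h" "j \<le> k" "e dvd h" "p ^ i * d = p ^ j * e"
      have "i = j" using le[OF *(5) *(2) *(4)] le[OF *(5)[symmetric] *(4) *(2)] by simp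
      then show "i = j \<and> d = e" using *(5) p0 by simp
    qed
  qed
  have img: "(\<lambda>(i, d). p ^ i * d) ` ({..k} \<times> {d. d dvd h}) = {d. d dvd p ^ k * h}"
  proof (intro equalityI subsetI)
    fix x assume "x \<in> (\<lambda>(i, d). p ^ i * d) ` ({..k} \<times> {d. d dvd h})"
    then show "x \<in> {d. d dvd p ^ k * h}" by (auto intro!: mult_dvd_mono le_imp_power_dvd)
  next
    fix x assume "x \<in> {d. d dvd p ^ k * h}"
    then have "x dvd p ^ k * h" by simp
    then obtain b c where bc: "x = b * c" "b dvd p ^ k" "c dvd h" using division_decomp by blast
    obtain i where i: "i \<le> k" "b = p ^ i" using bc(2) divides_primepow_nat[OF p] by blast
    then show "x \<in> (\<lambda>(i, d). p ^ i * d) ` ({..k} \<times> {d. d dvd h})"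
      using bc by (intro image_eqI[of _ _ "(i, c)"]) auto
  qed
  have "(\<Sum>d | d dvd p ^ k * h. F d) = (\<Sum>z\<in>{..k} \<times> {d. d dvd h}. F (case z of (i, d) \<Rightarrow> p ^ i * d))"
    unfolding img[symmetric] by (subst sum.reindex[OF inj]) (simp add: o_def)
  also have "\<dots> = (\<Sum>i\<le>k. \<Sum>d | d dvd h. F (p ^ i * d))"
    by (simp add: sum.cartesian_product case_prod_unfold)
  finally show ?thesis .
qed

lemma moebius_mu_prime_mult:
  assumes p: "prime p" and d: "d > 0" "\<not> p dvd d"
  shows "moebius_mu (p * d) = - moebius_mu d"
proof -
  have co: "coprime p d" using prime_imp_coprime[OF p d(2)] .
  have "squarefree (p * d) \<longleftrightarrow> squarefree d"
    using squarefree_mult_coprime[OF co squarefree_prime[OF p]] squarefree_multD(2) by blast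
  moreover have "prime_factors (p * d) = insert p (prime_factors d)"
    using p d(1) prime_gt_0_nat[OF p] by (subst prime_factors_product) (auto simp: prime_prime_factors)
  moreover have "p \<notin> prime_factors d" using d by auto
  ultimately show ?thesis by (simp add: moebius_mu_def)
qed

lemma moebius_mu_prime_power:
  assumes p: "prime p" "i \<ge> 2"
  shows "moebius_mu (p ^ i * d) = 0"
proof -
  have "p\<^sup>2 dvd p ^ i * d" using p(2) by (intro dvd_mult2 le_imp_power_dvd)
  then have "\<not> squarefree (p ^ i * d)" using p(1) by (intro not_squarefreeI[of p]) auto
  then show ?thesis by (simp add: moebius_mu_def)
qed

lemma kronecker_symbol_mult:
  assumes "m > 0" "n > 0"
  shows "kronecker_symbol D (m * n) = kronecker_symbol D m * kronecker_symbol D n"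
  using assms by (simp add: kronecker_symbol_def prime_factorization_mult)

lemma kronecker_symbol_prime: "prime p \<Longrightarrow> kronecker_symbol D p = kronecker_prime D p"
  using prime_gt_0_nat[of p] by (simp add: kronecker_symbol_def prime_factorization_prime)

lemma kronecker_symbol_bound: "\<bar>kronecker_symbol D n\<bar> \<le> 1"
proof -
  have "\<bar>prod_mset (image_mset f M)\<bar> \<le> 1" if "\<And>x. x \<in># M \<Longrightarrow> \<bar>f x\<bar> \<le> 1" for f :: "nat \<Rightarrow> int" and M
    using that
  proof (induction M)
    case (add x M)
    then have "\<bar>f x\<bar> * \<bar>prod_mset (image_mset f M)\<bar> \<le> 1 * 1" by (intro mult_mono) auto
    then show ?case by (simp add: abs_mult)
  qed simp
  moreover have "\<bar>kronecker_prime D x\<bar> \<le> 1" if "x \<in># prime_factorization n" for x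
    using that kronecker_prime_values(1)[of x D] by auto
  ultimately show ?thesis by (simp add: kronecker_symbol_def)
qed

text \<open>The divisor sum in \<open>L_disc\<close> taken at \<open>s = 2\<close>; the inner sum is
  \<open>\<sigma>\<close> with exponent -3.\<close>

definition cond_factor :: "int \<Rightarrow> nat \<Rightarrow> real" where
  "cond_factor D0 f = (\<Sum>d | d dvd f. of_int (moebius_mu d) * of_int (kronecker_symbol D0 d) / (real d)\<^sup>2 *
     (\<Sum>e | e dvd f div d. 1 / real e ^ 3))"

lemma sigma_prime_power:
  assumes p: "prime p" and h: "h > 0" "\<not> p dvd h"
  shows "(\<Sum>e | e dvd p ^ k * h. 1 / real e ^ 3) = (\<Sum>i\<le>k. (1 / real p ^ 3) ^ i) * (\<Sum>e | e dvd h. 1 / real e ^ 3)"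
  unfolding sum_divisors_prime_power[OF assms] sum_product
proof (intro sum.cong refl)
  fix i e
  have "(real p ^ i) ^ 3 = (real p ^ 3) ^ i" by (simp only: power_mult[symmetric] mult.commute)
  then show "1 / real (p ^ i * e) ^ 3 = (1 / real p ^ 3) ^ i * (1 / real e ^ 3)"
    by (simp add: power_mult_distrib power_one_over)
qed

text \<open>The Moebius function leaves only divisors whose exponent at \<open>p\<close> is 0 or 1,
  hence the two partial geometric sums.\<close>

lemma cond_factor_prime_power:
  assumes p: "prime p" and h: "h > 0" "\<not> p dvd h"
  defines "S \<equiv> \<lambda>k. \<Sum>i\<le>k. (1 / real p ^ 3) ^ i"
  shows "cond_factor D0 (p ^ Suc k * h) = cond_factor D0 h * (S (Suc k) - of_int (kronecker_prime D0 p) / (real p)\<^sup>2 * S k)"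
proof -
  have p0: "p > 0" using p prime_gt_0_nat by blast
  define T where "T d = (\<Sum>e | e dvd h div d. 1 / real e ^ 3)" for d
  define g where "g d = real_of_int (moebius_mu d) * of_int (kronecker_symbol D0 d) / (real d)\<^sup>2" for d
  have T: "(\<Sum>e | e dvd p ^ j * (h div d). 1 / real e ^ 3) = S j * T d" if d: "d dvd h" for d j
  proof -
    have "h div d > 0" using d h(1) by (simp add: dvd_div_eq_0_iff[symmetric] dvd_pos_nat dvd_imp_le div_greater_zero_iff)
    moreover have "\<not> p dvd h div d" using h(2) d by (metis dvd_mult dvd_div_mult_self dvd_mult2)
    ultimately show ?thesis unfolding T_def S_def by (rule sigma_prime_power[OF p])
  qed
  have dd: "d > 0" "\<not> p dvd d" if "d dvd h" for d
    using that h dvd_pos_nat dvd_trans by blast+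
  define G where "G i d = real_of_int (moebius_mu (p ^ i * d)) * of_int (kronecker_symbol D0 (p ^ i * d)) / (real (p ^ i * d))\<^sup>2 *
      (\<Sum>e | e dvd (p ^ Suc k * h) div (p ^ i * d). 1 / real e ^ 3)" for i d
  have "cond_factor D0 (p ^ Suc k * h) = (\<Sum>i\<le>Suc k. \<Sum>d | d dvd h. G i d)"
    unfolding cond_factor_def G_def by (rule sum_divisors_prime_power[OF p h])
  also have "\<dots> = (\<Sum>i\<in>{0, 1}. \<Sum>d | d dvd h. G i d)"
  proof (rule sum.mono_neutral_right)
    show "\<forall>i\<in>{..Suc k} - {0, 1}. (\<Sum>d | d dvd h. G i d) = 0"
      unfolding G_def using moebius_mu_prime_power[OF p] by (auto intro!: sum.neutral)
  qed auto
  also have "\<dots> = (\<Sum>d | d dvd h. G 0 d) + (\<Sum>d | d dvd h. G 1 d)" by simp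
  also have "(\<Sum>d | d dvd h. G 0 d) = (\<Sum>d | d dvd h. g d * T d * S (Suc k))"
  proof (rule sum.cong)
    fix d assume "d \<in> {d. d dvd h}"
    then have d: "d dvd h" by simp
    have "(p ^ Suc k * h) div (p ^ 0 * d) = p ^ Suc k * (h div d)" using d by (simp add: div_mult_swap)
    then have "G 0 d = g d * (\<Sum>e | e dvd p ^ Suc k * (h div d). 1 / real e ^ 3)"
      unfolding G_def g_def by (simp only: power_0 mult_1)
    then show "G 0 d = g d * T d * S (Suc k)" unfolding T[OF d] by simp
  qed simp
  also have "(\<Sum>d | d dvd h. G 1 d) = (\<Sum>d | d dvd h. - (g d * T d * (of_int (kronecker_prime D0 p) / (real p)\<^sup>2 * S k)))"
  proof (rule sum.cong)
    fix d assume "d \<in> {d. d dvd h}"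
    then have d: "d dvd h" by simp
    have "(p ^ Suc k * h) div (p ^ 1 * d) = p ^ k * (h div d)" using d p0 by (simp add: div_mult_swap mult.assoc)
    then have "G 1 d = real_of_int (moebius_mu (p * d)) * of_int (kronecker_symbol D0 (p * d)) / (real (p * d))\<^sup>2 * (S k * T d)"
      unfolding G_def using T[OF d] by simp
    also have "\<dots> = - (g d * T d * (of_int (kronecker_prime D0 p) / (real p)\<^sup>2 * S k))"
      unfolding moebius_mu_prime_mult[OF p dd[OF d]] kronecker_symbol_mult[OF p0 dd(1)[OF d]] kronecker_symbol_prime[OF p] g_def
      by (simp add: power_mult_distrib mult_ac)
    finally show "G 1 d = - (g d * T d * (of_int (kronecker_prime D0 p) / (real p)\<^sup>2 * S k))" .
  qed simp
  also have "(\<Sum>d | d dvd h. g d * T d * S (Suc k)) + (\<Sum>d | d dvd h. - (g d * T d * (of_int (kronecker_prime D0 p) / (real p)\<^sup>2 * S k))) =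
     (\<Sum>d | d dvd h. g d * T d) * (S (Suc k) - of_int (kronecker_prime D0 p) / (real p)\<^sup>2 * S k)"
    unfolding sum_negf sum_distrib_right[symmetric] by (simp add: right_diff_distrib)
  also have "(\<Sum>d | d dvd h. g d * T d) = cond_factor D0 h" unfolding cond_factor_def g_def T_def ..
  finally show ?thesis .
qed

lemma disc_mult_square:
  fixes D :: int
  assumes "D mod 4 = 0 \<or> D mod 4 = 1"
  shows "(D * h\<^sup>2) mod 4 = 0 \<or> (D * h\<^sup>2) mod 4 = 1"
  using assms square_mod_4[of h] by (auto simp: mod_mult_eq[of D 4 "h\<^sup>2", symmetric])

text \<open>With \<open>Z k\<close> for the series at the power \<open>p ^ k\<close>, the recursion
  is \<open>Z (Suc k) = (1 - c) * Z 0 + Z k / p ^ 3\<close>, which the bracket satisfies because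
  \<open>S (Suc k) = 1 + S k / p ^ 3\<close>.\<close>

lemma root_zeta_prime_power:
  assumes p: "prime p" and h: "h > 0" "\<not> p dvd h" and D0: "fundamental_discriminant D0" "D0 > 0"
  defines "S \<equiv> \<lambda>k. \<Sum>i\<le>k. (1 / real p ^ 3) ^ i"
  shows "root_zeta (D0 * (int (p ^ Suc k * h))\<^sup>2) = root_zeta (D0 * (int h)\<^sup>2) * (S (Suc k) - of_int (kronecker_prime D0 p) / (real p)\<^sup>2 * S k)"
proof -
  have p0: "p > 0" using p prime_gt_0_nat by blast
  let ?D = "\<lambda>k. D0 * (int (p ^ k * h))\<^sup>2"
  let ?c = "real_of_int (kronecker_prime D0 p) / (real p)\<^sup>2"
  let ?Z = "root_zeta (D0 * (int h)\<^sup>2)"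
  have D0': "D0 mod 4 = 0 \<or> D0 mod 4 = 1" by (rule fundamental_cases(1)[OF D0(1)])
  have pos: "?D k > 0" for k using D0(2) h p0 by simp
  have m4: "?D k mod 4 = 0 \<or> ?D k mod 4 = 1" for k by (rule disc_mult_square[OF D0'])
  have co: "coprime (int h) (int p)" using prime_imp_coprime[OF p h(2)] by (simp add: coprime_commute)
  \<comment> \<open>Indices prime to \<open>p\<close> do not notice powers of \<open>p\<close> in
    the conductor, so this part of the series is the same for every \<open>k\<close>.\<close>
  have same: "infsum (root_term (?D k)) {n. \<not> p dvd n} = infsum (root_term (D0 * (int h)\<^sup>2)) {n. \<not> p dvd n}" for k
  proof (rule infsum_cong)
    fix n assume "n \<in> {n. \<not> p dvd n}"
    then have n: "\<not> p dvd n" by simp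
    then have n0: "n > 0" by (auto intro: gr0I)
    have "coprime (int (p ^ k)) (int n)" using prime_imp_coprime[OF p n] by simp
    from root_count_scale[OF n0 disc_mult_square[OF D0'] this]
    have "root_count (D0 * (int h)\<^sup>2 * (int (p ^ k))\<^sup>2) n = root_count (D0 * (int h)\<^sup>2) n" .
    then show "root_term (?D k) n = root_term (D0 * (int h)\<^sup>2) n"
      by (simp add: root_term_def power_mult_distrib mult_ac)
  qed
  have base: "(1 + 1 / (real p)\<^sup>2) * infsum (root_term (D0 * (int h)\<^sup>2)) {n. \<not> p dvd n} = (1 - ?c) * ?Z"
    by (rule root_zeta_rec[OF p co D0(1) refl]) (use D0(2) h in simp)
  have step: "root_zeta (?D (Suc k)) = (1 - ?c) * ?Z + 1 / real p ^ 3 * root_zeta (?D k)" for k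
  proof -
    have "?D (Suc k) = ?D k * (int p)\<^sup>2" by (simp add: power2_eq_square mult_ac)
    then have "root_zeta (?D (Suc k)) = root_zeta (?D k * (int p)\<^sup>2)" by (rule arg_cong)
    also have "\<dots> = (1 + 1 / (real p)\<^sup>2) * infsum (root_term (?D k)) {n. \<not> p dvd n} + 1 / real p ^ 3 * root_zeta (?D k)"
      by (rule root_zeta_scale_prime[OF p pos m4])
    finally show ?thesis unfolding same base .
  qed
  have SS: "S (Suc k) = 1 + 1 / real p ^ 3 * S k" for k
    unfolding S_def by (subst sum.atMost_Suc_shift) (simp add: sum_distrib_left)
  show ?thesis
  proof (induction k)
    case 0
    have "S 0 = 1" by (simp add: S_def)
    then show ?case unfolding step SS by (simp add: algebra_simps)
  next
    case (Suc k)
    have "root_zeta (?D (Suc (Suc k))) = (1 - ?c) * ?Z + 1 / real p ^ 3 * (?Z * (S (Suc k) - ?c * S k))"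
      unfolding step[of "Suc k"] Suc ..
    also have "\<dots> = ?Z * ((1 + 1 / real p ^ 3 * S (Suc k)) - ?c * (1 + 1 / real p ^ 3 * S k))"
    proof -
      have "(1 - c) * Z + q * (Z * (A - c * B)) = Z * ((1 + q * A) - c * (1 + q * B))" for c Z q A B :: real
        by (simp add: algebra_simps)
      then show ?thesis .
    qed
    finally show ?case unfolding SS[symmetric] .
  qed
qed

theorem root_zeta_conductor:
  assumes "fundamental_discriminant D0" "D0 > 0" "f > 0"
  shows "root_zeta (D0 * (int f)\<^sup>2) = root_zeta D0 * cond_factor D0 f"
  using assms(3)
proof (induction f rule: less_induct)
  case (less f)
  show ?case
  proof (cases "f = 1")
    case True
    have "{d::nat. d dvd 1} = {1}" by auto
    then show ?thesis unfolding True cond_factor_def by (simp add: moebius_mu_def kronecker_symbol_def)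
  next
    case False
    then obtain p where p: "prime p" "p dvd f" using prime_factor_nat by blast
    have "f \<noteq> 0" "\<not> is_unit p" using less.prems p(1) by auto
    from multiplicity_decompose'[OF this] obtain h where h: "f = p ^ multiplicity p f * h" "\<not> p dvd h" by blast
    have "multiplicity p f > 0" using p less.prems by (simp add: prime_multiplicity_gt_zero_iff)
    then obtain k where k: "f = p ^ Suc k * h" using h(1) gr0_implies_Suc by metis
    have h0: "h > 0" using k less.prems by (auto intro: gr0I)
    have "1 * h < p ^ Suc k * h" using prime_gt_1_nat[OF p(1)] h0 by (intro mult_strict_right_mono one_less_power) auto
    then have "h < f" using k by simp
    then have IH: "root_zeta (D0 * (int h)\<^sup>2) = root_zeta D0 * cond_factor D0 h" using less.IH h0 by blast
    show ?thesis unfolding k root_zeta_prime_power[OF p(1) h0 h(2) assms(1,2)] cond_factor_prime_power[OF p(1) h0 h(2)] IH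
      by (simp only: mult.assoc)
  qed
qed

text \<open>The coefficients of L(s, chi) zeta(s) / zeta(2 s).\<close>

definition sqf_conv :: "int \<Rightarrow> nat \<Rightarrow> int" where
  "sqf_conv D n = (\<Sum>d | d dvd n. of_bool (squarefree d) * kronecker_symbol D (n div d))"

text \<open>The divisors prime to \<open>p\<close> are the same for \<open>n\<close> and
  \<open>p * n\<close>, so this part is simply multiplied by the symbol at \<open>p\<close>;
  squarefree divisors \<open>p * d\<close> bring in the same part once more.\<close>

definition sqf_conv' :: "int \<Rightarrow> nat \<Rightarrow> nat \<Rightarrow> int" where
  "sqf_conv' D p n = (\<Sum>d | d dvd n \<and> \<not> p dvd d. of_bool (squarefree d) * kronecker_symbol D (n div d))"

lemma sqf_conv'_mult:
  assumes p: "prime p" and n: "n > 0"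
  shows "sqf_conv' D p (p * n) = kronecker_prime D p * sqf_conv' D p n"
proof -
  have set: "{d. d dvd p * n \<and> \<not> p dvd d} = {d. d dvd n \<and> \<not> p dvd d}"
    using prime_imp_coprime[OF p] by (auto simp: coprime_commute coprime_dvd_mult_right_iff)
  have k: "kronecker_symbol D (p * n div d) = kronecker_prime D p * kronecker_symbol D (n div d)" if "d dvd n" for d
  proof -
    have "p * n div d = p * (n div d)" using that by (simp add: div_mult_swap)
    moreover have "n div d > 0" using that n by (metis dvd_div_eq_0_iff gr0I not_less0)
    ultimately show ?thesis using kronecker_symbol_mult[of p "n div d" D] p prime_gt_0_nat kronecker_symbol_prime by simp
  qed
  show ?thesis unfolding sqf_conv'_def set sum_distrib_left
    by (rule sum.cong) (simp_all add: k)
qed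

lemma squarefree_prime_mult_iff:
  assumes p: "prime (p::nat)"
  shows "squarefree (p * d) \<longleftrightarrow> squarefree d \<and> \<not> p dvd d"
proof
  assume sq: "squarefree (p * d)"
  have "\<not> p dvd d"
  proof
    assume "p dvd d"
    then have "p\<^sup>2 dvd p * d" by (simp add: power2_eq_square)
    then have "is_unit p" by (rule squarefreeD[OF sq])
    then show False using p by simp
  qed
  then show "squarefree d \<and> \<not> p dvd d" using squarefree_multD(2)[OF sq] by blast
next
  assume "squarefree d \<and> \<not> p dvd d"
  then show "squarefree (p * d)"
    using squarefree_mult_coprime[OF prime_imp_coprime[OF p] squarefree_prime[OF p]] by blast
qed

lemma sqf_conv_prime_mult:
  assumes p: "prime p" and n: "n > 0"
  shows "sqf_conv D (p * n) = (kronecker_prime D p + 1) * sqf_conv' D p n"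
proof -
  have p0: "p > 0" using p prime_gt_0_nat by blast
  let ?F = "\<lambda>d. of_bool (squarefree d) * kronecker_symbol D (p * n div d)"
  have fin: "finite {d. d dvd p * n}" using n p0 by simp
  have "sqf_conv D (p * n) = sum ?F {d. d dvd p * n \<and> \<not> p dvd d} + sum ?F {d. d dvd p * n \<and> p dvd d}"
    unfolding sqf_conv_def
    by (subst sum.union_disjoint[symmetric]) (auto intro!: sum.cong finite_subset[OF _ fin])
  also have "sum ?F {d. d dvd p * n \<and> p dvd d} = (\<Sum>e | e dvd n. of_bool (squarefree e \<and> \<not> p dvd e) * kronecker_symbol D (n div e))"
  proof (rule sum.reindex_bij_witness[of _ "\<lambda>e. p * e" "\<lambda>d. d div p"])
    fix d assume "d \<in> {d. d dvd p * n \<and> p dvd d}"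
    then have dd: "d dvd p * n" "p dvd d" by simp_all
    from dd(2) obtain e where e1: "d = p * e" ..
    have e: "d = p * e" "p * e dvd p * n" using e1 dd(1) by simp_all
    have "d div p = e" "e dvd n" using e p0 by simp_all
    then show "p * (d div p) = d" "d div p \<in> {e. e dvd n}"
      "of_bool (squarefree (d div p) \<and> \<not> p dvd d div p) * kronecker_symbol D (n div (d div p)) = ?F d"
      using p0 unfolding e(1) by (simp_all add: squarefree_prime_mult_iff[OF p])
  qed (use p0 in auto)
  also have "\<dots> = sqf_conv' D p n"
    unfolding sqf_conv'_def
  proof (rule sum.mono_neutral_cong_right)
    show "\<forall>e\<in>{e. e dvd n} - {d. d dvd n \<and> \<not> p dvd d}. of_bool (squarefree e \<and> \<not> p dvd e) * kronecker_symbol D (n div e) = 0"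
      by simp
  qed (use n in auto)
  also have "sum ?F {d. d dvd p * n \<and> \<not> p dvd d} = sqf_conv' D p (p * n)" unfolding sqf_conv'_def ..
  finally show ?thesis unfolding sqf_conv'_mult[OF p n] by (simp add: distrib_right)
qed

text \<open>Both sides are 1 at \<open>n = 1\<close> and obey the recursion of
  \<open>root_count_rec\<close> when a prime divisor is removed.\<close>

lemma root_count_sqf_conv:
  assumes D: "fundamental_discriminant D" and n: "n > 0"
  shows "int (root_count D n) = sqf_conv D n"
  using n
proof (induction n rule: less_induct)
  case (less n)
  show ?case
  proof (cases "n = 1")
    case True
    obtain \<beta> \<gamma> where bg: "\<beta>\<^sup>2 - 4 * \<gamma> = D" using disc_quadratic[OF fundamental_cases(1)[OF D]] .
    have "{0..<1::int} = {0}" by auto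
    then have "root_count D 1 = 1" using root_count_quadratic[OF _ bg, of 1] by simp
    moreover have "{d::nat. d dvd 1} = {1}" by auto
    ultimately show ?thesis unfolding True by (simp add: sqf_conv_def kronecker_symbol_def)
  next
    case False
    then obtain p where p: "prime p" "p dvd n" using prime_factor_nat by blast
    then obtain m where m: "n = p * m" by blast
    have m0: "m > 0" "m < n" using m less.prems prime_gt_1_nat[OF p(1)] by (auto intro: gr0I)
    have IH: "int (root_count D m) = sqf_conv D m" by (rule less.IH[OF m0(2,1)])
    have rec: "int (root_count D n) = kronecker_prime D p * sqf_conv D m + of_bool (\<not> p dvd m) * sqf_conv D m"
      using root_count_rec[OF p(1) coprime_1_left D m0(1)] IH unfolding m by simp
    show ?thesis
    proof (cases "p dvd m")
      case False
      have "{d. d dvd m \<and> \<not> p dvd d} = {d. d dvd m}" using False dvd_trans by blast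
      then have "sqf_conv' D p m = sqf_conv D m" unfolding sqf_conv_def sqf_conv'_def by simp
      then show ?thesis unfolding rec using False unfolding m sqf_conv_prime_mult[OF p(1) m0(1)]
        by (simp add: distrib_right)
    next
      case True
      then obtain l where l: "m = p * l" by blast
      have l0: "l > 0" using l m0 by (auto intro: gr0I)
      have "sqf_conv D n = (kronecker_prime D p + 1) * (kronecker_prime D p * sqf_conv' D p l)"
        unfolding m sqf_conv_prime_mult[OF p(1) m0(1)] unfolding l sqf_conv'_mult[OF p(1) l0] ..
      also have "\<dots> = kronecker_prime D p * sqf_conv D m" unfolding l sqf_conv_prime_mult[OF p(1) l0] by simp
      finally show ?thesis unfolding rec using True by simp
    qed
  qed
qed

lemma inverse_squares_summable_on: "(\<lambda>n. 1 / (real n)\<^sup>2) summable_on UNIV"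
proof -
  have "summable (\<lambda>n. inverse (real n ^ 2))" by (rule inverse_power_summable) simp
  then show ?thesis by (subst summable_on_UNIV_nonneg_real_iff) (simp_all add: inverse_eq_divide)
qed

definition kron_term :: "int \<Rightarrow> nat \<Rightarrow> real" where
  "kron_term D e = of_int (kronecker_symbol D e) / (real e)\<^sup>2"

text \<open>This is zeta(2)/zeta(4), but its value is not taken from there;
  \<open>sqf_const_eq\<close> reads it off from the discriminant 1.\<close>

definition sqf_const :: real where
  "sqf_const = (\<Sum>\<^sub>\<infinity>d. of_bool (squarefree d) / (real d)\<^sup>2)"

lemma kron_term_abs_summable: "Infinite_Sum.abs_summable_on (kron_term D) UNIV"
proof (rule summable_on_comparison_test[OF inverse_squares_summable_on])
  fix n
  have "\<bar>real_of_int (kronecker_symbol D n)\<bar> \<le> 1" using kronecker_symbol_bound[of D n] by linarith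
  then show "norm (kron_term D n) \<le> 1 / (real n)\<^sup>2" unfolding kron_term_def by (simp add: divide_right_mono)
qed simp

text \<open>The convolution becomes a product by absolute convergence; pairs \<open>(d, e)\<close>
  are regrouped by \<open>n = d * e\<close>.\<close>

lemma root_zeta_fundamental:
  assumes D: "fundamental_discriminant D"
  shows "root_zeta D = sqf_const * infsum (kron_term D) UNIV"
proof -
  define a where "a d = of_bool (squarefree d) / (real d)\<^sup>2" for d :: nat
  let ?b = "kron_term D"
  define f where "f = (\<lambda>(d, e). a d * ?b e)"
  have a0: "a d \<ge> 0" for d by (simp add: a_def)
  have sa: "a summable_on UNIV"
    by (rule summable_on_comparison_test[OF inverse_squares_summable_on]) (simp_all add: a_def)
  have sb: "(\<lambda>e. norm (?b e)) summable_on UNIV" by (rule kron_term_abs_summable)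
  have nf: "norm (f (d, e)) = a d * norm (?b e)" for d e unfolding f_def using a0 by (simp add: abs_mult)
  have "Infinite_Sum.abs_summable_on f (UNIV \<times> UNIV)"
    unfolding Infinite_Sum.abs_summable_on_Sigma_iff nf
  proof (intro conjI ballI)
    fix d
    show "(\<lambda>e. a d * norm (?b e)) summable_on UNIV" by (rule summable_on_cmult_right[OF sb])
  next
    have "norm (\<Sum>\<^sub>\<infinity>e. a d * norm (?b e)) = a d * (\<Sum>\<^sub>\<infinity>e. norm (?b e))" for d
      using a0 by (simp add: infsum_cmult_right' infsum_nonneg abs_mult)
    then show "Infinite_Sum.abs_summable_on (\<lambda>d. \<Sum>\<^sub>\<infinity>e. a d * norm (?b e)) UNIV"
      using summable_on_cmult_left[OF sa] by simp
  qed
  then have sf: "f summable_on UNIV \<times> UNIV" by (rule abs_summable_summable)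
  have bij: "bij_betw (\<lambda>(n, d). (d, n div d)) (Sigma {0<..} (\<lambda>n. {d. d dvd n})) {(d::nat, e::nat). d > 0 \<and> e > 0}"
    by (rule bij_betw_byWitness[of _ "\<lambda>(d, e). (d * e, d)"])
       (auto simp: dvd_div_eq_0_iff dvd_pos_nat elim!: dvdE)
  have "f summable_on {(d, e). d > 0 \<and> e > 0}" by (rule summable_on_subset_banach[OF sf]) simp
  then have sS: "(\<lambda>z. f (case z of (n, d) \<Rightarrow> (d, n div d))) summable_on (Sigma {0<..} (\<lambda>n. {d. d dvd n}))"
    by (rule iffD2[OF summable_on_reindex_bij_betw[OF bij]])
  have "sqf_const * infsum ?b UNIV = (\<Sum>\<^sub>\<infinity>d. a d * infsum ?b UNIV)"
    unfolding sqf_const_def a_def[symmetric] by (rule infsum_cmult_left'[symmetric])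
  also have "\<dots> = (\<Sum>\<^sub>\<infinity>d. \<Sum>\<^sub>\<infinity>e. a d * ?b e)" by (simp add: infsum_cmult_right')
  also have "\<dots> = infsum f (UNIV \<times> UNIV)"
    using infsum_Sigma'_banach[of "\<lambda>d e. a d * ?b e" UNIV "\<lambda>_. UNIV"] sf by (simp add: f_def)
  also have "\<dots> = infsum f {(d, e). d > 0 \<and> e > 0}"
    by (rule infsum_cong_neutral) (auto simp: f_def a_def kron_term_def)
  also have "\<dots> = infsum (\<lambda>z. f (case z of (n, d) \<Rightarrow> (d, n div d))) (Sigma {0<..} (\<lambda>n. {d. d dvd n}))"
    by (rule infsum_reindex_bij_betw[OF bij, symmetric])
  also have "infsum (\<lambda>z. f (case z of (n, d) \<Rightarrow> (d, n div d))) (Sigma {0<..} (\<lambda>n. {d. d dvd n})) =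
     (\<Sum>\<^sub>\<infinity>n\<in>{0<..}. \<Sum>\<^sub>\<infinity>d\<in>{d. d dvd n}. f (d, n div d))"
    using infsum_Sigma_banach[OF sS] by simp
  also have "\<dots> = (\<Sum>\<^sub>\<infinity>n\<in>{0<..}. root_term D n)"
  proof (rule infsum_cong)
    fix n :: nat assume "n \<in> {0<..}"
    then have n: "n > 0" by simp
    have "(\<Sum>\<^sub>\<infinity>d\<in>{d. d dvd n}. f (d, n div d)) = (\<Sum>d | d dvd n. f (d, n div d))"
      using n by simp
    also have "\<dots> = (\<Sum>d | d dvd n. real_of_int (of_bool (squarefree d) * kronecker_symbol D (n div d)) / (real n)\<^sup>2)"
    proof (rule sum.cong)
      fix d assume "d \<in> {d. d dvd n}"
      then have "real n = real d * real (n div d)" by (simp flip: of_nat_mult)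
      then show "f (d, n div d) = real_of_int (of_bool (squarefree d) * kronecker_symbol D (n div d)) / (real n)\<^sup>2"
        by (simp add: f_def a_def kron_term_def power_mult_distrib)
    qed simp
    also have "\<dots> = real_of_int (sqf_conv D n) / (real n)\<^sup>2"
      unfolding sqf_conv_def of_int_sum sum_divide_distrib ..
    also have "\<dots> = root_term D n" unfolding root_count_sqf_conv[OF D n, symmetric] root_term_def by simp
    finally show "(\<Sum>\<^sub>\<infinity>d\<in>{d. d dvd n}. f (d, n div d)) = root_term D n" .
  qed
  also have "\<dots> = root_zeta D" unfolding root_zeta_def
    by (rule infsum_cong_neutral) (auto simp: root_term_def)
  finally show ?thesis by simp
qed

lemma kron_term_infsum: "infsum (kron_term D) UNIV = (\<Sum>n. of_int (kronecker_symbol D (Suc n)) / (real (Suc n))\<^sup>2)"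
proof -
  have "kron_term D summable_on UNIV" by (rule abs_summable_summable[OF kron_term_abs_summable])
  then have "kron_term D sums infsum (kron_term D) UNIV" by (intro has_sum_imp_sums has_sum_infsum)
  moreover have "kron_term D 0 = 0" by (simp add: kron_term_def)
  ultimately have "(\<lambda>n. kron_term D (Suc n)) sums infsum (kron_term D) UNIV" by (simp add: sums_Suc_iff)
  then show ?thesis unfolding kron_term_def by (rule sums_unique)
qed

text \<open>For \<open>D = 1\<close> no form has \<open>a < 0 < c\<close>, so
  \<open>cyc_K 1 = 1/2\<close> and the series is 6 (1/2 - 1/12) = 5/2, while the L-value is
  zeta(2).\<close>

lemma sqf_const_eq: "sqf_const = 15 / pi\<^sup>2"
proof -
  have f1: "fundamental_discriminant 1" by (simp add: fundamental_discriminant_def)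
  have "vforms 1 (\<lambda>a c. a < 0 \<and> c > 0) = {}"
  proof (rule equals0I)
    fix Q assume Q: "Q \<in> vforms 1 (\<lambda>a c. a < 0 \<and> c > 0)"
    obtain a b c where abc: "Q = (a, b, c)" by (cases Q)
    have *: "b\<^sup>2 + 4 * ((- a) * c) = 1" "a < 0" "c > 0" using Q by (auto simp: abc vforms_def)
    have "(- a) * c > 0" using * by (intro mult_pos_pos) auto
    then show False using *(1) zero_le_power2[of b] by linarith
  qed
  then have "cyc_K 1 = 1 / 2" by (simp add: cyc_K_def cyc_alpha_def)
  then have z1: "root_zeta 1 = 5 / 2" using root_zeta_eq[of 1] by simp
  have kp: "kronecker_prime 1 p = 1" if "prime p" for p
    using that legendre_1[of p] prime_ge_2_nat[OF that] by (auto simp: kronecker_prime_def)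
  have k1: "kronecker_symbol 1 (Suc n) = 1" for n
  proof -
    have "image_mset (kronecker_prime 1) (prime_factorization (Suc n)) = image_mset (\<lambda>_. 1) (prime_factorization (Suc n))"
      by (rule image_mset_cong) (use kp in auto)
    then show ?thesis by (simp add: kronecker_symbol_def image_mset_const_eq)
  qed
  have i1: "infsum (kron_term 1) UNIV = pi\<^sup>2 / 6"
    unfolding kron_term_infsum k1 using sums_unique[OF inverse_squares_sums] by (simp add: add.commute)
  have "5 / 2 = sqf_const * (pi\<^sup>2 / 6)" using root_zeta_fundamental[OF f1] unfolding z1 i1 .
  then show ?thesis by (simp add: field_simps)
qed

text \<open>The only square that may divide a fundamental discriminant is 4, and the quotient is
  then no discriminant.\<close>

lemma fundamental_square_factor:
  assumes D: "fundamental_discriminant D" and g: "D = g\<^sup>2 * u" "g > 0"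
  shows "g = 1 \<or> g = 2 \<and> (u mod 4 = 2 \<or> u mod 4 = 3)"
proof -
  consider "squarefree D" | m where "D = 4 * m" "m mod 4 = 2 \<or> m mod 4 = 3" "squarefree m"
    using D unfolding fundamental_discriminant_def by blast
  then show ?thesis
  proof cases
    case 1
    have "g\<^sup>2 dvd D" unfolding g(1) by simp
    then have "is_unit g" by (rule squarefreeD[OF 1])
    then show ?thesis using g(2) by simp
  next
    case 2
    show ?thesis
    proof (cases "even g")
      case True
      then obtain l where l: "g = 2 * l" by blast
      have m: "m = l\<^sup>2 * u" using g(1) 2(1) unfolding l by (simp add: power_mult_distrib)
      then have "is_unit l" by (intro squarefreeD[OF 2(3)]) simp
      then have "l = 1" using g(2) l by simp
      then show ?thesis using 2(2) m l by simp
    next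
      case False
      then have "coprime g 2" by (simp add: coprime_right_2_iff_odd)
      then have "coprime g 4" using coprime_power_right_iff[of g 2 2] by simp
      then have "coprime (g\<^sup>2) 4" by simp
      moreover have "g\<^sup>2 dvd 4 * m" using g(1) 2(1) by simp
      ultimately have "g\<^sup>2 dvd m" by (simp only: coprime_dvd_mult_right_iff)
      then have "is_unit g" by (rule squarefreeD[OF 2(3)])
      then show ?thesis using g(2) by simp
    qed
  qed
qed

text \<open>After cancelling the gcd, \<open>D0 = g'\<^sup>2 * u\<close> and
  \<open>D1 = f'\<^sup>2 * u\<close> share the cofactor \<open>u\<close>. Its residue modulo 4
  decides for both at once whether the square is 4 or 1.\<close>

lemma fundamental_unique:
  assumes D: "fundamental_discriminant D0" "fundamental_discriminant D1"
    and eq: "D0 * (int f)\<^sup>2 = D1 * (int g)\<^sup>2" and pos: "f > 0" "g > 0"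
  shows "f = g"
proof -
  define k where "k = gcd f g"
  obtain f' g' where fg: "f = f' * k" "g = g' * k" "coprime f' g'"
    using gcd_coprime_exists[of f g] pos unfolding k_def by auto
  have k0: "k > 0" using pos fg(1) by (auto intro: gr0I)
  have p': "f' > 0" "g' > 0" using pos fg by (auto intro: gr0I)
  have "(D0 * (int f')\<^sup>2) * (int k)\<^sup>2 = (D1 * (int g')\<^sup>2) * (int k)\<^sup>2"
    using eq unfolding fg(1,2) by (simp add: power_mult_distrib mult_ac)
  then have eq': "D0 * (int f')\<^sup>2 = D1 * (int g')\<^sup>2" using k0 by simp
  have co: "coprime ((int g')\<^sup>2) ((int f')\<^sup>2)" using fg(3) by (simp add: coprime_commute)
  have "(int g')\<^sup>2 dvd D0 * (int f')\<^sup>2" unfolding eq' by simp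
  then have "(int g')\<^sup>2 dvd D0" using co by (simp only: coprime_dvd_mult_left_iff)
  then obtain u where u: "D0 = (int g')\<^sup>2 * u" by blast
  have "(int g')\<^sup>2 * (u * (int f')\<^sup>2) = (int g')\<^sup>2 * D1" using eq' unfolding u by (simp add: mult_ac)
  then have u1: "D1 = (int f')\<^sup>2 * u" using p' by (simp add: mult.commute)
  note a = fundamental_square_factor[OF D(1) u]
  note b = fundamental_square_factor[OF D(2) u1]
  have d0: "D0 mod 4 = 0 \<or> D0 mod 4 = 1" and d1: "D1 mod 4 = 0 \<or> D1 mod 4 = 1"
    using fundamental_cases(1) D by blast+
  have "f' = g'"
  proof (cases "u mod 4 = 2 \<or> u mod 4 = 3")
    case True
    have "int g' \<noteq> 1"
    proof
      assume "int g' = 1"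
      then have "D0 = u" using u by simp
      then show False using d0 True by auto
    qed
    then have "g' = 2" using a p' by simp
    have "int f' \<noteq> 1"
    proof
      assume "int f' = 1"
      then have "D1 = u" using u1 by simp
      then show False using d1 True by auto
    qed
    then have "f' = 2" using b p' by simp
    then show ?thesis using \<open>g' = 2\<close> by simp
  next
    case False
    then have "int g' = 1" "int f' = 1" using a b p' by simp_all
    then show ?thesis by simp
  qed
  then show ?thesis using fg by simp
qed

lemma discriminant_decompose:
  assumes "D > 0" "is_discriminant D"
  obtains D0 f where "fundamental_discriminant D0" "D0 > 0" "f > 0" "D = D0 * (int f)\<^sup>2"
    "fundamental_part D = D0" "conductor D = f"
proof -
  have "\<exists>D0 f. fundamental_discriminant D0 \<and> D = D0 * (int f)\<^sup>2"
  proof -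
    define s t where "s = squarefree_part D" and "t = square_part D"
    have D: "D = s * t\<^sup>2" unfolding s_def t_def by (rule squarefree_decompose)
    have sq: "squarefree s" unfolding s_def by simp
    have s4: "s mod 4 \<noteq> 0"
    proof
      assume "s mod 4 = 0"
      then have "2\<^sup>2 dvd s" by (simp add: dvd_eq_mod_eq_0)
      from squarefreeD[OF sq this] show False by simp
    qed
    have D4: "D mod 4 = 0 \<or> D mod 4 = 1" using assms(2) by (simp add: is_discriminant_def)
    have nat: "D = s * (int (nat \<bar>t\<bar>))\<^sup>2" using D by simp
    have range: "0 \<le> s mod 4" "s mod 4 < 4" by simp_all
    show ?thesis
    proof (cases "s mod 4 = 1")
      case True
      then have "fundamental_discriminant s" using sq by (simp add: fundamental_discriminant_def)
      then show ?thesis using nat by blast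
    next
      case False
      then have s23: "s mod 4 = 2 \<or> s mod 4 = 3" using s4 range by linarith
      \<comment> \<open>An odd \<open>t\<close> would give \<open>D\<close> the residue 2 or 3
        modulo 4. The factor 2 of \<open>t\<close> moves into the fundamental discriminant
        \<open>4 * s\<close>.\<close>
      have "even t"
      proof (rule ccontr)
        assume "odd t"
        then obtain k where "t = 2 * k + 1" by (elim oddE)
        then have "t\<^sup>2 = 1 + 4 * (k\<^sup>2 + k)" by (simp add: power2_eq_square algebra_simps)
        then have "D = s + 4 * (s * (k\<^sup>2 + k))" unfolding D by (simp add: algebra_simps)
        then have "D mod 4 = s mod 4" by (simp only: mod_mult_self2)
        then show False using D4 s23 by linarith
      qed
      then obtain l where l: "t = 2 * l" by blast
      have "D = (4 * s) * (int (nat \<bar>l\<bar>))\<^sup>2" unfolding D l by (simp add: power_mult_distrib)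
      moreover have "fundamental_discriminant (4 * s)" using sq s23 by (auto simp: fundamental_discriminant_def)
      ultimately show ?thesis by blast
    qed
  qed
  then obtain D0 f where D0: "fundamental_discriminant D0" "D = D0 * (int f)\<^sup>2" by blast
  have f: "f > 0" using assms(1) D0(2) by (auto intro: gr0I)
  have "(int f)\<^sup>2 > 0" using f by simp
  then have pos: "D0 > 0" using assms(1) D0(2) by (simp add: zero_less_mult_iff)
  have uniq: "D1 = D0 \<and> g = f" if "fundamental_discriminant D1" "g > 0" "D = D1 * (int g)\<^sup>2" for D1 g
  proof -
    have e: "D1 * (int g)\<^sup>2 = D0 * (int f)\<^sup>2" using that(3) D0(2) by simp
    have "g = f" by (rule fundamental_unique[OF that(1) D0(1) e that(2) f])
    then show ?thesis using e f by simp
  qed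
  have "fundamental_part D = D0" unfolding fundamental_part_def
    by (rule the_equality) (use D0 f uniq in blast)+
  moreover have "conductor D = f" unfolding conductor_def
    by (rule the_equality) (use D0 f uniq in blast)+
  ultimately show ?thesis using that D0 pos f by blast
qed

lemma sigma_3_reciprocal:
  assumes "n > 0"
  shows "(\<Sum>e | e dvd n. real e ^ 3) = real n ^ 3 * (\<Sum>e | e dvd n. 1 / real e ^ 3)"
proof -
  have "(\<Sum>e | e dvd n. real e ^ 3) = (\<Sum>e | e dvd n. real (n div e) ^ 3)"
    by (rule sum.reindex_bij_witness[of _ "\<lambda>e. n div e" "\<lambda>e. n div e"])
       (use assms in \<open>auto simp: div_dvd_div elim!: dvdE\<close>)
  also have "\<dots> = (\<Sum>e | e dvd n. real n ^ 3 * (1 / real e ^ 3))"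
    by (rule sum.cong) (auto simp: real_of_nat_div power_divide)
  finally show ?thesis by (simp add: sum_distrib_left)
qed

text \<open>Elementary reflection of the divisor sum from -1 to 2: \<open>d\<close> times
  \<open>\<sigma>\<close> of exponent 3 at \<open>f div d\<close> equals
  \<open>f ^ 3 / d\<^sup>2\<close> times \<open>\<sigma>\<close> of exponent -3.\<close>

lemma conductor_sum:
  assumes f: "f > 0"
  shows "(\<Sum>d | d dvd f. of_int (moebius_mu d) * of_int (kronecker_symbol D0 d) *
     of_nat d powr (- (- 1)) * divisor_power_sum (1 - 2 * (- 1)) (f div d)) = complex_of_real (real f ^ 3 * cond_factor D0 f)"
proof -
  have ds: "divisor_power_sum (1 - 2 * (- 1)) n = complex_of_real (real n ^ 3 * (\<Sum>e | e dvd n. 1 / real e ^ 3))" if "n > 0" for n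
  proof -
    have "of_nat e powr (1 - 2 * (- 1)) = complex_of_real (real e ^ 3)" if "e > 0" for e :: nat
    proof -
      have "of_nat e powr (1 - 2 * (- 1)) = (of_nat e :: complex) powr of_nat 3" by simp
      also have "\<dots> = of_nat e ^ 3" using that by (subst powr_nat') auto
      finally show ?thesis by simp
    qed
    moreover have "e > 0" if "e dvd n" for e using that \<open>n > 0\<close> by (rule dvd_pos_nat[rotated])
    ultimately have "divisor_power_sum (1 - 2 * (- 1)) n = complex_of_real (\<Sum>e | e dvd n. real e ^ 3)"
      unfolding divisor_power_sum_def by (simp cong: sum.cong)
    then show ?thesis unfolding sigma_3_reciprocal[OF that] .
  qed
  have "(\<Sum>d | d dvd f. of_int (moebius_mu d) * of_int (kronecker_symbol D0 d) *
     of_nat d powr (- (- 1)) * divisor_power_sum (1 - 2 * (- 1)) (f div d)) =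
     (\<Sum>d | d dvd f. complex_of_real (real f ^ 3 * (of_int (moebius_mu d) * of_int (kronecker_symbol D0 d) / (real d)\<^sup>2 *
     (\<Sum>e | e dvd f div d. 1 / real e ^ 3))))"
  proof (rule sum.cong)
    fix d assume "d \<in> {d. d dvd f}"
    then have d: "d dvd f" by simp
    have d0: "d > 0" using d f by (rule dvd_pos_nat[rotated])
    have fd: "f div d > 0" using d f by (metis dvd_div_eq_0_iff gr0I not_less0)
    have "real f = real d * real (f div d)" using d by (simp flip: of_nat_mult)
    then have r: "real d * real (f div d) ^ 3 = real f ^ 3 / (real d)\<^sup>2"
      using d0 by (simp add: power_mult_distrib power2_eq_square power3_eq_cube)
    have p: "of_nat d powr (- (- 1)) = complex_of_real (real d)" using d0 by simp
    have "of_int (moebius_mu d) * of_int (kronecker_symbol D0 d) * complex_of_real (real d) *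
       complex_of_real (real (f div d) ^ 3 * (\<Sum>e | e dvd f div d. 1 / real e ^ 3)) =
       complex_of_real (of_int (moebius_mu d) * of_int (kronecker_symbol D0 d) * (real d * real (f div d) ^ 3) * (\<Sum>e | e dvd f div d. 1 / real e ^ 3))"
      by simp
    also have "of_int (moebius_mu d) * of_int (kronecker_symbol D0 d) * (real d * real (f div d) ^ 3) * (\<Sum>e | e dvd f div d. 1 / real e ^ 3) =
       real f ^ 3 * (of_int (moebius_mu d) * of_int (kronecker_symbol D0 d) / (real d)\<^sup>2 * (\<Sum>e | e dvd f div d. 1 / real e ^ 3))"
      unfolding r by simp
    finally show "of_int (moebius_mu d) * of_int (kronecker_symbol D0 d) *
     of_nat d powr (- (- 1)) * divisor_power_sum (1 - 2 * (- 1)) (f div d) =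
     complex_of_real (real f ^ 3 * (of_int (moebius_mu d) * of_int (kronecker_symbol D0 d) / (real d)\<^sup>2 * (\<Sum>e | e dvd f div d. 1 / real e ^ 3)))"
      unfolding ds[OF fd] p .
  qed simp
  then show ?thesis unfolding cond_factor_def by (simp add: sum_distrib_left)
qed

text \<open>Both sides are multiples of \<open>D * sqrt D\<close> times the same value at 2: with
  15/(6 pi^2) on the right and -1/(2 pi^2) for \<open>L_disc\<close>, hence the factor -5. The
  \<open>f ^ 3\<close> of \<open>conductor_sum\<close> completes \<open>D0 * sqrt D0\<close> to
  \<open>D * sqrt D\<close>.\<close>

theorem L_disc_minus_one:
  assumes "D > 0" "is_discriminant D"
  shows "- 5 * L_disc D (- 1) = of_real (cyc_K D - of_bool (is_square D) / 12)"
proof -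
  obtain D0 f where D0: "fundamental_discriminant D0" "D0 > 0" "f > 0" "D = D0 * (int f)\<^sup>2"
    "fundamental_part D = D0" "conductor D = f" using discriminant_decompose[OF assms] .
  define \<Lambda> where "\<Lambda> = (\<Sum>n. real_of_int (kronecker_symbol D0 (Suc n)) / (real (Suc n))\<^sup>2)"
  define r where "r = sqrt (real_of_int D0)"
  have r: "real_of_int D0 = r * r" "r > 0" using D0(2) by (simp_all add: r_def)
  have sD: "sqrt (real_of_int D) = r * real f" unfolding D0(4) r_def by (simp add: real_sqrt_mult)
  have "6 / (of_int D * sqrt (of_int D)) * (cyc_K D - of_bool (is_square D) / 12) = 15 / pi\<^sup>2 * \<Lambda> * cond_factor D0 f"
    unfolding root_zeta_eq[OF assms(1), symmetric]
    unfolding D0(4) root_zeta_conductor[OF D0(1-3)] root_zeta_fundamental[OF D0(1)] kron_term_infsum sqf_const_eq \<Lambda>_def ..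
  then have K: "cyc_K D - of_bool (is_square D) / 12 = (of_int D * sqrt (of_int D)) / 6 * (15 / pi\<^sup>2 * \<Lambda> * cond_factor D0 f)"
    using assms(1) by (simp add: field_simps)
  have "L_disc D (- 1) = dirichlet_L D0 (- 1) * complex_of_real (real f ^ 3 * cond_factor D0 f)"
    unfolding L_disc_def Let_def D0(5,6) conductor_sum[OF D0(3)] ..
  also have "\<dots> = complex_of_real (- (of_int D0 * r) / (2 * pi\<^sup>2) * \<Lambda> * (real f ^ 3 * cond_factor D0 f))"
    unfolding dirichlet_L_minus_one[OF D0(1,2)] \<Lambda>_def r_def of_real_mult ..
  finally have "- 5 * L_disc D (- 1) = complex_of_real (- 5 * (- (of_int D0 * r) / (2 * pi\<^sup>2) * \<Lambda> * (real f ^ 3 * cond_factor D0 f)))"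
    by simp
  also have "- 5 * (- (of_int D0 * r) / (2 * pi\<^sup>2) * \<Lambda> * (real f ^ 3 * cond_factor D0 f)) = cyc_K D - of_bool (is_square D) / 12"
    unfolding K sD unfolding D0(4) by (simp add: power2_eq_square power3_eq_cube)
  finally show ?thesis .
qed

section \<open>The class number relation\<close>

lemma discriminant_diff_square:
  fixes D x :: int
  assumes "is_discriminant D" "[x = D] (mod 2)"
  shows "\<exists>m. D - x\<^sup>2 = 4 * m"
proof -
  have "even (x - D)" using assms(2) by (simp add: cong_iff_dvd_diff)
  then have par: "even x \<longleftrightarrow> even D" by simp
  have D4: "D mod 4 = 0 \<or> D mod 4 = 1" using assms(1) by (simp add: is_discriminant_def)
  have "D mod 4 = x\<^sup>2 mod 4"
  proof (cases "even x")
    case True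
    then obtain k where k: "x = 2 * k" by blast
    have "even D" using par True by simp
    then have "D mod 4 = 0" using D4 by presburger
    then show ?thesis by (simp add: k power_mult_distrib)
  next
    case False
    then obtain k where "x = 2 * k + 1" by (elim oddE)
    then have "x\<^sup>2 = 1 + 4 * (k\<^sup>2 + k)" by (simp add: power2_eq_square algebra_simps)
    then have "x\<^sup>2 mod 4 = 1 mod 4" by (simp only: mod_mult_self2)
    moreover have "odd D" using par False by simp
    then have "D mod 4 = 1" using D4 by presburger
    ultimately show ?thesis by simp
  qed
  then have "4 dvd D - x\<^sup>2" by (simp only: mod_eq_dvd_iff)
  then show ?thesis by (elim dvdE) blast
qed

text \<open>A factorization \<open>c * d = (D - x\<^sup>2) div 4\<close> is the form
  \<open>(- c, x, d)\<close>. The predicate \<open>P\<close> allows pairs where \<open>g\<close>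
  vanishes to be dropped.\<close>

lemma sum_psum_forms:
  assumes D: "is_discriminant D"
    and g: "\<And>c d. c > 0 \<Longrightarrow> d > 0 \<Longrightarrow> \<not> P c d \<Longrightarrow> g c d = 0"
  shows "(\<Sum>x\<in>{x. x\<^sup>2 < D \<and> [x = D] (mod 2)}. psum ((D - x\<^sup>2) div 4) g) =
    (\<Sum>(a, b, c)\<in>vforms D (\<lambda>a c. a < 0 \<and> c > 0 \<and> P (- a) c). g (- a) c)"
proof -
  let ?X = "{x. x\<^sup>2 < D \<and> [x = D] (mod 2)}"
  have finX: "finite ?X" by (rule finite_subset[OF _ finite_square_less[of D]]) auto
  let ?I = "Sigma ?X (\<lambda>x. dpairs ((D - x\<^sup>2) div 4))"
  have "(\<Sum>x\<in>?X. psum ((D - x\<^sup>2) div 4) g) = (\<Sum>(x, (c, d))\<in>?I. g c d)"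
    unfolding psum_def by (subst sum.Sigma) (simp_all add: finX finite_dpairs)
  also have "\<dots> = (\<Sum>(a, b, c)\<in>vforms D (\<lambda>a c. a < 0 \<and> c > 0). g (- a) c)"
  proof (rule sum.reindex_bij_witness[of _ "\<lambda>(a, b, c). (b, (- a, c))" "\<lambda>(x, (c, d)). (- c, x, d)"])
    fix z assume "z \<in> ?I"
    then obtain x c d where z: "z = (x, (c, d))" and x: "x\<^sup>2 < D" "[x = D] (mod 2)" and cd: "c > 0" "d > 0" "c * d = (D - x\<^sup>2) div 4"
      by (auto simp: dpairs_def)
    obtain m where m: "D - x\<^sup>2 = 4 * m" using discriminant_diff_square[OF D x(2)] by blast
    have "c * d = m" using cd(3) unfolding m by simp
    then have "x\<^sup>2 - 4 * (- c) * d = D" using m by simp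
    then show "(\<lambda>(x, (c, d)). (- c, x, d)) z \<in> vforms D (\<lambda>a c. a < 0 \<and> c > 0)"
      using cd unfolding z by (simp add: vforms_def)
    show "(\<lambda>(a, b, c). (b, (- a, c))) ((\<lambda>(x, (c, d)). (- c, x, d)) z) = z" unfolding z by simp
    show "(case (\<lambda>(x, (c, d)). (- c, x, d)) z of (a, b, c) \<Rightarrow> g (- a) c) = (case z of (x, c, d) \<Rightarrow> g c d)" unfolding z by simp
  next
    fix Q assume "Q \<in> vforms D (\<lambda>a c. a < 0 \<and> c > 0)"
    then obtain a b c where Q: "Q = (a, b, c)" and v: "b\<^sup>2 - 4 * a * c = D" "a < 0" "c > 0" by (auto simp: vforms_def)
    have e: "D - b\<^sup>2 = 4 * ((- a) * c)" using v(1) by simp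
    have "(- a) * c > 0" using v by (intro mult_pos_pos) auto
    then have lt: "b\<^sup>2 < D" using e by linarith
    have "even (D - b\<^sup>2)" unfolding e by simp
    then have "even (b - D)" by simp
    then have "[b = D] (mod 2)" by (simp add: cong_iff_dvd_diff)
    moreover have "(D - b\<^sup>2) div 4 = (- a) * c" unfolding e by simp
    ultimately show "(\<lambda>(a, b, c). (b, (- a, c))) Q \<in> ?I" using lt v unfolding Q by (simp add: dpairs_def)
    show "(\<lambda>(x, (c, d)). (- c, x, d)) ((\<lambda>(a, b, c). (b, (- a, c))) Q) = Q" unfolding Q by simp
  qed
  also have "\<dots> = (\<Sum>(a, b, c)\<in>vforms D (\<lambda>a c. a < 0 \<and> c > 0 \<and> P (- a) c). g (- a) c)"
  proof (rule sum.mono_neutral_right[OF finite_indef])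
    show "\<forall>Q\<in>vforms D (\<lambda>a c. a < 0 \<and> c > 0) - vforms D (\<lambda>a c. a < 0 \<and> c > 0 \<and> P (- a) c). (case Q of (a, b, c) \<Rightarrow> g (- a) c) = 0"
    proof
      fix Q assume "Q \<in> vforms D (\<lambda>a c. a < 0 \<and> c > 0) - vforms D (\<lambda>a c. a < 0 \<and> c > 0 \<and> P (- a) c)"
      then obtain a b c where "Q = (a, b, c)" "a < 0" "c > 0" "\<not> P (- a) c" by (auto simp: vforms_def)
      then show "(case Q of (a, b, c) \<Rightarrow> g (- a) c) = 0" using g[of "- a" c] by simp
    qed
  qed (auto simp: vforms_def)
  finally show ?thesis .
qed

lemma square_roots_card:
  assumes "D > (0::int)"
  shows "real (card {x. x\<^sup>2 = D}) = 2 * of_bool (is_square D)"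
proof (cases "is_square D")
  case True
  obtain m where m: "m > 0" "D = m\<^sup>2" using is_square_int_root[OF True assms] by blast
  have "{x. x\<^sup>2 = D} = {m, - m}" unfolding m(2) by (auto simp: power2_eq_iff)
  then show ?thesis using True m(1) by simp
next
  case False
  have "x\<^sup>2 \<noteq> D" for x using False by auto
  then have "{x. x\<^sup>2 = D} = {}" by blast
  then show ?thesis using False by simp
qed

lemma hurwitz_sum_x:
  assumes D: "D > 0" "is_discriminant D"
  shows "(\<Sum>x\<in>{x. x\<^sup>2 \<le> D \<and> [x = D] (mod 2)}. \<Sum>y\<in>{y. y\<^sup>2 \<le> D - x\<^sup>2}. hurwitz_class_number (D - x\<^sup>2 - y\<^sup>2)) =
    (\<Sum>x\<in>{x. x\<^sup>2 < D \<and> [x = D] (mod 2)}. psum ((D - x\<^sup>2) div 4) (\<lambda>c d. 2 * real_of_int d - real_of_int (min c d)))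
    - of_bool (is_square D) / 6"
proof -
  let ?h = "\<lambda>x. \<Sum>y\<in>{y. y\<^sup>2 \<le> D - x\<^sup>2}. hurwitz_class_number (D - x\<^sup>2 - y\<^sup>2)"
  let ?X = "{x. x\<^sup>2 < D \<and> [x = D] (mod 2)}" and ?E = "{x. x\<^sup>2 = D}"
  have finX: "finite ?X" by (rule finite_subset[OF _ finite_square_less[of D]]) auto
  have finE: "finite ?E" by (rule finite_subset[OF _ finite_square_less[of "D + 1"]]) auto
  have par: "[x = D] (mod 2)" if "x\<^sup>2 = D" for x
    unfolding that[symmetric] by (simp add: cong_iff_dvd_diff)
  have "{x. x\<^sup>2 \<le> D \<and> [x = D] (mod 2)} = ?X \<union> ?E" using par by auto
  then have "(\<Sum>x\<in>{x. x\<^sup>2 \<le> D \<and> [x = D] (mod 2)}. ?h x) = (\<Sum>x\<in>?X. ?h x) + (\<Sum>x\<in>?E. ?h x)"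
    by (simp only:) (rule sum.union_disjoint, use finX finE in auto)
  \<comment> \<open>For \<open>x\<^sup>2 = D\<close> only \<open>y = 0\<close> remains, with value
    -1/12; a square \<open>D\<close> has two such \<open>x\<close>.\<close>
  also have "(\<Sum>x\<in>?E. ?h x) = (\<Sum>x\<in>?E. - 1 / 12)"
  proof (rule sum.cong)
    fix x assume "x \<in> ?E"
    then have x: "D - x\<^sup>2 = 0" by simp
    have "{y::int. y\<^sup>2 \<le> 0} = {0}" by auto
    then show "?h x = - 1 / 12" unfolding x by (simp add: hurwitz_class_number_def)
  qed simp
  also have "\<dots> = - of_bool (is_square D) / 6" using square_roots_card[OF D(1)] by simp
  also have "(\<Sum>x\<in>?X. ?h x) = (\<Sum>x\<in>?X. psum ((D - x\<^sup>2) div 4) (\<lambda>c d. 2 * real_of_int d - real_of_int (min c d)))"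
  proof (rule sum.cong)
    fix x assume x: "x \<in> ?X"
    obtain m where m: "D - x\<^sup>2 = 4 * m" using discriminant_diff_square[OF D(2)] x by blast
    have "m > 0" using m x by auto
    then show "?h x = psum ((D - x\<^sup>2) div 4) (\<lambda>c d. 2 * real_of_int d - real_of_int (min c d))"
      unfolding m using hurwitz_relation[of m] by simp
  qed simp
  finally show ?thesis by simp
qed

theorem corollary1p5:
  fixes D :: int
  assumes "D > 0" and "is_discriminant D"
  shows "complex_of_real
           (\<Sum>\<^sub>\<infinity>(x, y) \<in> {(x :: int, y :: int). [x = D] (mod 2)}. hurwitz_class_number (D - x^2 - y^2)) =
         - 5 * L_disc D (- 1)
         + of_int (\<Sum>(a, b, c) \<in> {(a, b, c) \<in> bqf_set D. a + c > 0 \<and> 0 > a}. a + c)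
         - (1 / 12) * of_bool (is_square D) * (6 * of_int D + 1)"
proof -
  let ?X = "{x. x\<^sup>2 \<le> D \<and> [x = D] (mod 2)}" and ?Y = "\<lambda>x. {y. y\<^sup>2 \<le> D - x\<^sup>2}"
  let ?X' = "{x. x\<^sup>2 < D \<and> [x = D] (mod 2)}"
  define R where "R = (\<Sum>(a, b, c) \<in> {(a, b, c) \<in> bqf_set D. a + c > 0 \<and> 0 > a}. a + c)"
  have fin: "finite {t::int. t\<^sup>2 \<le> n}" for n
    by (rule finite_subset[OF _ finite_square_less[of "n + 1"]]) auto
  have finX: "finite ?X" by (rule finite_subset[OF _ fin[of D]]) auto
  have "(\<Sum>\<^sub>\<infinity>(x, y) \<in> {(x :: int, y :: int). [x = D] (mod 2)}. hurwitz_class_number (D - x^2 - y^2)) =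
     (\<Sum>\<^sub>\<infinity>(x, y) \<in> Sigma ?X ?Y. hurwitz_class_number (D - x^2 - y^2))"
  proof (rule infsum_cong_neutral)
    fix z assume "z \<in> {(x :: int, y :: int). [x = D] (mod 2)} - Sigma ?X ?Y"
    then obtain x y where z: "z = (x, y)" and n: "\<not> (x\<^sup>2 \<le> D \<and> y\<^sup>2 \<le> D - x\<^sup>2)" by auto
    have "D - x\<^sup>2 - y\<^sup>2 < 0" using n zero_le_power2[of y] zero_le_power2[of x] by linarith
    then show "(case z of (x, y) \<Rightarrow> hurwitz_class_number (D - x\<^sup>2 - y\<^sup>2)) = 0"
      unfolding z by (simp add: hurwitz_class_number_def)
  qed auto
  also have "\<dots> = (\<Sum>(x, y) \<in> Sigma ?X ?Y. hurwitz_class_number (D - x^2 - y^2))"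
    by (rule infsum_finite) (use finX fin in auto)
  also have "\<dots> = (\<Sum>x\<in>?X. \<Sum>y\<in>?Y x. hurwitz_class_number (D - x\<^sup>2 - y\<^sup>2))"
    by (rule sum.Sigma[symmetric]) (use finX fin in auto)
  also have "\<dots> = (\<Sum>x\<in>?X'. psum ((D - x\<^sup>2) div 4) (\<lambda>c d. 2 * real_of_int d - real_of_int (min c d)))
    - of_bool (is_square D) / 6"
    by (rule hurwitz_sum_x[OF assms])
  also have "(\<Sum>x\<in>?X'. psum ((D - x\<^sup>2) div 4) (\<lambda>c d. 2 * real_of_int d - real_of_int (min c d))) =
     (\<Sum>x\<in>?X'. psum ((D - x\<^sup>2) div 4) (\<lambda>c d. real_of_int d)) + (\<Sum>x\<in>?X'. psum ((D - x\<^sup>2) div 4) (\<lambda>c d. real_of_int (d - min c d)))"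
    unfolding sum.distrib[symmetric] psum_add[symmetric] by simp
  also have "(\<Sum>x\<in>?X'. psum ((D - x\<^sup>2) div 4) (\<lambda>c d. real_of_int d)) = cyc_alpha D"
    using sum_psum_forms[OF assms(2), of "\<lambda>_ _. True" "\<lambda>c d. real_of_int d"] by (simp add: cyc_alpha_def)
  also have "(\<Sum>x\<in>?X'. psum ((D - x\<^sup>2) div 4) (\<lambda>c d. real_of_int (d - min c d))) = real_of_int R"
  proof -
    have "(\<Sum>x\<in>?X'. psum ((D - x\<^sup>2) div 4) (\<lambda>c d. real_of_int (d - min c d))) =
      (\<Sum>(a, b, c)\<in>vforms D (\<lambda>a c. a < 0 \<and> c > 0 \<and> - a < c). real_of_int (c - min (- a) c))"
      by (rule sum_psum_forms[OF assms(2)]) auto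
    also have "\<dots> = (\<Sum>(a, b, c)\<in>{(a, b, c) \<in> bqf_set D. a + c > 0 \<and> 0 > a}. real_of_int (a + c))"
      by (rule sum.cong) (auto simp: vforms_def bqf_set_def)
    also have "\<dots> = real_of_int R" unfolding R_def by (simp add: case_prod_unfold)
    finally show ?thesis .
  qed
  \<comment> \<open>For square \<open>D\<close>, passing from \<open>cyc_alpha\<close> to
    \<open>cyc_K\<close> costs \<open>D / 2\<close>, and the -1/6 from \<open>x\<^sup>2 = D\<close>
    splits into two twelfths: one belongs to the L-value, the other completes
    \<open>(6 * D + 1) / 12\<close>.\<close>
  finally have "(\<Sum>\<^sub>\<infinity>(x, y) \<in> {(x :: int, y :: int). [x = D] (mod 2)}. hurwitz_class_number (D - x^2 - y^2)) =
     (cyc_K D - of_bool (is_square D) / 12) + real_of_int R - (1 / 12) * of_bool (is_square D) * (6 * of_int D + 1)"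
    unfolding cyc_K_def by (cases "is_square D") (simp_all add: field_simps)
  then show ?thesis unfolding L_disc_minus_one[OF assms] R_def[symmetric] by simp
qed

end
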